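(* Let $T>0$, let $x:\mathbb{R}\to\mathbb{R}$, $\alpha\mapsto x(\alpha)$, and let $b,\sigma,h:\mathbb{R}\times[0,T]\times\mathbb{R}\to\mathbb{R}$, written $(\alpha,t,x)\mapsto b(\alpha,t,x)$, etc. Assume that $x(\cdot)$ is Lipschitz in $\alpha$ and that $b,\sigma,h$ are Lipschitz in $(\alpha,x)$, uniformly with respect to $t\in[0,T]$. For $\alpha\in\mathbb{R}$ let $X^\alpha\in M_G^2(0,T)$ be the unique solution of $$X_t^{\alpha}=x(\alpha)+\int_0^t b(\alpha,s,X_s^{\alpha})\,ds+\int_0^t\sigma(\alpha,s,X_s^{\alpha})\,dB_s+\int_0^t h(\alpha,s,X_s^{\alpha})\,d\langle B\rangle_s,\quad t\in[0,T].$$ Assume that for all $t\in[0,T]$ the partial derivatives $b_x(\cdot,t,\cdot)$, $\sigma_x(\cdot,t,\cdot)$, $h_x(\cdot,t,\cdot)$, $b_\alpha(\cdot,t,\cdot)$, $\sigma_\alpha(\cdot,t,\cdot)$, $h_\alpha(\cdot,t,\cdot)$ belong to $C_{l,lip}(\mathbb{R}^2)$, that $b_x(\cdot,t,\cdot),\sigma_x(\cdot,t,\cdot),h_x(\cdot,t,\cdot)$ are bounded, and that $x(\cdot)$ is differentiable. Then, for all $t\in[0,T]$, $X_t^\alpha$ is differentiable in $L_G^2$ with respect to $\alpha$. Moreover, for all $t\in[0,T]$, $Y_t^\alpha:=\frac{\partial X_t^\alpha}{\partial\alpha}$ satisfies $$\begin{aligned}Y_t^{\alpha}={}&x'(\alpha)+\int_0^t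 b_x(\alpha,s,X_s^{\alpha})Y_s^{\alpha}\,ds+\int_0^t\sigma_x(\alpha,s,X_s^{\alpha})Y_s^{\alpha}\,dB_s+\int_0^t h_x(\alpha,s,X_s^{\alpha})Y_s^{\alpha}\,d\langle B\rangle_s\\&+\int_0^t b_\alpha(\alpha,s,X_s^{\alpha})\,ds+\int_0^t\sigma_\alpha(\alpha,s,X_s^{\alpha})\,dB_s+\int_0^t h_\alpha(\alpha,s,X_s^{\alpha})\,d\langle B\rangle_s.\end{aligned}$$
   Context: $C_{l,lip}(\mathbb{R}^m)$ is the set of $\varphi:\mathbb{R}^m\to\mathbb{R}$ with $|\varphi(x)-\varphi(y)|\le C(1+|x|^n+|y|^n)|x-y|$ for all $x,y$, for some $C>0$, $n\in\mathbb{N}$ depending on $\varphi$. A sublinear expectation on a linear space $\mathcal{H}$ of real functions (stable under $C_{l,lip}$ functions of finitely many elements) is a functional $\hat{\mathbb{E}}:\mathcal H\to\mathbb R$ that is monotone, satisfies $\hat{\mathbb{E}}[c]=c$ for constants, $\hat{\mathbb{E}}[X]-\hat{\mathbb{E}}[Y]\le\hat{\mathbb{E}}[X-Y]$, and $\hat{\mathbb{E}}[\lambda X]=\lambda\hat{\mathbb{E}}[X]$ for $\lambda\ge0$. A random vector $Y$ is independent from $X$ if $\hat{\mathbb{E}}[\varphi(X,Y)]=\hat{\mathbb{E}}[\hat{\mathbb{E}}[\varphi(x,Y)]_{x=X}]$ for all $\varphi\in C_{l,lip}$. Fix $\underline\sigma\in[0,1]$ and $G(a)=\frac12(a^+-\underline\sigma^2a^-)$.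 A random variable $\xi$ is $\mathcal N(0,[\underline\sigma^2,1])$-distributed if for each $\varphi\in C_{l,lip}(\mathbb R)$ the function $u(t,x)=\hat{\mathbb{E}}[\varphi(x+\sqrt t\,\xi)]$ is the unique continuous viscosity solution of polynomial growth of $\partial_tu=G(\partial^2_{xx}u)$ on $[0,\infty)\times\mathbb R$, $u(0,\cdot)=\varphi$. Let $\Omega=C_0(\mathbb{R}^+)$ be the continuous paths $\omega$ on $[0,\infty)$ with $\omega_0=0$, and $B_t(\omega)=\omega_t$. $L^0_{ip}(\mathcal F_T)$ is the set of $\varphi(B_{t_1},\dots,B_{t_m})$, $m\ge1$, $t_i\in[0,T]$, $\varphi\in C_{l,lip}(\mathbb R^m)$; $L^0_{ip}(\mathcal F)=\bigcup_nL^0_{ip}(\mathcal F_n)$. The $G$-expectation $\hat{\mathbb{E}}$ is defined by $\hat{\mathbb{E}}[\varphi(B_{t_1}-B_{t_0},\dots,B_{t_m}-B_{t_{m-1}})]=\widetilde{\mathbb E}[\varphi(\sqrt{t_1-t_0}\,\xi_1,\dots,\sqrt{t_m-t_{m-1}}\,\xi_m)]$ for $0=t_0\le t_1\le\dots\le t_m$, where in a sublinear expectation space with expectation $\widetilde{\mathbb E}$ each $\xi_i$ is $\mathcal N(0,[\underline\sigma^2,1])$-distributed and $\xi_{i+1}$ is independent from $(\xi_1,\dots,\xi_i)$. $L_G^p(\mathcal F)$ (resp. $L_G^p(\mathcal F_t)$), $p\ge1$, is the completion of $L^0_{ip}(\mathcal F)$ (resp. $L^0_{ip}(\mathcal F_t)$)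 under $\hat{\mathbb{E}}[|X|^p]^{1/p}$, and $\hat{\mathbb{E}}$ is extended continuously. Under $\hat{\mathbb{E}}$, $B$ is called a ($1$-dimensional) $G$-Brownian motion. $M_G^{p}(0,T)$ is the completion of the step processes $\eta_t=\sum_{j=0}^{N-1}\xi_jI_{[t_j,t_{j+1})}(t)$, $0=t_0<\dots<t_N=T$, $\xi_j\in L_G^p(\mathcal F_{t_j})$, under $\big(\frac1T\int_0^T\hat{\mathbb{E}}[|\eta_t|^p]dt\big)^{1/p}$. Integrals $\int\eta\,dB$ and $\int\eta\,d\langle B\rangle$ are Peng's: for step processes $\int_0^T\eta\,dB=\sum_j\xi_j(B_{t_{j+1}}-B_{t_j})$, extended by continuity to $M_G^2(0,T)$; $\langle B\rangle_t=B_t^2-2\int_0^tB_s\,dB_s$; and $\int_0^T\eta\,d\langle B\rangle=\sum_j\xi_j(\langle B\rangle_{t_{j+1}}-\langle B\rangle_{t_j})$, extended by continuity. Differentiability: a random function $g(\alpha)$ of a real variable is differentiable in $L_G^2$ with derivative $\frac{\partial g(\alpha)}{\partial\alpha}=f(\alpha)$ if $\lim_{\delta\to0}\hat{\mathbb{E}}\big[\big|\frac{g(\alpha+\delta)-g(\alpha)}{\delta}-f(\alpha)\big|^2\big]=0$. The subscripts $x$ and $\alpha$ on $b,\sigma,h$ denote partial derivatives in the third (space) and first (parameter) arguments.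
   Formalization: The formal theorem additionally assumes that t ↦ b, σ, h(α,t,x) is Lebesgue measurable on [0,T] for fixed (α,x); without this ∫ b_x Y ds may be undefined, e.g. b = c(t)(x−α), σ = h = 0, x(α) = α with c bounded and non-measurable. *)

theory Defs
  imports "HOL-Analysis.Analysis"
begin

section \<open>The spaces \<open>C\<^sub>l\<^sub>,\<^sub>l\<^sub>i\<^sub>p\<close>\<close>

definition Cllip :: "('a::real_normed_vector \<Rightarrow> real) set" where
  "Cllip = {\<phi>. \<exists>C>0. \<exists>n::nat. \<forall>x y.
     \<bar>\<phi> x - \<phi> y\<bar> \<le> C * (1 + norm x ^ n + norm y ^ n) * norm (x - y)}"

text \<open>
  The same space over \<open>\<real>\<^sup>m\<close> for a dimension \<open>m\<close> that varies inside formulas. A vector is a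
  sequence of which only the entries \<open>0, \<dots>, m - 1\<close> count: the norm below reads no other entry, so
  the estimate itself forces \<open>\<phi>\<close> to depend on the first \<open>m\<close> entries only.
\<close>

definition Cllip_n :: "nat \<Rightarrow> ((nat \<Rightarrow> real) \<Rightarrow> real) set" where
  "Cllip_n m = {\<phi>. \<exists>C>0. \<exists>n::nat. \<forall>x y.
     \<bar>\<phi> x - \<phi> y\<bar> \<le> C * (1 + L2_set x {..<m} ^ n + L2_set y {..<m} ^ n)
                       * L2_set (\<lambda>i. x i - y i) {..<m}}"

section \<open>Sublinear expectations, independence, the G-normal distribution\<close>

locale sublinear_expectation =
  fixes H :: "('w \<Rightarrow> real) set" and E :: "('w \<Rightarrow> real) \<Rightarrow> real"
  assumes zero: "(\<lambda>_. 0) \<in> H"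
    and add: "\<And>X Y. X \<in> H \<Longrightarrow> Y \<in> H \<Longrightarrow> (\<lambda>w. X w + Y w) \<in> H"
    and scale: "\<And>c X. X \<in> H \<Longrightarrow> (\<lambda>w. c * X w) \<in> H"
    and stable: "\<And>m \<phi> X. m \<ge> 1 \<Longrightarrow> \<phi> \<in> Cllip_n m \<Longrightarrow> (\<And>i. i < m \<Longrightarrow> X i \<in> H) \<Longrightarrow>
                   (\<lambda>w. \<phi> (\<lambda>i. X i w)) \<in> H"
    and mono: "\<And>X Y. X \<in> H \<Longrightarrow> Y \<in> H \<Longrightarrow> (\<And>w. X w \<le> Y w) \<Longrightarrow> E X \<le> E Y"
    and const: "\<And>c. E (\<lambda>_. c) = c"
    and subadd: "\<And>X Y. X \<in> H \<Longrightarrow> Y \<in> H \<Longrightarrow> E X - E Y \<le> E (\<lambda>w. X w - Y w)"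
    and pos_homogeneous: "\<And>c X. c \<ge> 0 \<Longrightarrow> X \<in> H \<Longrightarrow> E (\<lambda>w. c * X w) = c * E X"

text \<open>The \<open>k\<close>-dimensional vector \<open>Y\<close> is independent from the \<open>m\<close>-dimensional vector \<open>X\<close>.\<close>

definition indep_from ::
    "(('w \<Rightarrow> real) \<Rightarrow> real) \<Rightarrow> nat \<Rightarrow> (nat \<Rightarrow> 'w \<Rightarrow> real) \<Rightarrow> nat \<Rightarrow> (nat \<Rightarrow> 'w \<Rightarrow> real) \<Rightarrow> bool" where
  "indep_from E k Y m X \<longleftrightarrow> (\<forall>\<phi>\<in>Cllip_n (m + k).
     E (\<lambda>w. \<phi> (\<lambda>i. if i < m then X i w else Y (i - m) w)) =
     E (\<lambda>w. E (\<lambda>w'. \<phi> (\<lambda>i. if i < m then X i w else Y (i - m) w'))))"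

text \<open>The argument \<open>s\<close> is the lower volatility bound.\<close>

definition Gfun :: "real \<Rightarrow> real \<Rightarrow> real" where
  "Gfun s a = (max a 0 - s\<^sup>2 * max (- a) 0) / 2"

text \<open>\<open>\<psi>\<close> is of class \<open>C\<^sup>1\<^sup>,\<^sup>2\<close> on \<open>(0,\<infinity>) \<times> \<real>\<close>, with the derivatives displayed.\<close>

definition C12_test ::
    "(real \<Rightarrow> real \<Rightarrow> real) \<Rightarrow> (real \<Rightarrow> real \<Rightarrow> real) \<Rightarrow> (real \<Rightarrow> real \<Rightarrow> real) \<Rightarrow> (real \<Rightarrow> real \<Rightarrow> real) \<Rightarrow> bool" where
  "C12_test \<psi> \<psi>t \<psi>x \<psi>xx \<longleftrightarrow>
     (\<forall>t>0. \<forall>x. ((\<lambda>r. \<psi> r x) has_real_derivative \<psi>t t x) (at t) \<and>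
                (\<psi> t has_real_derivative \<psi>x t x) (at x) \<and>
                (\<psi>x t has_real_derivative \<psi>xx t x) (at x)) \<and>
     (\<forall>f\<in>{\<psi>, \<psi>t, \<psi>x, \<psi>xx}. continuous_on ({0<..} \<times> UNIV) (\<lambda>(t, x). f t x))"

definition visc_subsolution :: "(real \<Rightarrow> real) \<Rightarrow> (real \<Rightarrow> real \<Rightarrow> real) \<Rightarrow> bool" where
  "visc_subsolution G u \<longleftrightarrow> (\<forall>\<psi> \<psi>t \<psi>x \<psi>xx t0 x0. C12_test \<psi> \<psi>t \<psi>x \<psi>xx \<longrightarrow> t0 > 0 \<longrightarrow>
     (\<forall>\<^sub>F (t, x) in nhds (t0, x0). u t x - \<psi> t x \<le> u t0 x0 - \<psi> t0 x0) \<longrightarrow>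
     \<psi>t t0 x0 \<le> G (\<psi>xx t0 x0))"

definition visc_supersolution :: "(real \<Rightarrow> real) \<Rightarrow> (real \<Rightarrow> real \<Rightarrow> real) \<Rightarrow> bool" where
  "visc_supersolution G u \<longleftrightarrow> (\<forall>\<psi> \<psi>t \<psi>x \<psi>xx t0 x0. C12_test \<psi> \<psi>t \<psi>x \<psi>xx \<longrightarrow> t0 > 0 \<longrightarrow>
     (\<forall>\<^sub>F (t, x) in nhds (t0, x0). u t x - \<psi> t x \<ge> u t0 x0 - \<psi> t0 x0) \<longrightarrow>
     \<psi>t t0 x0 \<ge> G (\<psi>xx t0 x0))"

text \<open>
  Continuous viscosity solutions of polynomial growth of \<open>\<partial>\<^sub>t u = G (\<partial>\<^sup>2\<^sub>x\<^sub>x u)\<close>, \<open>u(0,\<cdot>) = \<phi>\<close>.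
  Time is unbounded, so the growth is measured in \<open>(t, x)\<close>.
\<close>

definition G_heat_solution ::
    "(real \<Rightarrow> real) \<Rightarrow> (real \<Rightarrow> real) \<Rightarrow> (real \<Rightarrow> real \<Rightarrow> real) \<Rightarrow> bool" where
  "G_heat_solution G \<phi> u \<longleftrightarrow>
     continuous_on ({0..} \<times> UNIV) (\<lambda>(t, x). u t x) \<and>
     (\<exists>C n. \<forall>t\<ge>0. \<forall>x. \<bar>u t x\<bar> \<le> C * (1 + t ^ n + \<bar>x\<bar> ^ n)) \<and>
     visc_subsolution G u \<and> visc_supersolution G u \<and> (\<forall>x. u 0 x = \<phi> x)"

text \<open>\<open>\<xi>\<close> is \<open>N(0,[s\<^sup>2,1])\<close>-distributed under \<open>E\<close>.\<close>

definition G_normal :: "(('w \<Rightarrow> real) \<Rightarrow> real) \<Rightarrow> real \<Rightarrow> ('w \<Rightarrow> real) \<Rightarrow> bool" where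
  "G_normal E s \<xi> \<longleftrightarrow> (\<forall>\<phi>\<in>Cllip.
     let u = (\<lambda>t x. E (\<lambda>w. \<phi> (x + sqrt t * \<xi> w))) in
     G_heat_solution (Gfun s) \<phi> u \<and>
     (\<forall>v. G_heat_solution (Gfun s) \<phi> v \<longrightarrow> (\<forall>t\<ge>0. \<forall>x. v t x = u t x)))"

section \<open>Path space and G-expectation\<close>

text \<open>Paths on \<open>[0,\<infinity>)\<close>, continued by \<open>0\<close> to negative times so that they are determined by their
  values on \<open>[0,\<infinity>)\<close>.\<close>

typedef path = "{\<omega> :: real \<Rightarrow> real. continuous_on {0..} \<omega> \<and> (\<forall>t\<le>0. \<omega> t = 0)}"
  by (rule exI[of _ "\<lambda>_. 0"]) simp

definition B :: "real \<Rightarrow> path \<Rightarrow> real" where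
  "B t \<omega> = Rep_path \<omega> t"

definition L0ip_upto :: "real \<Rightarrow> (path \<Rightarrow> real) set" where
  "L0ip_upto T = {X. \<exists>m\<ge>1. \<exists>t. \<exists>\<phi>\<in>Cllip_n m. (\<forall>i<m. t i \<in> {0..T}) \<and> X = (\<lambda>\<omega>. \<phi> (\<lambda>i. B (t i) \<omega>))}"

definition L0ip :: "(path \<Rightarrow> real) set" where
  "L0ip = (\<Union>n::nat. L0ip_upto (real n))"

text \<open>
  \<open>E\<close> is the G-expectation on \<open>L0ip\<close> obtained from the sublinear expectation space \<open>(H, E')\<close> and
  the sequence \<open>\<xi>\<close> in it (indexed from \<open>0\<close>). Its values outside \<open>L0ip\<close> are left open and are
  never used.
\<close>

definition G_expectation ::
    "real \<Rightarrow> ('w \<Rightarrow> real) set \<Rightarrow> (('w \<Rightarrow> real) \<Rightarrow> real) \<Rightarrow> (nat \<Rightarrow> 'w \<Rightarrow> real) \<Rightarrow> ((path \<Rightarrow> real) \<Rightarrow> real) \<Rightarrow> bool" where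
  "G_expectation s H E' \<xi> E \<longleftrightarrow>
     sublinear_expectation H E' \<and>
     (\<forall>i. \<xi> i \<in> H \<and> G_normal E' s (\<xi> i)) \<and>
     (\<forall>i\<ge>1. indep_from E' 1 (\<lambda>_. \<xi> i) i \<xi>) \<and>
     (\<forall>m\<ge>1. \<forall>t. \<forall>\<phi>\<in>Cllip_n m. t 0 = 0 \<longrightarrow> (\<forall>i<m. t i \<le> t (Suc i)) \<longrightarrow>
        E (\<lambda>\<omega>. \<phi> (\<lambda>i. B (t (Suc i)) \<omega> - B (t i) \<omega>)) =
        E' (\<lambda>w. \<phi> (\<lambda>i. sqrt (t (Suc i) - t i) * \<xi> i w)))"

section \<open>Completions\<close>

text \<open>
  An element of a completion of (a subspace of) \<open>L0ip\<close> is represented by a Cauchy sequence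
  \<open>X 0, X 1, \<dots>\<close> in that subspace; two representatives are identified when their difference has
  norm \<open>0\<close>. No quotient type is formed, since it would depend on \<open>E\<close>. A function of elements of the
  completion, such as a Lipschitz function of one of them or the product of two of them, is
  computed termwise on representatives.
\<close>

type_synonym rv = "nat \<Rightarrow> path \<Rightarrow> real"

definition Lp_norm :: "((path \<Rightarrow> real) \<Rightarrow> real) \<Rightarrow> real \<Rightarrow> (path \<Rightarrow> real) \<Rightarrow> real" where
  "Lp_norm E p X = E (\<lambda>\<omega>. \<bar>X \<omega>\<bar> powr p) powr (1 / p)"

text \<open>\<open>LG E p L0ip\<close> is \<open>L\<^sub>G\<^sup>p(F)\<close> and \<open>LG E p (L0ip_upto t)\<close> is \<open>L\<^sub>G\<^sup>p(F\<^sub>t)\<close>.\<close>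

definition LG :: "((path \<Rightarrow> real) \<Rightarrow> real) \<Rightarrow> real \<Rightarrow> (path \<Rightarrow> real) set \<Rightarrow> rv set" where
  "LG E p S = {X. (\<forall>n. X n \<in> S) \<and>
     (\<forall>e>0. \<exists>N. \<forall>m\<ge>N. \<forall>n\<ge>N. Lp_norm E p (\<lambda>\<omega>. X m \<omega> - X n \<omega>) < e)}"

text \<open>The continuous extension of \<open>E\<close>, and the norm of the completion.\<close>

definition EG :: "((path \<Rightarrow> real) \<Rightarrow> real) \<Rightarrow> rv \<Rightarrow> real" where
  "EG E X = lim (\<lambda>n. E (X n))"

definition LG_norm :: "((path \<Rightarrow> real) \<Rightarrow> real) \<Rightarrow> real \<Rightarrow> rv \<Rightarrow> real" where
  "LG_norm E p X = EG E (\<lambda>n \<omega>. \<bar>X n \<omega>\<bar> powr p) powr (1 / p)"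

text \<open>Equality of two elements of \<open>L\<^sub>G\<^sup>p(F)\<close>.\<close>

definition LG_eq :: "((path \<Rightarrow> real) \<Rightarrow> real) \<Rightarrow> real \<Rightarrow> rv \<Rightarrow> rv \<Rightarrow> bool" where
  "LG_eq E p X Y \<longleftrightarrow> LG_norm E p (\<lambda>n \<omega>. X n \<omega> - Y n \<omega>) = 0"

text \<open>Step processes: the triple \<open>(N, \<tau>, \<xi>)\<close> stands for
  \<open>\<Sum>j<N. \<xi>\<^sub>j I\<^bsub>[\<tau>\<^sub>j, \<tau>\<^sub>j\<^sub>+\<^sub>1)\<^esub>\<close>.\<close>

type_synonym step = "nat \<times> (nat \<Rightarrow> real) \<times> (nat \<Rightarrow> rv)"

fun is_step :: "((path \<Rightarrow> real) \<Rightarrow> real) \<Rightarrow> real \<Rightarrow> real \<Rightarrow> step \<Rightarrow> bool" where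
  "is_step E p T (N, \<tau>, \<xi>) \<longleftrightarrow> \<tau> 0 = 0 \<and> \<tau> N = T \<and>
     (\<forall>j<N. \<tau> j < \<tau> (Suc j) \<and> \<xi> j \<in> LG E p (L0ip_upto (\<tau> j)))"

fun step_process :: "step \<Rightarrow> real \<Rightarrow> rv" where
  "step_process (N, \<tau>, \<xi>) t n \<omega> = (\<Sum>j<N. \<xi> j n \<omega> * indicator {\<tau> j..<\<tau> (Suc j)} t)"

definition MG_dist :: "((path \<Rightarrow> real) \<Rightarrow> real) \<Rightarrow> real \<Rightarrow> real \<Rightarrow> (real \<Rightarrow> rv) \<Rightarrow> (real \<Rightarrow> rv) \<Rightarrow> real" where
  "MG_dist E p T \<eta> \<zeta> =
     (1 / T * integral {0..T} (\<lambda>t. EG E (\<lambda>n \<omega>. \<bar>\<eta> t n \<omega> - \<zeta> t n \<omega>\<bar> powr p))) powr (1 / p)"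

text \<open>
  The norm of \<open>M\<^sub>G\<^sup>p(0,T)\<close> on step processes is the Bochner norm of \<open>L\<^sup>p(0,T; L\<^sub>G\<^sup>p(F))\<close>. The completion
  is therefore the closure of the step processes in that space: its elements are represented by
  functions \<open>t \<mapsto> \<eta>\<^sub>t\<close> into \<open>L\<^sub>G\<^sup>p(F)\<close> that are limits of step processes. The integrability requirement
  excludes a meaningless value of the integral in \<open>MG_dist\<close>.
\<close>

definition MG_approx ::
    "((path \<Rightarrow> real) \<Rightarrow> real) \<Rightarrow> real \<Rightarrow> real \<Rightarrow> (nat \<Rightarrow> step) \<Rightarrow> (real \<Rightarrow> rv) \<Rightarrow> bool" where
  "MG_approx E p T S \<eta> \<longleftrightarrow>
     (\<forall>k. is_step E p T (S k)) \<and>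
     (\<forall>k. (\<lambda>t. EG E (\<lambda>n \<omega>. \<bar>step_process (S k) t n \<omega> - \<eta> t n \<omega>\<bar> powr p)) integrable_on {0..T}) \<and>
     (\<lambda>k. MG_dist E p T (step_process (S k)) \<eta>) \<longlonglongrightarrow> 0"

definition MG :: "((path \<Rightarrow> real) \<Rightarrow> real) \<Rightarrow> real \<Rightarrow> real \<Rightarrow> (real \<Rightarrow> rv) set" where
  "MG E p T = {\<eta>. (\<forall>t\<in>{0..T}. \<eta> t \<in> LG E p L0ip) \<and> (\<exists>S. MG_approx E p T S \<eta>)}"

section \<open>Integrals\<close>

fun step_integral :: "(real \<Rightarrow> rv) \<Rightarrow> step \<Rightarrow> rv" where
  "step_integral A (N, \<tau>, \<xi>) n \<omega> = (\<Sum>j<N. \<xi> j n \<omega> * (A (\<tau> (Suc j)) n \<omega> - A (\<tau> j) n \<omega>))"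

text \<open>
  \<open>I\<close> is the integral over \<open>[0,T]\<close> of \<open>\<eta> \<in> M\<^sub>G\<^sup>2(0,T)\<close> against \<open>A\<close>: the continuous extension of
  \<open>step_integral A\<close>, taken as a map from \<open>M\<^sub>G\<^sup>2(0,T)\<close> to \<open>L\<^sub>G\<^sup>q(F)\<close>.
\<close>

definition has_G_integral ::
    "((path \<Rightarrow> real) \<Rightarrow> real) \<Rightarrow> real \<Rightarrow> (real \<Rightarrow> rv) \<Rightarrow> real \<Rightarrow> (real \<Rightarrow> rv) \<Rightarrow> rv \<Rightarrow> bool" where
  "has_G_integral E q A T \<eta> I \<longleftrightarrow> \<eta> \<in> MG E 2 T \<and> I \<in> LG E q L0ip \<and>
     (\<exists>S. MG_approx E 2 T S \<eta> \<and>
          (\<lambda>k. LG_norm E q (\<lambda>n \<omega>. step_integral A (S k) n \<omega> - I n \<omega>)) \<longlonglongrightarrow> 0)"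

definition has_dt_integral where
  "has_dt_integral E = has_G_integral E 2 (\<lambda>t n \<omega>. t)"

definition has_dB_integral where
  "has_dB_integral E = has_G_integral E 2 (\<lambda>t n \<omega>. B t \<omega>)"

text \<open>The quadratic variation \<open>\<langle>B\<rangle>\<^sub>t = B\<^sub>t\<^sup>2 - 2 \<integral>\<^sub>0\<^sup>t B\<^sub>s dB\<^sub>s\<close>, an element of \<open>L\<^sub>G\<^sup>2(F)\<close>.\<close>

definition QV :: "((path \<Rightarrow> real) \<Rightarrow> real) \<Rightarrow> real \<Rightarrow> rv" where
  "QV E t = (\<lambda>n \<omega>. (B t \<omega>)\<^sup>2 - 2 * (SOME J. has_dB_integral E t (\<lambda>s n \<omega>. B s \<omega>) J) n \<omega>)"

text \<open>The product of a coefficient \<open>\<xi>\<^sub>j \<in> L\<^sub>G\<^sup>2\<close> and an increment of \<open>\<langle>B\<rangle>\<close>, formed termwise on arbitrary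
  representatives, is in general a Cauchy sequence for the norm of \<open>L\<^sub>G\<^sup>1\<close> only; hence the exponent
  \<open>1\<close>, as in Peng's construction.\<close>

definition has_dQV_integral where
  "has_dQV_integral E = has_G_integral E 1 (QV E)"

section \<open>Differentiability in \<open>L\<^sub>G\<^sup>2\<close>\<close>

definition has_LG2_derivative :: "((path \<Rightarrow> real) \<Rightarrow> real) \<Rightarrow> (real \<Rightarrow> rv) \<Rightarrow> rv \<Rightarrow> real \<Rightarrow> bool" where
  "has_LG2_derivative E g f \<alpha> \<longleftrightarrow> f \<in> LG E 2 L0ip \<and>
     ((\<lambda>\<delta>. EG E (\<lambda>n \<omega>. \<bar>(g (\<alpha> + \<delta>) n \<omega> - g \<alpha> n \<omega>) / \<delta> - f n \<omega>\<bar>\<^sup>2)) \<longlongrightarrow> 0) (at 0)"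

end

theory Submission
  imports Defs
begin

text \<open>
  The candidate for the derivative is constructed before it is shown to be one. Differentiating the equation formally in
  the parameter gives a linear equation for \<open>Y\<close> with the coefficients \<open>b\<^sub>x(\<alpha>, s, X\<^sub>s)\<close>, \<open>\<sigma>\<^sub>x(\<alpha>, s, X\<^sub>s)\<close>,
  \<open>h\<^sub>x(\<alpha>, s, X\<^sub>s)\<close>, which are bounded by the Lipschitz constant \<open>L\<close> of \<open>b, \<sigma>, h\<close>. Picard iteration solves it
  (\<open>SDE_solution\<close>). The difference quotient \<open>D\<close> of the given solutions satisfies an equation whose integrands differ
  from those of \<open>Y\<close> by at most \<open>L * \<bar>D - Y\<bar>\<close> plus the first order remainder
  \<open>\<rho> = (f(\<alpha> + \<delta>, X + \<delta> Y) - f(\<alpha>, X)) / \<delta> - f\<^sub>x(\<alpha>, X) Y - f\<^sub>\<alpha>(\<alpha>, X)\<close>. Gronwall's inequality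
  (\<open>SDE_stability\<close>) bounds \<open>D - Y\<close> in mean square by the norm of \<open>\<rho>\<close>, and it remains to see that this norm tends to
  \<open>0\<close> with \<open>\<delta>\<close>.

  Pointwise, \<open>\<bar>\<rho>\<bar>\<close> is at most \<open>2 L (1 + \<bar>Y\<bar>)\<close>, and because the derivatives are locally Lipschitz with polynomial growth
  it is also at most \<open>C (1 + \<bar>X\<bar> + \<bar>Y\<bar>)\<^sup>k \<bar>\<delta>\<bar>\<close> (\<open>remainder_bounds\<close>). The values of \<open>X\<close> and \<open>Y\<close> may lack higher
  moments, but each of them is a limit in mean square of cylinder functions, which have moments of all orders; so it is
  uniformly integrable, and the two bounds together give convergence at each time (\<open>remainder_small\<close>). Dominated
  convergence in time finishes the argument (\<open>SDE_derivative\<close>).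

  The G-expectation enters through three moments only: for a factor \<open>Z\<close> known at time \<open>u\<close>, the increment
  \<open>\<Delta> = B\<^sub>v - B\<^sub>u\<close> satisfies \<open>E[Z \<Delta>] = 0\<close> and, if \<open>Z \<ge> 0\<close>, \<open>E[Z \<Delta>\<^sup>2] = (v - u) E[Z]\<close> and
  \<open>E[Z \<Delta>\<^sup>4] = c (v - u)\<^sup>2 E[Z]\<close>. They follow from independence once \<open>E\<close> is written as \<open>E'\<close> composed with a map into path
  space (\<open>G_expectation_transfer\<close>), the first two moments of \<open>\<xi>\<close> being read off from explicit solutions of the G-heat
  equation. The first two identities give the mean square estimate for \<open>dB\<close>. The last one gives
  \<open>\<parallel>Z (\<langle>B\<rangle>\<^sub>v - \<langle>B\<rangle>\<^sub>u)\<parallel> \<le> sqrt c (v - u) \<parallel>Z\<parallel>\<close> for bounded \<open>Z\<close> by Minkowski's inequality (\<open>QV_increment\<close>). Hence the integrals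
  against \<open>dt\<close>, \<open>dB\<close> and \<open>d\<langle>B\<rangle>\<close> all satisfy \<open>\<parallel>\<integral>\<eta> dA\<parallel>\<^sup>2 \<le> C \<integral>\<parallel>\<eta>\<parallel>\<^sup>2 dt\<close> on elementary processes with bounded
  coefficients and are handled uniformly as integrals against an \<open>integrator\<close>.

  Two points of comparison connect this to the spaces of the theorem. The processes approximable by bounded elementary
  processes in the sense of upper integrals are those of \<open>MG E 2 T\<close> (\<open>MG_iff_MG2\<close>), and for them the norm is
  automatically integrable in time. The equation of the theorem is an equality in the first-order completion; between
  elements of the second-order completion this is the same as equality in mean square (\<open>d1_zero_imp_d2_zero\<close>), again by
  uniform integrability.
\<close>

section \<open>Functions of polynomial growth\<close>

text \<open>
  The sum of the moduli is comparable to the Euclidean norm up to the factor \<open>m\<close> and is the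
  easier of the two to split and to estimate.
\<close>

definition vnorm1 :: "nat \<Rightarrow> (nat \<Rightarrow> real) \<Rightarrow> real" where
  "vnorm1 m x = (\<Sum>i<m. \<bar>x i\<bar>)"

lemma vnorm1_nonneg [simp]: "0 \<le> vnorm1 m x"
  by (simp add: vnorm1_def sum_nonneg)

lemma abs_le_vnorm1: "i < m \<Longrightarrow> \<bar>x i\<bar> \<le> vnorm1 m x"
  unfolding vnorm1_def by (rule member_le_sum) auto

lemma L2_set_le_vnorm1: "L2_set x {..<m} \<le> vnorm1 m x"
  unfolding vnorm1_def by (rule L2_set_le_sum_abs)

lemma vnorm1_le_L2_set: "vnorm1 m x \<le> real m * L2_set x {..<m}"
proof -
  have "(\<Sum>i<m. \<bar>x i\<bar>) \<le> (\<Sum>i<m. L2_set x {..<m})"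
  proof (rule sum_mono)
    fix i assume i: "i \<in> {..<m}"
    have "\<bar>x i\<bar> \<le> L2_set (\<lambda>i. \<bar>x i\<bar>) {..<m}"
      by (rule member_le_L2_set[of _ _ "\<lambda>i. \<bar>x i\<bar>"]) (use i in auto)
    then show "\<bar>x i\<bar> \<le> L2_set x {..<m}" by (simp add: L2_set_def)
  qed
  then show ?thesis by (simp add: vnorm1_def)
qed

lemma power_add3_le:
  fixes a b :: real assumes "0 \<le> a" "0 \<le> b"
  shows "(1 + a + b) ^ n \<le> 3 ^ n * (1 + a ^ n + b ^ n)"
proof -
  define m where "m = max 1 (max a b)"
  have "(1 + a + b) ^ n \<le> (3 * m) ^ n"
    using assms by (intro power_mono) (auto simp: m_def)
  also have "\<dots> = 3 ^ n * m ^ n" by (simp add: power_mult_distrib)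
  also have "m ^ n \<le> 1 + a ^ n + b ^ n"
  proof -
    have "m = 1 \<or> m = a \<or> m = b" by (auto simp: m_def max_def)
    moreover have "0 \<le> a ^ n" "0 \<le> b ^ n" using assms by auto
    ultimately show ?thesis by (auto simp only: power_one)
  qed
  finally show ?thesis by simp
qed

text \<open>
  One power of a sum in place of a sum of powers makes closure under composition a matter of
  multiplying exponents. Both forms agree because \<open>(a + b + c)\<^sup>n\<close> and \<open>a\<^sup>n + b\<^sup>n + c\<^sup>n\<close> bound
  each other up to a constant.
\<close>

lemma Cllip_n_iff:
  "\<phi> \<in> Cllip_n m \<longleftrightarrow> (\<exists>C\<ge>0. \<exists>n. \<forall>x y.
     \<bar>\<phi> x - \<phi> y\<bar> \<le> C * (1 + vnorm1 m x + vnorm1 m y) ^ n * vnorm1 m (\<lambda>i. x i - y i))"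
proof
  assume "\<phi> \<in> Cllip_n m"
  then obtain C n where C: "C > 0" and H: "\<And>x y. \<bar>\<phi> x - \<phi> y\<bar> \<le> C * (1 + L2_set x {..<m} ^ n + L2_set y {..<m} ^ n)
                       * L2_set (\<lambda>i. x i - y i) {..<m}" by (auto simp: Cllip_n_def)
  have "\<bar>\<phi> x - \<phi> y\<bar> \<le> (3 * C) * (1 + vnorm1 m x + vnorm1 m y) ^ n * vnorm1 m (\<lambda>i. x i - y i)" for x y
  proof -
    let ?S = "1 + vnorm1 m x + vnorm1 m y"
    have a: "L2_set x {..<m} ^ n \<le> ?S ^ n" "L2_set y {..<m} ^ n \<le> ?S ^ n" "1 \<le> ?S ^ n"
      using L2_set_le_vnorm1[of x m] L2_set_le_vnorm1[of y m] vnorm1_nonneg[of m x] vnorm1_nonneg[of m y]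
      by (auto intro!: power_mono simp del: vnorm1_nonneg)
    have "\<bar>\<phi> x - \<phi> y\<bar> \<le> C * (1 + L2_set x {..<m} ^ n + L2_set y {..<m} ^ n)
                       * L2_set (\<lambda>i. x i - y i) {..<m}" by (rule H)
    also have "\<dots> \<le> C * (?S ^ n + ?S ^ n + ?S ^ n) * vnorm1 m (\<lambda>i. x i - y i)"
      using C a by (intro mult_mono L2_set_le_vnorm1 add_mono) auto
    finally show ?thesis by (simp add: algebra_simps)
  qed
  with C show "\<exists>C\<ge>0. \<exists>n. \<forall>x y.
     \<bar>\<phi> x - \<phi> y\<bar> \<le> C * (1 + vnorm1 m x + vnorm1 m y) ^ n * vnorm1 m (\<lambda>i. x i - y i)"
    by (intro exI[of _ "3 * C"]) auto
next
  assume "\<exists>C\<ge>0. \<exists>n. \<forall>x y.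
     \<bar>\<phi> x - \<phi> y\<bar> \<le> C * (1 + vnorm1 m x + vnorm1 m y) ^ n * vnorm1 m (\<lambda>i. x i - y i)"
  then obtain C n where C: "C \<ge> 0" and H: "\<And>x y. \<bar>\<phi> x - \<phi> y\<bar> \<le> C * (1 + vnorm1 m x + vnorm1 m y) ^ n * vnorm1 m (\<lambda>i. x i - y i)"
    by auto
  define D where "D = C * (1 + real m) ^ n * 3 ^ n * real m + 1"
  have "\<bar>\<phi> x - \<phi> y\<bar> \<le> D * (1 + L2_set x {..<m} ^ n + L2_set y {..<m} ^ n) * L2_set (\<lambda>i. x i - y i) {..<m}" for x y
  proof -
    let ?a = "L2_set x {..<m}" and ?b = "L2_set y {..<m}" and ?d = "L2_set (\<lambda>i. x i - y i) {..<m}"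
    have "1 + vnorm1 m x + vnorm1 m y \<le> (1 + real m) * (1 + ?a + ?b)"
      using vnorm1_le_L2_set[of m x] vnorm1_le_L2_set[of m y] by (simp add: algebra_simps add_mono add_increasing add_increasing2)
    then have "(1 + vnorm1 m x + vnorm1 m y) ^ n \<le> ((1 + real m) * (1 + ?a + ?b)) ^ n"
      by (intro power_mono) auto
    also have "\<dots> = (1 + real m) ^ n * (1 + ?a + ?b) ^ n" by (simp add: power_mult_distrib)
    also have "\<dots> \<le> (1 + real m) ^ n * (3 ^ n * (1 + ?a ^ n + ?b ^ n))"
      by (intro mult_left_mono power_add3_le) auto
    finally have p: "(1 + vnorm1 m x + vnorm1 m y) ^ n \<le> (1 + real m) ^ n * (3 ^ n * (1 + ?a ^ n + ?b ^ n))" .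
    have "\<bar>\<phi> x - \<phi> y\<bar> \<le> C * (1 + vnorm1 m x + vnorm1 m y) ^ n * vnorm1 m (\<lambda>i. x i - y i)" by (rule H)
    also have "\<dots> \<le> C * ((1 + real m) ^ n * (3 ^ n * (1 + ?a ^ n + ?b ^ n))) * (real m * ?d)"
      using C by (intro mult_mono p vnorm1_le_L2_set order_refl) auto
    also have "\<dots> = (D - 1) * (1 + ?a ^ n + ?b ^ n) * ?d"
      by (simp add: D_def algebra_simps)
    also have "\<dots> \<le> D * (1 + ?a ^ n + ?b ^ n) * ?d"
      by (intro mult_right_mono) auto
    finally show ?thesis .
  qed
  moreover have "D > 0" using C by (simp add: D_def add_nonneg_pos)
  ultimately show "\<phi> \<in> Cllip_n m" unfolding Cllip_n_def by auto
qed

lemma Cllip_nI: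
  assumes "C \<ge> 0" "\<And>x y. \<bar>\<phi> x - \<phi> y\<bar> \<le> C * (1 + vnorm1 m x + vnorm1 m y) ^ n * vnorm1 m (\<lambda>i. x i - y i)"
  shows "\<phi> \<in> Cllip_n m"
  using assms unfolding Cllip_n_iff by blast

text \<open>
  Each inner function grows at most like a power, so the growth factor of the outer function
  stays bounded by a power, and the increments of the inner functions supply the factor linear
  in the distance.
\<close>

lemma Cllip_n_compose:
  assumes \<psi>: "\<psi> \<in> Cllip_n k" and \<phi>: "\<And>i. i < k \<Longrightarrow> \<phi> i \<in> Cllip_n m"
  shows "(\<lambda>x. \<psi> (\<lambda>i. \<phi> i x)) \<in> Cllip_n m"
proof -
  obtain C n where C: "C \<ge> 0" and H: "\<And>x y. \<bar>\<psi> x - \<psi> y\<bar> \<le> C * (1 + vnorm1 k x + vnorm1 k y) ^ n * vnorm1 k (\<lambda>i. x i - y i)"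
    using \<psi> by (auto simp: Cllip_n_iff)
  have "\<forall>i\<in>{..<k}. \<exists>D p. D \<ge> 0 \<and> (\<forall>x y. \<bar>\<phi> i x - \<phi> i y\<bar> \<le> D * (1 + vnorm1 m x + vnorm1 m y) ^ p * vnorm1 m (\<lambda>j. x j - y j))"
    using \<phi> by (auto simp: Cllip_n_iff)
  then obtain D p where D: "\<And>i. i < k \<Longrightarrow> D i \<ge> 0" and
    HD: "\<And>i x y. i < k \<Longrightarrow> \<bar>\<phi> i x - \<phi> i y\<bar> \<le> D i * (1 + vnorm1 m x + vnorm1 m y) ^ p i * vnorm1 m (\<lambda>j. x j - y j)"
    unfolding bchoice_iff by (metis (no_types) lessThan_iff)
  define P where "P = (\<Sum>i<k. p i)"
  define DD where "DD = (\<Sum>i<k. D i)"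
  have DD: "DD \<ge> 0" unfolding DD_def using D by (intro sum_nonneg) auto
  have pP: "p i \<le> P" if "i < k" for i unfolding P_def using that by (intro member_le_sum) auto
  have diff: "vnorm1 k (\<lambda>i. \<phi> i x - \<phi> i y) \<le> DD * (1 + vnorm1 m x + vnorm1 m y) ^ P * vnorm1 m (\<lambda>j. x j - y j)" for x y
  proof -
    have "\<bar>\<phi> i x - \<phi> i y\<bar> \<le> D i * ((1 + vnorm1 m x + vnorm1 m y) ^ P * vnorm1 m (\<lambda>j. x j - y j))" if i: "i < k" for i
    proof -
      have "\<bar>\<phi> i x - \<phi> i y\<bar> \<le> D i * (1 + vnorm1 m x + vnorm1 m y) ^ p i * vnorm1 m (\<lambda>j. x j - y j)" by (rule HD[OF i])
      also have "\<dots> \<le> D i * (1 + vnorm1 m x + vnorm1 m y) ^ P * vnorm1 m (\<lambda>j. x j - y j)"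
        using D[OF i] pP[OF i] by (intro mult_right_mono mult_left_mono power_increasing) auto
      finally show ?thesis by (simp add: mult.assoc)
    qed
    then have "vnorm1 k (\<lambda>i. \<phi> i x - \<phi> i y) \<le> (\<Sum>i<k. D i * ((1 + vnorm1 m x + vnorm1 m y) ^ P * vnorm1 m (\<lambda>j. x j - y j)))"
      unfolding vnorm1_def[of k] by (intro sum_mono) auto
    then show ?thesis by (simp add: DD_def sum_distrib_right mult.assoc)
  qed
  define F where "F = vnorm1 k (\<lambda>i. \<phi> i (\<lambda>_. 0)) + DD"
  have F: "F \<ge> 0" using DD by (simp add: F_def)
  have size: "vnorm1 k (\<lambda>i. \<phi> i x) \<le> F * (1 + vnorm1 m x) ^ Suc P" for x
  proof -
    have "vnorm1 k (\<lambda>i. \<phi> i x) \<le> vnorm1 k (\<lambda>i. \<phi> i (\<lambda>_. 0)) + vnorm1 k (\<lambda>i. \<phi> i x - \<phi> i (\<lambda>_. 0))"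
      unfolding vnorm1_def by (subst sum.distrib[symmetric], rule sum_mono) auto
    also have "\<dots> \<le> vnorm1 k (\<lambda>i. \<phi> i (\<lambda>_. 0)) + DD * (1 + vnorm1 m x + vnorm1 m (\<lambda>_. 0)) ^ P * vnorm1 m (\<lambda>j. x j - 0)"
      using diff[of x "\<lambda>_. 0"] by simp
    also have "\<dots> = vnorm1 k (\<lambda>i. \<phi> i (\<lambda>_. 0)) + DD * ((1 + vnorm1 m x) ^ P * vnorm1 m x)"
      by (simp add: vnorm1_def)
    also have "\<dots> \<le> vnorm1 k (\<lambda>i. \<phi> i (\<lambda>_. 0)) * (1 + vnorm1 m x) ^ Suc P + DD * (1 + vnorm1 m x) ^ Suc P"
    proof (rule add_mono)
      have "1 \<le> (1 + vnorm1 m x) ^ Suc P" by (rule one_le_power) auto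
      then show "vnorm1 k (\<lambda>i. \<phi> i (\<lambda>_. 0)) \<le> vnorm1 k (\<lambda>i. \<phi> i (\<lambda>_. 0)) * (1 + vnorm1 m x) ^ Suc P"
        using mult_left_mono[of 1 _ "vnorm1 k (\<lambda>i. \<phi> i (\<lambda>_. 0))"] by fastforce
      have "(1 + vnorm1 m x) ^ P * vnorm1 m x \<le> (1 + vnorm1 m x) ^ P * (1 + vnorm1 m x)"
        by (intro mult_left_mono) auto
      then show "DD * ((1 + vnorm1 m x) ^ P * vnorm1 m x) \<le> DD * (1 + vnorm1 m x) ^ Suc P"
        using DD by (intro mult_left_mono) (auto simp: mult.commute)
    qed
    finally show ?thesis by (simp add: F_def algebra_simps)
  qed
  show ?thesis
  proof (rule Cllip_nI)
    show "0 \<le> C * (1 + 2 * F) ^ n * DD" using C F DD by simp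
    fix x y
    let ?S = "1 + vnorm1 m x + vnorm1 m y"
    have S1: "1 \<le> ?S ^ Suc P" by (rule one_le_power) auto
    have "F * (1 + vnorm1 m z) ^ Suc P \<le> F * ?S ^ Suc P" if "z = x \<or> z = y" for z
      using F that by (intro mult_left_mono power_mono) auto
    then have "1 + vnorm1 k (\<lambda>i. \<phi> i x) + vnorm1 k (\<lambda>i. \<phi> i y) \<le> ?S ^ Suc P + F * ?S ^ Suc P + F * ?S ^ Suc P"
      using size[of x] size[of y] S1 by (intro add_mono) (auto intro: order_trans)
    also have "\<dots> = (1 + 2 * F) * ?S ^ Suc P" by (simp add: algebra_simps)
    finally have "(1 + vnorm1 k (\<lambda>i. \<phi> i x) + vnorm1 k (\<lambda>i. \<phi> i y)) ^ n \<le> ((1 + 2 * F) * ?S ^ Suc P) ^ n"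
      by (intro power_mono) auto
    then have b: "(1 + vnorm1 k (\<lambda>i. \<phi> i x) + vnorm1 k (\<lambda>i. \<phi> i y)) ^ n \<le> (1 + 2 * F) ^ n * ?S ^ (Suc P * n)"
      by (simp only: power_mult_distrib power_mult)
    have "\<bar>\<psi> (\<lambda>i. \<phi> i x) - \<psi> (\<lambda>i. \<phi> i y)\<bar> \<le> C * (1 + vnorm1 k (\<lambda>i. \<phi> i x) + vnorm1 k (\<lambda>i. \<phi> i y)) ^ n * vnorm1 k (\<lambda>i. \<phi> i x - \<phi> i y)"
      by (rule H)
    also have "\<dots> \<le> C * ((1 + 2 * F) ^ n * ?S ^ (Suc P * n)) * (DD * ?S ^ P * vnorm1 m (\<lambda>j. x j - y j))"
      using C F by (intro mult_mono b diff) auto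
    also have "\<dots> = C * (1 + 2 * F) ^ n * DD * ?S ^ (Suc P * n + P) * vnorm1 m (\<lambda>j. x j - y j)"
      by (simp add: power_add algebra_simps)
    finally show "\<bar>\<psi> (\<lambda>i. \<phi> i x) - \<psi> (\<lambda>i. \<phi> i y)\<bar> \<le> C * (1 + 2 * F) ^ n * DD * ?S ^ (Suc P * n + P) * vnorm1 m (\<lambda>j. x j - y j)" .
  qed
qed

lemma Cllip_n_sum:
  assumes "finite J" "J \<subseteq> {..<m}" shows "(\<lambda>x. \<Sum>j\<in>J. c j * x j) \<in> Cllip_n m"
proof (rule Cllip_nI)
  show "0 \<le> (\<Sum>j\<in>J. \<bar>c j\<bar>)" by (simp add: sum_nonneg)
  fix x y :: "nat \<Rightarrow> real"
  have "\<bar>(\<Sum>j\<in>J. c j * x j) - (\<Sum>j\<in>J. c j * y j)\<bar> = \<bar>\<Sum>j\<in>J. c j * (x j - y j)\<bar>"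
    by (simp add: sum_subtractf right_diff_distrib)
  also have "\<dots> \<le> (\<Sum>j\<in>J. \<bar>c j\<bar> * \<bar>x j - y j\<bar>)"
    by (rule order_trans[OF sum_abs]) (simp add: abs_mult)
  also have "\<dots> \<le> (\<Sum>j\<in>J. \<bar>c j\<bar> * vnorm1 m (\<lambda>i. x i - y i))"
    using assms by (intro sum_mono mult_left_mono abs_le_vnorm1[of _ m "\<lambda>i. x i - y i"]) auto
  finally show "\<bar>(\<Sum>j\<in>J. c j * x j) - (\<Sum>j\<in>J. c j * y j)\<bar> \<le> (\<Sum>j\<in>J. \<bar>c j\<bar>) * (1 + vnorm1 m x + vnorm1 m y) ^ 0 * vnorm1 m (\<lambda>i. x i - y i)"
    by (simp add: sum_distrib_right)
qed

lemma Cllip_n_proj: "i < m \<Longrightarrow> (\<lambda>x. x i) \<in> Cllip_n m"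
  using Cllip_n_sum[of "{i}" m "\<lambda>_. 1"] by simp

lemma Cllip_n_cong:
  assumes "\<phi> \<in> Cllip_n m" "\<And>i. i < m \<Longrightarrow> x i = y i" shows "\<phi> x = \<phi> y"
proof -
  obtain C n where "\<bar>\<phi> x - \<phi> y\<bar> \<le> C * (1 + vnorm1 m x + vnorm1 m y) ^ n * vnorm1 m (\<lambda>i. x i - y i)"
    using assms(1) unfolding Cllip_n_iff by blast
  moreover have "vnorm1 m (\<lambda>i. x i - y i) = 0" using assms(2) by (simp add: vnorm1_def)
  ultimately show ?thesis by simp
qed

text \<open>
  The one-variable class in the form of \<open>Cllip_n_iff\<close>.
\<close>

definition polylip1 :: "(real \<Rightarrow> real) \<Rightarrow> bool" where
  "polylip1 f \<longleftrightarrow> (\<exists>C n. \<forall>x y. \<bar>f x - f y\<bar> \<le> C * (1 + \<bar>x\<bar> + \<bar>y\<bar>) ^ n * \<bar>x - y\<bar>)"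

lemma polylip1_Cllip_n:
  assumes "polylip1 f" "i < m" shows "(\<lambda>x. f (x i)) \<in> Cllip_n m"
proof -
  obtain C n where H: "\<And>x y. \<bar>f x - f y\<bar> \<le> C * (1 + \<bar>x\<bar> + \<bar>y\<bar>) ^ n * \<bar>x - y\<bar>" using assms by (auto simp: polylip1_def)
  have "(\<lambda>x. f (x 0)) \<in> Cllip_n 1"
  proof (rule Cllip_nI[of "\<bar>C\<bar>" _ _ n])
    fix x y :: "nat \<Rightarrow> real"
    have "\<bar>f (x 0) - f (y 0)\<bar> \<le> C * (1 + \<bar>x 0\<bar> + \<bar>y 0\<bar>) ^ n * \<bar>x 0 - y 0\<bar>" by (rule H)
    also have "\<dots> \<le> \<bar>C\<bar> * (1 + \<bar>x 0\<bar> + \<bar>y 0\<bar>) ^ n * \<bar>x 0 - y 0\<bar>" by (intro mult_right_mono) auto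
    finally show "\<bar>f (x 0) - f (y 0)\<bar> \<le> \<bar>C\<bar> * (1 + vnorm1 1 x + vnorm1 1 y) ^ n * vnorm1 1 (\<lambda>i. x i - y i)"
      by (simp add: vnorm1_def)
  qed simp
  from Cllip_n_compose[OF this, of "\<lambda>_ x. x i" m] Cllip_n_proj[OF assms(2)] show ?thesis by simp
qed

lemma Cllip_n_mult2: "(\<lambda>x. x 0 * x 1) \<in> Cllip_n 2"
proof (rule Cllip_nI[of 1 _ _ 1])
  fix x y :: "nat \<Rightarrow> real"
  have "\<bar>x 0 * x 1 - y 0 * y 1\<bar> = \<bar>x 0 * (x 1 - y 1) + y 1 * (x 0 - y 0)\<bar>" by (simp add: algebra_simps)
  also have "\<dots> \<le> \<bar>x 0\<bar> * \<bar>x 1 - y 1\<bar> + \<bar>y 1\<bar> * \<bar>x 0 - y 0\<bar>"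
    by (rule order_trans[OF abs_triangle_ineq]) (simp add: abs_mult)
  also have "\<dots> \<le> (1 + vnorm1 2 x + vnorm1 2 y) * \<bar>x 1 - y 1\<bar> + (1 + vnorm1 2 x + vnorm1 2 y) * \<bar>x 0 - y 0\<bar>"
    using abs_le_vnorm1[of 0 2 x] abs_le_vnorm1[of 1 2 y]
    by (intro add_mono mult_right_mono) (auto intro: add_increasing2 add_increasing)
  finally show "\<bar>x 0 * x 1 - y 0 * y 1\<bar> \<le> 1 * (1 + vnorm1 2 x + vnorm1 2 y) ^ 1 * vnorm1 2 (\<lambda>i. x i - y i)"
    by (simp add: vnorm1_def[of _ "\<lambda>i. x i - y i"] numeral_2_eq_2 algebra_simps)
qed simp

lemma Cllip_n_mult:
  assumes "\<phi> \<in> Cllip_n m" "\<psi> \<in> Cllip_n m" shows "(\<lambda>x. \<phi> x * \<psi> x) \<in> Cllip_n m"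
  using Cllip_n_compose[OF Cllip_n_mult2, of "\<lambda>i. if i = 0 then \<phi> else \<psi>" m] assms by simp

lemma Cllip_n_add:
  assumes "\<phi> \<in> Cllip_n m" "\<psi> \<in> Cllip_n m" shows "(\<lambda>x. \<phi> x + \<psi> x) \<in> Cllip_n m"
proof -
  have "(\<lambda>x. \<Sum>j\<in>{0,1}. 1 * x j) \<in> Cllip_n 2" by (rule Cllip_n_sum) auto
  then have "(\<lambda>x. x 0 + x 1) \<in> Cllip_n 2" by simp
  from Cllip_n_compose[OF this, of "\<lambda>i. if i = 0 then \<phi> else \<psi>" m] assms show ?thesis by simp
qed

lemma Cllip_n_mono:
  assumes "\<phi> \<in> Cllip_n m" "m \<le> k" shows "\<phi> \<in> Cllip_n k"
proof -
  have "(\<lambda>x. \<phi> (\<lambda>i. x i)) \<in> Cllip_n k"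
    by (rule Cllip_n_compose[OF assms(1)]) (use assms in \<open>auto intro: Cllip_n_proj\<close>)
  then show ?thesis by simp
qed

section \<open>Stable sets of random variables\<close>

text \<open>
  The closure property demanded of the domain of a sublinear expectation, without an
  expectation. It is shared by \<open>H\<close>, \<open>L0ip\<close> and each \<open>L0ip_upto u\<close>, so that sums, products and
  powers are dealt with once for all of them.
\<close>

definition Cllip_stable :: "('w \<Rightarrow> real) set \<Rightarrow> bool" where
  "Cllip_stable S \<longleftrightarrow> S \<noteq> {} \<and> (\<forall>m\<ge>1. \<forall>\<phi>\<in>Cllip_n m. \<forall>X. (\<forall>i<m. X i \<in> S) \<longrightarrow> (\<lambda>w. \<phi> (\<lambda>i. X i w)) \<in> S)"

lemma Cllip_stableD:
  "Cllip_stable S \<Longrightarrow> m \<ge> 1 \<Longrightarrow> \<phi> \<in> Cllip_n m \<Longrightarrow> (\<And>i. i < m \<Longrightarrow> X i \<in> S) \<Longrightarrow> (\<lambda>w. \<phi> (\<lambda>i. X i w)) \<in> S"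
  by (auto simp: Cllip_stable_def)

lemma stable_apply:
  assumes "Cllip_stable S" "X \<in> S" "polylip1 f" shows "(\<lambda>w. f (X w)) \<in> S"
  using Cllip_stableD[OF assms(1) _ polylip1_Cllip_n[OF assms(3), of 0 1], of "\<lambda>_. X"] assms(2) by simp

lemma polylip1I: "(\<And>x y. \<bar>f x - f y\<bar> \<le> C * (1 + \<bar>x\<bar> + \<bar>y\<bar>) ^ n * \<bar>x - y\<bar>) \<Longrightarrow> polylip1 f"
  by (auto simp: polylip1_def)

lemma polylip1_lipschitz: "(\<And>x y. \<bar>f x - f y\<bar> \<le> L * \<bar>x - y\<bar>) \<Longrightarrow> polylip1 f"
  by (rule polylip1I[of f L 0]) auto

lemma stable_const: assumes "Cllip_stable S" shows "(\<lambda>w. c) \<in> S"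
proof -
  obtain X where "X \<in> S" using assms by (auto simp: Cllip_stable_def)
  moreover have "polylip1 (\<lambda>x. c)" by (rule polylip1_lipschitz[of _ 0]) auto
  ultimately show ?thesis using stable_apply[OF assms, of X "\<lambda>x. c"] by auto
qed

lemma stable_mult: assumes "Cllip_stable S" "X \<in> S" "Y \<in> S" shows "(\<lambda>w. X w * Y w) \<in> S"
  using Cllip_stableD[OF assms(1) _ Cllip_n_mult2, of "\<lambda>i. if i = 0 then X else Y"] assms(2,3) by simp

lemma stable_add: assumes "Cllip_stable S" "X \<in> S" "Y \<in> S" shows "(\<lambda>w. X w + Y w) \<in> S"
  using Cllip_stableD[OF assms(1) _ Cllip_n_add[OF Cllip_n_proj[of 0 2] Cllip_n_proj[of 1 2]], of "\<lambda>i. if i = 0 then X else Y"]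
    assms(2,3) by simp

lemma stable_scale: assumes "Cllip_stable S" "X \<in> S" shows "(\<lambda>w. c * X w) \<in> S"
  using stable_mult[OF assms(1) stable_const[OF assms(1)] assms(2)] by simp

lemma stable_uminus: assumes "Cllip_stable S" "X \<in> S" shows "(\<lambda>w. - X w) \<in> S"
  using stable_scale[OF assms, of "-1"] by simp

lemma stable_diff: assumes "Cllip_stable S" "X \<in> S" "Y \<in> S" shows "(\<lambda>w. X w - Y w) \<in> S"
  using stable_add[OF assms(1,2) stable_uminus[OF assms(1,3)]] by simp

lemma stable_divide: assumes "Cllip_stable S" "X \<in> S" shows "(\<lambda>w. X w / c) \<in> S"
  using stable_scale[OF assms, of "1/c"] by simp

lemma stable_abs: assumes "Cllip_stable S" "X \<in> S" shows "(\<lambda>w. \<bar>X w\<bar>) \<in> S"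
  by (rule stable_apply[OF assms]) (rule polylip1_lipschitz[of _ 1], auto)

lemma stable_power: assumes "Cllip_stable S" "X \<in> S" shows "(\<lambda>w. X w ^ n) \<in> S"
  by (induction n) (auto intro: stable_const stable_mult assms)

lemma stable_sum:
  assumes "Cllip_stable S" "\<And>i. i \<in> J \<Longrightarrow> X i \<in> S" shows "(\<lambda>w. \<Sum>i\<in>J. X i w) \<in> S"
  using assms(2) by (induction J rule: infinite_finite_induct) (auto intro: stable_const stable_add assms(1))

lemmas stable_intros = stable_const stable_mult stable_add stable_scale stable_uminus stable_diff
  stable_divide stable_abs stable_power stable_sum

lemma (in sublinear_expectation) stable_H: "Cllip_stable H"
  using stable zero unfolding Cllip_stable_def by blast

section \<open>Cylinder functions on path space\<close>

text \<open>
  Finitely many cylinder functions are functions of the path at one common finite list of times;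
  an identity for all of \<open>cyl ts\<close> is therefore an identity for finitely many elements of \<open>L0ip\<close>
  at a time.
\<close>

definition cyl :: "real list \<Rightarrow> (path \<Rightarrow> real) set" where
  "cyl ts = {X. \<exists>\<phi>\<in>Cllip_n (length ts). X = (\<lambda>\<omega>. \<phi> (\<lambda>i. B (ts ! i) \<omega>))}"

lemma cyl_mono:
  assumes "set ts \<subseteq> set ts'" shows "cyl ts \<subseteq> cyl ts'"
proof
  fix X assume "X \<in> cyl ts"
  then obtain \<phi> where \<phi>: "\<phi> \<in> Cllip_n (length ts)" and X: "X = (\<lambda>\<omega>. \<phi> (\<lambda>i. B (ts ! i) \<omega>))" by (auto simp: cyl_def)
  have "\<forall>i\<in>{..<length ts}. \<exists>k<length ts'. ts' ! k = ts ! i"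
    using assms by (metis in_set_conv_nth lessThan_iff subsetD)
  then obtain k where k: "\<And>i. i < length ts \<Longrightarrow> k i < length ts' \<and> ts' ! k i = ts ! i"
    unfolding bchoice_iff by (metis lessThan_iff)
  have "(\<lambda>x. \<phi> (\<lambda>i. x (k i))) \<in> Cllip_n (length ts')"
    by (rule Cllip_n_compose[OF \<phi>]) (use k in \<open>auto intro: Cllip_n_proj\<close>)
  moreover have "X = (\<lambda>\<omega>. \<phi> (\<lambda>i. B (ts' ! (k i)) \<omega>))"
    unfolding X by (rule ext, rule Cllip_n_cong[OF \<phi>]) (use k in auto)
  ultimately show "X \<in> cyl ts'"
    unfolding cyl_def by (intro CollectI bexI[of _ "\<lambda>x. \<phi> (\<lambda>i. x (k i))"]) auto
qed

lemma cyl_stable: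
  assumes "\<And>i. i < k \<Longrightarrow> X i \<in> cyl ts" "\<psi> \<in> Cllip_n k"
  shows "(\<lambda>\<omega>. \<psi> (\<lambda>i. X i \<omega>)) \<in> cyl ts"
proof -
  have "\<forall>i\<in>{..<k}. \<exists>\<phi>. \<phi> \<in> Cllip_n (length ts) \<and> X i = (\<lambda>\<omega>. \<phi> (\<lambda>i. B (ts ! i) \<omega>))"
    using assms(1) by (auto simp: cyl_def)
  then obtain \<phi> where \<phi>: "\<And>i. i < k \<Longrightarrow> \<phi> i \<in> Cllip_n (length ts)"
     "\<And>i. i < k \<Longrightarrow> X i = (\<lambda>\<omega>. \<phi> i (\<lambda>j. B (ts ! j) \<omega>))"
    unfolding bchoice_iff by (metis lessThan_iff)
  have "(\<lambda>\<omega>. \<psi> (\<lambda>i. X i \<omega>)) = (\<lambda>\<omega>. \<psi> (\<lambda>i. \<phi> i (\<lambda>j. B (ts ! j) \<omega>)))"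
    by (rule ext, rule Cllip_n_cong[OF assms(2)]) (simp add: \<phi>(2))
  with Cllip_n_compose[OF assms(2) \<phi>(1)] show ?thesis unfolding cyl_def by (intro CollectI bexI) auto
qed

lemma L0ip_upto_eq: "L0ip_upto T = (\<Union>ts\<in>{ts. ts \<noteq> [] \<and> set ts \<subseteq> {0..T}}. cyl ts)"
proof (intro equalityI subsetI)
  fix X assume "X \<in> L0ip_upto T"
  then obtain m t \<phi> where m: "m \<ge> 1" and \<phi>: "\<phi> \<in> Cllip_n m" and t: "\<forall>i<m. t i \<in> {0..T}"
    and X: "X = (\<lambda>\<omega>. \<phi> (\<lambda>i. B (t i) \<omega>))" unfolding L0ip_upto_def by blast
  have "X = (\<lambda>\<omega>. \<phi> (\<lambda>i. B (map t [0..<m] ! i) \<omega>))"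
    unfolding X by (rule ext, rule Cllip_n_cong[OF \<phi>]) auto
  then have "X \<in> cyl (map t [0..<m])" using \<phi> unfolding cyl_def by auto
  moreover have "map t [0..<m] \<noteq> []" "set (map t [0..<m]) \<subseteq> {0..T}" using m t by auto
  ultimately show "X \<in> (\<Union>ts\<in>{ts. ts \<noteq> [] \<and> set ts \<subseteq> {0..T}}. cyl ts)" by blast
next
  fix X assume "X \<in> (\<Union>ts\<in>{ts. ts \<noteq> [] \<and> set ts \<subseteq> {0..T}}. cyl ts)"
  then obtain ts \<phi> where "ts \<noteq> []" "set ts \<subseteq> {0..T}" "\<phi>\<in>Cllip_n (length ts)" "X = (\<lambda>\<omega>. \<phi> (\<lambda>i. B (ts ! i) \<omega>))"
    by (auto simp: cyl_def)
  then show "X \<in> L0ip_upto T" unfolding L0ip_upto_def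
    by (intro CollectI exI[of _ "length ts"] conjI exI[of _ "\<lambda>i. ts ! i"] bexI[of _ \<phi>])
       (auto simp: Suc_le_eq dest!: nth_mem)
qed

lemma L0ip_upto_mono: "u \<le> v \<Longrightarrow> L0ip_upto u \<subseteq> L0ip_upto v"
  unfolding L0ip_upto_eq by (auto, meson atLeastatMost_subset_iff order_refl subset_trans)

text \<open>
  The time \<open>u\<close> itself is appended to the list, so that an increment after \<open>u\<close> starts at the last
  grid point.
\<close>

lemma L0ip_upto_common:
  assumes X: "\<And>i. i < (k::nat) \<Longrightarrow> X i \<in> L0ip_upto u" and u: "0 \<le> u"
  obtains ts where "ts \<noteq> []" "set ts \<subseteq> {0..u}" "sorted ts" "last ts = u" "\<And>i. i < k \<Longrightarrow> X i \<in> cyl ts"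
proof -
  have "\<forall>i\<in>{..<k}. \<exists>ts. set ts \<subseteq> {0..u} \<and> X i \<in> cyl ts" using X unfolding L0ip_upto_eq by auto
  then obtain f where f: "\<And>i. i < k \<Longrightarrow> set (f i) \<subseteq> {0..u} \<and> X i \<in> cyl (f i)"
    unfolding bchoice_iff by auto
  define ts where "ts = sort (concat (map f [0..<k])) @ [u]"
  have st: "set ts = insert u (\<Union>i<k. set (f i))" by (auto simp: ts_def)
  show thesis
  proof (rule that[of ts])
    show "ts \<noteq> []" "last ts = u" by (auto simp: ts_def)
    show "set ts \<subseteq> {0..u}" unfolding st using f u by auto
    show "sorted ts" unfolding ts_def sorted_append using f by (auto simp: subset_iff)
    show "X i \<in> cyl ts" if "i < k" for i
      using f[OF that] cyl_mono[of "f i" ts] that st by blast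
  qed
qed

lemma stable_L0ip_upto: assumes "0 \<le> u" shows "Cllip_stable (L0ip_upto u)"
  unfolding Cllip_stable_def
proof (intro conjI allI impI ballI)
  have "(\<lambda>\<omega>. (\<lambda>_. 0) (\<lambda>i. B 0 \<omega>)) \<in> L0ip_upto u" unfolding L0ip_upto_def
    using assms by (intro CollectI exI[of _ 1] conjI exI[of _ "\<lambda>_. 0"] bexI[of _ "\<lambda>_. 0"])
      (auto intro: Cllip_nI[of 0])
  then show "L0ip_upto u \<noteq> {}" by auto
  fix m \<phi> and X :: "nat \<Rightarrow> path \<Rightarrow> real"
  assume m: "1 \<le> m" and \<phi>: "\<phi> \<in> Cllip_n m" and X: "\<forall>i<m. X i \<in> L0ip_upto u"
  obtain ts where "ts \<noteq> []" "set ts \<subseteq> {0..u}" "sorted ts" "last ts = u" "\<And>i. i < m \<Longrightarrow> X i \<in> cyl ts"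
    using L0ip_upto_common[of m X u] X assms by auto
  with cyl_stable[of m X ts \<phi>] \<phi> show "(\<lambda>\<omega>. \<phi> (\<lambda>i. X i \<omega>)) \<in> L0ip_upto u"
    unfolding L0ip_upto_eq by blast
qed

lemma L0ip_upto_subset: "L0ip_upto u \<subseteq> L0ip"
  unfolding L0ip_def using L0ip_upto_mono[of u "real (nat \<lceil>u\<rceil>)"] by (auto simp: real_nat_ceiling_ge)

lemma L0ip_common:
  assumes "\<And>i. i < (k::nat) \<Longrightarrow> X i \<in> L0ip"
  obtains u where "0 \<le> u" "\<And>i. i < k \<Longrightarrow> X i \<in> L0ip_upto u"
proof -
  have "\<forall>i\<in>{..<k}. \<exists>n::nat. X i \<in> L0ip_upto (real n)" using assms by (auto simp: L0ip_def)
  then obtain f :: "nat \<Rightarrow> nat" where f: "\<And>i. i < k \<Longrightarrow> X i \<in> L0ip_upto (real (f i))"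
    unfolding bchoice_iff by auto
  have "real (f i) \<le> real (\<Sum>i<k. f i)" if "i < k" for i
    using that by (intro of_nat_mono member_le_sum) auto
  then have "X i \<in> L0ip_upto (real (\<Sum>i<k. f i))" if "i < k" for i
    using L0ip_upto_mono f that by blast
  then show thesis by (intro that[of "real (\<Sum>i<k. f i)"]) (auto simp del: of_nat_sum)
qed

lemma stable_L0ip: "Cllip_stable L0ip"
  unfolding Cllip_stable_def
proof (intro conjI allI impI ballI)
  show "L0ip \<noteq> {}" using stable_L0ip_upto[of 0] L0ip_upto_subset[of 0] by (auto simp: Cllip_stable_def)
  fix m \<phi> and X :: "nat \<Rightarrow> path \<Rightarrow> real"
  assume m: "1 \<le> m" and \<phi>: "\<phi> \<in> Cllip_n m" and X: "\<forall>i<m. X i \<in> L0ip"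
  obtain u where "0 \<le> u" "\<And>i. i < m \<Longrightarrow> X i \<in> L0ip_upto u" using L0ip_common[of m X] X by auto
  then show "(\<lambda>\<omega>. \<phi> (\<lambda>i. X i \<omega>)) \<in> L0ip"
    using Cllip_stableD[OF stable_L0ip_upto m \<phi>] L0ip_upto_subset by blast
qed

lemma B_zero: "t \<le> 0 \<Longrightarrow> B t \<omega> = 0"
  using Rep_path[of \<omega>] by (simp add: B_def)

lemma B_in_L0ip_upto: "0 \<le> u \<Longrightarrow> u \<le> v \<Longrightarrow> B u \<in> L0ip_upto v"
  unfolding L0ip_upto_def
  by (intro CollectI exI[of _ 1] conjI exI[of _ "\<lambda>_. u"] bexI[of _ "\<lambda>x. x 0"] Cllip_n_proj) auto

section \<open>Transfer of the G-expectation to path space\<close>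

text \<open>
  A path that is linear between consecutive grid points and constant after the last one.
\<close>

lemma path_with_increments:
  fixes t y :: "nat \<Rightarrow> real"
  assumes "t 0 = 0" "\<And>i. i < m \<Longrightarrow> t i \<le> t (Suc i)" "\<And>i. i < m \<Longrightarrow> t i = t (Suc i) \<Longrightarrow> y i = 0"
  obtains \<omega> where "\<And>i. i < m \<Longrightarrow> B (t (Suc i)) \<omega> - B (t i) \<omega> = y i"
proof -
  have "\<exists>f::real\<Rightarrow>real. continuous_on UNIV f \<and> (\<forall>x\<le>0. f x = 0) \<and> (\<forall>i<m. f (t (Suc i)) - f (t i) = y i)"
    using assms(2,3)
  proof (induction m)
    case 0 show ?case by (intro exI[of _ "\<lambda>_. 0"]) auto
  next
    case (Suc m)
    from Suc.IH Suc.prems obtain f where f: "continuous_on UNIV f" "\<And>x. x \<le> 0 \<Longrightarrow> f x = 0"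
      "\<And>i. i < m \<Longrightarrow> f (t (Suc i)) - f (t i) = y i" by (metis less_SucI)
    have mono: "t i \<le> t j" if "i \<le> j" "j \<le> Suc m" for i j
      using that by (induction j rule: dec_induct) (use Suc.prems(1) in \<open>auto intro: order_trans\<close>)
    show ?case
    proof (cases "t m = t (Suc m)")
      case True
      then have "y m = 0" using Suc.prems(2) by auto
      with True f show ?thesis by (intro exI[of _ f]) (auto simp: less_Suc_eq)
    next
      case False
      then have lt: "t m < t (Suc m)" using Suc.prems(1)[of m] by simp
      have tm: "0 \<le> t m" using mono[of 0 m] assms(1) by simp
      define g where "g x = f (min x (t m)) + y m * max 0 (min 1 ((x - t m) / (t (Suc m) - t m)))" for x
      have g0: "g x = f x" if "x \<le> t m" for x using that lt by (simp add: g_def divide_le_0_iff)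
      have "continuous_on UNIV (\<lambda>x. f (min x (t m)))"
        by (rule continuous_on_compose2[OF f(1)]) (auto intro!: continuous_intros)
      then have "continuous_on UNIV g" unfolding g_def using lt by (intro continuous_intros) auto
      moreover have "\<forall>x\<le>0. g x = 0" using g0 f(2) tm by auto
      moreover have "\<forall>i<Suc m. g (t (Suc i)) - g (t i) = y i"
        using f(3) g0 mono lt by (auto simp: less_Suc_eq) (simp add: g_def)
      ultimately show ?thesis by blast
    qed
  qed
  then obtain f where f: "continuous_on UNIV f" "\<forall>x\<le>0. f x = 0" "\<forall>i<m. f (t (Suc i)) - f (t i) = y i" by blast
  have "Rep_path (Abs_path f) = f" using f by (intro Abs_path_inverse) (auto intro: continuous_on_subset)
  then show thesis using f(3) by (intro that[of "Abs_path f"]) (simp add: B_def)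
qed

lemma grid_representation:
  assumes "ts \<noteq> []" "set ts \<subseteq> {0..}" "sorted ts"
  defines "t \<equiv> (\<lambda>i. (0 # ts) ! i)"
  shows "t 0 = 0" "\<And>i. i < length ts \<Longrightarrow> t i \<le> t (Suc i)"
    "\<And>i \<omega>. i < length ts \<Longrightarrow> B (ts ! i) \<omega> = (\<Sum>j<Suc i. B (t (Suc j)) \<omega> - B (t j) \<omega>)"
proof -
  show 0: "t 0 = 0" by (simp add: t_def)
  have "sorted (0 # ts)" using assms by auto
  from sorted_nth_mono[OF this, of i "Suc i" for i] show "\<And>i. i < length ts \<Longrightarrow> t i \<le> t (Suc i)" unfolding t_def by auto
  fix i \<omega> assume "i < length ts"
  have "(\<Sum>j<Suc i. B (t (Suc j)) \<omega> - B (t j) \<omega>) = B (t (Suc i)) \<omega> - B (t 0) \<omega>"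
    by (rule sum_lessThan_telescope)
  then show "B (ts ! i) \<omega> = (\<Sum>j<Suc i. B (t (Suc j)) \<omega> - B (t j) \<omega>)" using 0 B_zero[of 0] by (simp add: t_def)
qed

lemma Cllip_n_partial_sums:
  assumes "\<phi> \<in> Cllip_n m" shows "(\<lambda>y. \<phi> (\<lambda>i. \<Sum>j<Suc i. c j * y j)) \<in> Cllip_n m"
  by (rule Cllip_n_compose[OF assms]) (rule Cllip_n_sum, auto)

text \<open>
  A map \<open>\<pi>\<close> into path space realises \<open>sqrt (t (Suc i) - t i) * \<xi> i\<close> as the increments along the
  grid. The definition of \<open>E\<close> then reads \<open>E X = E' (X \<circ> \<pi>)\<close> simultaneously for all \<open>X\<close> on that
  grid. The last formula appends one more increment, driven by the next variable \<open>\<xi>\<close>; its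
  independence from the previous ones splits the expectation into an inner one over the new
  variable and an outer one over the old ones.
\<close>

lemma G_expectation_transfer:
  assumes G: "G_expectation s H E' \<xi> E" and ts: "ts \<noteq> []" "set ts \<subseteq> {0..}" "sorted ts"
  obtains \<pi> where "\<And>X. X \<in> cyl ts \<Longrightarrow> (\<lambda>w. X (\<pi> w)) \<in> H"
    "\<And>X. X \<in> cyl ts \<Longrightarrow> E X = E' (\<lambda>w. X (\<pi> w))"
    "\<And>v \<psi> X. X \<in> cyl ts \<Longrightarrow> last ts \<le> v \<Longrightarrow> polylip1 \<psi> \<Longrightarrow>
       E (\<lambda>\<omega>. X \<omega> * \<psi> (B v \<omega> - B (last ts) \<omega>)) =
       E' (\<lambda>w. E' (\<lambda>w'. X (\<pi> w) * \<psi> (sqrt (v - last ts) * \<xi> (length ts) w')))"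
proof -
  interpret sublinear_expectation H E' using G by (simp add: G_expectation_def)
  have \<xi>H: "\<xi> i \<in> H" for i using G by (auto simp: G_expectation_def)
  have E: "E (\<lambda>\<omega>. \<phi> (\<lambda>i. B (t (Suc i)) \<omega> - B (t i) \<omega>)) = E' (\<lambda>w. \<phi> (\<lambda>i. sqrt (t (Suc i) - t i) * \<xi> i w))"
    if "m \<ge> 1" "\<phi> \<in> Cllip_n m" "t 0 = 0" "\<forall>i<m. t i \<le> t (Suc i)" for m t \<phi>
    using G that unfolding G_expectation_def by blast
  define m where "m = length ts"
  define t where "t = (\<lambda>i. (0 # ts) ! i)"
  note grid = grid_representation[OF ts, folded t_def m_def]
  have m: "m \<ge> 1" using ts by (cases ts) (auto simp: m_def)
  define y where "y w i = sqrt (t (Suc i) - t i) * \<xi> i w" for w i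
  have "\<exists>\<omega>. \<forall>i<m. B (t (Suc i)) \<omega> - B (t i) \<omega> = y w i" for w
    by (rule path_with_increments[of t m "y w"]) (use grid in \<open>auto simp: y_def\<close>)
  then obtain \<pi> where \<pi>: "\<And>w i. i < m \<Longrightarrow> B (t (Suc i)) (\<pi> w) - B (t i) (\<pi> w) = y w i" by metis
  have Bpi: "B (ts ! i) (\<pi> w) = (\<Sum>j<Suc i. y w j)" if "i < m" for i w
    using grid(3)[OF that] \<pi> that by auto
  have rep: "\<exists>\<phi>\<in>Cllip_n m. X = (\<lambda>\<omega>. \<phi> (\<lambda>i. \<Sum>j<Suc i. B (t (Suc j)) \<omega> - B (t j) \<omega>)) \<and> (\<forall>w. X (\<pi> w) = \<phi> (\<lambda>i. \<Sum>j<Suc i. y w j))"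
    if X: "X \<in> cyl ts" for X
  proof -
    obtain \<phi> where \<phi>: "\<phi> \<in> Cllip_n m" and XX: "X = (\<lambda>\<omega>. \<phi> (\<lambda>i. B (ts ! i) \<omega>))" using X by (auto simp: cyl_def m_def)
    show ?thesis using \<phi> unfolding XX
      by (intro bexI[of _ \<phi>] conjI ext allI Cllip_n_cong[OF \<phi>] grid Bpi) auto
  qed
  have yH: "(\<lambda>w. y w i) \<in> H" for i unfolding y_def by (intro stable_intros stable_H \<xi>H)
  show thesis
  proof (rule that)
    fix X assume X: "X \<in> cyl ts"
    obtain \<phi> where \<phi>: "\<phi> \<in> Cllip_n m" and XX: "X = (\<lambda>\<omega>. \<phi> (\<lambda>i. \<Sum>j<Suc i. B (t (Suc j)) \<omega> - B (t j) \<omega>))"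
       and X\<pi>: "\<And>w. X (\<pi> w) = \<phi> (\<lambda>i. \<Sum>j<Suc i. y w j)"
      using rep[OF X] by blast
    have c: "(\<lambda>y. \<phi> (\<lambda>i. \<Sum>j<Suc i. y j)) \<in> Cllip_n m" using Cllip_n_partial_sums[OF \<phi>, of "\<lambda>_. 1"] by simp
    show "(\<lambda>w. X (\<pi> w)) \<in> H" unfolding X\<pi> using stable[OF m c, of "\<lambda>i w. y w i"] yH by simp
    show "E X = E' (\<lambda>w. X (\<pi> w))" unfolding XX using E[of m "\<lambda>y. \<phi> (\<lambda>i. \<Sum>j<Suc i. y j)" t, OF m c grid(1)] grid(2) X\<pi> unfolding XX
      by (simp add: y_def)
    fix v \<psi> assume v: "last ts \<le> v" and \<psi>: "polylip1 \<psi>"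
    (* The grid prolonged by v, so that the increment after the last time of ts is the one with
       index m. *)
    define t' where "t' i = (if i \<le> m then t i else v)" for i
    have tm: "t m = last ts" using ts by (simp add: t_def m_def last_conv_nth nth_Cons')
    define c where "c i = sqrt (t' (Suc i) - t' i)" for i
    have cy: "c i * \<xi> i w = y w i" if "i < m" for i w using that by (simp add: c_def y_def t'_def)
    have cm: "c m = sqrt (v - last ts)" by (simp add: c_def t'_def tm)
    have p1: "(\<lambda>y. \<phi> (\<lambda>i. \<Sum>j<Suc i. y j) * \<psi> (y m)) \<in> Cllip_n (m + 1)"
      by (intro Cllip_n_mult Cllip_n_mono[OF c] polylip1_Cllip_n \<psi>) auto
    have p2: "(\<lambda>y. \<phi> (\<lambda>i. \<Sum>j<Suc i. c j * y j) * \<psi> (c m * y m)) \<in> Cllip_n (m + 1)"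
      using Cllip_n_compose[OF p1, of "\<lambda>i y. c i * y i"]
         Cllip_n_sum[of "{i}" "m+1" c for i] by auto
    have g': "t' 0 = 0" "\<forall>i<m+1. t' i \<le> t' (Suc i)" using grid(1,2) v tm by (auto simp: t'_def le_Suc_eq less_Suc_eq)
    have X': "X \<omega> = \<phi> (\<lambda>i. \<Sum>j<Suc i. B (t' (Suc j)) \<omega> - B (t' j) \<omega>)" for \<omega>
      unfolding XX by (rule Cllip_n_cong[OF \<phi>]) (auto intro!: sum.cong simp: t'_def)
    have "E (\<lambda>\<omega>. X \<omega> * \<psi> (B v \<omega> - B (last ts) \<omega>)) =
      E (\<lambda>\<omega>. (\<lambda>y. \<phi> (\<lambda>i. \<Sum>j<Suc i. y j) * \<psi> (y m)) (\<lambda>i. B (t' (Suc i)) \<omega> - B (t' i) \<omega>))"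
      unfolding X' by (simp add: t'_def tm)
    also have "\<dots> = E' (\<lambda>w. \<phi> (\<lambda>i. \<Sum>j<Suc i. c j * \<xi> j w) * \<psi> (c m * \<xi> m w))"
      using E[of "m + 1" "\<lambda>y. \<phi> (\<lambda>i. \<Sum>j<Suc i. y j) * \<psi> (y m)" t', OF _ p1 g'] by (simp add: c_def)
    also have "\<dots> = E' (\<lambda>w. (\<lambda>y. \<phi> (\<lambda>i. \<Sum>j<Suc i. c j * y j) * \<psi> (c m * y m)) (\<lambda>i. if i < m then \<xi> i w else \<xi> m w))"
      by (intro arg_cong[of _ _ E'] ext arg_cong2[of _ _ _ _ "(*)"] Cllip_n_cong[OF \<phi>] sum.cong) auto
    also have "\<dots> = E' (\<lambda>w. E' (\<lambda>w'. (\<lambda>y. \<phi> (\<lambda>i. \<Sum>j<Suc i. c j * y j) * \<psi> (c m * y m)) (\<lambda>i. if i < m then \<xi> i w else \<xi> m w')))"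
    proof -
      have "indep_from E' 1 (\<lambda>_. \<xi> m) m \<xi>" using G m unfolding G_expectation_def by blast
      from this[unfolded indep_from_def, rule_format, OF p2] show ?thesis .
    qed
    also have "\<dots> = E' (\<lambda>w. E' (\<lambda>w'. X (\<pi> w) * \<psi> (c m * \<xi> m w')))"
      unfolding X\<pi> by (intro arg_cong[of _ _ E'] ext arg_cong2[of _ _ _ _ "(*)"] Cllip_n_cong[OF \<phi>] sum.cong) (auto simp: cy)
    finally show "E (\<lambda>\<omega>. X \<omega> * \<psi> (B v \<omega> - B (last ts) \<omega>)) =
       E' (\<lambda>w. E' (\<lambda>w'. X (\<pi> w) * \<psi> (sqrt (v - last ts) * \<xi> (length ts) w')))" unfolding cm[symmetric] m_def[symmetric] .
  qed
qed

text \<open>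
  Two elements of \<open>L0ip\<close> live on a common grid, where \<open>E\<close> is \<open>E'\<close> composed with one map \<open>\<pi>\<close>; the
  axioms are inherited from \<open>E'\<close> through \<open>\<pi>\<close>.
\<close>

lemma G_expectation_sublinear:
  assumes G: "G_expectation s H E' \<xi> E" shows "sublinear_expectation L0ip E"
proof -
  interpret S: sublinear_expectation H E' using G by (simp add: G_expectation_def)
  have tr: "\<exists>\<pi>. (\<lambda>w. X (\<pi> w)) \<in> H \<and> (\<lambda>w. Y (\<pi> w)) \<in> H \<and> E X = E' (\<lambda>w. X (\<pi> w)) \<and> E Y = E' (\<lambda>w. Y (\<pi> w))
     \<and> E (\<lambda>w. X w - Y w) = E' (\<lambda>w. X (\<pi> w) - Y (\<pi> w)) \<and> (\<forall>c. E (\<lambda>w. c * X w) = E' (\<lambda>w. c * X (\<pi> w)))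
     \<and> (\<forall>c. E (\<lambda>_. c) = E' (\<lambda>_. c))" if XY: "X \<in> L0ip" "Y \<in> L0ip" for X Y
  proof -
    define Z where "Z i = (if i = (0::nat) then X else Y)" for i
    obtain u where u: "0 \<le> u" "\<And>i. i < 2 \<Longrightarrow> Z i \<in> L0ip_upto u"
      by (rule L0ip_common[of 2 Z]) (use XY in \<open>auto simp: Z_def\<close>)
    obtain ts where ts: "ts \<noteq> []" "set ts \<subseteq> {0..u}" "sorted ts" "\<And>i. i < 2 \<Longrightarrow> Z i \<in> cyl ts"
      by (rule L0ip_upto_common[OF u(2) u(1)]) auto
    have Z: "X \<in> cyl ts" "Y \<in> cyl ts" using ts(4)[of 0] ts(4)[of 1] by (auto simp: Z_def)
    have ts0: "set ts \<subseteq> {0..}" using ts(2) by auto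
    obtain \<pi> where \<pi>: "\<And>X. X \<in> cyl ts \<Longrightarrow> (\<lambda>w. X (\<pi> w)) \<in> H"
    "\<And>X. X \<in> cyl ts \<Longrightarrow> E X = E' (\<lambda>w. X (\<pi> w))" using G_expectation_transfer[OF G ts(1) ts0 ts(3)] by metis
    have 1: "(\<lambda>w. X w - Y w) \<in> cyl ts"
      using cyl_stable[of 2 Z ts "\<lambda>x. x 0 + (-1) * x 1"] ts(4) Cllip_n_sum[of "{0,1}" 2 "\<lambda>i. if i = 0 then 1 else -1"]
      by (simp add: Z_def)
    have 2: "(\<lambda>w. c * X w) \<in> cyl ts" for c
      using cyl_stable[of 1 "\<lambda>_. X" ts "\<lambda>x. c * x 0"] Z Cllip_n_sum[of "{0}" 1 "\<lambda>i. c"] by simp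
    have 3: "(\<lambda>_. c) \<in> cyl ts" for c
      using cyl_stable[of 1 "\<lambda>_. X" ts "\<lambda>x. c"] Z Cllip_nI[of 0 "\<lambda>_. c"] by simp
    show ?thesis using \<pi> Z 1 2 3 by (intro exI[of _ \<pi>]) auto
  qed
  show ?thesis
  proof
    show z: "(\<lambda>_. 0) \<in> L0ip" by (intro stable_intros stable_L0ip)
    show "(\<lambda>w. X w + Y w) \<in> L0ip" if "X \<in> L0ip" "Y \<in> L0ip" for X Y using that by (intro stable_intros stable_L0ip)
    show "(\<lambda>w. c * X w) \<in> L0ip" if "X \<in> L0ip" for c X using that by (intro stable_intros stable_L0ip)
    show "(\<lambda>w. \<phi> (\<lambda>i. X i w)) \<in> L0ip" if "1 \<le> m" "\<phi> \<in> Cllip_n m" "\<And>i. i < m \<Longrightarrow> X i \<in> L0ip" for m \<phi> X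
      using Cllip_stableD[OF stable_L0ip that] .
    show "E (\<lambda>_. c) = c" for c using tr[OF z z] S.const by auto
    show "E X \<le> E Y" if XY: "X \<in> L0ip" "Y \<in> L0ip" "\<And>w. X w \<le> Y w" for X Y
    proof -
      obtain \<pi> where "(\<lambda>w. X (\<pi> w)) \<in> H" "(\<lambda>w. Y (\<pi> w)) \<in> H" "E X = E' (\<lambda>w. X (\<pi> w))" "E Y = E' (\<lambda>w. Y (\<pi> w))"
        using tr[OF XY(1,2)] by (elim exE conjE)
      with S.mono[of "\<lambda>w. X (\<pi> w)" "\<lambda>w. Y (\<pi> w)"] XY(3) show ?thesis by simp
    qed
    show "E X - E Y \<le> E (\<lambda>w. X w - Y w)" if XY: "X \<in> L0ip" "Y \<in> L0ip" for X Y
    proof -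
      obtain \<pi> where "(\<lambda>w. X (\<pi> w)) \<in> H" "(\<lambda>w. Y (\<pi> w)) \<in> H" "E X = E' (\<lambda>w. X (\<pi> w))" "E Y = E' (\<lambda>w. Y (\<pi> w))"
        "E (\<lambda>w. X w - Y w) = E' (\<lambda>w. X (\<pi> w) - Y (\<pi> w))"
        using tr[OF XY] by (elim exE conjE)
      with S.subadd[of "\<lambda>w. X (\<pi> w)" "\<lambda>w. Y (\<pi> w)"] show ?thesis by simp
    qed
    show "E (\<lambda>w. c * X w) = c * E X" if c: "0 \<le> c" and X: "X \<in> L0ip" for c X
    proof -
      obtain \<pi> where "(\<lambda>w. X (\<pi> w)) \<in> H" "E X = E' (\<lambda>w. X (\<pi> w))" "\<forall>c. E (\<lambda>w. c * X w) = E' (\<lambda>w. c * X (\<pi> w))"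
        using tr[OF X X] by (elim exE conjE)
      with S.pos_homogeneous[OF c, of "\<lambda>w. X (\<pi> w)"] show ?thesis by simp
    qed
  qed
qed

section \<open>Moments of the G-normal distribution\<close>

lemma second_derivative_at_local_max:
  fixes f :: "real \<Rightarrow> real"
  assumes f: "\<And>x. (f has_real_derivative f' x) (at x)" and f': "(f' has_real_derivative D) (at x0)"
    and max: "\<forall>\<^sub>F x in nhds x0. f x \<le> f x0"
  shows "D \<le> 0"
proof (rule ccontr)
  assume "\<not> D \<le> 0"
  obtain d where d: "d > 0" "\<And>x. dist x x0 < d \<Longrightarrow> f x \<le> f x0" using max by (auto simp: eventually_nhds_metric)
  have "f' x0 = 0" by (rule DERIV_local_max[OF f d(1)]) (use d in \<open>auto simp: dist_real_def\<close>)
  obtain e where e: "e > 0" "\<And>h. h > 0 \<Longrightarrow> h < e \<Longrightarrow> f' x0 < f' (x0 + h)"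
    using DERIV_pos_inc_right[OF f'] \<open>\<not> D \<le> 0\<close> by auto
  define h where "h = min d e / 2"
  have h: "0 < h" "h < d" "h < e" using d e by (auto simp: h_def)
  have "f x0 < f (x0 + h)"
  proof (rule DERIV_pos_imp_increasing_open[of x0 "x0 + h" f])
    show "x0 < x0 + h" using h by simp
    show "\<exists>y. (f has_real_derivative y) (at x) \<and> 0 < y" if "x0 < x" "x < x0 + h" for x
      using f[of x] e(2)[of "x - x0"] that h \<open>f' x0 = 0\<close> by auto
    show "continuous_on {x0..x0 + h} f"
      using f by (meson DERIV_continuous continuous_at_imp_continuous_on)
  qed
  moreover have "f (x0 + h) \<le> f x0" using h by (intro d(2)) (auto simp: dist_real_def)
  ultimately show False by simp
qed

lemma Gfun_mono: "a \<le> b \<Longrightarrow> Gfun s a \<le> Gfun s b"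
proof -
  assume "a \<le> b"
  then have "max a 0 \<le> max b 0" "s\<^sup>2 * max (- b) 0 \<le> s\<^sup>2 * max (- a) 0" by (auto intro!: mult_left_mono)
  then show ?thesis by (simp add: Gfun_def)
qed

text \<open>
  Where \<open>v - \<psi>\<close> has a local maximum, the time derivatives of \<open>v\<close> and \<open>\<psi>\<close> agree and the second
  space derivative of \<open>v\<close> is at most that of \<open>\<psi>\<close>; monotonicity of \<open>Gfun s\<close> gives the inequality
  for \<open>\<psi>\<close>. Minima are symmetric.
\<close>

lemma classical_imp_viscosity:
  assumes v: "\<And>t x. ((\<lambda>r. v r x) has_real_derivative vt t x) (at t)"
     "\<And>t x. (v t has_real_derivative vx t x) (at x)" "\<And>t x. (vx t has_real_derivative vxx t x) (at x)"
   and eq: "\<And>t x. vt t x = Gfun s (vxx t x)"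
  shows "visc_subsolution (Gfun s) v" "visc_supersolution (Gfun s) v"
proof -
  have slice: "\<forall>\<^sub>F x in nhds x0. P t0 x" "\<forall>\<^sub>F t in nhds t0. P t x0"
    if "\<forall>\<^sub>F (t, x) in nhds (t0, x0). P t x" for P and t0 x0 :: real
  proof -
    have "filterlim (\<lambda>x. (t0, x)) (nhds (t0, x0)) (nhds x0)" "filterlim (\<lambda>t. (t, x0)) (nhds (t0, x0)) (nhds t0)"
      by (rule tendsto_Pair[OF tendsto_const filterlim_ident], rule tendsto_Pair[OF filterlim_ident tendsto_const])
    from this[THEN filterlim_iff[THEN iffD1, rule_format, OF _ that]]
    show "\<forall>\<^sub>F x in nhds x0. P t0 x" "\<forall>\<^sub>F t in nhds t0. P t x0" by auto
  qed
  have crit: "D = 0" if f: "(f has_real_derivative D) (at y)" and max: "\<forall>\<^sub>F x in nhds y. f x \<le> f y" for f D and y :: real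
  proof -
    obtain d where d: "d > 0" "\<And>x. dist x y < d \<Longrightarrow> f x \<le> f y" using max by (auto simp: eventually_nhds_metric)
    show ?thesis by (rule DERIV_local_max[OF f d(1)]) (use d in \<open>auto simp: dist_real_def\<close>)
  qed
  show "visc_subsolution (Gfun s) v" unfolding visc_subsolution_def
  proof (intro allI impI)
    fix \<psi> \<psi>t \<psi>x \<psi>xx and t0 x0 :: real assume C: "C12_test \<psi> \<psi>t \<psi>x \<psi>xx" and t0: "0 < t0"
      and max: "\<forall>\<^sub>F (t, x) in nhds (t0, x0). v t x - \<psi> t x \<le> v t0 x0 - \<psi> t0 x0"
    have \<psi>: "((\<lambda>r. \<psi> r x) has_real_derivative \<psi>t t0 x) (at t0)" "(\<psi> t0 has_real_derivative \<psi>x t0 x) (at x)"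
        "(\<psi>x t0 has_real_derivative \<psi>xx t0 x) (at x)" for x
      using C t0 unfolding C12_test_def by auto
    have "vt t0 x0 - \<psi>t t0 x0 = 0"
      by (rule crit[OF DERIV_diff[OF v(1) \<psi>(1)] slice(2)[OF max]])
    moreover have "vxx t0 x0 - \<psi>xx t0 x0 \<le> 0"
      by (rule second_derivative_at_local_max[OF DERIV_diff[OF v(2) \<psi>(2)] DERIV_diff[OF v(3) \<psi>(3)] slice(1)[OF max]])
    ultimately show "\<psi>t t0 x0 \<le> Gfun s (\<psi>xx t0 x0)" using eq[of t0 x0] Gfun_mono[of "vxx t0 x0" "\<psi>xx t0 x0" s] by simp
  qed
  show "visc_supersolution (Gfun s) v" unfolding visc_supersolution_def
  proof (intro allI impI)
    fix \<psi> \<psi>t \<psi>x \<psi>xx and t0 x0 :: real assume C: "C12_test \<psi> \<psi>t \<psi>x \<psi>xx" and t0: "0 < t0"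
      and max: "\<forall>\<^sub>F (t, x) in nhds (t0, x0). v t x - \<psi> t x \<ge> v t0 x0 - \<psi> t0 x0"
    have \<psi>: "((\<lambda>r. \<psi> r x) has_real_derivative \<psi>t t0 x) (at t0)" "(\<psi> t0 has_real_derivative \<psi>x t0 x) (at x)"
        "(\<psi>x t0 has_real_derivative \<psi>xx t0 x) (at x)" for x
      using C t0 unfolding C12_test_def by auto
    have max': "\<forall>\<^sub>F (t, x) in nhds (t0, x0). \<psi> t x - v t x \<le> \<psi> t0 x0 - v t0 x0"
      by (rule eventually_mono[OF max]) auto
    have "\<psi>t t0 x0 - vt t0 x0 = 0"
      by (rule crit[OF DERIV_diff[OF \<psi>(1) v(1)] slice(2)[OF max']])
    moreover have "\<psi>xx t0 x0 - vxx t0 x0 \<le> 0"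
      by (rule second_derivative_at_local_max[OF DERIV_diff[OF \<psi>(2) v(2)] DERIV_diff[OF \<psi>(3) v(3)] slice(1)[OF max']])
    ultimately show "\<psi>t t0 x0 \<ge> Gfun s (\<psi>xx t0 x0)" using eq[of t0 x0] Gfun_mono[of "\<psi>xx t0 x0" "vxx t0 x0" s] by simp
  qed
qed

lemma Cllip_real_polylip1:
  fixes f :: "real \<Rightarrow> real" assumes "C > 0" "\<And>x y. \<bar>f x - f y\<bar> \<le> C * (1 + \<bar>x\<bar> + \<bar>y\<bar>) * \<bar>x - y\<bar>" shows "f \<in> Cllip"
  unfolding Cllip_def using assms by (intro CollectI exI[of _ C] conjI exI[of _ 1]) auto

text \<open>
  The function defining the G-normal distribution is the only viscosity solution, so any
  explicit classical solution with the right initial value computes the expectation, at \<open>t = 1\<close>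
  and \<open>x = 0\<close>.
\<close>

lemma G_normal_moment:
  assumes N: "G_normal E' s \<xi>" and \<phi>: "\<phi> \<in> Cllip"
    and sol: "\<And>t x. ((\<lambda>r. v r x) has_real_derivative vt t x) (at t)"
     "\<And>t x. (v t has_real_derivative vx t x) (at x)" "\<And>t x. (vx t has_real_derivative vxx t x) (at x)"
     "\<And>t x. vt t x = Gfun s (vxx t x)" "continuous_on ({0..} \<times> UNIV) (\<lambda>(t, x). v t x)"
     "\<And>x. v 0 x = \<phi> x"
    and growth: "\<And>t x. 0 \<le> t \<Longrightarrow> \<bar>v t x\<bar> \<le> 1 * (1 + t ^ 2 + \<bar>x\<bar> ^ 2)"
  shows "E' (\<lambda>w. \<phi> (\<xi> w)) = v 1 0"
proof -
  have "G_heat_solution (Gfun s) \<phi> v" unfolding G_heat_solution_def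
    using classical_imp_viscosity[OF sol(1-4)] sol(5,6) growth by blast
  then have "v 1 0 = E' (\<lambda>w. \<phi> (0 + sqrt 1 * \<xi> w))"
    using N \<phi> unfolding G_normal_def Let_def by (metis zero_le_one)
  then show ?thesis by simp
qed

text \<open>
  The solutions are \<open>x\<close>, \<open>- x\<close> and \<open>x\<^sup>2 + t\<close>: the first two are linear, and \<open>x\<^sup>2\<close> is convex,
  where \<open>Gfun s\<close> only sees the upper volatility \<open>1\<close>.
\<close>

lemma G_normal_moments:
  assumes N: "G_normal E' s \<xi>"
  shows "E' \<xi> = 0" "E' (\<lambda>w. - \<xi> w) = 0" "E' (\<lambda>w. (\<xi> w)\<^sup>2) = 1"
proof -
  have g: "\<bar>x\<bar> \<le> 1 + t\<^sup>2 + \<bar>x\<bar>\<^sup>2" for t x :: real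
  proof -
    have "0 \<le> (\<bar>x\<bar> - 1)\<^sup>2" by simp
    then have "2 * \<bar>x\<bar> \<le> 1 + \<bar>x\<bar>\<^sup>2" by (simp add: power2_diff algebra_simps)
    then show ?thesis using zero_le_power2[of t] abs_ge_zero[of x] by linarith
  qed
  have Cllip: "(\<lambda>x::real. x) \<in> Cllip" "(\<lambda>x::real. - x) \<in> Cllip"
    by (rule Cllip_real_polylip1[of 1]; simp add: mult_le_cancel_right1 abs_minus_commute)+
  have "E' (\<lambda>w. (\<lambda>x. x) (\<xi> w)) = 0"
    by (rule G_normal_moment[OF N Cllip(1), of "\<lambda>t x. x" "\<lambda>t x. 0" "\<lambda>t x. 1" "\<lambda>t x. 0"])
       (use g in \<open>auto intro!: derivative_eq_intros continuous_intros simp: case_prod_beta Gfun_def\<close>)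
  then show "E' \<xi> = 0" by simp
  have "E' (\<lambda>w. (\<lambda>x. - x) (\<xi> w)) = - 0"
    by (rule G_normal_moment[OF N Cllip(2), of "\<lambda>t x. -x" "\<lambda>t x. 0" "\<lambda>t x. -1" "\<lambda>t x. 0"])
       (use g in \<open>auto intro!: derivative_eq_intros continuous_intros simp: case_prod_beta Gfun_def\<close>)
  then show "E' (\<lambda>w. - \<xi> w) = 0" by simp
  have sqd: "(x::real)\<^sup>2 - y\<^sup>2 = (x + y) * (x - y)" for x y by (simp add: power2_eq_square algebra_simps)
  then have sq: "\<bar>x\<^sup>2 - y\<^sup>2\<bar> \<le> 1 * (1 + \<bar>x\<bar> + \<bar>y\<bar>) * \<bar>x - y\<bar>" for x y :: real
    unfolding sqd abs_mult mult_1 by (intro mult_right_mono) auto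
  have t2: "t \<le> 1 + t\<^sup>2" for t :: real using g[of t 0] by simp
  have Cllip2: "(\<lambda>x::real. x\<^sup>2) \<in> Cllip" by (rule Cllip_real_polylip1[OF _ sq]) simp
  have gr: "\<bar>x\<^sup>2 + t\<bar> \<le> 1 * (1 + t\<^sup>2 + \<bar>x\<bar>\<^sup>2)" if "0 \<le> t" for t x :: real
    using t2[of t] that by simp
  have "E' (\<lambda>w. (\<lambda>x. x\<^sup>2) (\<xi> w)) = 0\<^sup>2 + 1"
  proof (rule G_normal_moment[OF N Cllip2, of "\<lambda>t x. x\<^sup>2 + t" "\<lambda>t x. 1" "\<lambda>t x. 2 * x" "\<lambda>t x. 2"])
    show "((\<lambda>r. x\<^sup>2 + r) has_real_derivative 1) (at t)" for t x :: real by (auto intro!: derivative_eq_intros)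
    show "((\<lambda>x. x\<^sup>2 + t) has_real_derivative 2 * x) (at x)" for t x :: real by (auto intro!: derivative_eq_intros)
    show "((\<lambda>x. 2 * x) has_real_derivative 2) (at x)" for x :: real by (auto intro!: derivative_eq_intros)
    show "1 = Gfun s 2" by (simp add: Gfun_def)
    show "continuous_on ({0..} \<times> UNIV) (\<lambda>(t, x). x\<^sup>2 + (t::real))" unfolding case_prod_beta by (intro continuous_intros)
  qed (use gr in auto)
  then show "E' (\<lambda>w. (\<xi> w)\<^sup>2) = 1" by simp
qed

lemma polylip1E:
  assumes "polylip1 f" obtains C n where "\<And>x y. \<bar>f x - f y\<bar> \<le> C * (1 + \<bar>x\<bar> + \<bar>y\<bar>) ^ n * \<bar>x - y\<bar>"
  using assms unfolding polylip1_def by blast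

lemma polylip1_power: "polylip1 (\<lambda>x. x ^ n)"
proof (induction n)
  case 0 show ?case by (rule polylip1_lipschitz[of _ 0]) auto
next
  case (Suc n)
  obtain C k where H: "\<And>x y :: real. \<bar>x ^ n - y ^ n\<bar> \<le> C * (1 + \<bar>x\<bar> + \<bar>y\<bar>) ^ k * \<bar>x - y\<bar>" by (rule polylip1E[OF Suc.IH]) blast
  show ?case
  proof (rule polylip1I[of _ "\<bar>C\<bar> + 1" "Suc k + n"])
    fix x y :: real
    let ?S = "1 + \<bar>x\<bar> + \<bar>y\<bar>"
    have "\<bar>x ^ Suc n - y ^ Suc n\<bar> = \<bar>x * (x ^ n - y ^ n) + y ^ n * (x - y)\<bar>" by (simp add: algebra_simps)
    also have "\<dots> \<le> \<bar>x\<bar> * \<bar>x ^ n - y ^ n\<bar> + \<bar>y\<bar> ^ n * \<bar>x - y\<bar>" by (rule order_trans[OF abs_triangle_ineq]) (simp add: abs_mult power_abs)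
    also have "\<dots> \<le> ?S * (\<bar>C\<bar> * ?S ^ k * \<bar>x - y\<bar>) + ?S ^ n * \<bar>x - y\<bar>"
    proof (intro add_mono mult_mono mult_right_mono power_mono)
      have "C * ?S ^ k * \<bar>x - y\<bar> \<le> \<bar>C\<bar> * ?S ^ k * \<bar>x - y\<bar>" by (intro mult_right_mono) auto
      then show "\<bar>x ^ n - y ^ n\<bar> \<le> \<bar>C\<bar> * ?S ^ k * \<bar>x - y\<bar>" using H[of x y] by linarith
    qed auto
    also have "\<dots> = \<bar>C\<bar> * ?S ^ Suc k * \<bar>x - y\<bar> + 1 * ?S ^ n * \<bar>x - y\<bar>" by simp
    also have "\<dots> \<le> \<bar>C\<bar> * ?S ^ (Suc k + n) * \<bar>x - y\<bar> + 1 * ?S ^ (Suc k + n) * \<bar>x - y\<bar>"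
      by (intro add_mono mult_right_mono mult_left_mono power_increasing) auto
    finally show "\<bar>x ^ Suc n - y ^ Suc n\<bar> \<le> (\<bar>C\<bar> + 1) * ?S ^ (Suc k + n) * \<bar>x - y\<bar>" by (simp add: algebra_simps)
  qed
qed

lemma Cllip_power4: "(\<lambda>x::real. x ^ 4) \<in> Cllip"
proof -
  obtain C n where H: "\<And>x y :: real. \<bar>x ^ 4 - y ^ 4\<bar> \<le> C * (1 + \<bar>x\<bar> + \<bar>y\<bar>) ^ n * \<bar>x - y\<bar>"
    by (rule polylip1E[OF polylip1_power[of 4]]) blast
  have "\<bar>x ^ 4 - y ^ 4\<bar> \<le> ((\<bar>C\<bar> + 1) * 3 ^ n) * (1 + norm x ^ n + norm y ^ n) * norm (x - y)" for x y :: real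
  proof -
    have "\<bar>x ^ 4 - y ^ 4\<bar> \<le> C * (1 + \<bar>x\<bar> + \<bar>y\<bar>) ^ n * \<bar>x - y\<bar>" by (rule H)
    also have "\<dots> \<le> (\<bar>C\<bar> + 1) * (3 ^ n * (1 + \<bar>x\<bar> ^ n + \<bar>y\<bar> ^ n)) * \<bar>x - y\<bar>"
      by (intro mult_right_mono mult_mono power_add3_le) auto
    finally show ?thesis by (simp add: mult.assoc)
  qed
  then show ?thesis unfolding Cllip_def by (intro CollectI exI[of _ "(\<bar>C\<bar> + 1) * 3 ^ n"] conjI exI[of _ n]) auto
qed

section \<open>Moments of the increments\<close>

text \<open>
  The whole later development rests on these moments of an increment after time \<open>u\<close>, in the
  presence of a factor known at time \<open>u\<close>. The constant \<open>c4\<close> is the fourth moment of \<open>\<xi> 0\<close>; it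
  bounds the increments of the quadratic variation, whose squares are of fourth order in \<open>B\<close>.
\<close>

locale G_Brownian_expectation = sublinear_expectation L0ip E for E +
  fixes c4 :: real
  assumes c4_nonneg: "0 \<le> c4"
    and increment_mean: "\<And>Z u v. Z \<in> L0ip_upto u \<Longrightarrow> 0 \<le> u \<Longrightarrow> u \<le> v \<Longrightarrow> E (\<lambda>\<omega>. Z \<omega> * (B v \<omega> - B u \<omega>)) = 0"
    and increment_square: "\<And>Z u v. Z \<in> L0ip_upto u \<Longrightarrow> (\<And>\<omega>. 0 \<le> Z \<omega>) \<Longrightarrow> 0 \<le> u \<Longrightarrow> u \<le> v \<Longrightarrow>
       E (\<lambda>\<omega>. Z \<omega> * (B v \<omega> - B u \<omega>)\<^sup>2) = (v - u) * E Z"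
    and increment_fourth: "\<And>Z u v. Z \<in> L0ip_upto u \<Longrightarrow> (\<And>\<omega>. 0 \<le> Z \<omega>) \<Longrightarrow> 0 \<le> u \<Longrightarrow> u \<le> v \<Longrightarrow>
       E (\<lambda>\<omega>. Z \<omega> * (B v \<omega> - B u \<omega>) ^ 4) = c4 * (v - u)\<^sup>2 * E Z"

text \<open>
  In the transfer formula the inner expectation is a constant multiple of \<open>Z\<close> by positive
  homogeneity if \<open>Z \<ge> 0\<close>. For \<open>Z\<close> of either sign the mean is \<open>0\<close> because \<open>\<xi>\<close> and \<open>- \<xi>\<close> both have
  expectation \<open>0\<close>.
\<close>

lemma G_expectation_increments:
  assumes G: "G_expectation s H E' \<xi> E"
  shows "G_Brownian_expectation E (E' (\<lambda>w. \<xi> 0 w ^ 4))"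
proof -
  interpret S: sublinear_expectation H E' using G by (simp add: G_expectation_def)
  have \<xi>H: "\<xi> i \<in> H" and N: "G_normal E' s (\<xi> i)" for i using G by (auto simp: G_expectation_def)
  have fourth: "E' (\<lambda>w. \<xi> i w ^ 4) = E' (\<lambda>w. \<xi> 0 w ^ 4)" for i
  proof -
    have "\<forall>t\<ge>0. \<forall>x. E' (\<lambda>w. (x + sqrt t * \<xi> 0 w) ^ 4) = E' (\<lambda>w. (x + sqrt t * \<xi> i w) ^ 4)"
      using N[of i] N[of 0] Cllip_power4 unfolding G_normal_def Let_def by blast
    from this[rule_format, of 1 0] show ?thesis by simp
  qed
  have tr: "\<exists>\<pi> i. (\<lambda>w. Z (\<pi> w)) \<in> H \<and> E Z = E' (\<lambda>w. Z (\<pi> w)) \<and> (\<forall>\<psi>. polylip1 \<psi> \<longrightarrow>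
     E (\<lambda>\<omega>. Z \<omega> * \<psi> (B v \<omega> - B u \<omega>)) = E' (\<lambda>w. E' (\<lambda>w'. Z (\<pi> w) * \<psi> (sqrt (v - u) * \<xi> i w'))))"
    if Z: "Z \<in> L0ip_upto u" and uv: "0 \<le> u" "u \<le> v" for Z u v
  proof -
    obtain ts where ts: "ts \<noteq> []" "set ts \<subseteq> {0..u}" "sorted ts" "last ts = u" "\<And>i. i < (1::nat) \<Longrightarrow> Z \<in> cyl ts"
      by (rule L0ip_upto_common[of 1 "\<lambda>_. Z", OF Z uv(1)]) auto
    have ts0: "set ts \<subseteq> {0..}" using ts(2) by auto
    have Z: "Z \<in> cyl ts" using ts(5)[of 0] by simp
    obtain \<pi> where \<pi>: "(\<lambda>w. Z (\<pi> w)) \<in> H" "E Z = E' (\<lambda>w. Z (\<pi> w))"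
      "\<And>\<psi>. polylip1 \<psi> \<Longrightarrow> E (\<lambda>\<omega>. Z \<omega> * \<psi> (B v \<omega> - B u \<omega>)) =
       E' (\<lambda>w. E' (\<lambda>w'. Z (\<pi> w) * \<psi> (sqrt (v - u) * \<xi> (length ts) w')))"
      by (rule G_expectation_transfer[OF G ts(1) ts0 ts(3)], unfold ts(4)) (use Z uv in blast)
    show ?thesis by (intro exI[of _ \<pi>] exI[of _ "length ts"] conjI allI impI \<pi>)
  qed
  interpret L: sublinear_expectation L0ip E by (rule G_expectation_sublinear[OF G])
  show ?thesis
  proof
    have "E' (\<lambda>_. 0) \<le> E' (\<lambda>w. \<xi> 0 w ^ 4)" by (intro S.mono stable_intros S.stable_H \<xi>H) auto
    then show "0 \<le> E' (\<lambda>w. \<xi> 0 w ^ 4)" by (simp add: S.const)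
  next
    fix Z and u v :: real assume Z: "Z \<in> L0ip_upto u" and uv: "0 \<le> u" "u \<le> v"
    obtain \<pi> i where \<pi>: "(\<lambda>w. Z (\<pi> w)) \<in> H" "E Z = E' (\<lambda>w. Z (\<pi> w))"
      "\<forall>\<psi>. polylip1 \<psi> \<longrightarrow> E (\<lambda>\<omega>. Z \<omega> * \<psi> (B v \<omega> - B u \<omega>)) = E' (\<lambda>w. E' (\<lambda>w'. Z (\<pi> w) * \<psi> (sqrt (v - u) * \<xi> i w')))"
      using tr[OF Z uv] by (elim exE conjE)
    have "polylip1 (\<lambda>x. x)" by (rule polylip1_lipschitz[of _ 1]) auto
    note t = \<pi>(3)[rule_format, OF this]
    have "E' (\<lambda>w'. z * (sqrt (v - u) * \<xi> j w')) = 0" for z j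
    proof (cases "z \<ge> 0")
      case True
      then show ?thesis using S.pos_homogeneous[of "z * sqrt (v - u)" "\<xi> j"] \<xi>H G_normal_moments[OF N, of j] uv by (simp add: mult.assoc)
    next
      case False
      then have "(- z) * sqrt (v - u) \<ge> 0" using uv by (intro mult_nonneg_nonneg) auto
      then show ?thesis using S.pos_homogeneous[of "(- z) * sqrt (v - u)" "\<lambda>w. - \<xi> j w"] S.scale[OF \<xi>H, of "-1" j]
          G_normal_moments(2)[OF N, of j] by (simp add: mult.assoc)
    qed
    then show "E (\<lambda>\<omega>. Z \<omega> * (B v \<omega> - B u \<omega>)) = 0" using t S.const by simp
  next
    fix Z and u v :: real assume Z: "Z \<in> L0ip_upto u" and Z0: "\<And>\<omega>. 0 \<le> Z \<omega>" and uv: "0 \<le> u" "u \<le> v"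
    obtain \<pi> i where \<pi>: "(\<lambda>w. Z (\<pi> w)) \<in> H" "E Z = E' (\<lambda>w. Z (\<pi> w))"
      "\<forall>\<psi>. polylip1 \<psi> \<longrightarrow> E (\<lambda>\<omega>. Z \<omega> * \<psi> (B v \<omega> - B u \<omega>)) = E' (\<lambda>w. E' (\<lambda>w'. Z (\<pi> w) * \<psi> (sqrt (v - u) * \<xi> i w')))"
      using tr[OF Z uv] by (elim exE conjE)
    have gen: "E (\<lambda>\<omega>. Z \<omega> * (B v \<omega> - B u \<omega>) ^ k) = (sqrt (v - u) ^ k * c) * E Z"
      if c: "\<And>j. E' (\<lambda>w. \<xi> j w ^ k) = c" "0 \<le> c" for k c
    proof -
      have "E (\<lambda>\<omega>. Z \<omega> * (B v \<omega> - B u \<omega>) ^ k) = E' (\<lambda>w. E' (\<lambda>w'. Z (\<pi> w) * (sqrt (v - u) * \<xi> i w') ^ k))"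
        by (rule \<pi>(3)[rule_format, OF polylip1_power])
      also have "\<dots> = E' (\<lambda>w. (sqrt (v - u) ^ k * c) * Z (\<pi> w))"
      proof (intro arg_cong[of _ _ E'] ext)
        fix w
        have "E' (\<lambda>w'. (Z (\<pi> w) * sqrt (v - u) ^ k) * \<xi> i w' ^ k) = (Z (\<pi> w) * sqrt (v - u) ^ k) * c"
          unfolding c(1)[of i, symmetric] using Z0 uv by (intro S.pos_homogeneous stable_power S.stable_H \<xi>H) auto
        then show "E' (\<lambda>w'. Z (\<pi> w) * (sqrt (v - u) * \<xi> i w') ^ k) = (sqrt (v - u) ^ k * c) * Z (\<pi> w)"
          by (simp add: power_mult_distrib algebra_simps)
      qed
      also have "\<dots> = (sqrt (v - u) ^ k * c) * E' (\<lambda>w. Z (\<pi> w))"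
        using c(2) uv by (intro S.pos_homogeneous \<pi>(1)) auto
      finally show ?thesis using \<pi>(2) by simp
    qed
    show "E (\<lambda>\<omega>. Z \<omega> * (B v \<omega> - B u \<omega>)\<^sup>2) = (v - u) * E Z"
      using gen[of 2 1] G_normal_moments(3)[OF N] uv by simp
    have "E' (\<lambda>_. 0) \<le> E' (\<lambda>w. \<xi> 0 w ^ 4)" by (intro S.mono stable_intros S.stable_H \<xi>H) auto
    then have c0: "0 \<le> E' (\<lambda>w. \<xi> 0 w ^ 4)" by (simp add: S.const)
    have "sqrt (v - u) ^ 4 = ((sqrt (v - u))\<^sup>2)\<^sup>2" by (simp flip: power_mult)
    then have "sqrt (v - u) ^ 4 = (v - u)\<^sup>2" using uv by simp
    then show "E (\<lambda>\<omega>. Z \<omega> * (B v \<omega> - B u \<omega>) ^ 4) = E' (\<lambda>w. \<xi> 0 w ^ 4) * (v - u)\<^sup>2 * E Z"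
      using gen[of 4 "E' (\<lambda>w. \<xi> 0 w ^ 4)", OF fourth c0] by simp
  qed
qed

lemmas L0_intros = stable_intros[OF stable_L0ip]

section \<open>Cauchy sequences and their distances\<close>

text \<open>
  The representatives of the elements of a completion, for an arbitrary seminorm \<open>N\<close>; \<open>LG E 1\<close>
  and \<open>LG E 2\<close> are the two instances that matter, and \<open>cdist N\<close> below is the distance in the
  completion.
\<close>

definition cseq :: "((path \<Rightarrow> real) \<Rightarrow> real) \<Rightarrow> (path \<Rightarrow> real) set \<Rightarrow> rv set" where
  "cseq N S = {X. (\<forall>n. X n \<in> S) \<and> (\<forall>e>0. \<exists>M. \<forall>m\<ge>M. \<forall>n\<ge>M. N (\<lambda>w. X m w - X n w) < e)}"

definition cdist :: "((path \<Rightarrow> real) \<Rightarrow> real) \<Rightarrow> rv \<Rightarrow> rv \<Rightarrow> real" where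
  "cdist N X Y = lim (\<lambda>n. N (\<lambda>w. X n w - Y n w))"

text \<open>
  A seminorm that is monotone in the absolute value. The single inequality \<open>dominated\<close> contains
  the triangle inequality and homogeneity, and it is the form in which pointwise bounds pass to
  norms and, termwise, to distances of Cauchy sequences.
\<close>

locale riesz_seminorm =
  fixes N :: "(path \<Rightarrow> real) \<Rightarrow> real"
  assumes nonneg: "X \<in> L0ip \<Longrightarrow> 0 \<le> N X"
    and dominated: "X \<in> L0ip \<Longrightarrow> Y \<in> L0ip \<Longrightarrow> Z \<in> L0ip \<Longrightarrow> 0 \<le> a \<Longrightarrow> 0 \<le> b \<Longrightarrow>
       (\<And>w. \<bar>X w\<bar> \<le> a * \<bar>Y w\<bar> + b * \<bar>Z w\<bar>) \<Longrightarrow> N X \<le> a * N Y + b * N Z"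
begin

lemma zero: "N (\<lambda>_. 0) = 0"
  using dominated[of "\<lambda>_. 0" "\<lambda>_. 0" "\<lambda>_. 0" 0 0] nonneg[of "\<lambda>_. 0"] L0_intros(1)[of 0] by fastforce

lemma triangle:
  assumes "X \<in> L0ip" "Y \<in> L0ip" "Z \<in> L0ip"
  shows "N (\<lambda>w. X w - Z w) \<le> N (\<lambda>w. X w - Y w) + N (\<lambda>w. Y w - Z w)"
  using dominated[of "\<lambda>w. X w - Z w" "\<lambda>w. X w - Y w" "\<lambda>w. Y w - Z w" 1 1] assms
  by (force intro: L0_intros)

lemma mono:
  assumes "X \<in> L0ip" "Y \<in> L0ip" "\<And>w. \<bar>X w\<bar> \<le> \<bar>Y w\<bar>"
  shows "N X \<le> N Y"
  using dominated[of X Y Y 1 0] assms by force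

lemma commute:
  assumes "X \<in> L0ip" "Y \<in> L0ip" shows "N (\<lambda>w. X w - Y w) = N (\<lambda>w. Y w - X w)"
  by (rule antisym; rule mono) (auto intro: L0_intros assms)

lemma cseqD:
  assumes "X \<in> cseq N S" shows "X n \<in> S" and "0 < e \<Longrightarrow> \<exists>M. \<forall>m\<ge>M. \<forall>n\<ge>M. N (\<lambda>w. X m w - X n w) < e"
  using assms by (auto simp: cseq_def)

lemma cseqI:
  assumes "\<And>n. X n \<in> S" "\<And>e. 0 < e \<Longrightarrow> \<exists>M. \<forall>m\<ge>M. \<forall>n\<ge>M. N (\<lambda>w. X m w - X n w) < e"
  shows "X \<in> cseq N S"
  using assms by (auto simp: cseq_def)

lemma cseq_mono: "S \<subseteq> S' \<Longrightarrow> cseq N S \<subseteq> cseq N S'"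
  by (auto simp: cseq_def)

lemma cdist_tendsto:
  assumes X: "X \<in> cseq N L0ip" and Y: "Y \<in> cseq N L0ip"
  shows "(\<lambda>n. N (\<lambda>w. X n w - Y n w)) \<longlonglongrightarrow> cdist N X Y"
proof -
  have "Cauchy (\<lambda>n. N (\<lambda>w. X n w - Y n w))"
  proof (rule metric_CauchyI)
    fix e :: real assume e: "0 < e"
    obtain M1 where M1: "\<And>m n. m \<ge> M1 \<Longrightarrow> n \<ge> M1 \<Longrightarrow> N (\<lambda>w. X m w - X n w) < e/2"
      using cseqD(2)[OF X, of "e/2"] e by auto
    obtain M2 where M2: "\<And>m n. m \<ge> M2 \<Longrightarrow> n \<ge> M2 \<Longrightarrow> N (\<lambda>w. Y m w - Y n w) < e/2"
      using cseqD(2)[OF Y, of "e/2"] e by auto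
    have lt: "N (\<lambda>w. X m w - Y m w) < N (\<lambda>w. X n w - Y n w) + e" if mn: "m \<ge> max M1 M2" "n \<ge> max M1 M2" for m n
    proof -
      note L = cseqD(1)[OF X] cseqD(1)[OF Y]
      have "N (\<lambda>w. X m w - Y m w) \<le> N (\<lambda>w. X m w - X n w) + N (\<lambda>w. X n w - Y m w)" by (rule triangle) (intro L)+
      also have "N (\<lambda>w. X n w - Y m w) \<le> N (\<lambda>w. X n w - Y n w) + N (\<lambda>w. Y n w - Y m w)" by (rule triangle) (intro L)+
      finally show ?thesis using M1[of m n] M2[of n m] mn by auto
    qed
    show "\<exists>M. \<forall>m\<ge>M. \<forall>n\<ge>M. dist (N (\<lambda>w. X m w - Y m w)) (N (\<lambda>w. X n w - Y n w)) < e"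
    proof (intro exI[of _ "max M1 M2"] allI impI)
      fix m n assume mn: "max M1 M2 \<le> m" "max M1 M2 \<le> n"
      show "dist (N (\<lambda>w. X m w - Y m w)) (N (\<lambda>w. X n w - Y n w)) < e"
        using lt[OF mn] lt[OF mn(2,1)] unfolding dist_real_def by linarith
    qed
  qed
  then show ?thesis unfolding cdist_def using Cauchy_convergent convergent_LIMSEQ_iff by blast
qed

lemma cdist_nonneg:
  assumes X: "X \<in> cseq N L0ip" and Y: "Y \<in> cseq N L0ip" shows "0 \<le> cdist N X Y"
  by (rule LIMSEQ_le_const[OF cdist_tendsto[OF X Y]])
     (use cseqD(1)[OF X] cseqD(1)[OF Y] in \<open>auto intro!: nonneg L0_intros\<close>)

lemma cdist_dominated:
  assumes "X \<in> cseq N L0ip" "Y \<in> cseq N L0ip" "X' \<in> cseq N L0ip" "Y' \<in> cseq N L0ip" "X'' \<in> cseq N L0ip" "Y'' \<in> cseq N L0ip"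
    "0 \<le> a" "0 \<le> b" and le: "\<And>n w. \<bar>X n w - Y n w\<bar> \<le> a * \<bar>X' n w - Y' n w\<bar> + b * \<bar>X'' n w - Y'' n w\<bar>"
  shows "cdist N X Y \<le> a * cdist N X' Y' + b * cdist N X'' Y''"
proof (rule LIMSEQ_le[OF cdist_tendsto[OF assms(1,2)]])
  show "(\<lambda>n. a * N (\<lambda>w. X' n w - Y' n w) + b * N (\<lambda>w. X'' n w - Y'' n w)) \<longlonglongrightarrow> a * cdist N X' Y' + b * cdist N X'' Y''"
    by (intro tendsto_intros cdist_tendsto assms)
  note L = assms(1-6)[THEN cseqD(1)]
  have "N (\<lambda>w. X n w - Y n w) \<le> a * N (\<lambda>w. X' n w - Y' n w) + b * N (\<lambda>w. X'' n w - Y'' n w)" for n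
    by (rule dominated) (use L in \<open>auto intro!: L0_intros assms(7,8) le\<close>)
  then show "\<exists>M. \<forall>n\<ge>M. N (\<lambda>w. X n w - Y n w) \<le> a * N (\<lambda>w. X' n w - Y' n w) + b * N (\<lambda>w. X'' n w - Y'' n w)"
    by auto
qed

lemma cdist_mono:
  assumes "X \<in> cseq N L0ip" "Y \<in> cseq N L0ip" "X' \<in> cseq N L0ip" "Y' \<in> cseq N L0ip"
    "0 \<le> a" and le: "\<And>n w. \<bar>X n w - Y n w\<bar> \<le> a * \<bar>X' n w - Y' n w\<bar>"
  shows "cdist N X Y \<le> a * cdist N X' Y'"
  using cdist_dominated[of X Y X' Y' X' Y' a 0] assms by auto

lemma cdist_triangle:
  assumes "X \<in> cseq N L0ip" "Y \<in> cseq N L0ip" "Z \<in> cseq N L0ip"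
  shows "cdist N X Z \<le> cdist N X Y + cdist N Y Z"
  using cdist_dominated[of X Z X Y Y Z 1 1] assms by force

lemma cdist_commute:
  assumes "X \<in> cseq N L0ip" "Y \<in> cseq N L0ip" shows "cdist N X Y = cdist N Y X"
  using cdist_mono[of X Y Y X 1] cdist_mono[of Y X X Y 1] assms by force

lemma cdist_self: "cdist N X X = 0"
  by (simp add: cdist_def zero)

lemma cdist_const: "cdist N (\<lambda>n. Z) (\<lambda>n. W) = N (\<lambda>w. Z w - W w)"
  by (simp add: cdist_def)

lemma cdist_le:
  assumes "X \<in> cseq N L0ip" "Y \<in> cseq N L0ip" "\<And>n. n \<ge> M \<Longrightarrow> N (\<lambda>w. X n w - Y n w) \<le> c"
  shows "cdist N X Y \<le> c"
  by (rule LIMSEQ_le_const2[OF cdist_tendsto[OF assms(1,2)]]) (use assms(3) in auto)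

lemma cseq_dominated:
  assumes S: "S \<subseteq> L0ip" and W: "\<And>n. W n \<in> S" and X: "X \<in> cseq N L0ip" and Y: "Y \<in> cseq N L0ip"
    and ab: "0 \<le> a" "0 \<le> b" and le: "\<And>m n w. \<bar>W m w - W n w\<bar> \<le> a * \<bar>X m w - X n w\<bar> + b * \<bar>Y m w - Y n w\<bar>"
  shows "W \<in> cseq N S"
proof (rule cseqI[OF W])
  fix e :: real assume e: "0 < e"
  define e' where "e' = e / (2 * (a + b + 1))"
  have e': "e' > 0" using e ab by (simp add: e'_def)
  obtain M1 where M1: "\<And>m n. m \<ge> M1 \<Longrightarrow> n \<ge> M1 \<Longrightarrow> N (\<lambda>w. X m w - X n w) < e'"
    using cseqD(2)[OF X, of "e'"] e' by auto
  obtain M2 where M2: "\<And>m n. m \<ge> M2 \<Longrightarrow> n \<ge> M2 \<Longrightarrow> N (\<lambda>w. Y m w - Y n w) < e'"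
    using cseqD(2)[OF Y, of "e'"] e' by auto
  have "N (\<lambda>w. W m w - W n w) < e" if "m \<ge> max M1 M2" "n \<ge> max M1 M2" for m n
  proof -
    have "N (\<lambda>w. W m w - W n w) \<le> a * N (\<lambda>w. X m w - X n w) + b * N (\<lambda>w. Y m w - Y n w)"
      by (rule dominated) (use W S cseqD(1)[OF X] cseqD(1)[OF Y] in \<open>auto intro!: L0_intros ab le\<close>)
    also have "\<dots> \<le> a * e' + b * e'" using M1[of m n] M2[of m n] that ab by (intro add_mono mult_left_mono) auto
    also have "\<dots> < 2 * (a + b + 1) * e'" using e' ab by (simp add: algebra_simps add_strict_increasing2 add_pos_nonneg)
    also have "\<dots> = e" using ab by (simp add: e'_def)
    finally show ?thesis .
  qed
  then show "\<exists>M. \<forall>m\<ge>M. \<forall>n\<ge>M. N (\<lambda>w. W m w - W n w) < e" by blast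
qed

lemma cseq_const: "Z \<in> S \<Longrightarrow> (\<lambda>n. Z) \<in> cseq N S"
  by (rule cseqI) (auto simp: zero)

lemma cseq_add:
  assumes X: "X \<in> cseq N L0ip" and Y: "Y \<in> cseq N L0ip" shows "(\<lambda>n w. X n w + Y n w) \<in> cseq N L0ip"
proof (rule cseq_dominated[OF order_refl _ X Y, of _ 1 1])
  show "(\<lambda>w. X n w + Y n w) \<in> L0ip" for n by (intro L0_intros cseqD(1)[OF X] cseqD(1)[OF Y])
qed auto

lemma cdist_sum_le:
  assumes "\<And>j. j \<in> J \<Longrightarrow> X j \<in> cseq N L0ip" "\<And>j. j \<in> J \<Longrightarrow> Y j \<in> cseq N L0ip"
  shows "(\<lambda>n w. \<Sum>j\<in>J. X j n w) \<in> cseq N L0ip \<and> (\<lambda>n w. \<Sum>j\<in>J. Y j n w) \<in> cseq N L0ip \<and>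
    cdist N (\<lambda>n w. \<Sum>j\<in>J. X j n w) (\<lambda>n w. \<Sum>j\<in>J. Y j n w) \<le> (\<Sum>j\<in>J. cdist N (X j) (Y j))"
  using assms
proof (induction J rule: infinite_finite_induct)
  case (insert a F)
  then have ih: "(\<lambda>n w. \<Sum>j\<in>F. X j n w) \<in> cseq N L0ip" "(\<lambda>n w. \<Sum>j\<in>F. Y j n w) \<in> cseq N L0ip"
    "cdist N (\<lambda>n w. \<Sum>j\<in>F. X j n w) (\<lambda>n w. \<Sum>j\<in>F. Y j n w) \<le> (\<Sum>j\<in>F. cdist N (X j) (Y j))" by auto
  have a: "X a \<in> cseq N L0ip" "Y a \<in> cseq N L0ip" using insert by auto
  have "cdist N (\<lambda>n w. X a n w + (\<Sum>j\<in>F. X j n w)) (\<lambda>n w. Y a n w + (\<Sum>j\<in>F. Y j n w))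
      \<le> 1 * cdist N (X a) (Y a) + 1 * cdist N (\<lambda>n w. \<Sum>j\<in>F. X j n w) (\<lambda>n w. \<Sum>j\<in>F. Y j n w)"
    by (rule cdist_dominated[OF cseq_add[OF a(1) ih(1)] cseq_add[OF a(2) ih(2)] a ih(1,2)]) auto
  then show ?case using ih a insert(1,2) by (auto intro: cseq_add)
qed (auto simp: cdist_self intro: cseq_const L0_intros)

lemma cseq_diff:
  assumes X: "X \<in> cseq N L0ip" and Y: "Y \<in> cseq N L0ip" shows "(\<lambda>n w. X n w - Y n w) \<in> cseq N L0ip"
proof (rule cseq_dominated[OF order_refl _ X Y, of _ 1 1])
  show "(\<lambda>w. X n w - Y n w) \<in> L0ip" for n by (intro L0_intros cseqD(1)[OF X] cseqD(1)[OF Y])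
qed auto

lemma cseq_bmult:
  assumes Z: "Z \<in> L0ip" and M: "\<And>w. \<bar>Z w\<bar> \<le> M" and X: "X \<in> cseq N L0ip"
  shows "(\<lambda>n w. Z w * X n w) \<in> cseq N L0ip"
proof (rule cseq_dominated[OF order_refl _ X X, of _ M 0])
  show "(\<lambda>w. Z w * X n w) \<in> L0ip" for n by (intro L0_intros Z cseqD(1)[OF X])
  show "0 \<le> M" using M[of undefined] by (rule order_trans[OF abs_ge_zero])
  fix m n w
  have "\<bar>Z w * X m w - Z w * X n w\<bar> = \<bar>Z w\<bar> * \<bar>X m w - X n w\<bar>" by (simp add: abs_mult flip: right_diff_distrib)
  also have "\<dots> \<le> M * \<bar>X m w - X n w\<bar>" by (intro mult_right_mono M) auto
  finally show "\<bar>Z w * X m w - Z w * X n w\<bar> \<le> M * \<bar>X m w - X n w\<bar> + 0 * \<bar>X m w - X n w\<bar>" by simp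
qed simp

lemma cseq_scale: "X \<in> cseq N L0ip \<Longrightarrow> (\<lambda>n w. c * X n w) \<in> cseq N L0ip"
  by (rule cseq_bmult[of "\<lambda>_. c" "\<bar>c\<bar>"]) (auto intro: L0_intros)

lemma cseq_lipschitz:
  assumes "X \<in> cseq N L0ip" "\<And>x y. \<bar>f x - f y\<bar> \<le> L * \<bar>x - y\<bar>"
  shows "(\<lambda>n w. f (X n w)) \<in> cseq N L0ip"
proof -
  have L: "0 \<le> L" using assms(2)[of 0 1] by (simp add: order_trans[OF abs_ge_zero])
  show ?thesis
  proof (rule cseq_dominated[OF order_refl _ assms(1) assms(1) L order_refl])
    show "(\<lambda>w. f (X n w)) \<in> L0ip" for n
      by (rule stable_apply[OF stable_L0ip cseqD(1)[OF assms(1)] polylip1_lipschitz[OF assms(2)]])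
  qed (use assms(2) in auto)
qed

lemma cdist_approx:
  assumes X: "X \<in> cseq N L0ip" and e: "0 < e"
  shows "\<exists>M. \<forall>n\<ge>M. cdist N X (\<lambda>_. X n) < e"
proof -
  obtain M where M: "\<And>m n. m \<ge> M \<Longrightarrow> n \<ge> M \<Longrightarrow> N (\<lambda>w. X m w - X n w) < e/2"
    using cseqD(2)[OF X, of "e/2"] e by auto
  have "cdist N X (\<lambda>_. X n) \<le> e/2" if "n \<ge> M" for n
    by (rule cdist_le[of _ _ M]) (use M that X cseqD(1)[OF X] in \<open>auto intro!: cseq_const less_imp_le\<close>)
  then show ?thesis using e by (intro exI[of _ M]) force
qed

text \<open>
  The limit is a diagonal sequence: from the \<open>k\<close>-th element a term within \<open>1 / (k + 1)\<close> of it.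
\<close>

lemma cseq_complete:
  assumes X: "\<And>k. X k \<in> cseq N L0ip" and C: "\<And>e. 0 < e \<Longrightarrow> \<exists>M. \<forall>k\<ge>M. \<forall>l\<ge>M. cdist N (X k) (X l) < e"
  obtains Y where "Y \<in> cseq N L0ip" "(\<lambda>k. cdist N (X k) Y) \<longlonglongrightarrow> 0"
proof -
  have "\<exists>n. cdist N (X k) (\<lambda>_. X k n) < 1 / real (Suc k)" for k
    using cdist_approx[OF X[of k], of "1 / real (Suc k)"] by auto
  then obtain m where m: "\<And>k. cdist N (X k) (\<lambda>_. X k (m k)) < 1 / real (Suc k)" by metis
  define Y where "Y k = X k (m k)" for k
  have YL: "Y k \<in> L0ip" for k using cseqD(1)[OF X] by (simp add: Y_def)
  have Yc: "(\<lambda>_. Y k) \<in> cseq N L0ip" for k by (rule cseq_const[OF YL])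
  have sm: "\<exists>M. \<forall>k\<ge>M. 1 / real (Suc k) < e" if e0: "0 < e" for e
  proof -
    obtain M where "1 / real (Suc M) < e" using reals_Archimedean[OF e0] by (auto simp: inverse_eq_divide)
    then show ?thesis by (intro exI[of _ M]) (auto intro: le_less_trans[rotated] simp: frac_le)
  qed
  have cl: "cdist N (\<lambda>_. Y k) (\<lambda>_. Y l) < 1 / real (Suc k) + cdist N (X k) (X l) + 1 / real (Suc l)" for k l
  proof -
    have "cdist N (\<lambda>_. Y k) (\<lambda>_. Y l) \<le> cdist N (\<lambda>_. Y k) (X k) + cdist N (X k) (\<lambda>_. Y l)"
      by (intro cdist_triangle Yc X)
    also have "cdist N (X k) (\<lambda>_. Y l) \<le> cdist N (X k) (X l) + cdist N (X l) (\<lambda>_. Y l)"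
      by (intro cdist_triangle Yc X)
    finally show ?thesis using m[of k] m[of l] cdist_commute[OF X[of k] Yc[of k]] by (simp add: Y_def)
  qed
  have Y: "Y \<in> cseq N L0ip"
  proof (rule cseqI[OF YL])
    fix e :: real assume e: "0 < e"
    obtain M1 where M1: "\<forall>k\<ge>M1. 1 / real (Suc k) < e/3" using sm[of "e/3"] e by auto
    obtain M2 where M2: "\<forall>k\<ge>M2. \<forall>l\<ge>M2. cdist N (X k) (X l) < e/3" using C[of "e/3"] e by auto
    have "N (\<lambda>w. Y k w - Y l w) < e" if "k \<ge> max M1 M2" "l \<ge> max M1 M2" for k l
      using cl[of k l] M1[rule_format, of k] M1[rule_format, of l] M2[rule_format, of k l] that by (auto simp: cdist_const)
    then show "\<exists>M. \<forall>m\<ge>M. \<forall>n\<ge>M. N (\<lambda>w. Y m w - Y n w) < e" by blast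
  qed
  have "(\<lambda>k. cdist N (X k) Y) \<longlonglongrightarrow> 0"
  proof (rule LIMSEQ_I)
    fix e :: real assume e: "0 < e"
    obtain M1 where M1: "\<forall>k\<ge>M1. 1 / real (Suc k) < e/2" using sm[of "e/2"] e by auto
    obtain M2 where M2: "\<forall>k\<ge>M2. cdist N Y (\<lambda>_. Y k) < e/2" using cdist_approx[OF Y, of "e/2"] e by auto
    have "norm (cdist N (X k) Y - 0) < e" if "k \<ge> max M1 M2" for k
      using cdist_triangle[OF X[of k] Yc[of k] Y] m[of k] M1[rule_format, of k] M2[rule_format, of k] that
        cdist_nonneg[OF X[of k] Y] cdist_commute[OF Y Yc[of k]] by (auto simp: Y_def)
    then show "\<exists>M. \<forall>n\<ge>M. norm (cdist N (X n) Y - 0) < e" by blast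
  qed
  with Y show thesis by (rule that)
qed

end

section \<open>The norms of first and second order\<close>

context G_Brownian_expectation
begin

definition n1 :: "(path \<Rightarrow> real) \<Rightarrow> real" where "n1 X = E (\<lambda>w. \<bar>X w\<bar>)"
definition n2 :: "(path \<Rightarrow> real) \<Rightarrow> real" where "n2 X = sqrt (E (\<lambda>w. (X w)\<^sup>2))"

lemma E_nonneg: "X \<in> L0ip \<Longrightarrow> (\<And>w. 0 \<le> X w) \<Longrightarrow> 0 \<le> E X"
  using mono[of "\<lambda>_. 0" X] const[of 0] L0_intros(1)[of 0] by auto

lemma E_add_le: "X \<in> L0ip \<Longrightarrow> Y \<in> L0ip \<Longrightarrow> E (\<lambda>w. X w + Y w) \<le> E X + E Y"
  using subadd[of "\<lambda>w. X w + Y w" Y] by (simp add: L0_intros)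

lemma E_dominated:
  assumes "X \<in> L0ip" "Y \<in> L0ip" "Z \<in> L0ip" "0 \<le> a" "0 \<le> b" "\<And>w. X w \<le> a * Y w + b * Z w"
  shows "E X \<le> a * E Y + b * E Z"
proof -
  have "E X \<le> E (\<lambda>w. a * Y w + b * Z w)" by (intro mono L0_intros assms)
  also have "\<dots> \<le> E (\<lambda>w. a * Y w) + E (\<lambda>w. b * Z w)" by (intro E_add_le L0_intros assms)
  finally show ?thesis using assms pos_homogeneous by auto
qed

lemma n1_nonneg: "X \<in> L0ip \<Longrightarrow> 0 \<le> n1 X"
  unfolding n1_def by (intro E_nonneg L0_intros) auto

lemma n2_nonneg: "X \<in> L0ip \<Longrightarrow> 0 \<le> n2 X"
  unfolding n2_def by (intro real_sqrt_ge_zero E_nonneg L0_intros) auto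

lemma n2_square: "X \<in> L0ip \<Longrightarrow> (n2 X)\<^sup>2 = E (\<lambda>w. (X w)\<^sup>2)"
  unfolding n2_def by (intro real_sqrt_pow2 E_nonneg L0_intros) auto

text \<open>
  Minkowski's inequality from subadditivity alone: the weights \<open>1 + b / a\<close> and \<open>1 + a / b\<close> turn
  the mixed term into squares, with \<open>a\<close> and \<open>b\<close> slightly above the two norms to keep them
  positive.
\<close>

lemma n2_add_le:
  assumes X: "X \<in> L0ip" and Y: "Y \<in> L0ip" shows "n2 (\<lambda>w. X w + Y w) \<le> n2 X + n2 Y"
proof (rule field_le_epsilon)
  fix e0 :: real assume "0 < e0"
  define e where "e = e0 / 2"
  have e: "0 < e" using \<open>0 < e0\<close> by (simp add: e_def)
  define a where "a = n2 X + e"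
  define b where "b = n2 Y + e"
  have ab: "a > 0" "b > 0" "n2 X \<le> a" "n2 Y \<le> b" using e n2_nonneg[OF X] n2_nonneg[OF Y] by (auto simp: a_def b_def)
  have "(n2 (\<lambda>w. X w + Y w))\<^sup>2 = E (\<lambda>w. (X w + Y w)\<^sup>2)" by (intro n2_square L0_intros assms)
  also have "\<dots> \<le> (1 + b / a) * E (\<lambda>w. (X w)\<^sup>2) + (1 + a / b) * E (\<lambda>w. (Y w)\<^sup>2)"
  proof (intro E_dominated L0_intros assms)
    fix w
    have "0 \<le> (b * X w - a * Y w)\<^sup>2 / (a * b)" using ab by simp
    also have "\<dots> = (1 + b / a) * (X w)\<^sup>2 + (1 + a / b) * (Y w)\<^sup>2 - (X w + Y w)\<^sup>2"
      using ab by (simp add: power2_eq_square field_simps)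
    finally show "(X w + Y w)\<^sup>2 \<le> (1 + b / a) * (X w)\<^sup>2 + (1 + a / b) * (Y w)\<^sup>2" by simp
  qed (use ab in auto)
  also have "\<dots> \<le> (1 + b / a) * a\<^sup>2 + (1 + a / b) * b\<^sup>2"
    unfolding n2_square[OF X, symmetric] n2_square[OF Y, symmetric]
    using ab n2_nonneg[OF X] n2_nonneg[OF Y] by (intro add_mono mult_left_mono power_mono) auto
  also have "\<dots> = (a + b)\<^sup>2" using ab by (simp add: power2_eq_square field_simps)
  finally have "n2 (\<lambda>w. X w + Y w) \<le> a + b" by (rule power2_le_imp_le) (use ab in auto)
  then show "n2 (\<lambda>w. X w + Y w) \<le> n2 X + n2 Y + e0" by (simp add: a_def b_def e_def)
qed

lemma n2_mono:
  assumes "X \<in> L0ip" "Y \<in> L0ip" "\<And>w. \<bar>X w\<bar> \<le> \<bar>Y w\<bar>" shows "n2 X \<le> n2 Y"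
  unfolding n2_def using assms by (intro real_sqrt_le_mono mono L0_intros) (auto simp: abs_le_square_iff)

lemma n2_scale: "X \<in> L0ip \<Longrightarrow> n2 (\<lambda>w. c * X w) = \<bar>c\<bar> * n2 X"
  unfolding n2_def by (simp add: power_mult_distrib pos_homogeneous L0_intros real_sqrt_mult)

lemma n2_const: "n2 (\<lambda>_. c) = \<bar>c\<bar>"
  unfolding n2_def by (simp add: const)

text \<open>
  The Cauchy-Schwarz inequality, by the same weighting as in \<open>n2_add_le\<close>.
\<close>

lemma n1_mult_le:
  assumes X: "X \<in> L0ip" and Y: "Y \<in> L0ip" shows "n1 (\<lambda>w. X w * Y w) \<le> n2 X * n2 Y"
proof -
  have "n1 (\<lambda>w. X w * Y w) \<le> (n2 X + e) * (n2 Y + e)" if e: "0 < e" for e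
  proof -
    define a where "a = n2 X + e"
    define b where "b = n2 Y + e"
    have ab: "a > 0" "b > 0" "n2 X \<le> a" "n2 Y \<le> b" using e n2_nonneg[OF X] n2_nonneg[OF Y] by (auto simp: a_def b_def)
    have "n1 (\<lambda>w. X w * Y w) \<le> (b / a / 2) * E (\<lambda>w. (X w)\<^sup>2) + (a / b / 2) * E (\<lambda>w. (Y w)\<^sup>2)"
      unfolding n1_def
    proof (intro E_dominated L0_intros assms)
      fix w
      have "0 \<le> (b * \<bar>X w\<bar> - a * \<bar>Y w\<bar>)\<^sup>2 / (2 * (a * b))" using ab by simp
      also have "\<dots> = (b / a / 2) * \<bar>X w\<bar>\<^sup>2 + (a / b / 2) * \<bar>Y w\<bar>\<^sup>2 - \<bar>X w\<bar> * \<bar>Y w\<bar>"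
        using ab by (simp add: power2_eq_square field_simps)
      finally show "\<bar>X w * Y w\<bar> \<le> (b / a / 2) * (X w)\<^sup>2 + (a / b / 2) * (Y w)\<^sup>2" by (simp add: abs_mult)
    qed (use ab in auto)
    also have "\<dots> \<le> (b / a / 2) * a\<^sup>2 + (a / b / 2) * b\<^sup>2"
      unfolding n2_square[OF X, symmetric] n2_square[OF Y, symmetric]
      using ab n2_nonneg[OF X] n2_nonneg[OF Y] by (intro add_mono mult_left_mono power_mono) auto
    also have "\<dots> = a * b" using ab by (simp add: power2_eq_square field_simps)
    finally show ?thesis by (simp add: a_def b_def)
  qed
  moreover have "((\<lambda>e. (n2 X + e) * (n2 Y + e)) \<longlongrightarrow> (n2 X + 0) * (n2 Y + 0)) (at_right 0)"
    by (intro tendsto_intros)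
  ultimately show ?thesis
    using tendsto_lowerbound[of "\<lambda>e. (n2 X + e) * (n2 Y + e)" _ "at_right 0" "n1 (\<lambda>w. X w * Y w)"]
    by (simp add: eventually_at_right_less eventually_mono[OF eventually_at_right_less])
qed

lemma n1_le_n2: "X \<in> L0ip \<Longrightarrow> n1 X \<le> n2 X"
  using n1_mult_le[of X "\<lambda>_. 1"] by (simp add: L0_intros n2_const)

sublocale two: riesz_seminorm n2
proof
  fix X Y Z a b assume L: "X \<in> L0ip" "Y \<in> L0ip" "Z \<in> L0ip" and ab: "0 \<le> a" "(0::real) \<le> b"
    and le: "\<And>w. \<bar>X w\<bar> \<le> a * \<bar>Y w\<bar> + b * \<bar>Z w\<bar>"
  have "n2 X \<le> n2 (\<lambda>w. a * \<bar>Y w\<bar> + b * \<bar>Z w\<bar>)"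
    by (rule n2_mono) (use L le ab in \<open>auto intro!: L0_intros simp: order_trans[OF _ abs_ge_self]\<close>)
  also have "\<dots> \<le> n2 (\<lambda>w. a * \<bar>Y w\<bar>) + n2 (\<lambda>w. b * \<bar>Z w\<bar>)" by (intro n2_add_le L0_intros L)
  also have "\<dots> = a * n2 Y + b * n2 Z" using ab n2_scale[of "\<lambda>w. \<bar>Y w\<bar>"] n2_scale[of "\<lambda>w. \<bar>Z w\<bar>"] L
    by (simp add: L0_intros n2_def)
  finally show "n2 X \<le> a * n2 Y + b * n2 Z" .
qed (rule n2_nonneg)

sublocale one: riesz_seminorm n1
proof
  fix X Y Z a b assume L: "X \<in> L0ip" "Y \<in> L0ip" "Z \<in> L0ip" and ab: "0 \<le> a" "(0::real) \<le> b"
    and le: "\<And>w. \<bar>X w\<bar> \<le> a * \<bar>Y w\<bar> + b * \<bar>Z w\<bar>"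
  show "n1 X \<le> a * n1 Y + b * n1 Z" unfolding n1_def by (intro E_dominated L0_intros L ab le)
qed (rule n1_nonneg)

abbreviation "V2 \<equiv> cseq n2 L0ip"
abbreviation "V1 \<equiv> cseq n1 L0ip"
abbreviation "d2 \<equiv> cdist n2"
abbreviation "d1 \<equiv> cdist n1"

lemma Lp_norm_2: "X \<in> L0ip \<Longrightarrow> Lp_norm E 2 X = n2 X"
  unfolding Lp_norm_def n2_def by (simp add: powr_half_sqrt E_nonneg L0_intros)

lemma Lp_norm_1: "X \<in> L0ip \<Longrightarrow> Lp_norm E 1 X = n1 X"
  unfolding Lp_norm_def n1_def by (simp add: E_nonneg L0_intros)

lemma LG_2_eq: "S \<subseteq> L0ip \<Longrightarrow> LG E 2 S = cseq n2 S"
  unfolding LG_def cseq_def using Lp_norm_2[OF L0_intros(6)] by (auto simp: subset_iff)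

lemma LG_1_eq: "S \<subseteq> L0ip \<Longrightarrow> LG E 1 S = cseq n1 S"
  unfolding LG_def cseq_def using Lp_norm_1[OF L0_intros(6)] by (auto simp: subset_iff)

lemma EG_square:
  assumes "X \<in> V2" "Y \<in> V2" shows "EG E (\<lambda>n w. \<bar>X n w - Y n w\<bar> powr 2) = (d2 X Y)\<^sup>2"
    "EG E (\<lambda>n w. \<bar>X n w - Y n w\<bar>\<^sup>2) = (d2 X Y)\<^sup>2"
proof -
  have "(\<lambda>n. (n2 (\<lambda>w. X n w - Y n w))\<^sup>2) \<longlonglongrightarrow> (d2 X Y)\<^sup>2"
    by (intro tendsto_intros two.cdist_tendsto assms)
  then have "(\<lambda>n. E (\<lambda>w. (X n w - Y n w)\<^sup>2)) \<longlonglongrightarrow> (d2 X Y)\<^sup>2"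
    using n2_square[OF L0_intros(6), OF two.cseqD(1)[OF assms(1)] two.cseqD(1)[OF assms(2)]] by simp
  then show "EG E (\<lambda>n w. \<bar>X n w - Y n w\<bar> powr 2) = (d2 X Y)\<^sup>2"
    "EG E (\<lambda>n w. \<bar>X n w - Y n w\<bar>\<^sup>2) = (d2 X Y)\<^sup>2" by (simp_all add: EG_def limI)
qed

lemma LG_norm_2:
  assumes "X \<in> V2" "Y \<in> V2" shows "LG_norm E 2 (\<lambda>n w. X n w - Y n w) = d2 X Y"
  unfolding LG_norm_def EG_square(1)[OF assms] using two.cdist_nonneg[OF assms] by (simp add: powr_half_sqrt)

lemma LG_norm_1:
  assumes "X \<in> V1" "Y \<in> V1" shows "LG_norm E 1 (\<lambda>n w. X n w - Y n w) = d1 X Y"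
proof -
  have "EG E (\<lambda>n w. \<bar>X n w - Y n w\<bar> powr 1) = d1 X Y"
    using one.cdist_tendsto[OF assms] by (simp add: EG_def limI n1_def)
  then show ?thesis unfolding LG_norm_def using one.cdist_nonneg[OF assms] by simp
qed

lemma V_V1: assumes "X \<in> V2" shows "X \<in> V1"
proof (rule one.cseqI)
  show "X n \<in> L0ip" for n by (rule two.cseqD(1)[OF assms])
  fix e :: real assume "0 < e"
  then obtain M where "\<forall>m\<ge>M. \<forall>n\<ge>M. n2 (\<lambda>w. X m w - X n w) < e" using two.cseqD(2)[OF assms] by blast
  then show "\<exists>M. \<forall>m\<ge>M. \<forall>n\<ge>M. n1 (\<lambda>w. X m w - X n w) < e"
    using n1_le_n2[OF L0_intros(6)[OF two.cseqD(1)[OF assms] two.cseqD(1)[OF assms]]] le_less_trans by blast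
qed

lemma d1_le_d2: assumes "X \<in> V2" "Y \<in> V2" shows "d1 X Y \<le> d2 X Y"
  by (rule LIMSEQ_le[OF one.cdist_tendsto[OF V_V1[OF assms(1)] V_V1[OF assms(2)]] two.cdist_tendsto[OF assms]])
     (use two.cseqD(1)[OF assms(1)] two.cseqD(1)[OF assms(2)] in \<open>auto intro!: n1_le_n2 L0_intros\<close>)

lemma V_bounded:
  assumes X: "X \<in> V2" shows "\<exists>K>0. \<forall>n. n2 (X n) \<le> K"
proof -
  have "(\<lambda>n. n2 (\<lambda>w. X n w - 0)) \<longlonglongrightarrow> d2 X (\<lambda>_ _. 0)"
    by (rule two.cdist_tendsto[OF X]) (intro two.cseq_const L0_intros)
  then have "Bseq (\<lambda>n. n2 (X n))" by (simp add: convergent_imp_Bseq convergentI)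
  then show ?thesis by (auto simp: Bseq_def abs_le_iff)
qed

lemma V_mult_V1:
  assumes X: "X \<in> V2" and Y: "Y \<in> V2" shows "(\<lambda>n w. X n w * Y n w) \<in> V1"
proof (rule one.cseqI)
  note L = two.cseqD(1)[OF X] two.cseqD(1)[OF Y]
  show "(\<lambda>w. X n w * Y n w) \<in> L0ip" for n by (intro L0_intros L)
  obtain K where K: "K > 0" "\<And>n. n2 (X n) \<le> K" using V_bounded[OF X] by blast
  obtain K' where K': "K' > 0" "\<And>n. n2 (Y n) \<le> K'" using V_bounded[OF Y] by blast
  fix e :: real assume e: "0 < e"
  define e' where "e' = e / (K + K' + 1)"
  have e': "e' > 0" using e K K' by (simp add: e'_def)
  obtain M1 where M1: "\<And>m n. m \<ge> M1 \<Longrightarrow> n \<ge> M1 \<Longrightarrow> n2 (\<lambda>w. X m w - X n w) < e'" using two.cseqD(2)[OF X e'] by auto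
  obtain M2 where M2: "\<And>m n. m \<ge> M2 \<Longrightarrow> n \<ge> M2 \<Longrightarrow> n2 (\<lambda>w. Y m w - Y n w) < e'" using two.cseqD(2)[OF Y e'] by auto
  have "n1 (\<lambda>w. X m w * Y m w - X n w * Y n w) < e" if "m \<ge> max M1 M2" "n \<ge> max M1 M2" for m n
  proof -
    have "n1 (\<lambda>w. X m w * Y m w - X n w * Y n w) \<le> 1 * n1 (\<lambda>w. (X m w - X n w) * Y m w) + 1 * n1 (\<lambda>w. X n w * (Y m w - Y n w))"
    proof (rule one.dominated)
      fix w
      have "X m w * Y m w - X n w * Y n w = (X m w - X n w) * Y m w + X n w * (Y m w - Y n w)" by (simp add: algebra_simps)
      then show "\<bar>X m w * Y m w - X n w * Y n w\<bar> \<le> 1 * \<bar>(X m w - X n w) * Y m w\<bar> + 1 * \<bar>X n w * (Y m w - Y n w)\<bar>" by simp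
    qed ((intro L0_intros L)+, simp_all)
    also have "\<dots> \<le> n2 (\<lambda>w. X m w - X n w) * n2 (Y m) + n2 (X n) * n2 (\<lambda>w. Y m w - Y n w)"
      unfolding mult_1 by (intro add_mono n1_mult_le L0_intros L)
    also have "\<dots> \<le> e' * K' + K * e'"
      using less_imp_le[OF M1[of m n]] less_imp_le[OF M2[of m n]] that K K' e' n2_nonneg[OF L(2)[of m]] n2_nonneg[OF L0_intros(6)[OF L(2)[of m] L(2)[of n]]]
      by (intro add_mono mult_mono) auto
    also have "\<dots> < (K + K' + 1) * e'" using e' by (simp add: algebra_simps)
    also have "\<dots> = e" using K K' by (simp add: e'_def)
    finally show ?thesis .
  qed
  then show "\<exists>M. \<forall>m\<ge>M. \<forall>n\<ge>M. n1 (\<lambda>w. X m w * Y m w - X n w * Y n w) < e" by blast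
qed

lemma d1_mult_le:
  assumes X: "X \<in> V2" "X' \<in> V2" and Y: "Y \<in> V2" "Y' \<in> V2"
  shows "d1 (\<lambda>n w. (X n w - X' n w) * (Y n w - Y' n w)) (\<lambda>n w. 0) \<le> d2 X X' * d2 Y Y'"
proof (rule LIMSEQ_le)
  show "(\<lambda>n. n1 (\<lambda>w. (X n w - X' n w) * (Y n w - Y' n w) - 0)) \<longlonglongrightarrow> d1 (\<lambda>n w. (X n w - X' n w) * (Y n w - Y' n w)) (\<lambda>n w. 0)"
    by (intro one.cdist_tendsto V_mult_V1 two.cseq_diff X Y one.cseq_const L0_intros)
  show "(\<lambda>n. n2 (\<lambda>w. X n w - X' n w) * n2 (\<lambda>w. Y n w - Y' n w)) \<longlonglongrightarrow> d2 X X' * d2 Y Y'"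
    by (intro tendsto_intros two.cdist_tendsto X Y)
  have "n1 (\<lambda>w. (X n w - X' n w) * (Y n w - Y' n w)) \<le> n2 (\<lambda>w. X n w - X' n w) * n2 (\<lambda>w. Y n w - Y' n w)" for n
    by (intro n1_mult_le L0_intros two.cseqD(1) X Y)
  then show "\<exists>M. \<forall>n\<ge>M. n1 (\<lambda>w. (X n w - X' n w) * (Y n w - Y' n w) - 0) \<le> n2 (\<lambda>w. X n w - X' n w) * n2 (\<lambda>w. Y n w - Y' n w)"
    by simp
qed

text \<open>
  A cylinder function has moments of all orders, and \<open>\<bar>z - max (-R) (min R z)\<bar> \<le> z\<^sup>2 / R\<close>.
\<close>

lemma truncate:
  assumes Z: "Z \<in> L0ip" and R: "0 < R"
  shows "n2 (\<lambda>w. Z w - max (-R) (min R (Z w))) \<le> n2 (\<lambda>w. (Z w)\<^sup>2) / R"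
    "polylip1 (\<lambda>x. max (-R) (min R x))"
proof -
  show p: "polylip1 (\<lambda>x. max (-R) (min R x))" by (rule polylip1_lipschitz[of _ 1]) auto
  have "n2 (\<lambda>w. Z w - max (-R) (min R (Z w))) \<le> n2 (\<lambda>w. (1/R) * (Z w)\<^sup>2)"
  proof (rule n2_mono)
    fix w
    have "\<bar>z - max (-R) (min R z)\<bar> \<le> (1/R) * z\<^sup>2" for z
    proof (cases "\<bar>z\<bar> \<le> R")
      case True then show ?thesis using R by (auto simp: max_def min_def)
    next
      case False
      then have "R * \<bar>z\<bar> \<le> \<bar>z\<bar> * \<bar>z\<bar>" by (intro mult_right_mono) auto
      then have "R * \<bar>z\<bar> \<le> z\<^sup>2" by (simp add: power2_eq_square)
      then have "\<bar>z\<bar> \<le> (1/R) * z\<^sup>2" using R by (simp add: field_simps)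
      moreover have "\<bar>z - max (-R) (min R z)\<bar> \<le> \<bar>z\<bar>" using R by (auto simp: max_def min_def)
      ultimately show ?thesis by linarith
    qed
    then show "\<bar>Z w - max (-R) (min R (Z w))\<bar> \<le> \<bar>(1/R) * (Z w)\<^sup>2\<bar>" using abs_ge_self order_trans by blast
  qed (intro L0_intros Z stable_apply[OF stable_L0ip Z p])+
  also have "\<dots> = n2 (\<lambda>w. (Z w)\<^sup>2) / R" using R Z by (subst n2_scale) (auto intro: L0_intros)
  finally show "n2 (\<lambda>w. Z w - max (-R) (min R (Z w))) \<le> n2 (\<lambda>w. (Z w)\<^sup>2) / R" .
qed

text \<open>
  Equality in the first-order completion of two elements of the second-order one is equality in
  the latter. The reason is uniform integrability: with \<open>Z = X - Y\<close> and a truncation \<open>W\<close> of one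
  late term, bounded by \<open>R\<close>, \<open>E (Z n)\<^sup>2 \<le> E \<bar>Z n * (Z n - W)\<bar> + R * E \<bar>Z n\<bar>\<close>, where the first
  summand is small uniformly in \<open>n\<close> and the second tends to \<open>0\<close>. Equations that hold only in the
  first-order norm, as those with an integral against the quadratic variation do, can therefore
  be read in mean square.
\<close>

lemma d1_zero_imp_d2_zero:
  assumes X: "X \<in> V2" and Y: "Y \<in> V2" and z: "d1 X Y = 0" shows "d2 X Y = 0"
proof -
  define Z where "Z n w = X n w - Y n w" for n w
  have Z: "Z \<in> V2" unfolding Z_def by (intro two.cseq_diff X Y)
  note ZL = two.cseqD(1)[OF Z]
  have n1Z: "(\<lambda>n. n1 (Z n)) \<longlonglongrightarrow> 0" using one.cdist_tendsto[OF V_V1[OF X] V_V1[OF Y]] z by (simp add: Z_def[abs_def])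
  have n2Z: "(\<lambda>n. n2 (Z n)) \<longlonglongrightarrow> d2 X Y" using two.cdist_tendsto[OF X Y] by (simp add: Z_def[abs_def])
  obtain K where K: "K > 0" "\<And>n. n2 (Z n) \<le> K" using V_bounded[OF Z] by blast
  have "(d2 X Y)\<^sup>2 \<le> e" if e: "0 < e" for e
  proof -
    define e' where "e' = e / (2 * K)"
    have e': "e' > 0" using e K by (simp add: e'_def)
    obtain M where M: "\<And>m n. m \<ge> M \<Longrightarrow> n \<ge> M \<Longrightarrow> n2 (\<lambda>w. Z m w - Z n w) < e'" using two.cseqD(2)[OF Z e'] by auto
    define Q where "Q = n2 (\<lambda>w. (Z M w)\<^sup>2)"
    define R where "R = (Q + 1) / e'"
    have Q0: "Q \<ge> 0" unfolding Q_def by (intro n2_nonneg L0_intros ZL)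
    have R: "R > 0" using Q0 e' by (simp add: R_def)
    have QR: "Q / R \<le> e'" using Q0 e' by (simp add: R_def field_simps)
    define W where "W w = max (-R) (min R (Z M w))" for w
    have WL: "W \<in> L0ip" unfolding W_def by (rule stable_apply[OF stable_L0ip ZL truncate(2)[OF ZL R]])
    have t: "n2 (\<lambda>w. Z M w - W w) \<le> e'" using truncate(1)[OF ZL R, of M] QR unfolding W_def Q_def by linarith
    have b: "(n2 (Z n))\<^sup>2 \<le> K * (2 * e') + R * n1 (Z n)" if "n \<ge> M" for n
    proof -
      have "(n2 (Z n))\<^sup>2 = E (\<lambda>w. (Z n w)\<^sup>2)" by (rule n2_square[OF ZL])
      also have "\<dots> \<le> 1 * E (\<lambda>w. \<bar>Z n w * (Z n w - W w)\<bar>) + R * E (\<lambda>w. \<bar>Z n w\<bar>)"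
      proof (intro E_dominated L0_intros ZL WL)
        fix w
        have "(Z n w)\<^sup>2 = Z n w * (Z n w - W w) + W w * Z n w" by (simp add: power2_eq_square algebra_simps)
        also have "\<dots> \<le> \<bar>Z n w * (Z n w - W w)\<bar> + R * \<bar>Z n w\<bar>"
        proof (intro add_mono abs_ge_self)
          have "W w * Z n w \<le> \<bar>W w\<bar> * \<bar>Z n w\<bar>" by (simp flip: abs_mult)
          also have "\<dots> \<le> R * \<bar>Z n w\<bar>" using R by (intro mult_right_mono) (auto simp: W_def)
          finally show "W w * Z n w \<le> R * \<bar>Z n w\<bar>" .
        qed
        finally show "(Z n w)\<^sup>2 \<le> 1 * \<bar>Z n w * (Z n w - W w)\<bar> + R * \<bar>Z n w\<bar>" by simp
      qed (use R in auto)
      also have "\<dots> \<le> n2 (Z n) * n2 (\<lambda>w. Z n w - W w) + R * n1 (Z n)"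
        using n1_mult_le[OF ZL[of n] L0_intros(6)[OF ZL[of n] WL]] by (simp add: n1_def)
      also have "n2 (\<lambda>w. Z n w - W w) \<le> 2 * e'"
        using two.triangle[OF ZL[of n] ZL[of M] WL] t M[of n M] that by simp
      also have "n2 (Z n) * (2 * e') \<le> K * (2 * e')" using K e' by (intro mult_right_mono) auto
      finally show ?thesis using n2_nonneg[OF ZL[of n]] by (simp add: mult_left_mono)
    qed
    have l1: "(\<lambda>n. (n2 (Z n))\<^sup>2) \<longlonglongrightarrow> (d2 X Y)\<^sup>2" by (intro tendsto_intros n2Z)
    have l2: "(\<lambda>n. K * (2 * e') + R * n1 (Z n)) \<longlonglongrightarrow> K * (2 * e') + R * 0" by (intro tendsto_intros n1Z)
    have "(d2 X Y)\<^sup>2 \<le> K * (2 * e') + R * 0"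
      by (rule LIMSEQ_le[OF l1 l2]) (use b in blast)
    also have "\<dots> = e" using K by (simp add: e'_def)
    finally show ?thesis .
  qed
  from this[of "(d2 X Y)\<^sup>2 / 2"] show ?thesis by (cases "d2 X Y = 0") auto
qed

end

section \<open>Bounded random variables\<close>

text \<open>
  Multiplication by a bounded variable acts on the second-order completion, whereas a product of
  two of its elements is only of first order; hence the coefficients of elementary processes are
  taken bounded.
\<close>

definition bL0 :: "real \<Rightarrow> (path \<Rightarrow> real) set" where
  "bL0 u = {Z \<in> L0ip_upto u. \<exists>M. \<forall>w. \<bar>Z w\<bar> \<le> M}"

lemma L0ip_upto_time_nonneg: "Z \<in> L0ip_upto u \<Longrightarrow> 0 \<le> u"
  unfolding L0ip_upto_def by (force simp: Suc_le_eq)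

lemma bL0_L0ip_upto: "Z \<in> bL0 u \<Longrightarrow> Z \<in> L0ip_upto u"
  by (simp add: bL0_def)

lemma bL0_L0ip: "Z \<in> bL0 u \<Longrightarrow> Z \<in> L0ip"
  using bL0_L0ip_upto L0ip_upto_subset by blast

lemma bL0_time_nonneg: "Z \<in> bL0 u \<Longrightarrow> 0 \<le> u"
  using bL0_L0ip_upto L0ip_upto_time_nonneg by blast

lemma bL0_bounded: assumes "Z \<in> bL0 u" obtains M where "0 < M" "\<And>w. \<bar>Z w\<bar> \<le> M"
proof -
  obtain M where M: "\<And>w. \<bar>Z w\<bar> \<le> M" using assms by (auto simp: bL0_def)
  then show thesis by (intro that[of "\<bar>M\<bar> + 1"]) (auto intro: order_trans[OF M])
qed

lemma bL0_mono: "Z \<in> bL0 u \<Longrightarrow> u \<le> v \<Longrightarrow> Z \<in> bL0 v"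
  using L0ip_upto_mono by (auto simp: bL0_def)

lemma bL0_const: "0 \<le> u \<Longrightarrow> (\<lambda>_. c) \<in> bL0 u"
  by (auto simp: bL0_def intro: stable_const stable_L0ip_upto)

lemma bL0_add: assumes "Z \<in> bL0 u" "W \<in> bL0 u" shows "(\<lambda>w. Z w + W w) \<in> bL0 u"
proof -
  obtain M where M: "\<And>w. \<bar>Z w\<bar> \<le> M" by (rule bL0_bounded[OF assms(1)]) blast
  obtain M' where M': "\<And>w. \<bar>W w\<bar> \<le> M'" by (rule bL0_bounded[OF assms(2)]) blast
  have "\<bar>Z w + W w\<bar> \<le> M + M'" for w using M[of w] M'[of w] by linarith
  then show ?thesis using assms bL0_time_nonneg[OF assms(1)] unfolding bL0_def
    by (auto intro!: stable_add stable_L0ip_upto)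
qed

lemma bL0_mult: assumes "Z \<in> bL0 u" "W \<in> bL0 u" shows "(\<lambda>w. Z w * W w) \<in> bL0 u"
proof -
  obtain M where M: "\<And>w. \<bar>Z w\<bar> \<le> M" "0 < M" by (rule bL0_bounded[OF assms(1)]) blast
  obtain M' where M': "\<And>w. \<bar>W w\<bar> \<le> M'" by (rule bL0_bounded[OF assms(2)]) blast
  have "\<bar>Z w * W w\<bar> \<le> M * M'" for w using M(1)[of w] M'[of w] M(2) unfolding abs_mult by (intro mult_mono) auto
  then show ?thesis using assms bL0_time_nonneg[OF assms(1)] unfolding bL0_def
    by (auto intro!: stable_mult stable_L0ip_upto)
qed

lemma bL0_scale: assumes "Z \<in> bL0 u" shows "(\<lambda>w. c * Z w) \<in> bL0 u"
  by (rule bL0_mult[OF bL0_const assms]) (rule bL0_time_nonneg[OF assms])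

lemma bL0_sum_list:
  assumes "\<And>i. i \<in> set J \<Longrightarrow> Z i \<in> bL0 u" "0 \<le> u" shows "(\<lambda>w. \<Sum>i\<leftarrow>J. Z i w) \<in> bL0 u"
  using assms by (induction J) (auto intro: bL0_const bL0_add)

lemma bL0_lipschitz:
  assumes Z: "Z \<in> bL0 u" and f: "\<And>x y. \<bar>f x - f y\<bar> \<le> L * \<bar>x - y\<bar>" shows "(\<lambda>w. f (Z w)) \<in> bL0 u"
proof -
  obtain M where M: "\<And>w. \<bar>Z w\<bar> \<le> M" "0 < M" by (rule bL0_bounded[OF assms(1)]) blast
  have "\<bar>f (Z w)\<bar> \<le> \<bar>f 0\<bar> + \<bar>L\<bar> * M" for w
  proof -
    have "L * \<bar>Z w - 0\<bar> \<le> \<bar>L\<bar> * M" using M by (intro mult_mono) auto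
    then show ?thesis using f[of "Z w" 0] by linarith
  qed
  then show ?thesis unfolding bL0_def
    using stable_apply[OF stable_L0ip_upto[OF bL0_time_nonneg[OF Z]] bL0_L0ip_upto[OF Z] polylip1_lipschitz[OF f]] by auto
qed

section \<open>Upper integrals\<close>

text \<open>
  The upper integral of \<open>f\<close> over \<open>[0,T]\<close> is below \<open>e\<close>. The distance of two processes is a
  function of time whose measurability is not known in advance, and this notion does without it.
\<close>

definition upper_less :: "real \<Rightarrow> (real \<Rightarrow> real) \<Rightarrow> real \<Rightarrow> bool" where
  "upper_less T f e \<longleftrightarrow> (\<exists>g. g integrable_on {0..T} \<and> (\<forall>t\<in>{0..T}. f t \<le> g t) \<and> integral {0..T} g < e)"

lemma upper_lessI: "g integrable_on {0..T} \<Longrightarrow> (\<And>t. t \<in> {0..T} \<Longrightarrow> f t \<le> g t) \<Longrightarrow> integral {0..T} g < e \<Longrightarrow> upper_less T f e"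
  by (auto simp: upper_less_def)

lemma upper_less_mono: "upper_less T f e \<Longrightarrow> (\<And>t. t \<in> {0..T} \<Longrightarrow> f' t \<le> f t) \<Longrightarrow> e \<le> e' \<Longrightarrow> upper_less T f' e'"
  unfolding upper_less_def by (meson order_trans less_le_trans)

lemma upper_less_lin:
  assumes "upper_less T f e" "upper_less T f' e'" "0 < a" "0 \<le> b" "\<And>t. t \<in> {0..T} \<Longrightarrow> h t \<le> a * f t + b * f' t"
  shows "upper_less T h (a * e + b * e')"
proof -
  obtain g where g: "g integrable_on {0..T}" "\<And>t. t \<in> {0..T} \<Longrightarrow> f t \<le> g t" "integral {0..T} g < e" using assms(1) unfolding upper_less_def by blast
  obtain g' where g': "g' integrable_on {0..T}" "\<And>t. t \<in> {0..T} \<Longrightarrow> f' t \<le> g' t" "integral {0..T} g' < e'" using assms(2) unfolding upper_less_def by blast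
  show ?thesis
  proof (rule upper_lessI)
    have i: "(\<lambda>t. a * g t) integrable_on {0..T}" "(\<lambda>t. b * g' t) integrable_on {0..T}"
      using g g' by (auto intro: integrable_on_mult_right)
    then show "(\<lambda>t. a * g t + b * g' t) integrable_on {0..T}" by (rule integrable_add)
    show "h t \<le> a * g t + b * g' t" if "t \<in> {0..T}" for t
      using assms(5)[OF that] mult_left_mono[OF g(2)[OF that], of a] mult_left_mono[OF g'(2)[OF that], of b] assms(3,4) by linarith
    have "integral {0..T} (\<lambda>t. a * g t + b * g' t) = a * integral {0..T} g + b * integral {0..T} g'"
      using integral_add[OF i] by simp
    also have "\<dots> < a * e + b * e'" using assms(3,4) g(3) g'(3) by (intro add_less_le_mono mult_strict_left_mono mult_left_mono) auto
    finally show "integral {0..T} (\<lambda>t. a * g t + b * g' t) < a * e + b * e'" .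
  qed
qed

lemma upper_less_const:
  assumes "0 \<le> T" "\<And>t. t \<in> {0..T} \<Longrightarrow> f t \<le> c" "c * T < e" shows "upper_less T f e"
  by (rule upper_lessI[of "\<lambda>_. c"]) (use assms in \<open>auto simp: mult.commute\<close>)

lemma upper_less_subinterval:
  assumes "upper_less T f e" "t \<le> T" "\<And>r. r \<in> {0..T} \<Longrightarrow> 0 \<le> f r" shows "upper_less t f e"
proof -
  obtain g where g: "g integrable_on {0..T}" "\<And>t. t \<in> {0..T} \<Longrightarrow> f t \<le> g t" "integral {0..T} g < e" using assms(1) unfolding upper_less_def by blast
  have i: "g integrable_on {0..t}" by (rule integrable_on_subinterval[OF g(1)]) (use assms in auto)
  have nn: "0 \<le> g r" if "r \<in> {0..T}" for r using assms(3)[OF that] g(2)[OF that] by linarith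
  have "integral {0..t} g \<le> integral {0..T} g"
    by (rule integral_subset_le[OF _ i g(1)]) (use assms(2) nn in auto)
  then show ?thesis using g i assms by (intro upper_lessI[of g]) auto
qed

lemma upper_less_extend:
  assumes "upper_less s f e" "s \<le> T" "\<And>r. r \<in> {0..s} \<Longrightarrow> f' r \<le> f r" "\<And>r. s < r \<Longrightarrow> f' r \<le> 0" shows "upper_less T f' e"
proof -
  obtain g where g: "g integrable_on {0..s}" "\<And>t. t \<in> {0..s} \<Longrightarrow> f t \<le> g t" "integral {0..s} g < e" using assms(1) unfolding upper_less_def by blast
  have sub: "{0..s} \<subseteq> {0..T}" using assms(2) by auto
  define g' where "g' t = (if t \<in> {0..s} then g t else 0)" for t
  have h: "(g' has_integral integral {0..s} g) {0..T}"
    unfolding g'_def has_integral_restrict[OF sub] using g(1) by (rule integrable_integral)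
  show ?thesis
  proof (rule upper_lessI)
    show "g' integrable_on {0..T}" using h by blast
    show "integral {0..T} g' < e" using integral_unique[OF h] g(3) by simp
    show "f' t \<le> g' t" if "t \<in> {0..T}" for t
    proof (cases "t \<le> s")
      case True then show ?thesis using that g(2)[of t] assms(3)[of t] by (simp add: g'_def)
    next
      case False then show ?thesis using assms(4)[of t] by (simp add: g'_def)
    qed
  qed
qed

lemma upper_less_spike:
  assumes "upper_less T f e" "negligible N" "\<And>t. t \<in> {0..T} - N \<Longrightarrow> f' t \<le> f t" shows "upper_less T f' e"
proof -
  obtain g where g: "g integrable_on {0..T}" "\<And>t. t \<in> {0..T} \<Longrightarrow> f t \<le> g t" "integral {0..T} g < e" using assms(1) unfolding upper_less_def by blast
  define g' where "g' t = (if t \<in> N then max (f' t) (g t) else g t)" for t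
  have "(g' has_integral integral {0..T} g) {0..T}"
    by (rule has_integral_spike[OF assms(2) _ integrable_integral[OF g(1)]]) (auto simp: g'_def)
  then have h: "g' integrable_on {0..T}" "integral {0..T} g' = integral {0..T} g" by (auto simp: has_integral_iff)
  show ?thesis
  proof (rule upper_lessI[OF h(1)])
    show "integral {0..T} g' < e" using h(2) g(3) by simp
    show "f' t \<le> g' t" if "t \<in> {0..T}" for t
      using that g(2)[OF that] assms(3)[of t] by (cases "t \<in> N") (auto simp: g'_def)
  qed
qed

section \<open>Elementary processes\<close>

text \<open>
  The list stands for the process \<open>\<Sum> Z I\<^sub>[\<^sub>u\<^sub>,\<^sub>v\<^sub>)\<close> over its triples. The intervals may overlap,
  so that a sum of processes is a concatenation of lists.
\<close>

type_synonym elem = "(path \<Rightarrow> real) \<times> real \<times> real"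

definition elem :: "real \<Rightarrow> elem list \<Rightarrow> bool" where
  "elem T Ls \<longleftrightarrow> (\<forall>(Z, u, v)\<in>set Ls. Z \<in> bL0 u \<and> u \<le> v \<and> v \<le> T)"

definition eproc :: "elem list \<Rightarrow> real \<Rightarrow> path \<Rightarrow> real" where
  "eproc Ls t w = (\<Sum>(Z, u, v)\<leftarrow>Ls. Z w * indicator {u..<v} t)"

definition eint :: "(real \<Rightarrow> rv) \<Rightarrow> elem list \<Rightarrow> rv" where
  "eint A Ls n w = (\<Sum>(Z, u, v)\<leftarrow>Ls. Z w * (A v n w - A u n w))"

definition escale :: "real \<Rightarrow> elem list \<Rightarrow> elem list" where
  "escale c Ls = map (\<lambda>(Z, u, v). (\<lambda>w. c * Z w, u, v)) Ls"

lemma elem_Nil [simp]: "elem T []" and eproc_Nil [simp]: "eproc [] t w = 0" and eint_Nil [simp]: "eint A [] n w = 0"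
  by (auto simp: elem_def eproc_def eint_def)

lemma elem_Cons: "elem T ((Z, u, v) # Ls) \<longleftrightarrow> Z \<in> bL0 u \<and> u \<le> v \<and> v \<le> T \<and> elem T Ls"
  by (auto simp: elem_def)

lemma eproc_Cons: "eproc ((Z, u, v) # Ls) t w = Z w * indicator {u..<v} t + eproc Ls t w"
  by (simp add: eproc_def)

lemma eint_Cons: "eint A ((Z, u, v) # Ls) n w = Z w * (A v n w - A u n w) + eint A Ls n w"
  by (simp add: eint_def)

lemma elem_append [simp]: "elem T (Ls @ Ls') \<longleftrightarrow> elem T Ls \<and> elem T Ls'"
  unfolding elem_def by (simp add: ball_Un)

lemma eproc_append [simp]: "eproc (Ls @ Ls') t w = eproc Ls t w + eproc Ls' t w"
  by (simp add: eproc_def)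

lemma eint_append [simp]: "eint A (Ls @ Ls') n w = eint A Ls n w + eint A Ls' n w"
  by (simp add: eint_def)

lemma elem_scale: "elem T Ls \<Longrightarrow> elem T (escale c Ls)"
  by (auto simp: elem_def escale_def intro: bL0_scale)

lemma eproc_scale [simp]: "eproc (escale c Ls) t w = c * eproc Ls t w"
  by (induction Ls) (auto simp: eproc_def escale_def algebra_simps)

lemma eint_scale [simp]: "eint A (escale c Ls) n w = c * eint A Ls n w"
  by (induction Ls) (auto simp: eint_def escale_def algebra_simps)

lemma elem_mono: "elem s Ls \<Longrightarrow> s \<le> T \<Longrightarrow> elem T Ls"
  by (force simp: elem_def)

lemma eproc_bL0: "elem T Ls \<Longrightarrow> 0 \<le> T \<Longrightarrow> eproc Ls t \<in> bL0 T"
proof (induction Ls)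
  case Nil then show ?case using bL0_const[of T 0] by (simp add: eproc_def[abs_def])
next
  case (Cons a Ls)
  obtain Z u v where a: "a = (Z, u, v)" by (cases a) auto
  have "(\<lambda>w. indicator {u..<v} t * Z w + eproc Ls t w) \<in> bL0 T"
    using Cons a by (intro bL0_add bL0_scale bL0_mono[of Z u T]) (auto simp: elem_Cons)
  then show ?case by (simp add: a eproc_Cons[abs_def] mult.commute)
qed

lemma eproc_L0ip: "elem T Ls \<Longrightarrow> 0 \<le> T \<Longrightarrow> eproc Ls t \<in> L0ip"
  using eproc_bL0 bL0_L0ip by blast

text \<open>
  Pieces that begin after \<open>s\<close> are dropped and the others end at \<open>s\<close> at the latest.
\<close>

definition ecut :: "real \<Rightarrow> elem list \<Rightarrow> elem list" where
  "ecut s Ls = map (\<lambda>(Z, u, v). (Z, u, min v s)) (filter (\<lambda>(Z, u, v). u \<le> s) Ls)"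

lemma elem_cut: "elem T Ls \<Longrightarrow> elem s (ecut s Ls)"
  by (auto simp: elem_def ecut_def)

lemma eproc_cut: "eproc (ecut s Ls) t w = eproc Ls t w * indicator {..<s} t"
  by (induction Ls) (auto simp: eproc_def ecut_def indicator_def)

definition is_partition :: "real \<Rightarrow> nat \<Rightarrow> (nat \<Rightarrow> real) \<Rightarrow> bool" where
  "is_partition T N \<tau> \<longleftrightarrow> \<tau> 0 = 0 \<and> \<tau> N = T \<and> (\<forall>j<N. \<tau> j < \<tau> (Suc j))"

lemma telescope_between:
  fixes F :: "real \<Rightarrow> real" and \<tau> :: "nat \<Rightarrow> real"
  assumes "a \<le> b" "b \<le> N" "\<And>i j. i < j \<Longrightarrow> j \<le> N \<Longrightarrow> \<tau> i < \<tau> j"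
  shows "(\<Sum>j<N. if \<tau> a \<le> \<tau> j \<and> \<tau> j < \<tau> b then F (\<tau> (Suc j)) - F (\<tau> j) else 0) = F (\<tau> b) - F (\<tau> a)"
proof -
  have iff: "\<tau> a \<le> \<tau> j \<and> \<tau> j < \<tau> b \<longleftrightarrow> j \<in> {a..<b}" if "j < N" for j
    using assms that by (smt (verit) atLeastLessThan_iff linorder_not_less nat_less_le order_trans less_imp_le_nat)
  have "(\<Sum>j<N. if \<tau> a \<le> \<tau> j \<and> \<tau> j < \<tau> b then F (\<tau> (Suc j)) - F (\<tau> j) else 0) = (\<Sum>j<N. if j \<in> {a..<b} then F (\<tau> (Suc j)) - F (\<tau> j) else 0)"
    by (rule sum.cong) (use iff in auto)
  also have "\<dots> = (\<Sum>j\<in>{..<N} \<inter> {a..<b}. F (\<tau> (Suc j)) - F (\<tau> j))" by (simp add: sum.inter_restrict)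
  also have "{..<N} \<inter> {a..<b} = {a..<b}" using assms by auto
  also have "(\<Sum>j\<in>{a..<b}. F (\<tau> (Suc j)) - F (\<tau> j)) = F (\<tau> b) - F (\<tau> a)"
    using sum_Suc_diff'[OF assms(1), of "\<lambda>j. F (\<tau> j)"] by simp
  finally show ?thesis .
qed

lemma is_partition_mono:
  assumes "is_partition T N \<tau>" "i < j" "j \<le> N" shows "\<tau> i < \<tau> j"
  using assms(2,3)
proof (induction j)
  case (Suc j)
  have "\<tau> j < \<tau> (Suc j)" using assms(1) Suc.prems unfolding is_partition_def by auto
  then show ?case using Suc by (cases "i = j") auto
qed simp

text \<open>
  The endpoints of all pieces, sorted, form a partition; on each cell the coefficient is the sum
  of those active there. The telescoping identity is proved for the increments of an arbitrary
  function \<open>F\<close>, which yields the integral directly and the process itself by inserting the jump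
  function \<open>v \<mapsto> - of_bool (v \<le> t)\<close>.
\<close>

lemma elem_partition:
  assumes T: "0 \<le> T" and Ls: "elem T Ls"
  obtains N \<tau> Z where "is_partition T N \<tau>" "\<And>j. j < N \<Longrightarrow> Z j \<in> bL0 (\<tau> j)"
    "\<And>t w. eproc Ls t w = (\<Sum>j<N. Z j w * indicator {\<tau> j..<\<tau> (Suc j)} t)"
    "\<And>A n w. eint A Ls n w = (\<Sum>j<N. Z j w * (A (\<tau> (Suc j)) n w - A (\<tau> j) n w))"
proof -
  define P where "P = {0, T} \<union> fst ` snd ` set Ls \<union> snd ` snd ` set Ls"
  define ps where "ps = sorted_list_of_set P"
  define N where "N = length ps - 1"
  define \<tau> where "\<tau> j = ps ! j" for j
  have finP: "finite P" by (simp add: P_def)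
  have setps: "set ps = P" using finP by (simp add: ps_def)
  have PT: "P \<subseteq> {0..T}" using Ls T unfolding P_def elem_def by (fastforce dest: bL0_time_nonneg)
  have len: "length ps = Suc N" using finP unfolding N_def ps_def P_def by (simp add: card_gt_0_iff)
  have sps: "sorted_wrt (<) ps" unfolding ps_def by (rule strict_sorted_list_of_set)
  have mono: "\<tau> i < \<tau> j" if "i < j" "j \<le> N" for i j
    using sorted_wrt_nth_less[OF sps] that len by (simp add: \<tau>_def)
  have ex: "\<exists>j\<le>N. \<tau> j = p" if "p \<in> P" for p
    using that len setps by (metis \<tau>_def in_set_conv_nth less_Suc_eq_le)
  have inP: "\<tau> j \<in> P" if "j \<le> N" for j using that len setps by (metis \<tau>_def less_Suc_eq_le nth_mem)
  have mono': "\<tau> i \<le> \<tau> j" if "i \<le> j" "j \<le> N" for i j using mono that by (cases "i = j") (auto intro: less_imp_le)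
  have \<tau>0: "\<tau> 0 = 0"
  proof -
    obtain j where "j \<le> N" "\<tau> j = 0" using ex[of 0] by (auto simp: P_def)
    then have "\<tau> 0 \<le> 0" using mono'[of 0 j] by auto
    then show ?thesis using inP[of 0] PT by auto
  qed
  have \<tau>N: "\<tau> N = T"
  proof -
    obtain j where "j \<le> N" "\<tau> j = T" using ex[of T] by (auto simp: P_def)
    then have "T \<le> \<tau> N" using mono'[of j N] by auto
    then show ?thesis using inP[of N] PT by auto
  qed
  have part: "is_partition T N \<tau>" unfolding is_partition_def using \<tau>0 \<tau>N mono by auto
  define Z where "Z j w = (\<Sum>(W, u, v)\<leftarrow>Ls. if u \<le> \<tau> j \<and> \<tau> j < v then W w else 0)" for j w
  have key: "(\<Sum>(W, u, v)\<leftarrow>Ls. W w * (F v - F u)) = (\<Sum>j<N. Z j w * (F (\<tau> (Suc j)) - F (\<tau> j)))" for F :: "real \<Rightarrow> real" and w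
  proof -
    have "(\<Sum>(W, u, v)\<leftarrow>Ks. W w * (F v - F u)) = (\<Sum>j<N. (\<Sum>(W, u, v)\<leftarrow>Ks. if u \<le> \<tau> j \<and> \<tau> j < v then W w else 0) * (F (\<tau> (Suc j)) - F (\<tau> j)))"
      if "set Ks \<subseteq> set Ls" for Ks using that
    proof (induction Ks)
      case (Cons k Ks)
      obtain W u v where k: "k = (W, u, v)" by (cases k) auto
      have uvP: "u \<in> P" "v \<in> P" "u \<le> v" using Cons.prems Ls unfolding k P_def elem_def by (auto intro!: rev_image_eqI)
      obtain a b where ab: "a \<le> N" "\<tau> a = u" "b \<le> N" "\<tau> b = v" using ex[OF uvP(1)] ex[OF uvP(2)] by auto
      have "a \<le> b" using mono[of b a] ab uvP(3) by (cases "a \<le> b") auto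
      from telescope_between[OF this ab(3), where F=F and \<tau>=\<tau>] mono
      have t: "F v - F u = (\<Sum>j<N. if u \<le> \<tau> j \<and> \<tau> j < v then F (\<tau> (Suc j)) - F (\<tau> j) else 0)" by (simp add: ab)
      have "W w * (F v - F u) = (\<Sum>j<N. (if u \<le> \<tau> j \<and> \<tau> j < v then W w else 0) * (F (\<tau> (Suc j)) - F (\<tau> j)))"
        unfolding t sum_distrib_left by (rule sum.cong) auto
      then show ?case using Cons by (simp add: k distrib_right sum.distrib)
    qed simp
    from this[of Ls] show ?thesis by (simp add: Z_def)
  qed
  show thesis
  proof (rule that[OF part])
    fix j assume j: "j < N"
    have \<tau>j0: "0 \<le> \<tau> j" using mono'[of 0 j] j \<tau>0 by auto
    have "(\<lambda>w. \<Sum>x\<leftarrow>Ls. (case x of (W, u, v) \<Rightarrow> if u \<le> \<tau> j \<and> \<tau> j < v then W w else 0)) \<in> bL0 (\<tau> j)"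
    proof (rule bL0_sum_list[OF _ \<tau>j0])
      fix x assume x: "x \<in> set Ls"
      obtain W u v where xx: "x = (W, u, v)" by (cases x) auto
      show "(\<lambda>w. case x of (W, u, v) \<Rightarrow> if u \<le> \<tau> j \<and> \<tau> j < v then W w else 0) \<in> bL0 (\<tau> j)"
      proof (cases "u \<le> \<tau> j \<and> \<tau> j < v")
        case True
        have "W \<in> bL0 u" using x Ls unfolding xx elem_def by auto
        then show ?thesis using True bL0_mono[of W u "\<tau> j"] by (simp add: xx)
      next
        case False show ?thesis unfolding xx prod.case if_not_P[OF False] by (rule bL0_const[OF \<tau>j0])
      qed
    qed
    then show "Z j \<in> bL0 (\<tau> j)" by (simp add: Z_def[abs_def])
  next
    fix A n w
    show "eint A Ls n w = (\<Sum>j<N. Z j w * (A (\<tau> (Suc j)) n w - A (\<tau> j) n w))"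
      unfolding eint_def by (rule key)
  next
    fix t w
    have "eproc Ls t w = (\<Sum>(W, u, v)\<leftarrow>Ls. W w * ((- of_bool (v \<le> t)) - (- of_bool (u \<le> t))))"
    proof -
      have "eproc Ks t w = (\<Sum>(W, u, v)\<leftarrow>Ks. W w * ((- of_bool (v \<le> t)) - (- of_bool (u \<le> t))))" if "set Ks \<subseteq> set Ls" for Ks
        using that
      proof (induction Ks)
        case (Cons k Ks)
        obtain W u v where k: "k = (W, u, v)" by (cases k) auto
        have "u \<le> v" using Cons.prems Ls unfolding k elem_def by auto
        then show ?case using Cons by (auto simp: k eproc_Cons indicator_def)
      qed simp
      then show ?thesis by blast
    qed
    also have "\<dots> = (\<Sum>j<N. Z j w * ((- of_bool (\<tau> (Suc j) \<le> t)) - (- of_bool (\<tau> j \<le> t))))" by (rule key)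
    also have "\<dots> = (\<Sum>j<N. Z j w * indicator {\<tau> j..<\<tau> (Suc j)} t)"
    proof (rule sum.cong[OF refl])
      fix j assume "j \<in> {..<N}"
      then have "\<tau> j < \<tau> (Suc j)" using mono by auto
      then show "Z j w * ((- of_bool (\<tau> (Suc j) \<le> t)) - (- of_bool (\<tau> j \<le> t))) = Z j w * indicator {\<tau> j..<\<tau> (Suc j)} t"
        by (auto simp: indicator_def)
    qed
    finally show "eproc Ls t w = (\<Sum>j<N. Z j w * indicator {\<tau> j..<\<tau> (Suc j)} t)" .
  qed
qed

lemma partition_sum_cases:
  assumes "is_partition T N \<tau>"
  shows "(\<forall>f :: nat \<Rightarrow> real. (\<Sum>j<N. f j * indicator {\<tau> j..<\<tau> (Suc j)} t) = 0) \<or>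
    (\<exists>k<N. \<tau> k \<le> t \<and> t < \<tau> (Suc k) \<and> (\<forall>f :: nat \<Rightarrow> real. (\<Sum>j<N. f j * indicator {\<tau> j..<\<tau> (Suc j)} t) = f k))"
proof (cases "\<exists>k<N. t \<in> {\<tau> k..<\<tau> (Suc k)}")
  case True
  then obtain k where k: "k < N" "t \<in> {\<tau> k..<\<tau> (Suc k)}" by blast
  have other: "t \<notin> {\<tau> j..<\<tau> (Suc j)}" if "j < N" "j \<noteq> k" for j
  proof (cases "j < k")
    case True
    then have "\<tau> (Suc j) \<le> \<tau> k" using is_partition_mono[OF assms, of "Suc j" k] k by (cases "Suc j = k") auto
    then show ?thesis using k by auto
  next
    case False
    then have "\<tau> (Suc k) \<le> \<tau> j" using is_partition_mono[OF assms, of "Suc k" j] that by (cases "Suc k = j") auto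
    then show ?thesis using k by auto
  qed
  have "(\<Sum>j<N. f j * indicator {\<tau> j..<\<tau> (Suc j)} t) = f k" for f :: "nat \<Rightarrow> real"
  proof -
    have "(\<Sum>j<N. f j * indicator {\<tau> j..<\<tau> (Suc j)} t) = (\<Sum>j<N. if j = k then f k else 0)"
      by (rule sum.cong) (use k other in auto)
    then show ?thesis using k by simp
  qed
  then show ?thesis using k by auto
qed (auto intro!: sum.neutral simp: indicator_def)

lemma has_integral_scaled_indicator:
  fixes a b T c :: real assumes "0 \<le> a" "a \<le> b" "b \<le> T"
  shows "((\<lambda>t. c * indicator {a..<b} t) has_integral c * (b - a)) {0..T}"
proof -
  have sub: "{a..b} \<subseteq> {0..T}" using assms by auto
  have "((\<lambda>_. c) has_integral c * (b - a)) {a..b}" using has_integral_const_real[of c a b] assms by (simp add: mult.commute)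
  then have "((\<lambda>t. if t \<in> {a..b} then c else 0) has_integral c * (b - a)) {0..T}" by (simp only: has_integral_restrict[OF sub])
  then show ?thesis by (rule has_integral_spike_finite[of "{b}", rotated -1]) (auto simp: indicator_def)
qed

section \<open>Processes approximable by elementary processes\<close>

context G_Brownian_expectation
begin

text \<open>
  The second-order elements known at time \<open>u\<close>: limits of bounded cylinder functions up to \<open>u\<close>.
  In contrast to a Cauchy sequence in \<open>L0ip_upto u\<close>, this does not depend on the representative.
\<close>

definition adapted :: "real \<Rightarrow> rv set" where
  "adapted u = {X \<in> V2. \<forall>e>0. \<exists>Z\<in>bL0 u. d2 X (\<lambda>_. Z) < e}"

text \<open>
  The space \<open>MG E 2 T\<close> in terms of bounded elementary processes and of upper integrals; the two
  agree by \<open>MG_iff_MG2\<close>.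
\<close>

definition MG2 :: "real \<Rightarrow> (real \<Rightarrow> rv) set" where
  "MG2 T = {\<eta>. (\<forall>t\<in>{0..T}. \<eta> t \<in> V2) \<and>
     (\<forall>e>0. \<exists>Ls. elem T Ls \<and> upper_less T (\<lambda>t. (d2 (\<eta> t) (\<lambda>_. eproc Ls t))\<^sup>2) e)}"

lemma V_const: "Z \<in> L0ip \<Longrightarrow> (\<lambda>_. Z) \<in> V2"
  by (rule two.cseq_const)

lemma V_zero: "(\<lambda>n w. 0) \<in> V2"
  by (intro V_const L0_intros)

lemmas V_intros = V_zero two.cseq_add two.cseq_diff two.cseq_scale

lemma d2_add_le:
  assumes "X \<in> V2" "Y \<in> V2" "X' \<in> V2" "Y' \<in> V2"
  shows "d2 (\<lambda>n w. X n w + Y n w) (\<lambda>n w. X' n w + Y' n w) \<le> d2 X X' + d2 Y Y'"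
  using two.cdist_dominated[of "\<lambda>n w. X n w + Y n w" "\<lambda>n w. X' n w + Y' n w" X X' Y Y' 1 1] assms
  by (simp add: V_intros)

lemma d2_scale:
  assumes "X \<in> V2" "Y \<in> V2" shows "d2 (\<lambda>n w. c * X n w) (\<lambda>n w. c * Y n w) \<le> \<bar>c\<bar> * d2 X Y"
  by (rule two.cdist_mono) (use assms in \<open>auto intro: V_intros simp: abs_mult simp flip: right_diff_distrib\<close>)

lemma sum_square_le: "(a + b)\<^sup>2 \<le> 2 * a\<^sup>2 + 2 * (b::real)\<^sup>2"
proof -
  have "0 \<le> (a - b)\<^sup>2" by simp
  then show ?thesis by (simp add: power2_eq_square algebra_simps)
qed

lemma d2_triangle_square:
  assumes "X \<in> V2" "Y \<in> V2" "Z \<in> V2" shows "(d2 X Z)\<^sup>2 \<le> 2 * (d2 X Y)\<^sup>2 + 2 * (d2 Y Z)\<^sup>2"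
proof -
  have "(d2 X Z)\<^sup>2 \<le> (d2 X Y + d2 Y Z)\<^sup>2"
    by (intro power_mono two.cdist_triangle two.cdist_nonneg assms)
  then show ?thesis using sum_square_le[of "d2 X Y" "d2 Y Z"] by linarith
qed

lemma d2_eq_0_cong:
  assumes "X \<in> V2" "Y \<in> V2" "Z \<in> V2" "d2 X Y = 0" shows "d2 X Z = d2 Y Z"
  using two.cdist_triangle[of X Y Z] two.cdist_triangle[of Y X Z] two.cdist_commute[of X Y] assms by auto

lemma adaptedD: "X \<in> adapted u \<Longrightarrow> X \<in> V2" "X \<in> adapted u \<Longrightarrow> 0 < e \<Longrightarrow> \<exists>Z\<in>bL0 u. d2 X (\<lambda>_. Z) < e"
  by (auto simp: adapted_def)

lemma adapted_time_nonneg: "X \<in> adapted u \<Longrightarrow> 0 \<le> u"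
  using adaptedD(2)[of X u 1] bL0_time_nonneg by auto

lemma adapted_mono: "X \<in> adapted u \<Longrightarrow> u \<le> v \<Longrightarrow> X \<in> adapted v"
  unfolding adapted_def using bL0_mono by blast

lemma adapted_bL0: "Z \<in> bL0 u \<Longrightarrow> (\<lambda>_. Z) \<in> adapted u"
  unfolding adapted_def using V_const[OF bL0_L0ip] by (auto simp: two.cdist_self intro!: bexI[of _ Z])

lemma adapted_limit:
  assumes "X \<in> V2" "\<And>e. 0 < e \<Longrightarrow> \<exists>Y\<in>adapted u. d2 X Y < e" shows "X \<in> adapted u"
  unfolding adapted_def
proof (intro CollectI conjI allI impI assms(1))
  fix e :: real assume "0 < e"
  then obtain Y where Y: "Y \<in> adapted u" "d2 X Y < e/2" using assms(2)[of "e/2"] by auto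
  obtain Z where Z: "Z \<in> bL0 u" "d2 Y (\<lambda>_. Z) < e/2" using adaptedD(2)[OF Y(1), of "e/2"] \<open>0 < e\<close> by auto
  have "d2 X (\<lambda>_. Z) < e" using two.cdist_triangle[OF assms(1) adaptedD(1)[OF Y(1)] V_const[OF bL0_L0ip[OF Z(1)]]] Y Z by linarith
  then show "\<exists>Z\<in>bL0 u. d2 X (\<lambda>_. Z) < e" using Z by blast
qed

lemma adapted_add:
  assumes X: "X \<in> adapted u" and Y: "Y \<in> adapted u" shows "(\<lambda>n w. X n w + Y n w) \<in> adapted u"
  unfolding adapted_def
proof (intro CollectI conjI allI impI V_intros adaptedD(1)[OF X] adaptedD(1)[OF Y])
  fix e :: real assume e: "0 < e"
  obtain Z where Z: "Z \<in> bL0 u" "d2 X (\<lambda>_. Z) < e/2" using adaptedD(2)[OF X, of "e/2"] e by auto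
  obtain W where W: "W \<in> bL0 u" "d2 Y (\<lambda>_. W) < e/2" using adaptedD(2)[OF Y, of "e/2"] e by auto
  have "d2 (\<lambda>n w. X n w + Y n w) (\<lambda>_ w. Z w + W w) < e"
    using d2_add_le[OF adaptedD(1)[OF X] adaptedD(1)[OF Y] V_const[OF bL0_L0ip[OF Z(1)]] V_const[OF bL0_L0ip[OF W(1)]]] Z W by linarith
  then show "\<exists>Z\<in>bL0 u. d2 (\<lambda>n w. X n w + Y n w) (\<lambda>_. Z) < e" using bL0_add[OF Z(1) W(1)] by blast
qed

lemma d2_bmult:
  assumes Z: "Z \<in> L0ip" "\<And>w. \<bar>Z w\<bar> \<le> M" and X: "X \<in> V2" "Y \<in> V2"
  shows "d2 (\<lambda>n w. Z w * X n w) (\<lambda>n w. Z w * Y n w) \<le> M * d2 X Y"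
proof (rule two.cdist_mono)
  show "0 \<le> M" using Z(2)[of undefined] by linarith
  fix n w
  have "\<bar>Z w * X n w - Z w * Y n w\<bar> = \<bar>Z w\<bar> * \<bar>X n w - Y n w\<bar>" by (simp add: abs_mult flip: right_diff_distrib)
  also have "\<dots> \<le> M * \<bar>X n w - Y n w\<bar>" by (intro mult_right_mono Z) auto
  finally show "\<bar>Z w * X n w - Z w * Y n w\<bar> \<le> M * \<bar>X n w - Y n w\<bar>" .
qed (intro X two.cseq_bmult[OF Z])+

lemma adapted_bmult:
  assumes W: "W \<in> bL0 u" and X: "X \<in> adapted u" shows "(\<lambda>n w. W w * X n w) \<in> adapted u"
proof -
  obtain M where M: "0 < M" "\<And>w. \<bar>W w\<bar> \<le> M" by (rule bL0_bounded[OF W]) blast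
  note XV = adaptedD(1)[OF X]
  show ?thesis
    unfolding adapted_def
  proof (intro CollectI conjI allI impI)
    show "(\<lambda>n w. W w * X n w) \<in> V2" by (rule two.cseq_bmult[OF bL0_L0ip[OF W] M(2) XV])
    fix e :: real assume e: "0 < e"
    obtain Z where Z: "Z \<in> bL0 u" "d2 X (\<lambda>_. Z) < e / M" using adaptedD(2)[OF X, of "e/M"] e M by auto
    have "d2 (\<lambda>n w. W w * X n w) (\<lambda>n w. W w * Z w) \<le> M * d2 X (\<lambda>_. Z)"
      by (rule d2_bmult[OF bL0_L0ip[OF W] M(2) XV V_const[OF bL0_L0ip[OF Z(1)]]])
    also have "\<dots> < e" using Z(2) M by (simp add: field_simps)
    finally show "\<exists>Z\<in>bL0 u. d2 (\<lambda>n w. W w * X n w) (\<lambda>_. Z) < e" using bL0_mult[OF W Z(1)] by blast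
  qed
qed

lemma adapted_const: "0 \<le> u \<Longrightarrow> (\<lambda>n w. c) \<in> adapted u"
  by (rule adapted_bL0[OF bL0_const])

lemma adapted_scale: assumes "X \<in> adapted u" shows "(\<lambda>n w. c * X n w) \<in> adapted u"
  by (rule adapted_bmult[OF bL0_const assms]) (rule adapted_time_nonneg[OF assms])

lemma adapted_diff: "X \<in> adapted u \<Longrightarrow> Y \<in> adapted u \<Longrightarrow> (\<lambda>n w. X n w - Y n w) \<in> adapted u"
  using adapted_add[of X u "\<lambda>n w. (-1) * Y n w"] adapted_scale[of Y u "-1"] by simp

lemma bL0_truncation:
  assumes Z: "Z \<in> L0ip_upto u" and e: "0 < e"
  shows "\<exists>R>0. (\<lambda>w. max (-R) (min R (Z w))) \<in> bL0 u \<and> n2 (\<lambda>w. Z w - max (-R) (min R (Z w))) < e"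
proof -
  have ZL: "Z \<in> L0ip" using Z L0ip_upto_subset by blast
  define Q where "Q = n2 (\<lambda>w. (Z w)\<^sup>2)"
  have Q: "0 \<le> Q" unfolding Q_def by (intro n2_nonneg L0_intros ZL)
  define R where "R = (Q + 1) / e"
  have R: "0 < R" using Q e by (simp add: R_def)
  have "Q / R < e" using Q e by (simp add: R_def field_simps)
  then have "n2 (\<lambda>w. Z w - max (-R) (min R (Z w))) < e" using truncate(1)[OF ZL R] by (simp add: Q_def)
  moreover have "(\<lambda>w. max (-R) (min R (Z w))) \<in> bL0 u" unfolding bL0_def
    using stable_apply[OF stable_L0ip_upto[OF L0ip_upto_time_nonneg[OF Z]] Z truncate(2)[OF ZL R]] R
    by (auto intro!: exI[of _ R])
  ultimately show ?thesis using R by blast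
qed

lemma adapted_L0ip_upto: assumes Z: "Z \<in> L0ip_upto u" shows "(\<lambda>_. Z) \<in> adapted u"
  unfolding adapted_def
proof (intro CollectI conjI allI impI)
  show "(\<lambda>_. Z) \<in> V2" using Z L0ip_upto_subset by (intro V_const) blast
  fix e :: real assume e: "0 < e"
  show "\<exists>W\<in>bL0 u. d2 (\<lambda>_. Z) (\<lambda>_. W) < e" using bL0_truncation[OF Z e] by (auto simp: two.cdist_const)
qed

lemma adapted_cseq: assumes X: "X \<in> cseq n2 (L0ip_upto u)" shows "X \<in> adapted u"
proof (rule adapted_limit)
  show XV: "X \<in> V2" using X two.cseq_mono[OF L0ip_upto_subset] by blast
  fix e :: real assume "0 < e"
  then obtain n where "d2 X (\<lambda>_. X n) < e" using two.cdist_approx[OF XV] by blast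
  then show "\<exists>Y\<in>adapted u. d2 X Y < e" using adapted_L0ip_upto[OF two.cseqD(1)[OF X]] by blast
qed

lemma MG2D: "\<eta> \<in> MG2 T \<Longrightarrow> t \<in> {0..T} \<Longrightarrow> \<eta> t \<in> V2"
  "\<eta> \<in> MG2 T \<Longrightarrow> 0 < e \<Longrightarrow> \<exists>Ls. elem T Ls \<and> upper_less T (\<lambda>t. (d2 (\<eta> t) (\<lambda>_. eproc Ls t))\<^sup>2) e"
  by (auto simp: MG2_def)

lemma eproc_V: "elem T Ls \<Longrightarrow> t \<in> {0..T} \<Longrightarrow> (\<lambda>_. eproc Ls t) \<in> V2"
  by (intro V_const eproc_L0ip[of T]) auto

lemma MG2_elem: "elem T Ls \<Longrightarrow> 0 \<le> T \<Longrightarrow> (\<lambda>t _. eproc Ls t) \<in> MG2 T"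
  unfolding MG2_def using eproc_V by (auto simp: two.cdist_self intro!: exI[of _ Ls] upper_less_const[of _ _ 0])

lemma MG2_limit:
  assumes V2: "\<And>t. t \<in> {0..T} \<Longrightarrow> \<eta> t \<in> V2"
    and ex: "\<And>e. 0 < e \<Longrightarrow> \<exists>\<zeta>\<in>MG2 T. upper_less T (\<lambda>t. (d2 (\<eta> t) (\<zeta> t))\<^sup>2) e"
  shows "\<eta> \<in> MG2 T"
  unfolding MG2_def
proof (intro CollectI conjI ballI allI impI V2)
  fix e :: real assume e: "0 < e"
  obtain \<zeta> where \<zeta>: "\<zeta> \<in> MG2 T" "upper_less T (\<lambda>t. (d2 (\<eta> t) (\<zeta> t))\<^sup>2) (e/4)" using ex[of "e/4"] e by auto
  obtain Ls where Ls: "elem T Ls" "upper_less T (\<lambda>t. (d2 (\<zeta> t) (\<lambda>_. eproc Ls t))\<^sup>2) (e/4)" using MG2D(2)[OF \<zeta>(1), of "e/4"] e by auto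
  have "upper_less T (\<lambda>t. (d2 (\<eta> t) (\<lambda>_. eproc Ls t))\<^sup>2) (2 * (e/4) + 2 * (e/4))"
    by (rule upper_less_lin[OF \<zeta>(2) Ls(2)]) (auto intro!: d2_triangle_square V2 MG2D(1)[OF \<zeta>(1)] eproc_V[OF Ls(1)])
  then show "\<exists>Ls. elem T Ls \<and> upper_less T (\<lambda>t. (d2 (\<eta> t) (\<lambda>_. eproc Ls t))\<^sup>2) e" using Ls(1) by auto
qed auto

lemma approx_add:
  assumes V2: "\<And>t. t \<in> {0..T} \<Longrightarrow> \<eta> t \<in> V2" "\<And>t. t \<in> {0..T} \<Longrightarrow> \<zeta> t \<in> V2"
    and Ls: "elem T Ls" "upper_less T (\<lambda>t. (d2 (\<eta> t) (\<lambda>_. eproc Ls t))\<^sup>2) d"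
    and Ls': "elem T Ls'" "upper_less T (\<lambda>t. (d2 (\<zeta> t) (\<lambda>_. eproc Ls' t))\<^sup>2) d'"
  shows "upper_less T (\<lambda>t. (d2 (\<lambda>n w. \<eta> t n w + \<zeta> t n w) (\<lambda>_. eproc (Ls @ Ls') t))\<^sup>2) (2 * d + 2 * d')"
proof (rule upper_less_lin[OF Ls(2) Ls'(2)])
  fix t assume t: "t \<in> {0..T}"
  note v = V2[OF t] eproc_V[OF Ls(1) t] eproc_V[OF Ls'(1) t]
  have eq: "(\<lambda>_::nat. eproc (Ls @ Ls') t) = (\<lambda>n w. eproc Ls t w + eproc Ls' t w)" by (intro ext) simp
  have "(d2 (\<lambda>n w. \<eta> t n w + \<zeta> t n w) (\<lambda>n w. eproc Ls t w + eproc Ls' t w))\<^sup>2 \<le> (d2 (\<eta> t) (\<lambda>_. eproc Ls t) + d2 (\<zeta> t) (\<lambda>_. eproc Ls' t))\<^sup>2"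
    by (intro power_mono d2_add_le two.cdist_nonneg V_intros v)
  then show "(d2 (\<lambda>n w. \<eta> t n w + \<zeta> t n w) (\<lambda>_. eproc (Ls @ Ls') t))\<^sup>2 \<le> 2 * (d2 (\<eta> t) (\<lambda>_. eproc Ls t))\<^sup>2 + 2 * (d2 (\<zeta> t) (\<lambda>_. eproc Ls' t))\<^sup>2"
    unfolding eq using sum_square_le order_trans by blast
qed auto

lemma approx_scale:
  assumes V2: "\<And>t. t \<in> {0..T} \<Longrightarrow> \<eta> t \<in> V2"
    and Ls: "elem T Ls" "upper_less T (\<lambda>t. (d2 (\<eta> t) (\<lambda>_. eproc Ls t))\<^sup>2) d" and k: "c\<^sup>2 < k"
  shows "upper_less T (\<lambda>t. (d2 (\<lambda>n w. c * \<eta> t n w) (\<lambda>_. eproc (escale c Ls) t))\<^sup>2) (k * d)"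
proof -
  have k0: "0 < k" using k zero_le_power2[of c] by linarith
  have "upper_less T (\<lambda>t. (d2 (\<lambda>n w. c * \<eta> t n w) (\<lambda>_. eproc (escale c Ls) t))\<^sup>2) (k * d + 0 * d)"
  proof (rule upper_less_lin[OF Ls(2) Ls(2) k0 order_refl])
    fix t assume t: "t \<in> {0..T}"
    note v = V2[OF t] eproc_V[OF Ls(1) t]
    have eq: "(\<lambda>_::nat. eproc (escale c Ls) t) = (\<lambda>n w. c * eproc Ls t w)" by (intro ext) simp
    have "(d2 (\<lambda>n w. c * \<eta> t n w) (\<lambda>n w. c * eproc Ls t w))\<^sup>2 \<le> (\<bar>c\<bar> * d2 (\<eta> t) (\<lambda>_. eproc Ls t))\<^sup>2"
      by (intro power_mono d2_scale two.cdist_nonneg V_intros v)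
    also have "\<dots> \<le> k * (d2 (\<eta> t) (\<lambda>_. eproc Ls t))\<^sup>2" using k by (simp add: power_mult_distrib mult_right_mono)
    finally show "(d2 (\<lambda>n w. c * \<eta> t n w) (\<lambda>_. eproc (escale c Ls) t))\<^sup>2 \<le> k * (d2 (\<eta> t) (\<lambda>_. eproc Ls t))\<^sup>2 + 0 * (d2 (\<eta> t) (\<lambda>_. eproc Ls t))\<^sup>2"
      unfolding eq by simp
  qed
  then show ?thesis by simp
qed

lemma MG2_add:
  assumes X: "\<eta> \<in> MG2 T" and Y: "\<zeta> \<in> MG2 T" shows "(\<lambda>t n w. \<eta> t n w + \<zeta> t n w) \<in> MG2 T"
  unfolding MG2_def
proof (intro CollectI conjI ballI allI impI)
  show "(\<lambda>n w. \<eta> t n w + \<zeta> t n w) \<in> V2" if "t \<in> {0..T}" for t by (intro V_intros MG2D(1)[OF X that] MG2D(1)[OF Y that])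
  fix e :: real assume e: "0 < e"
  obtain Ls where Ls: "elem T Ls" "upper_less T (\<lambda>t. (d2 (\<eta> t) (\<lambda>_. eproc Ls t))\<^sup>2) (e/4)" using MG2D(2)[OF X, of "e/4"] e by auto
  obtain Ls' where Ls': "elem T Ls'" "upper_less T (\<lambda>t. (d2 (\<zeta> t) (\<lambda>_. eproc Ls' t))\<^sup>2) (e/4)" using MG2D(2)[OF Y, of "e/4"] e by auto
  have "upper_less T (\<lambda>t. (d2 (\<lambda>n w. \<eta> t n w + \<zeta> t n w) (\<lambda>_. eproc (Ls @ Ls') t))\<^sup>2) e"
    using approx_add[OF MG2D(1)[OF X] MG2D(1)[OF Y] Ls Ls'] by simp
  then show "\<exists>Ls. elem T Ls \<and> upper_less T (\<lambda>t. (d2 (\<lambda>n w. \<eta> t n w + \<zeta> t n w) (\<lambda>_. eproc Ls t))\<^sup>2) e"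
    using Ls(1) Ls'(1) by (intro exI[of _ "Ls @ Ls'"]) auto
qed

lemma MG2_scale:
  assumes X: "\<eta> \<in> MG2 T" shows "(\<lambda>t n w. c * \<eta> t n w) \<in> MG2 T"
  unfolding MG2_def
proof (intro CollectI conjI ballI allI impI)
  show "(\<lambda>n w. c * \<eta> t n w) \<in> V2" if "t \<in> {0..T}" for t by (intro V_intros MG2D(1)[OF X that])
  fix e :: real assume e: "0 < e"
  have c: "c\<^sup>2 + 1 > 0" by (simp add: add_nonneg_pos)
  obtain Ls where Ls: "elem T Ls" "upper_less T (\<lambda>t. (d2 (\<eta> t) (\<lambda>_. eproc Ls t))\<^sup>2) (e/(c\<^sup>2+1))"
    using MG2D(2)[OF X, of "e/(c\<^sup>2+1)"] e c by auto
  have "upper_less T (\<lambda>t. (d2 (\<lambda>n w. c * \<eta> t n w) (\<lambda>_. eproc (escale c Ls) t))\<^sup>2) e"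
    using approx_scale[OF MG2D(1)[OF X] Ls, of c "c\<^sup>2 + 1"] c by simp
  then show "\<exists>Ls. elem T Ls \<and> upper_less T (\<lambda>t. (d2 (\<lambda>n w. c * \<eta> t n w) (\<lambda>_. eproc Ls t))\<^sup>2) e"
    using elem_scale[OF Ls(1)] c by (intro exI[of _ "escale c Ls"]) auto
qed

lemma MG2_diff:
  assumes X: "\<eta> \<in> MG2 T" and Y: "\<zeta> \<in> MG2 T" shows "(\<lambda>t n w. \<eta> t n w - \<zeta> t n w) \<in> MG2 T"
  using MG2_add[OF X MG2_scale[OF Y, of "-1"]] by simp

lemma MG2_zero: "0 \<le> T \<Longrightarrow> (\<lambda>t n w. 0) \<in> MG2 T"
  using MG2_elem[of T "[]"] by (simp add: eproc_def[abs_def])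

lemma MG2_sum: "(\<And>i. i \<in> K \<Longrightarrow> \<eta> i \<in> MG2 T) \<Longrightarrow> 0 \<le> T \<Longrightarrow> (\<lambda>t n w. \<Sum>i\<in>K. \<eta> i t n w) \<in> MG2 T"
  by (induction K rule: infinite_finite_induct) (auto intro: MG2_zero MG2_add)

lemma MG2_spike:
  assumes X: "\<eta> \<in> MG2 T" and N: "negligible N" and V2: "\<And>t. t \<in> {0..T} \<Longrightarrow> \<zeta> t \<in> V2"
    and eq: "\<And>t. t \<in> {0..T} - N \<Longrightarrow> d2 (\<zeta> t) (\<eta> t) = 0" and T: "0 \<le> T"
  shows "\<zeta> \<in> MG2 T"
proof (rule MG2_limit[OF V2])
  fix e :: real assume e: "0 < e"
  have "upper_less T (\<lambda>t. 0) e" using e T by (intro upper_less_const[of _ _ 0]) auto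
  then have "upper_less T (\<lambda>t. (d2 (\<zeta> t) (\<eta> t))\<^sup>2) e" by (rule upper_less_spike[OF _ N]) (simp add: eq)
  then show "\<exists>\<eta>\<in>MG2 T. upper_less T (\<lambda>t. (d2 (\<zeta> t) (\<eta> t))\<^sup>2) e" using X by blast
qed

lemma MG2_restrict:
  assumes X: "\<eta> \<in> MG2 T" and s: "0 \<le> s" "s \<le> T" shows "\<eta> \<in> MG2 s"
  unfolding MG2_def
proof (intro CollectI conjI ballI allI impI)
  show "\<eta> t \<in> V2" if "t \<in> {0..s}" for t using MG2D(1)[OF X] that s by auto
  fix e :: real assume e: "0 < e"
  obtain Ls where Ls: "elem T Ls" "upper_less T (\<lambda>t. (d2 (\<eta> t) (\<lambda>_. eproc Ls t))\<^sup>2) e" using MG2D(2)[OF X e] by auto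
  have "upper_less s (\<lambda>t. (d2 (\<eta> t) (\<lambda>_. eproc (ecut s Ls) t))\<^sup>2) e"
  proof (rule upper_less_spike)
    show "upper_less s (\<lambda>t. (d2 (\<eta> t) (\<lambda>_. eproc Ls t))\<^sup>2) e" by (rule upper_less_subinterval[OF Ls(2) s(2)]) simp
    show "negligible {s}" by simp
    show "(d2 (\<eta> t) (\<lambda>_. eproc (ecut s Ls) t))\<^sup>2 \<le> (d2 (\<eta> t) (\<lambda>_. eproc Ls t))\<^sup>2" if "t \<in> {0..s} - {s}" for t
    proof -
      have "eproc (ecut s Ls) t = eproc Ls t" using that by (intro ext) (auto simp: eproc_cut indicator_def)
      then show ?thesis by simp
    qed
  qed
  then show "\<exists>Ls. elem s Ls \<and> upper_less s (\<lambda>t. (d2 (\<eta> t) (\<lambda>_. eproc Ls t))\<^sup>2) e" using elem_cut[OF Ls(1)] by blast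
qed

lemma cut_V: "X \<in> V2 \<Longrightarrow> (\<lambda>n w. X n w * indicator S (t::real)) \<in> V2"
  using two.cseq_scale[of X "indicator S t"] by (simp add: mult.commute)

lemma eproc_norm_has_integral:
  assumes T: "0 \<le> T" and part: "is_partition T N \<tau>"
    and eproc: "\<And>t w. eproc Ls t w = (\<Sum>j<N. Z j w * indicator {\<tau> j..<\<tau> (Suc j)} t)"
  shows "((\<lambda>t. (n2 (eproc Ls t))\<^sup>2) has_integral (\<Sum>j<N. (n2 (Z j))\<^sup>2 * (\<tau> (Suc j) - \<tau> j))) {0..T}"
proof -
  have "(n2 (eproc Ls t))\<^sup>2 = (\<Sum>j<N. (n2 (Z j))\<^sup>2 * indicator {\<tau> j..<\<tau> (Suc j)} t)" for t
    using partition_sum_cases[OF part, of t]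
  proof
    assume 0: "\<forall>f :: nat \<Rightarrow> real. (\<Sum>j<N. f j * indicator {\<tau> j..<\<tau> (Suc j)} t) = 0"
    then have "eproc Ls t = (\<lambda>_. 0)" by (intro ext) (simp add: eproc)
    then show ?thesis using 0 by (simp add: n2_const)
  next
    assume "\<exists>k<N. \<tau> k \<le> t \<and> t < \<tau> (Suc k) \<and> (\<forall>f :: nat \<Rightarrow> real. (\<Sum>j<N. f j * indicator {\<tau> j..<\<tau> (Suc j)} t) = f k)"
    then obtain k where k: "\<And>f :: nat \<Rightarrow> real. (\<Sum>j<N. f j * indicator {\<tau> j..<\<tau> (Suc j)} t) = f k" by blast
    have "eproc Ls t = Z k" by (intro ext) (simp add: eproc k)
    then show ?thesis by (simp add: k)
  qed
  moreover have "((\<lambda>t. \<Sum>j<N. (n2 (Z j))\<^sup>2 * indicator {\<tau> j..<\<tau> (Suc j)} t) has_integral (\<Sum>j<N. (n2 (Z j))\<^sup>2 * (\<tau> (Suc j) - \<tau> j))) {0..T}"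
  proof (intro has_integral_sum has_integral_scaled_indicator)
    fix j assume "j \<in> {..<N}"
    then show "0 \<le> \<tau> j" "\<tau> j \<le> \<tau> (Suc j)" "\<tau> (Suc j) \<le> T"
      using is_partition_mono[OF part, of 0 j] is_partition_mono[OF part, of j "Suc j"] is_partition_mono[OF part, of "Suc j" N] part
      unfolding is_partition_def by (cases "j = 0"; cases "Suc j = N"; force)+
  qed simp
  ultimately show ?thesis by simp
qed

lemma eproc_norm_integrable:
  assumes "0 \<le> T" "elem T Ls" shows "(\<lambda>t. (n2 (eproc Ls t))\<^sup>2) integrable_on {0..T}"
proof -
  obtain N \<tau> Z where "is_partition T N \<tau>" "\<And>t w. eproc Ls t w = (\<Sum>j<N. Z j w * indicator {\<tau> j..<\<tau> (Suc j)} t)"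
    by (rule elem_partition[OF assms]) blast
  from eproc_norm_has_integral[OF assms(1) this] show ?thesis by blast
qed

lemma square_young:
  fixes a b e :: real assumes "0 < e" shows "(a + b)\<^sup>2 \<le> (1 + e) * a\<^sup>2 + (1 + 1 / e) * b\<^sup>2"
proof -
  have "0 \<le> (e * a - b)\<^sup>2 / e" using assms by simp
  also have "\<dots> = (1 + e) * a\<^sup>2 + (1 + 1 / e) * b\<^sup>2 - (a + b)\<^sup>2" using assms by (simp add: power2_eq_square field_simps)
  finally show ?thesis by simp
qed

text \<open>
  By Young's inequality the squared norm of the process lies between \<open>(1 - e)\<close> and \<open>(1 + e)\<close>
  times that of an elementary process, up to a large multiple of an integrable function of tiny
  integral. Such a squeeze yields integrability.
\<close>

lemma MG2_norm_integrable:
  assumes T: "0 \<le> T" and X: "\<eta> \<in> MG2 T" shows "(\<lambda>t. (d2 (\<eta> t) (\<lambda>_ _. 0))\<^sup>2) integrable_on {0..T}"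
proof (rule integrable_straddle)
  let ?f = "\<lambda>t. (d2 (\<eta> t) (\<lambda>_ _. 0))\<^sup>2"
  fix d :: real assume d: "0 < d"
  obtain L0 g0 where L0: "elem T L0" and g0: "g0 integrable_on {0..T}" "\<And>t. t \<in> {0..T} \<Longrightarrow> (d2 (\<eta> t) (\<lambda>_. eproc L0 t))\<^sup>2 \<le> g0 t"
    using MG2D(2)[OF X, of 1] by (auto simp: upper_less_def)
  have cmp: "?f t \<le> (1 + e) * (n2 (eproc Ls t))\<^sup>2 + (1 + 1/e) * (d2 (\<eta> t) (\<lambda>_. eproc Ls t))\<^sup>2"
     "(n2 (eproc Ls t))\<^sup>2 \<le> (1 + e) * ?f t + (1 + 1/e) * (d2 (\<eta> t) (\<lambda>_. eproc Ls t))\<^sup>2"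
    if e: "0 < e" and Ls: "elem T Ls" and t: "t \<in> {0..T}" for e Ls t
  proof -
    note v = MG2D(1)[OF X t] eproc_V[OF Ls t] V_zero
    have n: "n2 (eproc Ls t) = d2 (\<lambda>_. eproc Ls t) (\<lambda>_ _. 0)" by (simp add: two.cdist_const)
    have "?f t \<le> (n2 (eproc Ls t) + d2 (\<eta> t) (\<lambda>_. eproc Ls t))\<^sup>2"
      using two.cdist_triangle[OF v] two.cdist_nonneg[OF v(1,3)] by (intro power_mono) (auto simp: n)
    also have "\<dots> \<le> (1 + e) * (n2 (eproc Ls t))\<^sup>2 + (1 + 1/e) * (d2 (\<eta> t) (\<lambda>_. eproc Ls t))\<^sup>2" by (rule square_young[OF e])
    finally show "?f t \<le> (1 + e) * (n2 (eproc Ls t))\<^sup>2 + (1 + 1/e) * (d2 (\<eta> t) (\<lambda>_. eproc Ls t))\<^sup>2" .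
    have "(n2 (eproc Ls t))\<^sup>2 \<le> (d2 (\<eta> t) (\<lambda>_ _. 0) + d2 (\<eta> t) (\<lambda>_. eproc Ls t))\<^sup>2"
      using two.cdist_triangle[OF v(2,1,3)] two.cdist_nonneg[OF v(2,3)] two.cdist_commute[OF v(1,2)] by (intro power_mono) (auto simp: n)
    also have "\<dots> \<le> (1 + e) * ?f t + (1 + 1/e) * (d2 (\<eta> t) (\<lambda>_. eproc Ls t))\<^sup>2" by (rule square_young[OF e])
    finally show "(n2 (eproc Ls t))\<^sup>2 \<le> (1 + e) * ?f t + (1 + 1/e) * (d2 (\<eta> t) (\<lambda>_. eproc Ls t))\<^sup>2" .
  qed
  define F where "F t = 2 * (n2 (eproc L0 t))\<^sup>2 + 2 * g0 t" for t
  have F: "F integrable_on {0..T}" unfolding F_def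
    by (intro integrable_add integrable_on_mult_right eproc_norm_integrable T L0 g0(1))
  have fF: "?f t \<le> F t" if "t \<in> {0..T}" for t using cmp(1)[OF _ L0 that, of 1] g0(2)[OF that] by (simp add: F_def)
  define I where "I = integral {0..T} F"
  have I: "0 \<le> I" unfolding I_def using fF by (intro integral_nonneg F) (meson order_trans zero_le_power2)
  (* e is the relative error, r the tolerance for the elementary approximation; r is of order d *
     e because the error term enters with the factor 1 + 1/e. *)
  define e where "e = min 1 (d / (12 * (I + 1)))"
  have e: "0 < e" "e \<le> 1" using d I by (auto simp: e_def)
  have "e \<le> d / (12 * (I + 1))" by (simp add: e_def)
  then have e3: "e * (12 * (I + 1)) \<le> d" using I by (subst (asm) pos_le_divide_eq) auto
  define r where "r = min 1 (d * e / 12)"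
  have r: "0 < r" "r \<le> 1" "12 * r \<le> d * e" using d e by (auto simp: r_def)
  obtain Ls g where Ls: "elem T Ls" and g: "g integrable_on {0..T}" "\<And>t. t \<in> {0..T} \<Longrightarrow> (d2 (\<eta> t) (\<lambda>_. eproc Ls t))\<^sup>2 \<le> g t" "integral {0..T} g < r"
    using MG2D(2)[OF X r(1)] by (auto simp: upper_less_def)
  define n where "n t = (n2 (eproc Ls t))\<^sup>2" for t
  have ni: "n integrable_on {0..T}" unfolding n_def by (rule eproc_norm_integrable[OF T Ls])
  define J where "J = integral {0..T} n"
  define G where "G = integral {0..T} g"
  have g0': "0 \<le> g t" if "t \<in> {0..T}" for t using g(2)[OF that] order_trans[OF zero_le_power2] by blast
  have G: "0 \<le> G" "G < r" unfolding G_def using g(3) integral_nonneg[OF g(1) g0'] by auto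
  have J0: "0 \<le> J" unfolding J_def by (intro integral_nonneg ni) (simp add: n_def)
  have "J \<le> integral {0..T} (\<lambda>t. 2 * F t + 2 * g t)" unfolding J_def
  proof (intro integral_le ni integrable_add integrable_on_mult_right F g(1))
    fix t assume t: "t \<in> {0..T}"
    show "n t \<le> 2 * F t + 2 * g t" using cmp(2)[OF _ Ls t, of 1] fF[OF t] g(2)[OF t] by (simp add: n_def)
  qed
  also have "\<dots> = 2 * I + 2 * G" unfolding I_def G_def using F g(1) by (subst integral_add) (auto intro: integrable_on_mult_right)
  finally have J: "J \<le> 2 * I + 2" using G r by linarith
  let ?lo = "\<lambda>t. (1 - e) * n t - (1 / e) * g t" and ?hi = "\<lambda>t. (1 + e) * n t + (1 + 1/e) * g t"
  show "\<exists>l h i j. (l has_integral i) {0..T} \<and> (h has_integral j) {0..T} \<and> \<bar>i - j\<bar> < d \<and> (\<forall>x\<in>{0..T}. l x \<le> ?f x \<and> ?f x \<le> h x)"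
  proof (intro exI conjI ballI)
    show "(?lo has_integral (1 - e) * J - (1 / e) * G) {0..T}" unfolding J_def G_def
      by (intro has_integral_diff has_integral_mult_right integrable_integral ni g(1))
    show "(?hi has_integral (1 + e) * J + (1 + 1/e) * G) {0..T}" unfolding J_def G_def
      by (intro has_integral_add has_integral_mult_right integrable_integral ni g(1))
    have eq: "((1 - e) * J - (1 / e) * G) - ((1 + e) * J + (1 + 1/e) * G) = - (2 * e * J + (1 + 2/e) * G)"
      using e by (simp add: field_simps)
    have p: "0 \<le> 2 * e * J + (1 + 2/e) * G" using e J0 G by simp
    have "2 * e * J \<le> 2 * e * (2 * I + 2)" using J e by (intro mult_left_mono) auto
    also have "\<dots> \<le> d / 3" using e3 by (simp add: algebra_simps)
    finally have a: "2 * e * J \<le> d / 3" .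
    have "(1 + 2/e) * G \<le> (3 / e) * r" using e G by (intro mult_mono) (auto simp: field_simps)
    also have "\<dots> \<le> d / 4" using r(3) e by (simp add: field_simps)
    finally have b: "(1 + 2/e) * G \<le> d / 4" .
    show "\<bar>((1 - e) * J - (1 / e) * G) - ((1 + e) * J + (1 + 1/e) * G)\<bar> < d"
      unfolding eq using p a b d by linarith
  next
    fix t assume t: "t \<in> {0..T}"
    have "(1 + 1/e) * (d2 (\<eta> t) (\<lambda>_. eproc Ls t))\<^sup>2 \<le> (1 + 1/e) * g t" using e g(2)[OF t] by (intro mult_left_mono) auto
    then show "?f t \<le> ?hi t" using cmp(1)[OF e(1) Ls t] by (simp add: n_def)
    have "(1 + 1/e) * (d2 (\<eta> t) (\<lambda>_. eproc Ls t))\<^sup>2 \<le> (1 + 1/e) * g t" using e g(2)[OF t] by (intro mult_left_mono) auto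
    then have 1: "n t \<le> (1 + e) * ?f t + (1 + 1/e) * g t" using cmp(2)[OF e(1) Ls t] by (simp add: n_def)
    have n0: "0 \<le> n t" by (simp add: n_def)
    have "(1 - e) * n t \<le> n t / (1 + e)"
    proof -
      have "(1 - e) * (1 + e) * n t \<le> 1 * n t" using n0 by (intro mult_right_mono) (auto simp: algebra_simps)
      then show ?thesis using e by (simp add: field_simps)
    qed
    also have "\<dots> \<le> ?f t + (1 / e) * g t"
    proof -
      have "(1 + e) * (1 / e) = 1 + 1/e" using e by (simp add: field_simps)
      then have "(1 + e) * (?f t + (1 / e) * g t) = (1 + e) * ?f t + (1 + 1/e) * g t" by (metis distrib_left mult.assoc)
      then have "n t \<le> (1 + e) * (?f t + (1 / e) * g t)" using 1 by simp
      then show ?thesis using e by (simp add: pos_divide_le_eq mult.commute)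
    qed
    finally show "?lo t \<le> ?f t" by simp
  qed
qed

lemma d2_diff_zero: "d2 (\<lambda>n w. X n w - Y n w) (\<lambda>_ _. 0) = d2 X Y"
  by (simp add: cdist_def)

lemma MG2_dist_integrable:
  assumes "0 \<le> T" "\<eta> \<in> MG2 T" "\<zeta> \<in> MG2 T" shows "(\<lambda>t. (d2 (\<eta> t) (\<zeta> t))\<^sup>2) integrable_on {0..T}"
  using MG2_norm_integrable[OF assms(1) MG2_diff[OF assms(2,3)]] by (simp add: d2_diff_zero)

text \<open>
  The squared distances of \<open>\<eta> k\<close> and \<open>\<eta> l\<close> are integrable and dominated. Letting \<open>l\<close> tend to
  infinity makes the distances to \<open>\<zeta>\<close> integrable and dominated as well, and these tend to \<open>0\<close>.
\<close>

lemma MG2_dominated_convergence: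
  assumes T: "0 \<le> T" and X: "\<And>k::nat. \<eta> k \<in> MG2 T" and V2: "\<And>t. t \<in> {0..T} \<Longrightarrow> \<zeta> t \<in> V2"
    and conv: "\<And>t. t \<in> {0..T} \<Longrightarrow> (\<lambda>k. d2 (\<eta> k t) (\<zeta> t)) \<longlonglongrightarrow> 0"
    and G: "G integrable_on {0..T}" "\<And>k t. t \<in> {0..T} \<Longrightarrow> (d2 (\<eta> k t) (\<lambda>_ _. 0))\<^sup>2 \<le> G t"
  shows "\<zeta> \<in> MG2 T" "(\<lambda>k. integral {0..T} (\<lambda>t. (d2 (\<eta> k t) (\<zeta> t))\<^sup>2)) \<longlonglongrightarrow> 0"
proof -
  note XV = MG2D(1)[OF X]
  have b: "(d2 (\<eta> k t) (\<eta> l t))\<^sup>2 \<le> 4 * G t" if t: "t \<in> {0..T}" for k l t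
    using d2_triangle_square[OF XV[OF t, of k] V_zero XV[OF t, of l]] G(2)[OF t, of k] G(2)[OF t, of l]
      two.cdist_commute[OF V_zero XV[OF t, of l]] by simp
  have lim: "(\<lambda>l. d2 (\<eta> k t) (\<eta> l t)) \<longlonglongrightarrow> d2 (\<eta> k t) (\<zeta> t)" if t: "t \<in> {0..T}" for k t
  proof (rule LIM_zero_cancel, rule Lim_null_comparison[OF _ conv[OF t]])
    show "\<forall>\<^sub>F l in sequentially. norm (d2 (\<eta> k t) (\<eta> l t) - d2 (\<eta> k t) (\<zeta> t)) \<le> d2 (\<eta> l t) (\<zeta> t)"
      using two.cdist_triangle[OF XV[OF t, of k] XV[OF t] V2[OF t]] two.cdist_triangle[OF XV[OF t, of k] V2[OF t] XV[OF t]]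
        two.cdist_commute[OF V2[OF t] XV[OF t]] by (intro always_eventually allI) (auto simp: abs_le_iff algebra_simps)
  qed
  have lim2: "(\<lambda>l. (d2 (\<eta> k t) (\<eta> l t))\<^sup>2) \<longlonglongrightarrow> (d2 (\<eta> k t) (\<zeta> t))\<^sup>2" if "t \<in> {0..T}" for k t
    by (intro tendsto_power lim that)
  have G4: "(\<lambda>t. 4 * G t) integrable_on {0..T}" using G(1) by (intro integrable_on_mult_right)
  have fk: "(\<lambda>t. (d2 (\<eta> k t) (\<zeta> t))\<^sup>2) integrable_on {0..T}" for k
    by (rule dominated_convergence(1)[OF MG2_dist_integrable[OF T X[of k] X] G4 _ lim2]) (use b in auto)
  have bk: "(d2 (\<eta> k t) (\<zeta> t))\<^sup>2 \<le> 4 * G t" if t: "t \<in> {0..T}" for k t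
    by (rule LIMSEQ_le_const2[OF lim2[OF t]]) (use b[OF t] in auto)
  have "(\<lambda>k. integral {0..T} (\<lambda>t. (d2 (\<eta> k t) (\<zeta> t))\<^sup>2)) \<longlonglongrightarrow> integral {0..T} (\<lambda>t. 0\<^sup>2)"
    by (rule dominated_convergence(2)[OF fk G4]) (use bk in \<open>auto intro!: tendsto_power conv simp del: power_zero_numeral\<close>)
  then show lim0: "(\<lambda>k. integral {0..T} (\<lambda>t. (d2 (\<eta> k t) (\<zeta> t))\<^sup>2)) \<longlonglongrightarrow> 0" by simp
  show "\<zeta> \<in> MG2 T"
  proof (rule MG2_limit[OF V2])
    fix e :: real assume e: "0 < e"
    obtain k where k: "integral {0..T} (\<lambda>t. (d2 (\<eta> k t) (\<zeta> t))\<^sup>2) < e"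
      using eventually_happens[OF order_tendstoD(2)[OF lim0 e]] by auto
    show "\<exists>\<eta>\<in>MG2 T. upper_less T (\<lambda>t. (d2 (\<zeta> t) (\<eta> t))\<^sup>2) e"
      using upper_lessI[OF fk _ k, of "\<lambda>t. (d2 (\<zeta> t) (\<eta> k t))\<^sup>2"] two.cdist_commute[OF V2 XV[of _ k]] by (intro bexI[OF _ X[of k]]) auto
  qed
qed

section \<open>Integrators and their integrals\<close>

text \<open>
  The property that time, \<open>B\<close> and its quadratic variation have in common: a bound for the
  integrals of elementary processes by the time integral of the squared norm. All integrals of
  the equation are treated through it, without distinguishing the three.
\<close>

definition integrator :: "(real \<Rightarrow> rv) \<Rightarrow> real \<Rightarrow> real \<Rightarrow> bool" where
  "integrator A C T \<longleftrightarrow> 0 \<le> C \<and> (\<forall>t\<in>{0..T}. A t \<in> adapted t) \<and>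
     (\<forall>t N \<tau> Z. t \<le> T \<longrightarrow> is_partition t N \<tau> \<longrightarrow> (\<forall>j<N. Z j \<in> bL0 (\<tau> j)) \<longrightarrow>
       (d2 (\<lambda>n w. \<Sum>j<N. Z j w * (A (\<tau> (Suc j)) n w - A (\<tau> j) n w)) (\<lambda>_ _. 0))\<^sup>2
        \<le> C * (\<Sum>j<N. (n2 (Z j))\<^sup>2 * (\<tau> (Suc j) - \<tau> j)))"

text \<open>
  The integral as an element of the second-order completion. The graph of the elementary
  integral is closed up directly: elementary processes exist that are close to \<open>\<eta>\<close> while their
  integrals are close to \<open>I\<close>.
\<close>

definition has_int :: "(real \<Rightarrow> rv) \<Rightarrow> real \<Rightarrow> (real \<Rightarrow> rv) \<Rightarrow> rv \<Rightarrow> bool" where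
  "has_int A T \<eta> I \<longleftrightarrow> I \<in> adapted T \<and> (\<forall>t\<in>{0..T}. \<eta> t \<in> V2) \<and>
     (\<forall>e>0. \<exists>Ls. elem T Ls \<and> upper_less T (\<lambda>t. (d2 (\<eta> t) (\<lambda>_. eproc Ls t))\<^sup>2) e \<and> d2 I (eint A Ls) < e)"

lemma integrator_restrict: "integrator A C T \<Longrightarrow> s \<le> T \<Longrightarrow> integrator A C s"
  unfolding integrator_def by (meson atLeastAtMost_iff order_trans)

lemma integrator_estimate:
  "integrator A C T \<Longrightarrow> t \<le> T \<Longrightarrow> is_partition t N \<tau> \<Longrightarrow> (\<And>j. j < N \<Longrightarrow> Z j \<in> bL0 (\<tau> j)) \<Longrightarrow>
    (d2 (\<lambda>n w. \<Sum>j<N. Z j w * (A (\<tau> (Suc j)) n w - A (\<tau> j) n w)) (\<lambda>_ _. 0))\<^sup>2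
        \<le> C * (\<Sum>j<N. (n2 (Z j))\<^sup>2 * (\<tau> (Suc j) - \<tau> j))"
  unfolding integrator_def by simp

lemma integratorD: "integrator A C T \<Longrightarrow> 0 \<le> C" "integrator A C T \<Longrightarrow> t \<in> {0..T} \<Longrightarrow> A t \<in> adapted t"
  by (auto simp: integrator_def)

lemma eint_adapted:
  assumes A: "\<And>t. t \<in> {0..T} \<Longrightarrow> A t \<in> adapted t" and T: "0 \<le> T" and Ls: "elem T Ls" shows "eint A Ls \<in> adapted T"
  using Ls
proof (induction Ls)
  case Nil show ?case using adapted_const[OF T, of 0] by (simp add: eint_def[abs_def])
next
  case (Cons a Ls)
  obtain Z u v where a: "a = (Z, u, v)" by (cases a) auto
  have Z: "Z \<in> bL0 u" "u \<le> v" "v \<le> T" "0 \<le> u" using Cons.prems bL0_time_nonneg[of Z u] by (auto simp: a elem_Cons)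
  have "A v \<in> adapted T" "A u \<in> adapted T" using A[of v] A[of u] Z adapted_mono by auto
  then have "(\<lambda>n w. Z w * (A v n w - A u n w)) \<in> adapted T"
    using Z by (intro adapted_bmult adapted_diff bL0_mono[of Z u T]) auto
  moreover have "eint A Ls \<in> adapted T" using Cons by (simp add: a elem_Cons)
  ultimately show ?case unfolding a eint_Cons[abs_def] by (rule adapted_add)
qed

lemma eint_V: "integrator A C T \<Longrightarrow> 0 \<le> T \<Longrightarrow> elem T Ls \<Longrightarrow> eint A Ls \<in> V2"
  using eint_adapted[of T A Ls] integratorD(2) adaptedD(1) by blast

lemma eint_estimate:
  assumes A: "integrator A C T" and T: "0 \<le> T" and Ls: "elem T Ls"
  shows "(d2 (eint A Ls) (\<lambda>_ _. 0))\<^sup>2 \<le> C * integral {0..T} (\<lambda>t. (n2 (eproc Ls t))\<^sup>2)"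
proof -
  obtain N \<tau> Z where p: "is_partition T N \<tau>" "\<And>j. j < N \<Longrightarrow> Z j \<in> bL0 (\<tau> j)"
    and e: "\<And>t w. eproc Ls t w = (\<Sum>j<N. Z j w * indicator {\<tau> j..<\<tau> (Suc j)} t)"
    and i: "\<And>A n w. eint A Ls n w = (\<Sum>j<N. Z j w * (A (\<tau> (Suc j)) n w - A (\<tau> j) n w))"
    by (rule elem_partition[OF T Ls]) blast
  have "eint A Ls = (\<lambda>n w. \<Sum>j<N. Z j w * (A (\<tau> (Suc j)) n w - A (\<tau> j) n w))" using i by (intro ext)
  then have "(d2 (eint A Ls) (\<lambda>_ _. 0))\<^sup>2 \<le> C * (\<Sum>j<N. (n2 (Z j))\<^sup>2 * (\<tau> (Suc j) - \<tau> j))"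
    using integrator_estimate[OF A order_refl p] by simp
  then show ?thesis using integral_unique[OF eproc_norm_has_integral[OF T p(1) e]] by simp
qed

lemma eint_dist:
  assumes A: "integrator A C T" and T: "0 \<le> T" and Ls: "elem T Ls" "elem T Ls'"
    and sm: "upper_less T (\<lambda>t. (d2 (\<lambda>_. eproc Ls t) (\<lambda>_. eproc Ls' t))\<^sup>2) e"
  shows "(d2 (eint A Ls) (eint A Ls'))\<^sup>2 \<le> C * e"
proof -
  define K where "K = Ls @ escale (-1) Ls'"
  have K: "elem T K" using Ls by (auto simp: K_def intro: elem_scale)
  have e: "eint A K = (\<lambda>n w. eint A Ls n w - eint A Ls' n w)" by (intro ext) (simp add: K_def)
  have p: "n2 (eproc K t) = d2 (\<lambda>_. eproc Ls t) (\<lambda>_. eproc Ls' t)" for t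
  proof -
    have "eproc K t = (\<lambda>w. eproc Ls t w - eproc Ls' t w)" by (intro ext) (simp add: K_def)
    then show ?thesis by (simp add: two.cdist_const)
  qed
  obtain g where g: "g integrable_on {0..T}" "\<And>t. t \<in> {0..T} \<Longrightarrow> (n2 (eproc K t))\<^sup>2 \<le> g t" "integral {0..T} g < e"
    using sm unfolding upper_less_def p[symmetric] by blast
  have "(d2 (eint A Ls) (eint A Ls'))\<^sup>2 = (d2 (eint A K) (\<lambda>_ _. 0))\<^sup>2" unfolding e d2_diff_zero ..
  also have "\<dots> \<le> C * integral {0..T} (\<lambda>t. (n2 (eproc K t))\<^sup>2)" by (rule eint_estimate[OF A T K])
  also have "integral {0..T} (\<lambda>t. (n2 (eproc K t))\<^sup>2) \<le> integral {0..T} g"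
    by (intro integral_le eproc_norm_integrable T K g)
  finally show ?thesis using integratorD(1)[OF A] g(3) by (smt (verit) mult_left_mono)
qed

lemma has_intD: "has_int A T \<eta> I \<Longrightarrow> I \<in> adapted T" "has_int A T \<eta> I \<Longrightarrow> I \<in> V2" "has_int A T \<eta> I \<Longrightarrow> t \<in> {0..T} \<Longrightarrow> \<eta> t \<in> V2"
   "has_int A T \<eta> I \<Longrightarrow> 0 < e \<Longrightarrow> \<exists>Ls. elem T Ls \<and> upper_less T (\<lambda>t. (d2 (\<eta> t) (\<lambda>_. eproc Ls t))\<^sup>2) e \<and> d2 I (eint A Ls) < e"
  by (auto simp: has_int_def dest: adaptedD)

lemma has_int_MG2: "has_int A T \<eta> I \<Longrightarrow> \<eta> \<in> MG2 T"
  unfolding has_int_def MG2_def by blast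

lemma has_int_exists:
  assumes A: "integrator A C T" and T: "0 \<le> T" and X: "\<eta> \<in> MG2 T"
  obtains I where "has_int A T \<eta> I"
proof -
  have "\<exists>Ls. elem T Ls \<and> upper_less T (\<lambda>t. (d2 (\<eta> t) (\<lambda>_. eproc Ls t))\<^sup>2) (1 / real (Suc k))" for k
    by (rule MG2D(2)[OF X]) simp
  then obtain L where L: "\<And>k. elem T (L k)" "\<And>k. upper_less T (\<lambda>t. (d2 (\<eta> t) (\<lambda>_. eproc (L k) t))\<^sup>2) (1 / real (Suc k))" by metis
  have V2: "eint A (L k) \<in> V2" for k by (rule eint_V[OF A T L(1)])
  have d: "(d2 (eint A (L k)) (eint A (L l)))\<^sup>2 \<le> C * (2 * (1 / real (Suc k)) + 2 * (1 / real (Suc l)))" for k l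
  proof (rule eint_dist[OF A T L(1) L(1)], rule upper_less_lin[OF L(2) L(2)])
    fix t assume t: "t \<in> {0..T}"
    note v = eproc_V[OF L(1) t] MG2D(1)[OF X t]
    show "(d2 (\<lambda>_. eproc (L k) t) (\<lambda>_. eproc (L l) t))\<^sup>2 \<le> 2 * (d2 (\<eta> t) (\<lambda>_. eproc (L k) t))\<^sup>2 + 2 * (d2 (\<eta> t) (\<lambda>_. eproc (L l) t))\<^sup>2"
      using d2_triangle_square[OF v(1)[of k] v(2) v(1)[of l]] two.cdist_commute[OF v(1)[of k] v(2)] by simp
  qed auto
  have sm: "\<exists>M. \<forall>k\<ge>M. 1 / real (Suc k) < e" if e0: "0 < e" for e
  proof -
    obtain M where "1 / real (Suc M) < e" using reals_Archimedean[OF e0] by (auto simp: inverse_eq_divide)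
    then show ?thesis by (intro exI[of _ M]) (auto intro: le_less_trans[rotated] simp: frac_le)
  qed
  have C0: "0 \<le> C" by (rule integratorD(1)[OF A])
  obtain I where I: "I \<in> V2" "(\<lambda>k. d2 (eint A (L k)) I) \<longlonglongrightarrow> 0"
  proof (rule two.cseq_complete[of "\<lambda>k. eint A (L k)", OF V2])
    fix e :: real assume e: "0 < e"
    define e' where "e' = e\<^sup>2 / (4 * (C + 1))"
    have e': "0 < e'" using e C0 by (simp add: e'_def)
    obtain M where M: "\<forall>k\<ge>M. 1 / real (Suc k) < e'" using sm[OF e'] by blast
    have "d2 (eint A (L k)) (eint A (L l)) < e" if "k \<ge> M" "l \<ge> M" for k l
    proof -
      have "C * (2 * (1 / real (Suc k)) + 2 * (1 / real (Suc l))) \<le> C * (4 * e')"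
        using M[rule_format, OF that(1)] M[rule_format, OF that(2)] C0 by (intro mult_left_mono) auto
      also have "\<dots> < (C + 1) * (4 * e')" using e' by simp
      also have "\<dots> = e\<^sup>2" using C0 by (simp add: e'_def field_simps)
      finally have "(d2 (eint A (L k)) (eint A (L l)))\<^sup>2 < e\<^sup>2" using d[of k l] by linarith
      then show ?thesis using e by (intro power2_less_imp_less[of _ e]) auto
    qed
    then show "\<exists>M. \<forall>k\<ge>M. \<forall>l\<ge>M. d2 (eint A (L k)) (eint A (L l)) < e" by blast
  qed blast
  have near: "\<exists>k. 1 / real (Suc k) < e \<and> d2 I (eint A (L k)) < e" if e: "0 < e" for e
  proof -
    obtain M1 where M1: "\<forall>k\<ge>M1. 1 / real (Suc k) < e" using sm[OF e] by blast
    obtain M2 where M2: "\<forall>k\<ge>M2. d2 (eint A (L k)) I < e" using order_tendstoD(2)[OF I(2) e] by (auto simp: eventually_sequentially)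
    show ?thesis using M1[rule_format, of "max M1 M2"] M2[rule_format, of "max M1 M2"] two.cdist_commute[OF I(1) V2]
      by (intro exI[of _ "max M1 M2"]) auto
  qed
  have "I \<in> adapted T"
  proof (rule adapted_limit[OF I(1)])
    fix e :: real assume "0 < e"
    then show "\<exists>Y\<in>adapted T. d2 I Y < e" using near eint_adapted[OF integratorD(2)[OF A] T L(1)] by blast
  qed
  moreover have "\<exists>Ls. elem T Ls \<and> upper_less T (\<lambda>t. (d2 (\<eta> t) (\<lambda>_. eproc Ls t))\<^sup>2) e \<and> d2 I (eint A Ls) < e" if e: "0 < e" for e
  proof -
    obtain k where k: "1 / real (Suc k) < e" "d2 I (eint A (L k)) < e" using near[OF e] by blast
    then show ?thesis using L(1)[of k] upper_less_mono[OF L(2)[of k], of _ e] by (intro exI[of _ "L k"]) auto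
  qed
  ultimately have "has_int A T \<eta> I" unfolding has_int_def using MG2D(1)[OF X] by blast
  then show thesis by (rule that)
qed

lemma sum3_square_le: "((a::real) + b + c)\<^sup>2 \<le> 3 * a\<^sup>2 + 3 * b\<^sup>2 + 3 * c\<^sup>2"
proof -
  have "0 \<le> (a - b)\<^sup>2 + (b - c)\<^sup>2 + (a - c)\<^sup>2" by simp
  then show ?thesis by (simp add: power2_eq_square algebra_simps)
qed

lemma d2_triangle3_square:
  assumes "X \<in> V2" "Y \<in> V2" "Z \<in> V2" "W \<in> V2" shows "(d2 X W)\<^sup>2 \<le> 3 * (d2 X Y)\<^sup>2 + 3 * (d2 Y Z)\<^sup>2 + 3 * (d2 Z W)\<^sup>2"
proof -
  have "d2 X W \<le> d2 X Y + d2 Y Z + d2 Z W"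
    using two.cdist_triangle[OF assms(1,2,4)] two.cdist_triangle[OF assms(2,3,4)] by linarith
  then have "(d2 X W)\<^sup>2 \<le> (d2 X Y + d2 Y Z + d2 Z W)\<^sup>2"
    by (intro power_mono two.cdist_nonneg assms)
  then show ?thesis using sum3_square_le order_trans by blast
qed

lemma has_int_dist_small:
  assumes A: "integrator A C T" and T: "0 \<le> T" and I: "has_int A T \<eta> I" and J: "has_int A T \<zeta> J"
    and sm: "upper_less T (\<lambda>t. (d2 (\<eta> t) (\<zeta> t))\<^sup>2) e"
  shows "d2 I J \<le> sqrt (3 * C * e)"
proof (rule field_le_epsilon)
  fix r :: real assume r: "0 < r"
  have C0: "0 \<le> C" by (rule integratorD(1)[OF A])
  have e0: "0 \<le> e"
  proof -
    obtain g where g: "g integrable_on {0..T}" "\<And>t. t \<in> {0..T} \<Longrightarrow> (d2 (\<eta> t) (\<zeta> t))\<^sup>2 \<le> g t" "integral {0..T} g < e"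
      using sm unfolding upper_less_def by blast
    have "0 \<le> integral {0..T} g" by (intro integral_nonneg g(1)) (use g(2) order_trans[OF zero_le_power2] in blast)
    then show ?thesis using g(3) by simp
  qed
  define d where "d = min (r / 4) (r\<^sup>2 / (4 * (6 * C + 1)))"
  have d1: "d \<le> r / 4" unfolding d_def by (rule min.cobounded1)
  have d0: "0 < d" using r C0 by (simp add: d_def add_nonneg_pos)
  note d = d0 d1
  have d2: "6 * C * d \<le> (r/2)\<^sup>2"
  proof -
    have "d * (4 * (6 * C + 1)) \<le> r\<^sup>2" using C0 unfolding d_def by (subst pos_le_divide_eq[symmetric]) auto
    then have "6 * C * d * 4 \<le> r\<^sup>2" using d by (simp add: algebra_simps)
    then show ?thesis by (simp add: power_divide)
  qed
  obtain Ls where Ls: "elem T Ls" "upper_less T (\<lambda>t. (d2 (\<eta> t) (\<lambda>_. eproc Ls t))\<^sup>2) d" "d2 I (eint A Ls) < d" using has_intD(4)[OF I d(1)] by blast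
  obtain Ls' where Ls': "elem T Ls'" "upper_less T (\<lambda>t. (d2 (\<zeta> t) (\<lambda>_. eproc Ls' t))\<^sup>2) d" "d2 J (eint A Ls') < d" using has_intD(4)[OF J d(1)] by blast
  have s1: "upper_less T (\<lambda>t. 3 * (d2 (\<eta> t) (\<lambda>_. eproc Ls t))\<^sup>2 + 3 * (d2 (\<zeta> t) (\<lambda>_. eproc Ls' t))\<^sup>2) (3 * d + 3 * d)"
    by (rule upper_less_lin[OF Ls(2) Ls'(2)]) auto
  have "upper_less T (\<lambda>t. (d2 (\<lambda>_. eproc Ls t) (\<lambda>_. eproc Ls' t))\<^sup>2) (1 * (3 * d + 3 * d) + 3 * e)"
  proof (rule upper_less_lin[OF s1 sm])
    fix t assume t: "t \<in> {0..T}"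
    note v = eproc_V[OF Ls(1) t] has_intD(3)[OF I t] has_intD(3)[OF J t] eproc_V[OF Ls'(1) t]
    show "(d2 (\<lambda>_. eproc Ls t) (\<lambda>_. eproc Ls' t))\<^sup>2 \<le> 1 * (3 * (d2 (\<eta> t) (\<lambda>_. eproc Ls t))\<^sup>2 + 3 * (d2 (\<zeta> t) (\<lambda>_. eproc Ls' t))\<^sup>2) + 3 * (d2 (\<eta> t) (\<zeta> t))\<^sup>2"
      using d2_triangle3_square[OF v] two.cdist_commute[OF v(1,2)] by simp
  qed auto
  then have "(d2 (eint A Ls) (eint A Ls'))\<^sup>2 \<le> C * (1 * (3 * d + 3 * d) + 3 * e)" by (rule eint_dist[OF A T Ls(1) Ls'(1)])
  also have "\<dots> = 6 * C * d + 3 * C * e" by (simp add: algebra_simps)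
  also have "\<dots> \<le> (r/2)\<^sup>2 + (sqrt (3 * C * e))\<^sup>2" using d2 C0 e0 by simp
  also have "\<dots> \<le> (sqrt (3 * C * e) + r/2)\<^sup>2" using r C0 e0 by (simp add: power2_sum)
  finally have "d2 (eint A Ls) (eint A Ls') \<le> sqrt (3 * C * e) + r/2" by (rule power2_le_imp_le) (use r C0 e0 in auto)
  moreover note v = has_intD(2)[OF I] has_intD(2)[OF J] eint_V[OF A T Ls(1)] eint_V[OF A T Ls'(1)]
  have "d2 I J \<le> d2 I (eint A Ls) + d2 (eint A Ls) (eint A Ls') + d2 J (eint A Ls')"
    using two.cdist_triangle[OF v(1,3,2)] two.cdist_triangle[OF v(3,4,2)] two.cdist_commute[OF v(2,4)] by linarith
  ultimately show "d2 I J \<le> sqrt (3 * C * e) + r" using Ls(3) Ls'(3) d by linarith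
qed

text \<open>
  The bound for elementary integrals passes to the limit; the factor \<open>3\<close> comes from splitting
  the distance over two approximating integrals.
\<close>

lemma has_int_dist:
  assumes A: "integrator A C T" and T: "0 \<le> T" and I: "has_int A T \<eta> I" and J: "has_int A T \<zeta> J"
  shows "(d2 I J)\<^sup>2 \<le> 3 * C * integral {0..T} (\<lambda>t. (d2 (\<eta> t) (\<zeta> t))\<^sup>2)"
proof (rule field_le_epsilon)
  fix r :: real assume r: "0 < r"
  have C0: "0 \<le> C" by (rule integratorD(1)[OF A])
  have i: "(\<lambda>t. (d2 (\<eta> t) (\<zeta> t))\<^sup>2) integrable_on {0..T}" by (rule MG2_dist_integrable[OF T has_int_MG2[OF I] has_int_MG2[OF J]])
  define Q where "Q = integral {0..T} (\<lambda>t. (d2 (\<eta> t) (\<zeta> t))\<^sup>2)"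
  have Q: "0 \<le> Q" unfolding Q_def by (intro integral_nonneg i) auto
  define d where "d = r / (3 * C + 1)"
  have d: "0 < d" "3 * C * d \<le> r" using r C0 by (auto simp: d_def field_simps)
  have "upper_less T (\<lambda>t. (d2 (\<eta> t) (\<zeta> t))\<^sup>2) (Q + d)" by (rule upper_lessI[OF i]) (use d in \<open>auto simp: Q_def\<close>)
  from has_int_dist_small[OF A T I J this] have "d2 I J \<le> sqrt (3 * C * (Q + d))" .
  then have "(d2 I J)\<^sup>2 \<le> (sqrt (3 * C * (Q + d)))\<^sup>2"
    by (intro power_mono two.cdist_nonneg has_intD(2)[OF I] has_intD(2)[OF J])
  also have "\<dots> = 3 * C * (Q + d)" using C0 Q d by simp
  also have "\<dots> \<le> 3 * C * Q + r" using d by (simp add: algebra_simps)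
  finally show "(d2 I J)\<^sup>2 \<le> 3 * C * integral {0..T} (\<lambda>t. (d2 (\<eta> t) (\<zeta> t))\<^sup>2) + r" by (simp add: Q_def)
qed

lemma has_int_unique:
  assumes "integrator A C T" "0 \<le> T" "has_int A T \<eta> I" "has_int A T \<eta> J" shows "d2 I J = 0"
  using has_int_dist[OF assms] by (simp add: two.cdist_self)

lemma has_int_add:
  assumes A: "integrator A C T" and T: "0 \<le> T" and I: "has_int A T \<eta> I" and J: "has_int A T \<zeta> J"
  shows "has_int A T (\<lambda>t n w. \<eta> t n w + \<zeta> t n w) (\<lambda>n w. I n w + J n w)"
  unfolding has_int_def
proof (intro conjI ballI allI impI)
  show "(\<lambda>n w. I n w + J n w) \<in> adapted T" by (intro adapted_add has_intD(1)[OF I] has_intD(1)[OF J])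
  show "(\<lambda>n w. \<eta> t n w + \<zeta> t n w) \<in> V2" if "t \<in> {0..T}" for t by (intro V_intros has_intD(3)[OF I that] has_intD(3)[OF J that])
  fix e :: real assume e: "0 < e"
  define d where "d = e/4"
  have d: "0 < d" using e by (simp add: d_def)
  obtain Ls where Ls: "elem T Ls" "upper_less T (\<lambda>t. (d2 (\<eta> t) (\<lambda>_. eproc Ls t))\<^sup>2) d" "d2 I (eint A Ls) < d" using has_intD(4)[OF I d] by blast
  obtain Ls' where Ls': "elem T Ls'" "upper_less T (\<lambda>t. (d2 (\<zeta> t) (\<lambda>_. eproc Ls' t))\<^sup>2) d" "d2 J (eint A Ls') < d" using has_intD(4)[OF J d] by blast
  have s: "upper_less T (\<lambda>t. (d2 (\<lambda>n w. \<eta> t n w + \<zeta> t n w) (\<lambda>_. eproc (Ls @ Ls') t))\<^sup>2) e"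
    using approx_add[OF has_intD(3)[OF I] has_intD(3)[OF J] Ls(1,2) Ls'(1,2)] by (simp add: d_def)
  have eq: "eint A (Ls @ Ls') = (\<lambda>n w. eint A Ls n w + eint A Ls' n w)" by (intro ext) simp
  have "d2 (\<lambda>n w. I n w + J n w) (eint A (Ls @ Ls')) \<le> d2 I (eint A Ls) + d2 J (eint A Ls')"
    unfolding eq by (intro d2_add_le has_intD(2)[OF I] has_intD(2)[OF J] eint_V[OF A T] Ls(1) Ls'(1))
  also have "\<dots> < e" using Ls(3) Ls'(3) e by (simp add: d_def)
  finally show "\<exists>Ls. elem T Ls \<and> upper_less T (\<lambda>t. (d2 (\<lambda>n w. \<eta> t n w + \<zeta> t n w) (\<lambda>_. eproc Ls t))\<^sup>2) e \<and> d2 (\<lambda>n w. I n w + J n w) (eint A Ls) < e"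
    using s Ls(1) Ls'(1) by (intro exI[of _ "Ls @ Ls'"]) auto
qed

lemma has_int_scale:
  assumes A: "integrator A C T" and T: "0 \<le> T" and I: "has_int A T \<eta> I"
  shows "has_int A T (\<lambda>t n w. c * \<eta> t n w) (\<lambda>n w. c * I n w)"
  unfolding has_int_def
proof (intro conjI ballI allI impI)
  show "(\<lambda>n w. c * I n w) \<in> adapted T" by (intro adapted_scale has_intD(1)[OF I])
  show "(\<lambda>n w. c * \<eta> t n w) \<in> V2" if "t \<in> {0..T}" for t by (intro V_intros has_intD(3)[OF I that])
  fix e :: real assume e: "0 < e"
  define d where "d = e / (c\<^sup>2 + \<bar>c\<bar> + 1)"
  have c: "0 < c\<^sup>2 + \<bar>c\<bar> + 1" by (simp add: add_nonneg_pos)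
  have d: "0 < d" "(c\<^sup>2 + \<bar>c\<bar> + 1) * d = e" using e c by (auto simp: d_def)
  obtain Ls where Ls: "elem T Ls" "upper_less T (\<lambda>t. (d2 (\<eta> t) (\<lambda>_. eproc Ls t))\<^sup>2) d" "d2 I (eint A Ls) < d" using has_intD(4)[OF I d(1)] by blast
  have s: "upper_less T (\<lambda>t. (d2 (\<lambda>n w. c * \<eta> t n w) (\<lambda>_. eproc (escale c Ls) t))\<^sup>2) ((c\<^sup>2 + \<bar>c\<bar> + 1) * d + 0 * d)"
    using approx_scale[OF has_intD(3)[OF I] Ls(1,2), of c "c\<^sup>2 + \<bar>c\<bar> + 1"] by (simp add: add_strict_increasing2)
  have eq: "eint A (escale c Ls) = (\<lambda>n w. c * eint A Ls n w)" by (intro ext) simp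
  have "d2 (\<lambda>n w. c * I n w) (eint A (escale c Ls)) \<le> \<bar>c\<bar> * d2 I (eint A Ls)"
    unfolding eq by (intro d2_scale has_intD(2)[OF I] eint_V[OF A T] Ls(1))
  also have "\<dots> \<le> \<bar>c\<bar> * d" using Ls(3) by (intro mult_left_mono) auto
  also have "\<dots> < (c\<^sup>2 + \<bar>c\<bar> + 1) * d" using d by (intro mult_strict_right_mono) (auto simp: add_strict_increasing2 add_nonneg_pos)
  finally have "d2 (\<lambda>n w. c * I n w) (eint A (escale c Ls)) < e" using d by simp
  then show "\<exists>Ls. elem T Ls \<and> upper_less T (\<lambda>t. (d2 (\<lambda>n w. c * \<eta> t n w) (\<lambda>_. eproc Ls t))\<^sup>2) e \<and> d2 (\<lambda>n w. c * I n w) (eint A Ls) < e"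
    using s elem_scale[OF Ls(1)] d by (intro exI[of _ "escale c Ls"]) auto
qed

lemma has_int_diff:
  assumes A: "integrator A C T" and T: "0 \<le> T" and I: "has_int A T \<eta> I" and J: "has_int A T \<zeta> J"
  shows "has_int A T (\<lambda>t n w. \<eta> t n w - \<zeta> t n w) (\<lambda>n w. I n w - J n w)"
  using has_int_add[OF A T I has_int_scale[OF A T J, of "-1"]] by simp

lemma adapted_cong: assumes "X \<in> adapted u" "Y \<in> V2" "d2 X Y = 0" shows "Y \<in> adapted u"
proof (rule adapted_limit[OF assms(2)])
  fix e :: real assume "0 < e"
  then show "\<exists>Z\<in>adapted u. d2 Y Z < e"
    using assms two.cdist_commute[OF adaptedD(1)[OF assms(1)] assms(2)] by (intro bexI[of _ X]) auto
qed

lemma has_int_cong: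
  assumes A: "integrator A C T" and T: "0 \<le> T" and I: "has_int A T \<eta> I" and N: "negligible N" and V2: "\<And>t. t \<in> {0..T} \<Longrightarrow> \<zeta> t \<in> V2"
    and eq: "\<And>t. t \<in> {0..T} - N \<Longrightarrow> d2 (\<eta> t) (\<zeta> t) = 0" and J: "J \<in> V2" "d2 I J = 0"
  shows "has_int A T \<zeta> J"
  unfolding has_int_def
proof (intro conjI ballI allI impI V2)
  show "J \<in> adapted T" by (rule adapted_cong[OF has_intD(1)[OF I] J])
  fix e :: real assume e: "0 < e"
  obtain Ls where Ls: "elem T Ls" "upper_less T (\<lambda>t. (d2 (\<eta> t) (\<lambda>_. eproc Ls t))\<^sup>2) e" "d2 I (eint A Ls) < e" using has_intD(4)[OF I e] by blast
  have "upper_less T (\<lambda>t. (d2 (\<zeta> t) (\<lambda>_. eproc Ls t))\<^sup>2) e"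
  proof (rule upper_less_spike[OF Ls(2) N])
    fix t assume t: "t \<in> {0..T} - N"
    then have t': "t \<in> {0..T}" by simp
    show "(d2 (\<zeta> t) (\<lambda>_. eproc Ls t))\<^sup>2 \<le> (d2 (\<eta> t) (\<lambda>_. eproc Ls t))\<^sup>2"
      using d2_eq_0_cong[OF has_intD(3)[OF I t'] V2[OF t'] eproc_V[OF Ls(1) t'] eq[OF t]] by simp
  qed
  moreover have "d2 J (eint A Ls) < e" using d2_eq_0_cong[OF has_intD(2)[OF I] J(1) eint_V[OF A T Ls(1)] J(2)] Ls(3) by simp
  ultimately show "\<exists>Ls. elem T Ls \<and> upper_less T (\<lambda>t. (d2 (\<zeta> t) (\<lambda>_. eproc Ls t))\<^sup>2) e \<and> d2 J (eint A Ls) < e" using Ls(1) by blast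
qed simp

lemma eproc_zero_after: "elem s Ls \<Longrightarrow> s \<le> t \<Longrightarrow> eproc Ls t w = 0"
proof (induction Ls)
  case (Cons a Ls)
  obtain Z u v where a: "a = (Z, u, v)" by (cases a) auto
  show ?case using Cons by (auto simp: a eproc_Cons elem_Cons indicator_def)
qed simp

text \<open>
  An integral up to \<open>s\<close> is the integral up to \<open>T\<close> of the process cut off after \<open>s\<close>. This
  expresses increments of an indefinite integral as integrals.
\<close>

lemma has_int_extend:
  assumes I: "has_int A s \<eta> I" and s: "s \<le> T" and V2: "\<And>t. t \<in> {0..T} \<Longrightarrow> \<eta> t \<in> V2"
  shows "has_int A T (\<lambda>t n w. \<eta> t n w * indicator {..s} t) I"
  unfolding has_int_def
proof (intro conjI ballI allI impI)
  show "I \<in> adapted T" by (rule adapted_mono[OF has_intD(1)[OF I] s])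
  show "(\<lambda>n w. \<eta> t n w * indicator {..s} t) \<in> V2" if "t \<in> {0..T}" for t by (rule cut_V[OF V2[OF that]])
  fix e :: real assume e: "0 < e"
  obtain Ls where Ls: "elem s Ls" "upper_less s (\<lambda>t. (d2 (\<eta> t) (\<lambda>_. eproc Ls t))\<^sup>2) e" "d2 I (eint A Ls) < e" using has_intD(4)[OF I e] by blast
  have 0: "eproc Ls t = (\<lambda>_. 0)" if "s < t" for t using eproc_zero_after[OF Ls(1)] that by (intro ext) auto
  have "upper_less T (\<lambda>t. (d2 (\<lambda>n w. \<eta> t n w * indicator {..s} t) (\<lambda>_. eproc Ls t))\<^sup>2) e"
    by (rule upper_less_extend[OF Ls(2) s]) (auto simp: 0 two.cdist_self)
  then show "\<exists>Ls. elem T Ls \<and> upper_less T (\<lambda>t. (d2 (\<lambda>n w. \<eta> t n w * indicator {..s} t) (\<lambda>_. eproc Ls t))\<^sup>2) e \<and> d2 I (eint A Ls) < e"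
    using Ls elem_mono[OF Ls(1) s] by blast
qed

lemma has_int_increment:
  assumes A: "integrator A C T" and s: "0 \<le> s" "s \<le> t" "t \<le> T" and X: "\<eta> \<in> MG2 T" and I: "has_int A s \<eta> I" and J: "has_int A t \<eta> J"
  shows "(d2 J I)\<^sup>2 \<le> 3 * C * integral {s..t} (\<lambda>r. (d2 (\<eta> r) (\<lambda>_ _. 0))\<^sup>2)"
proof -
  have t: "0 \<le> t" and At: "integrator A C t" using s integrator_restrict[OF A] by auto
  have V2: "\<eta> r \<in> V2" if "r \<in> {0..t}" for r using MG2D(1)[OF X] that s by auto
  let ?f = "\<lambda>r. (d2 (\<eta> r) (\<lambda>_ _. 0))\<^sup>2"
  let ?c = "\<lambda>r n w. \<eta> r n w * indicator {..s} r"
  have fi: "?f integrable_on {s..t}"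
    by (rule integrable_on_subinterval[OF MG2_norm_integrable[OF _ X]]) (use s in auto)
  have sub: "{s..t} \<subseteq> {0..t}" using s by auto
  have h: "((\<lambda>r. if r \<in> {s..t} then ?f r else 0) has_integral integral {s..t} ?f) {0..t}"
    unfolding has_integral_restrict[OF sub] by (rule integrable_integral[OF fi])
  have "(d2 J I)\<^sup>2 \<le> 3 * C * integral {0..t} (\<lambda>r. (d2 (\<eta> r) (?c r))\<^sup>2)"
    by (rule has_int_dist[OF At t J has_int_extend[OF I s(2) V2]])
  also have "integral {0..t} (\<lambda>r. (d2 (\<eta> r) (?c r))\<^sup>2) \<le> integral {0..t} (\<lambda>r. if r \<in> {s..t} then ?f r else 0)"
  proof (rule integral_le)
    show "(\<lambda>r. (d2 (\<eta> r) (?c r))\<^sup>2) integrable_on {0..t}"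
      by (intro MG2_dist_integrable t has_int_MG2[OF J] has_int_MG2[OF has_int_extend[OF I s(2) V2]])
    show "(\<lambda>r. if r \<in> {s..t} then ?f r else 0) integrable_on {0..t}" using h by blast
    fix r assume "r \<in> {0..t}"
    then show "(d2 (\<eta> r) (?c r))\<^sup>2 \<le> (if r \<in> {s..t} then ?f r else 0)"
      by (cases "r \<le> s") (auto simp: two.cdist_self)
  qed
  also have "\<dots> = integral {s..t} ?f" by (rule integral_unique[OF h])
  finally show ?thesis using integratorD(1)[OF A] by (simp add: mult_left_mono)
qed

section \<open>Step processes and elementary processes\<close>

lemma one_over_Suc_tendsto: "(\<lambda>k. 1 / real (Suc k)) \<longlonglongrightarrow> 0"
  using LIMSEQ_inverse_real_of_nat by (simp add: inverse_eq_divide)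

lemma elem_to_step:
  assumes T: "0 \<le> T" and Ls: "elem T Ls"
  obtains S where "is_step E 2 T S" "\<And>t n. step_process S t n = eproc Ls t" "\<And>A. step_integral A S = eint A Ls"
proof -
  obtain N \<tau> Z where p: "is_partition T N \<tau>" "\<And>j. j < N \<Longrightarrow> Z j \<in> bL0 (\<tau> j)"
    and e: "\<And>t w. eproc Ls t w = (\<Sum>j<N. Z j w * indicator {\<tau> j..<\<tau> (Suc j)} t)"
    and i: "\<And>A n w. eint A Ls n w = (\<Sum>j<N. Z j w * (A (\<tau> (Suc j)) n w - A (\<tau> j) n w))"
    by (rule elem_partition[OF T Ls]) blast
  show thesis
  proof (rule that[of "(N, \<tau>, \<lambda>j _. Z j)"])
    have "(\<lambda>_. Z j) \<in> LG E 2 (L0ip_upto (\<tau> j))" if "j < N" for j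
      unfolding LG_2_eq[OF L0ip_upto_subset] by (intro two.cseq_const bL0_L0ip_upto p(2) that)
    then show "is_step E 2 T (N, \<tau>, \<lambda>j _. Z j)" using p(1) by (auto simp: is_partition_def)
  qed (auto intro!: ext simp: e i)
qed

text \<open>
  Coefficients of a step process need not be bounded and are replaced by bounded ones. The
  integrals are compared in the first-order norm, because the product of a general coefficient
  with an increment is only of first order.
\<close>

lemma step_to_elem:
  assumes T: "0 \<le> T" and S: "is_step E 2 T S" and e: "0 < e" and A: "\<And>t. t \<in> {0..T} \<Longrightarrow> A t \<in> V2"
  obtains Ls where "elem T Ls" "\<And>t. step_process S t \<in> V2" "\<And>t. d2 (step_process S t) (\<lambda>_. eproc Ls t) \<le> e"
    "step_integral A S \<in> V1" "eint A Ls \<in> V1" "d1 (step_integral A S) (eint A Ls) \<le> e"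
proof -
  obtain N \<tau> \<xi> where SS: "S = (N, \<tau>, \<xi>)" by (cases S) auto
  let ?dA = "\<lambda>j n w. A (\<tau> (Suc j)) n w - A (\<tau> j) n w" and ?ind = "\<lambda>j t. indicator {\<tau> j..<\<tau> (Suc j)} t :: real"
  have part: "is_partition T N \<tau>" and \<xi>: "\<And>j. j < N \<Longrightarrow> \<xi> j \<in> adapted (\<tau> j)"
    using S unfolding SS is_partition_def by (auto simp: LG_2_eq[OF L0ip_upto_subset] intro: adapted_cseq)
  have \<tau>T: "\<tau> j \<in> {0..T}" if "j \<le> N" for j
    using is_partition_mono[OF part, of 0 j] is_partition_mono[OF part, of j N] part that unfolding is_partition_def
    by (cases "j = 0"; cases "j = N"; force)
  define Q where "Q = (\<Sum>j<N. d2 (A (\<tau> (Suc j))) (A (\<tau> j)))"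
  have dA: "0 \<le> d2 (A (\<tau> (Suc j))) (A (\<tau> j))" if "j < N" for j
    using that by (intro two.cdist_nonneg A \<tau>T) auto
  have Q: "0 \<le> Q" unfolding Q_def by (intro sum_nonneg dA) auto
  define d where "d = e / (real N + Q + 1)"
  have d: "0 < d" using e Q by (simp add: d_def)
  have "\<exists>Z. Z \<in> bL0 (\<tau> j) \<and> d2 (\<xi> j) (\<lambda>_. Z) < d" if "j < N" for j using adaptedD(2)[OF \<xi>[OF that] d] by blast
  then obtain Z where Z: "\<And>j. j < N \<Longrightarrow> Z j \<in> bL0 (\<tau> j)" "\<And>j. j < N \<Longrightarrow> d2 (\<xi> j) (\<lambda>_. Z j) < d" by metis
  define Ls where "Ls = map (\<lambda>j. (Z j, \<tau> j, \<tau> (Suc j))) [0..<N]"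
  have eproc: "eproc Ls t = (\<lambda>w. \<Sum>j<N. Z j w * ?ind j t)" for t
    by (intro ext) (simp add: eproc_def Ls_def comp_def interv_sum_list_conv_sum_set_nat atLeast0LessThan)
  have eint: "eint A Ls = (\<lambda>n w. \<Sum>j<N. Z j w * ?dA j n w)"
    by (intro ext) (simp add: eint_def Ls_def comp_def interv_sum_list_conv_sum_set_nat atLeast0LessThan)
  have sp: "step_process S t = (\<lambda>n w. \<Sum>j<N. \<xi> j n w * ?ind j t)" for t
    by (intro ext) (simp add: SS)
  have si: "step_integral A S = (\<lambda>n w. \<Sum>j<N. \<xi> j n w * ?dA j n w)"
    by (intro ext) (simp add: SS)
  have ZV: "(\<lambda>_. Z j) \<in> V2" if "j < N" for j using V_const[OF bL0_L0ip[OF Z(1)[OF that]]] .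
  have \<xi>V2: "\<xi> j \<in> V2" if "j < N" for j using adaptedD(1)[OF \<xi>[OF that]] .
  show thesis
  proof (rule that[of Ls])
    show "elem T Ls" unfolding Ls_def elem_def using Z(1) \<tau>T is_partition_mono[OF part, of j "Suc j" for j] by (auto simp: Suc_le_eq intro: less_imp_le)
    fix t
    have c: "(\<lambda>n w. \<Sum>j<N. \<xi> j n w * ?ind j t) \<in> V2 \<and> (\<lambda>n w. \<Sum>j<N. Z j w * ?ind j t) \<in> V2 \<and>
      d2 (\<lambda>n w. \<Sum>j<N. \<xi> j n w * ?ind j t) (\<lambda>n w. \<Sum>j<N. Z j w * ?ind j t)
      \<le> (\<Sum>j<N. d2 (\<lambda>n w. \<xi> j n w * ?ind j t) (\<lambda>n w. Z j w * ?ind j t))"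
      by (rule two.cdist_sum_le) (auto intro: cut_V ZV \<xi>V2)
    then show "step_process S t \<in> V2" by (simp add: sp)
    have "d2 (\<lambda>n w. \<xi> j n w * ?ind j t) (\<lambda>n w. Z j w * ?ind j t) \<le> d" if j: "j < N" for j
    proof -
      have "d2 (\<lambda>n w. \<xi> j n w * ?ind j t) (\<lambda>n w. Z j w * ?ind j t) \<le> 1 * d2 (\<xi> j) (\<lambda>_. Z j)"
        by (rule two.cdist_mono) (auto intro: cut_V ZV[OF j] \<xi>V2[OF j] V_zero simp: indicator_def)
      then show ?thesis using Z(2)[OF j] by simp
    qed
    then have "d2 (step_process S t) (\<lambda>_. eproc Ls t) \<le> (\<Sum>j<N. d)" unfolding sp eproc by (intro order_trans[OF conjunct2[OF conjunct2[OF c]]] sum_mono) auto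
    also have "\<dots> = real N * d" by simp
    also have "\<dots> \<le> (real N + Q + 1) * d" using d Q by (intro mult_right_mono) auto
    also have "\<dots> = e" using Q by (simp add: d_def)
    finally show "d2 (step_process S t) (\<lambda>_. eproc Ls t) \<le> e" .
  next
    have AV: "(?dA j) \<in> V2" if "j < N" for j
      using that by (intro V_intros A \<tau>T) auto
    have c: "(\<lambda>n w. \<Sum>j<N. \<xi> j n w * ?dA j n w) \<in> V1 \<and> (\<lambda>n w. \<Sum>j<N. Z j w * ?dA j n w) \<in> V1 \<and>
      d1 (\<lambda>n w. \<Sum>j<N. \<xi> j n w * ?dA j n w) (\<lambda>n w. \<Sum>j<N. Z j w * ?dA j n w)
      \<le> (\<Sum>j<N. d1 (\<lambda>n w. \<xi> j n w * ?dA j n w) (\<lambda>n w. Z j w * ?dA j n w))"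
      by (rule one.cdist_sum_le; rule V_mult_V1) (auto intro: AV ZV \<xi>V2)
    show "step_integral A S \<in> V1" "eint A Ls \<in> V1" using c by (simp_all add: si eint)
    have "d1 (\<lambda>n w. \<xi> j n w * ?dA j n w) (\<lambda>n w. Z j w * ?dA j n w) \<le> d * d2 (A (\<tau> (Suc j))) (A (\<tau> j))" if j: "j < N" for j
    proof -
      have "d1 (\<lambda>n w. \<xi> j n w * ?dA j n w) (\<lambda>n w. Z j w * ?dA j n w) =
         d1 (\<lambda>n w. (\<xi> j n w - Z j w) * ?dA j n w) (\<lambda>n w. 0)"
        by (simp add: cdist_def left_diff_distrib)
      also have "\<dots> \<le> d2 (\<xi> j) (\<lambda>_. Z j) * d2 (A (\<tau> (Suc j))) (A (\<tau> j))"
        using j by (intro d1_mult_le ZV \<xi>V2 A \<tau>T) auto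
      also have "\<dots> \<le> d * d2 (A (\<tau> (Suc j))) (A (\<tau> j))" using Z(2)[OF j] dA[OF j] by (intro mult_right_mono) auto
      finally show ?thesis .
    qed
    then have "d1 (step_integral A S) (eint A Ls) \<le> (\<Sum>j<N. d * d2 (A (\<tau> (Suc j))) (A (\<tau> j)))" unfolding si eint
      by (intro order_trans[OF conjunct2[OF conjunct2[OF c]]] sum_mono) auto
    also have "\<dots> = d * Q" by (simp add: Q_def sum_distrib_left)
    also have "\<dots> \<le> d * (real N + Q + 1)" using d by (intro mult_left_mono) auto
    also have "\<dots> = e" using Q by (simp add: d_def)
    finally show "d1 (step_integral A S) (eint A Ls) \<le> e" .
  qed
qed

lemma step_process_V: assumes "0 \<le> T" "is_step E 2 T S" shows "step_process S t \<in> V2"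
proof -
  obtain Ls where "\<And>t. step_process S t \<in> V2"
    by (rule step_to_elem[OF assms, of 1 "\<lambda>_ _ _. 0"]) (auto intro: V_zero)
  then show ?thesis .
qed

lemma MG_approx_iff:
  assumes T: "0 < T" and S: "\<And>k. is_step E 2 T (S k)" and V2: "\<And>t. t \<in> {0..T} \<Longrightarrow> \<eta> t \<in> V2"
  shows "MG_approx E 2 T S \<eta> \<longleftrightarrow> (\<forall>k. (\<lambda>t. (d2 (step_process (S k) t) (\<eta> t))\<^sup>2) integrable_on {0..T}) \<and>
     (\<lambda>k. integral {0..T} (\<lambda>t. (d2 (step_process (S k) t) (\<eta> t))\<^sup>2)) \<longlonglongrightarrow> 0"
proof -
  let ?d = "\<lambda>k t. (d2 (step_process (S k) t) (\<eta> t))\<^sup>2"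
  have eq: "EG E (\<lambda>n w. \<bar>step_process (S k) t n w - \<eta> t n w\<bar> powr 2) = ?d k t" if "t \<in> {0..T}" for k t
    by (rule EG_square(1)[OF step_process_V[OF less_imp_le[OF T] S] V2[OF that]])
  have int_iff: "(\<lambda>t. EG E (\<lambda>n w. \<bar>step_process (S k) t n w - \<eta> t n w\<bar> powr 2)) integrable_on {0..T} \<longleftrightarrow>
    (?d k) integrable_on {0..T}" for k
    by (rule integrable_cong) (simp only: eq)
  have dist_eq: "MG_dist E 2 T (step_process (S k)) \<eta> = sqrt (1 / T * integral {0..T} (?d k))"
    if "(?d k) integrable_on {0..T}" for k
  proof -
    have i: "integral {0..T} (\<lambda>t. EG E (\<lambda>n w. \<bar>step_process (S k) t n w - \<eta> t n w\<bar> powr 2)) = integral {0..T} (?d k)"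
      by (rule integral_cong) (simp only: eq)
    show ?thesis unfolding MG_dist_def i using T integral_nonneg[OF that] by (intro powr_half_sqrt) simp
  qed
  have lim_iff: "(\<lambda>k. sqrt (1 / T * x k)) \<longlonglongrightarrow> 0 \<longleftrightarrow> x \<longlonglongrightarrow> 0" if "\<And>k. 0 \<le> x k" for x :: "nat \<Rightarrow> real"
  proof
    assume "(\<lambda>k. sqrt (1 / T * x k)) \<longlonglongrightarrow> 0"
    then have "(\<lambda>k. T * (sqrt (1 / T * x k))\<^sup>2) \<longlonglongrightarrow> T * 0\<^sup>2" by (intro tendsto_intros)
    then show "x \<longlonglongrightarrow> 0" using T that by simp
  next
    assume "x \<longlonglongrightarrow> 0"
    then have "(\<lambda>k. sqrt (1 / T * x k)) \<longlonglongrightarrow> sqrt (1 / T * 0)" by (intro tendsto_intros)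
    then show "(\<lambda>k. sqrt (1 / T * x k)) \<longlonglongrightarrow> 0" by simp
  qed
  show ?thesis
  proof (cases "\<forall>k. (?d k) integrable_on {0..T}")
    case True
    have "(\<lambda>k. MG_dist E 2 T (step_process (S k)) \<eta>) = (\<lambda>k. sqrt (1 / T * integral {0..T} (?d k)))"
      using dist_eq True by blast
    moreover have "0 \<le> integral {0..T} (?d k)" for k
      using True by (intro integral_nonneg) auto
    ultimately show ?thesis unfolding MG_approx_def int_iff using S True lim_iff by simp
  next
    case False
    then show ?thesis unfolding MG_approx_def int_iff by blast
  qed
qed

text \<open>
  For \<open>T = 0\<close> the factor \<open>1 / T\<close> makes every distance \<open>0\<close>, and the only step process is the
  empty one.
\<close>

lemma MG_approx_0:
  "MG_approx E 2 0 S \<eta> \<longleftrightarrow> (\<forall>k. is_step E 2 0 (S k))"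
  unfolding MG_approx_def MG_dist_def by (auto simp: integrable_on_refl[of _ "0::real", simplified])

lemma MG_approx_of_small:
  assumes T: "0 \<le> T" and S: "\<And>k. is_step E 2 T (S k)" "\<And>k t n. step_process (S k) t n = eproc (L k) t"
    and L: "\<And>k. elem T (L k)" and X: "\<eta> \<in> MG2 T"
    and sm: "\<And>k. upper_less T (\<lambda>t. (d2 (\<eta> t) (\<lambda>_. eproc (L k) t))\<^sup>2) (1 / real (Suc k))"
  shows "MG_approx E 2 T S \<eta>"
proof (cases "T = 0")
  case True then show ?thesis using S(1) MG_approx_0 by simp
next
  case False
  then have T': "0 < T" using T by simp
  have sp: "step_process (S k) t = (\<lambda>_. eproc (L k) t)" for k t by (intro ext) (simp add: S(2))
  have i: "(\<lambda>t. (d2 (\<lambda>_. eproc (L k) t) (\<eta> t))\<^sup>2) integrable_on {0..T}" for k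
    by (rule MG2_dist_integrable[OF T MG2_elem[OF L T] X])
  have b: "integral {0..T} (\<lambda>t. (d2 (\<lambda>_. eproc (L k) t) (\<eta> t))\<^sup>2) \<le> 1 / real (Suc k)" for k
  proof -
    obtain g where g: "g integrable_on {0..T}" "\<And>t. t \<in> {0..T} \<Longrightarrow> (d2 (\<eta> t) (\<lambda>_. eproc (L k) t))\<^sup>2 \<le> g t" "integral {0..T} g < 1 / real (Suc k)"
      using sm[of k] unfolding upper_less_def by blast
    have "integral {0..T} (\<lambda>t. (d2 (\<lambda>_. eproc (L k) t) (\<eta> t))\<^sup>2) \<le> integral {0..T} g"
      by (intro integral_le i g(1)) (use g(2) two.cdist_commute[OF eproc_V[OF L] MG2D(1)[OF X]] in auto)
    then show ?thesis using g(3) by linarith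
  qed
  have "(\<lambda>k. integral {0..T} (\<lambda>t. (d2 (\<lambda>_. eproc (L k) t) (\<eta> t))\<^sup>2)) \<longlonglongrightarrow> 0"
    by (rule tendsto_sandwich[OF _ _ tendsto_const one_over_Suc_tendsto])
       (auto intro!: always_eventually integral_nonneg i b simp del: of_nat_Suc)
  moreover have "MG_approx E 2 T S \<eta> \<longleftrightarrow> (\<forall>k. (\<lambda>t. (d2 (step_process (S k) t) (\<eta> t))\<^sup>2) integrable_on {0..T}) \<and>
     (\<lambda>k. integral {0..T} (\<lambda>t. (d2 (step_process (S k) t) (\<eta> t))\<^sup>2)) \<longlonglongrightarrow> 0"
    by (rule MG_approx_iff[OF T' S(1) MG2D(1)[OF X]])
  ultimately show ?thesis unfolding sp using i by blast
qed

lemma MG_approx_imp_small: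
  assumes T: "0 \<le> T" and S: "MG_approx E 2 T S \<eta>" and V2: "\<And>t. t \<in> {0..T} \<Longrightarrow> \<eta> t \<in> V2" and e: "0 < e"
  shows "\<exists>M. \<forall>k\<ge>M. upper_less T (\<lambda>t. (d2 (step_process (S k) t) (\<eta> t))\<^sup>2) e"
proof (cases "T = 0")
  case True
  have "upper_less 0 (\<lambda>t. (d2 (step_process (S k) t) (\<eta> t))\<^sup>2) e" for k
    by (rule upper_less_const[of _ _ "(d2 (step_process (S k) 0) (\<eta> 0))\<^sup>2"]) (use e in auto)
  then show ?thesis using True by auto
next
  case False
  then have T': "0 < T" using T by simp
  have st: "is_step E 2 T (S k)" for k using S by (auto simp: MG_approx_def)
  have "MG_approx E 2 T S \<eta> \<longleftrightarrow> (\<forall>k. (\<lambda>t. (d2 (step_process (S k) t) (\<eta> t))\<^sup>2) integrable_on {0..T}) \<and>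
     (\<lambda>k. integral {0..T} (\<lambda>t. (d2 (step_process (S k) t) (\<eta> t))\<^sup>2)) \<longlonglongrightarrow> 0"
    by (rule MG_approx_iff[OF T' st V2])
  note S' = this[THEN iffD1, OF S]
  have *: "(\<lambda>t. (d2 (step_process (S k) t) (\<eta> t))\<^sup>2) integrable_on {0..T}" for k
    using S' by blast
  have lim: "(\<lambda>k. integral {0..T} (\<lambda>t. (d2 (step_process (S k) t) (\<eta> t))\<^sup>2)) \<longlonglongrightarrow> 0"
    using S' by blast
  have "\<forall>\<^sub>F k in sequentially. integral {0..T} (\<lambda>t. (d2 (step_process (S k) t) (\<eta> t))\<^sup>2) < e"
    by (rule order_tendstoD(2)[OF lim e])
  then show ?thesis using * unfolding eventually_sequentially by (meson order_refl upper_lessI)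
qed

lemma MG_iff_MG2:
  assumes T: "0 \<le> T" shows "\<eta> \<in> MG E 2 T \<longleftrightarrow> \<eta> \<in> MG2 T"
proof
  assume X: "\<eta> \<in> MG2 T"
  have "\<exists>L. elem T L \<and> upper_less T (\<lambda>t. (d2 (\<eta> t) (\<lambda>_. eproc L t))\<^sup>2) (1 / real (Suc k))" for k
    by (rule MG2D(2)[OF X]) simp
  then obtain L where L: "\<And>k. elem T (L k)" "\<And>k. upper_less T (\<lambda>t. (d2 (\<eta> t) (\<lambda>_. eproc (L k) t))\<^sup>2) (1 / real (Suc k))" by metis
  have "\<exists>S. is_step E 2 T S \<and> (\<forall>t n. step_process S t n = eproc (L k) t)" for k
    by (rule elem_to_step[OF T L(1)[of k]]) blast
  then obtain S where S: "\<And>k. is_step E 2 T (S k)" "\<And>k t n. step_process (S k) t n = eproc (L k) t" by metis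
  have "MG_approx E 2 T S \<eta>" by (rule MG_approx_of_small[OF T S L(1) X L(2)])
  then show "\<eta> \<in> MG E 2 T" using MG2D(1)[OF X] unfolding MG_def LG_2_eq[OF order_refl] by blast
next
  assume X: "\<eta> \<in> MG E 2 T"
  then obtain S where S: "MG_approx E 2 T S \<eta>" and V2: "\<And>t. t \<in> {0..T} \<Longrightarrow> \<eta> t \<in> V2" by (auto simp: MG_def LG_2_eq)
  have st: "is_step E 2 T (S k)" for k using S by (auto simp: MG_approx_def)
  show "\<eta> \<in> MG2 T" unfolding MG2_def
  proof (intro CollectI conjI ballI allI impI V2)
    fix e :: real assume e: "0 < e"
    obtain k where k: "upper_less T (\<lambda>t. (d2 (step_process (S k) t) (\<eta> t))\<^sup>2) (e/4)"
      using MG_approx_imp_small[OF T S V2, of "e/4"] e by auto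
    define d where "d = sqrt (e / (8 * (T + 1)))"
    have d: "0 < d" using e T by (simp add: d_def)
    obtain Ls where Ls: "elem T Ls" "\<And>t. d2 (step_process (S k) t) (\<lambda>_. eproc Ls t) \<le> d"
      by (rule step_to_elem[OF T st[of k] d, of "\<lambda>_ _ _. 0"]) (auto intro: V_zero)
    have s2: "upper_less T (\<lambda>t. (d2 (step_process (S k) t) (\<lambda>_. eproc Ls t))\<^sup>2) (e/4)"
    proof (rule upper_less_const[OF T])
      fix t assume t: "t \<in> {0..T}"
      show "(d2 (step_process (S k) t) (\<lambda>_. eproc Ls t))\<^sup>2 \<le> d\<^sup>2"
        by (intro power_mono Ls two.cdist_nonneg step_process_V[OF T st] eproc_V[OF Ls(1) t])
    qed (use e T in \<open>simp add: d_def field_simps add_pos_nonneg\<close>)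
    have "upper_less T (\<lambda>t. (d2 (\<eta> t) (\<lambda>_. eproc Ls t))\<^sup>2) (2 * (e/4) + 2 * (e/4))"
    proof (rule upper_less_lin[OF k s2])
      fix t assume t: "t \<in> {0..T}"
      note v = V2[OF t] step_process_V[OF T st, of k t] eproc_V[OF Ls(1) t]
      show "(d2 (\<eta> t) (\<lambda>_. eproc Ls t))\<^sup>2 \<le> 2 * (d2 (step_process (S k) t) (\<eta> t))\<^sup>2 + 2 * (d2 (step_process (S k) t) (\<lambda>_. eproc Ls t))\<^sup>2"
        using d2_triangle_square[OF v] two.cdist_commute[OF v(1,2)] by simp
    qed auto
    then show "\<exists>Ls. elem T Ls \<and> upper_less T (\<lambda>t. (d2 (\<eta> t) (\<lambda>_. eproc Ls t))\<^sup>2) e" using Ls(1) by auto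
  qed
qed

lemma has_int_has_G_integral:
  assumes A: "integrator A C T" and T: "0 \<le> T" and I: "has_int A T \<eta> I" and q: "q = 1 \<or> q = 2"
  shows "has_G_integral E q A T \<eta> I"
proof -
  have "\<exists>L. elem T L \<and> upper_less T (\<lambda>t. (d2 (\<eta> t) (\<lambda>_. eproc L t))\<^sup>2) (1 / real (Suc k)) \<and> d2 I (eint A L) < 1 / real (Suc k)" for k
    by (rule has_intD(4)[OF I]) simp
  then have "\<exists>L. \<forall>k. elem T (L k) \<and> upper_less T (\<lambda>t. (d2 (\<eta> t) (\<lambda>_. eproc (L k) t))\<^sup>2) (1 / real (Suc k)) \<and> d2 I (eint A (L k)) < 1 / real (Suc k)"
    by (intro choice allI)
  then obtain L where L: "\<And>k. elem T (L k)" "\<And>k. upper_less T (\<lambda>t. (d2 (\<eta> t) (\<lambda>_. eproc (L k) t))\<^sup>2) (1 / real (Suc k))"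
    "\<And>k. d2 I (eint A (L k)) < 1 / real (Suc k)" by blast
  have "\<exists>S. is_step E 2 T S \<and> (\<forall>t n. step_process S t n = eproc (L k) t) \<and> step_integral A S = eint A (L k)" for k
    by (rule elem_to_step[OF T L(1)[of k]]) blast
  then have "\<exists>S. \<forall>k. is_step E 2 T (S k) \<and> (\<forall>t n. step_process (S k) t n = eproc (L k) t) \<and> step_integral A (S k) = eint A (L k)"
    by (intro choice allI)
  then obtain S where S: "\<And>k. is_step E 2 T (S k)" "\<And>k t n. step_process (S k) t n = eproc (L k) t"
    "\<And>k. step_integral A (S k) = eint A (L k)" by blast
  have ap: "MG_approx E 2 T S \<eta>" by (rule MG_approx_of_small[OF T S(1,2) L(1) has_int_MG2[OF I] L(2)])
  have IV: "I \<in> V2" by (rule has_intD(2)[OF I])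
  have eV: "eint A (L k) \<in> V2" for k by (rule eint_V[OF A T L(1)])
  have norm: "0 \<le> LG_norm E q (\<lambda>n w. step_integral A (S k) n w - I n w) \<and> LG_norm E q (\<lambda>n w. step_integral A (S k) n w - I n w) \<le> 1 / real (Suc k)" for k
  proof -
    have "d2 (eint A (L k)) I \<le> 1 / real (Suc k)" using L(3)[of k] two.cdist_commute[OF IV eV] by (simp add: less_imp_le)
    moreover have "LG_norm E q (\<lambda>n w. step_integral A (S k) n w - I n w) \<le> d2 (eint A (L k)) I"
      using q d1_le_d2[OF eV IV] LG_norm_2[OF eV IV] LG_norm_1[OF V_V1[OF eV] V_V1[OF IV]] by (auto simp: S(3))
    ultimately show ?thesis by (auto simp: LG_norm_def)
  qed
  have "(\<lambda>k. LG_norm E q (\<lambda>n w. step_integral A (S k) n w - I n w)) \<longlonglongrightarrow> 0"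
    by (rule tendsto_sandwich[OF _ _ tendsto_const one_over_Suc_tendsto]) (use norm in \<open>auto intro!: always_eventually\<close>)
  moreover have "I \<in> LG E q L0ip" using q IV V_V1[OF IV] by (auto simp: LG_2_eq LG_1_eq)
  ultimately show ?thesis unfolding has_G_integral_def MG_iff_MG2[OF T] using has_int_MG2[OF I] ap by blast
qed

text \<open>
  An integral in the sense of \<open>has_G_integral\<close> agrees in the first-order norm with the one in
  the sense of \<open>has_int\<close>: along the step processes that define the former, both are close to
  integrals of elementary processes.
\<close>

lemma has_G_integral_has_int:
  assumes A: "integrator A C T" and T: "0 \<le> T" and I: "has_G_integral E q A T \<eta> I"
    and q: "q = 1 \<or> q = 2 \<and> (\<forall>S. is_step E 2 T S \<longrightarrow> step_integral A S \<in> V2)"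
  obtains I' where "has_int A T \<eta> I'" "I \<in> V1" "d1 I I' = 0"
proof -
  have X: "\<eta> \<in> MG2 T" using I unfolding has_G_integral_def MG_iff_MG2[OF T] by blast
  obtain I' where I': "has_int A T \<eta> I'" by (rule has_int_exists[OF A T X])
  obtain S where S: "MG_approx E 2 T S \<eta>" and lim: "(\<lambda>k. LG_norm E q (\<lambda>n w. step_integral A (S k) n w - I n w)) \<longlonglongrightarrow> 0"
    using I unfolding has_G_integral_def by blast
  have st: "is_step E 2 T (S k)" for k using S by (auto simp: MG_approx_def)
  have IV1: "I \<in> V1" using I q unfolding has_G_integral_def by (auto simp: LG_2_eq LG_1_eq V_V1)
  have AV: "A t \<in> V2" if "t \<in> {0..T}" for t using integratorD(2)[OF A that] adaptedD(1) by blast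
  have C0: "0 \<le> C" by (rule integratorD(1)[OF A])
  have sV1: "step_integral A (S k) \<in> V1" for k
    by (rule step_to_elem[OF T st[of k] zero_less_one AV])
  have norm: "d1 (step_integral A (S k)) I \<le> LG_norm E q (\<lambda>n w. step_integral A (S k) n w - I n w)" for k
    using q
  proof
    assume "q = 1" then show ?thesis using LG_norm_1[OF sV1 IV1] by simp
  next
    assume q2: "q = 2 \<and> (\<forall>S. is_step E 2 T S \<longrightarrow> step_integral A S \<in> V2)"
    then have "I \<in> V2" using I unfolding has_G_integral_def by (auto simp: LG_2_eq)
    moreover have "step_integral A (S k) \<in> V2" using q2 st by blast
    ultimately show ?thesis using q2 LG_norm_2 d1_le_d2 by simp
  qed
  have main: "d1 I I' \<le> 3 * e + sqrt (C * (3 * (e\<^sup>2 * T + e) + 6 * e))" if e: "0 < e" for e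
  proof -
    obtain M where M: "\<forall>k\<ge>M. upper_less T (\<lambda>t. (d2 (step_process (S k) t) (\<eta> t))\<^sup>2) e"
      using MG_approx_imp_small[OF T S MG2D(1)[OF X] e] by blast
    obtain M' where M': "\<forall>k\<ge>M'. LG_norm E q (\<lambda>n w. step_integral A (S k) n w - I n w) < e"
      using order_tendstoD(2)[OF lim e] unfolding eventually_sequentially by blast
    define k where "k = max M M'"
    have k: "upper_less T (\<lambda>t. (d2 (step_process (S k) t) (\<eta> t))\<^sup>2) e" "d1 (step_integral A (S k)) I < e"
      using M M' norm[of k] by (auto simp: k_def intro: le_less_trans)
    obtain Ls where Ls': "elem T Ls" "\<And>t. step_process (S k) t \<in> V2" "\<And>t. d2 (step_process (S k) t) (\<lambda>_. eproc Ls t) \<le> e"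
      "step_integral A (S k) \<in> V1" "eint A Ls \<in> V1" "d1 (step_integral A (S k)) (eint A Ls) \<le> e"
      by (rule step_to_elem[of T "S k" e A, OF T st[of k] e AV]) (assumption, rule that)
    note Ls = Ls'(1,3,5,6)
    obtain Ls' where Ls': "elem T Ls'" "upper_less T (\<lambda>t. (d2 (\<eta> t) (\<lambda>_. eproc Ls' t))\<^sup>2) e" "d2 I' (eint A Ls') < e" using has_intD(4)[OF I' e] by blast
    have s1: "upper_less T (\<lambda>t. (d2 (step_process (S k) t) (\<lambda>_. eproc Ls t))\<^sup>2) (e\<^sup>2 * T + e)"
    proof (rule upper_less_const[OF T])
      fix t assume t: "t \<in> {0..T}"
      show "(d2 (step_process (S k) t) (\<lambda>_. eproc Ls t))\<^sup>2 \<le> e\<^sup>2"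
        by (intro power_mono Ls two.cdist_nonneg step_process_V[OF T st] eproc_V[OF Ls(1) t])
    qed (use e in auto)
    have s2: "upper_less T (\<lambda>t. 3 * (d2 (step_process (S k) t) (\<eta> t))\<^sup>2 + 3 * (d2 (\<eta> t) (\<lambda>_. eproc Ls' t))\<^sup>2) (3 * e + 3 * e)"
      by (rule upper_less_lin[OF k(1) Ls'(2)]) auto
    have "upper_less T (\<lambda>t. (d2 (\<lambda>_. eproc Ls t) (\<lambda>_. eproc Ls' t))\<^sup>2) (3 * (e\<^sup>2 * T + e) + 1 * (3 * e + 3 * e))"
    proof (rule upper_less_lin[OF s1 s2])
      fix t assume t: "t \<in> {0..T}"
      note v = eproc_V[OF Ls(1) t] step_process_V[OF T st, of k t] MG2D(1)[OF X t] eproc_V[OF Ls'(1) t]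
      show "(d2 (\<lambda>_. eproc Ls t) (\<lambda>_. eproc Ls' t))\<^sup>2 \<le> 3 * (d2 (step_process (S k) t) (\<lambda>_. eproc Ls t))\<^sup>2 + 1 * (3 * (d2 (step_process (S k) t) (\<eta> t))\<^sup>2 + 3 * (d2 (\<eta> t) (\<lambda>_. eproc Ls' t))\<^sup>2)"
        using d2_triangle3_square[OF v] two.cdist_commute[OF v(1,2)] by simp
    qed auto
    then have "(d2 (eint A Ls) (eint A Ls'))\<^sup>2 \<le> C * (3 * (e\<^sup>2 * T + e) + 1 * (3 * e + 3 * e))" by (rule eint_dist[OF A T Ls(1) Ls'(1)])
    then have "d2 (eint A Ls) (eint A Ls') \<le> sqrt (C * (3 * (e\<^sup>2 * T + e) + 6 * e))" by (intro real_le_rsqrt) simp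
    moreover note eV = eint_V[OF A T Ls(1)] eint_V[OF A T Ls'(1)] has_intD(2)[OF I']
    note w = IV1 sV1[of k] V_V1[OF eV(1)] V_V1[OF eV(2)] V_V1[OF eV(3)]
    have "d1 I I' \<le> d1 (step_integral A (S k)) I + d1 (step_integral A (S k)) (eint A Ls) + d1 (eint A Ls) (eint A Ls') + d1 (eint A Ls') I'"
      using one.cdist_triangle[OF w(1,2,5)] one.cdist_triangle[OF w(2,3,5)] one.cdist_triangle[OF w(3,4,5)] one.cdist_commute[OF w(1,2)] by linarith
    ultimately show ?thesis using k(2) Ls(4) Ls'(3) d1_le_d2[OF eV(1,2)] d1_le_d2[OF eV(2,3)] two.cdist_commute[OF eV(2,3)] by linarith
  qed
  have "((\<lambda>e. 3 * e + sqrt (C * (3 * (e\<^sup>2 * T + e) + 6 * e))) \<longlongrightarrow> 3 * 0 + sqrt (C * (3 * (0\<^sup>2 * T + 0) + 6 * 0))) (at_right 0)"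
    by (intro tendsto_intros)
  moreover have "\<forall>\<^sub>F e in at_right 0. d1 I I' \<le> 3 * e + sqrt (C * (3 * (e\<^sup>2 * T + e) + 6 * e))"
    using eventually_at_right_less by (rule eventually_mono) (rule main)
  ultimately have "d1 I I' \<le> 3 * 0 + sqrt (C * (3 * (0\<^sup>2 * T + 0) + 6 * 0))"
    by (rule tendsto_lowerbound) simp
  then have "d1 I I' \<le> 0" by simp
  then have "d1 I I' = 0" using one.cdist_nonneg[OF IV1 V_V1[OF has_intD(2)[OF I']]] by linarith
  then show thesis using I' IV1 by (intro that)
qed

section \<open>The three integrators\<close>

lemma weighted_Cauchy_Schwarz:
  fixes x w :: "nat \<Rightarrow> real"
  assumes "\<And>j. j < N \<Longrightarrow> 0 \<le> w j" shows "(\<Sum>j<N. x j * w j)\<^sup>2 \<le> (\<Sum>j<N. w j) * (\<Sum>j<N. (x j)\<^sup>2 * w j)"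
proof -
  have "(\<Sum>j<N. sqrt (w j) * (x j * sqrt (w j)))\<^sup>2 \<le> (\<Sum>j<N. (sqrt (w j))\<^sup>2) * (\<Sum>j<N. (x j * sqrt (w j))\<^sup>2)"
    by (rule Cauchy_Schwarz_ineq_sum)
  moreover have "(\<Sum>j<N. sqrt (w j) * (x j * sqrt (w j))) = (\<Sum>j<N. x j * w j)"
    using assms by (intro sum.cong) (auto simp: algebra_simps)
  moreover have "(\<Sum>j<N. (sqrt (w j))\<^sup>2) = (\<Sum>j<N. w j)" using assms by (intro sum.cong) auto
  moreover have "(\<Sum>j<N. (x j * sqrt (w j))\<^sup>2) = (\<Sum>j<N. (x j)\<^sup>2 * w j)"
    using assms by (intro sum.cong) (auto simp: power_mult_distrib)
  ultimately show ?thesis by simp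
qed

text \<open>
  By the triangle inequality the norm of the sum is at most \<open>c\<close> times the weighted sum of the
  norms of the coefficients, and Cauchy-Schwarz with the lengths of the intervals as weights
  bounds its square.
\<close>

lemma integrator_bounded_variation:
  assumes A: "\<And>t. t \<in> {0..T} \<Longrightarrow> A t \<in> adapted t" and c: "0 \<le> c" and T: "0 \<le> T"
    and inc: "\<And>Z u v. Z \<in> bL0 u \<Longrightarrow> u \<le> v \<Longrightarrow> v \<le> T \<Longrightarrow> d2 (\<lambda>n w. Z w * (A v n w - A u n w)) (\<lambda>_ _. 0) \<le> c * (v - u) * n2 Z"
  shows "integrator A (c\<^sup>2 * T) T"
  unfolding integrator_def
proof (intro conjI ballI allI impI A)
  show "0 \<le> c\<^sup>2 * T" using c T by simp
  fix t N \<tau> Z assume t: "t \<le> T" and part: "is_partition t N \<tau>" and Z: "\<forall>j<N. Z j \<in> bL0 (\<tau> j)"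
  let ?s = "\<lambda>j n w. Z j w * (A (\<tau> (Suc j)) n w - A (\<tau> j) n w)" and ?S = "\<lambda>n w. \<Sum>j<N. Z j w * (A (\<tau> (Suc j)) n w - A (\<tau> j) n w)"
  have \<tau>: "0 \<le> \<tau> j" "\<tau> j \<le> \<tau> (Suc j)" "\<tau> (Suc j) \<le> T" if "j < N" for j
    using bL0_time_nonneg Z that is_partition_mono[OF part, of j "Suc j"] is_partition_mono[OF part, of "Suc j" N] part t
    unfolding is_partition_def by (cases "Suc j = N"; force)+
  have V2: "(?s j) \<in> V2" if j: "j < N" for j
  proof -
    have z: "Z j \<in> bL0 (\<tau> j)" using Z j by blast
    then obtain M where M: "\<And>w. \<bar>Z j w\<bar> \<le> M" by (rule bL0_bounded) blast
    have "A (\<tau> (Suc j)) \<in> V2" "A (\<tau> j) \<in> V2" using A[of "\<tau> j"] A[of "\<tau> (Suc j)"] \<tau>[OF j] adaptedD(1) by auto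
    then show ?thesis by (intro two.cseq_bmult[OF bL0_L0ip[OF z] M] V_intros)
  qed
  have "d2 ?S (\<lambda>n w. \<Sum>j<N. 0) \<le>
     (\<Sum>j<N. d2 (?s j) (\<lambda>n w. 0))"
    using two.cdist_sum_le[of "{..<N}" ?s "\<lambda>j n w. 0"] V2 V_zero by simp
  also have "\<dots> \<le> (\<Sum>j<N. c * (\<tau> (Suc j) - \<tau> j) * n2 (Z j))"
    using Z \<tau> by (intro sum_mono inc) auto
  also have "\<dots> = c * (\<Sum>j<N. n2 (Z j) * (\<tau> (Suc j) - \<tau> j))" by (simp add: sum_distrib_left algebra_simps)
  finally have le: "d2 ?S (\<lambda>_ _. 0) \<le> c * (\<Sum>j<N. n2 (Z j) * (\<tau> (Suc j) - \<tau> j))" by simp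
  have sV: "?S \<in> V2"
    using two.cdist_sum_le[of "{..<N}" ?s "\<lambda>j n w. 0"] V2 V_zero by simp
  have tel: "(\<Sum>j<N. \<tau> (Suc j) - \<tau> j) = t" using sum_lessThan_telescope[of \<tau> N] part by (simp add: is_partition_def)
  have "(d2 ?S (\<lambda>_ _. 0))\<^sup>2 \<le> (c * (\<Sum>j<N. n2 (Z j) * (\<tau> (Suc j) - \<tau> j)))\<^sup>2"
    by (intro power_mono le two.cdist_nonneg sV V_zero)
  also have "\<dots> = c\<^sup>2 * (\<Sum>j<N. n2 (Z j) * (\<tau> (Suc j) - \<tau> j))\<^sup>2" by (simp add: power_mult_distrib)
  also have "\<dots> \<le> c\<^sup>2 * (t * (\<Sum>j<N. (n2 (Z j))\<^sup>2 * (\<tau> (Suc j) - \<tau> j)))"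
    using weighted_Cauchy_Schwarz[of N "\<lambda>j. \<tau> (Suc j) - \<tau> j" "\<lambda>j. n2 (Z j)"] \<tau> tel by (intro mult_left_mono) auto
  also have "\<dots> \<le> c\<^sup>2 * (T * (\<Sum>j<N. (n2 (Z j))\<^sup>2 * (\<tau> (Suc j) - \<tau> j)))"
    using t \<tau> by (intro mult_left_mono mult_right_mono sum_nonneg) auto
  finally show "(d2 ?S (\<lambda>_ _. 0))\<^sup>2
      \<le> c\<^sup>2 * T * (\<Sum>j<N. (n2 (Z j))\<^sup>2 * (\<tau> (Suc j) - \<tau> j))" by (simp add: mult.assoc)
qed

lemma integrator_dt: "0 \<le> T \<Longrightarrow> integrator (\<lambda>t n w. t) (1\<^sup>2 * T) T"
proof (rule integrator_bounded_variation)
  fix Z u v assume Z: "Z \<in> bL0 u" and uv: "u \<le> (v::real)"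
  have "d2 (\<lambda>n w. Z w * (v - u)) (\<lambda>_ _. 0) = n2 (\<lambda>w. (v - u) * Z w)" by (simp add: cdist_def mult.commute)
  also have "\<dots> = (v - u) * n2 Z" using n2_scale[OF bL0_L0ip[OF Z]] uv by simp
  finally show "d2 (\<lambda>n w. Z w * (v - u)) (\<lambda>_ _. 0) \<le> 1 * (v - u) * n2 Z" by simp
qed (auto intro: adapted_const)

lemma L0ip_uptoD: "Z \<in> L0ip_upto u \<Longrightarrow> Z \<in> L0ip"
  using L0ip_upto_subset by blast

lemma B_L0ip: "0 \<le> u \<Longrightarrow> B u \<in> L0ip"
  using B_in_L0ip_upto[of u u] L0ip_uptoD by simp

lemma n2_mult_dB:
  assumes Z: "Z \<in> L0ip_upto u" and uv: "u \<le> v"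
  shows "n2 (\<lambda>w. Z w * (B v w - B u w)) = n2 Z * sqrt (v - u)"
proof -
  have u: "0 \<le> u" by (rule L0ip_upto_time_nonneg[OF Z])
  have "E (\<lambda>w. (Z w * (B v w - B u w))\<^sup>2) = (v - u) * E (\<lambda>w. (Z w)\<^sup>2)"
    using increment_square[OF stable_power[OF stable_L0ip_upto[OF u] Z, of 2] _ u uv] by (simp add: power_mult_distrib)
  then show ?thesis by (simp add: n2_def real_sqrt_mult mult.commute)
qed

text \<open>
  The mixed terms have expectation \<open>0\<close> because the increment has mean \<open>0\<close> against every factor
  known at its start. Subadditivity leaves an inequality.
\<close>

lemma dB_isometry:
  assumes "\<And>j. j < N \<Longrightarrow> Z j \<in> L0ip_upto (\<tau> j)" "\<And>j. j < N \<Longrightarrow> \<tau> j \<le> \<tau> (Suc j)" "0 \<le> \<tau> 0"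
  shows "(\<lambda>w. \<Sum>j<N. Z j w * (B (\<tau> (Suc j)) w - B (\<tau> j) w)) \<in> L0ip_upto (\<tau> N) \<and>
     E (\<lambda>w. (\<Sum>j<N. Z j w * (B (\<tau> (Suc j)) w - B (\<tau> j) w))\<^sup>2) \<le> (\<Sum>j<N. (n2 (Z j))\<^sup>2 * (\<tau> (Suc j) - \<tau> j))"
  using assms
proof (induction N)
  case 0 then show ?case using const[of 0] by (simp add: stable_const stable_L0ip_upto)
next
  case (Suc N)
  define S where "S w = (\<Sum>j<N. Z j w * (B (\<tau> (Suc j)) w - B (\<tau> j) w))" for w
  define D where "D w = B (\<tau> (Suc N)) w - B (\<tau> N) w" for w
  have ih: "S \<in> L0ip_upto (\<tau> N)" "E (\<lambda>w. (S w)\<^sup>2) \<le> (\<Sum>j<N. (n2 (Z j))\<^sup>2 * (\<tau> (Suc j) - \<tau> j))"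
    using Suc unfolding S_def by auto
  have Z: "Z N \<in> L0ip_upto (\<tau> N)" using Suc.prems by auto
  have u: "0 \<le> \<tau> N" by (rule L0ip_upto_time_nonneg[OF Z])
  have uv: "\<tau> N \<le> \<tau> (Suc N)" using Suc.prems by auto
  have D: "D \<in> L0ip_upto (\<tau> (Suc N))" unfolding D_def
    using u uv by (intro stable_diff stable_L0ip_upto B_in_L0ip_upto) auto
  have up: "S \<in> L0ip_upto (\<tau> (Suc N))" "Z N \<in> L0ip_upto (\<tau> (Suc N))" using ih Z L0ip_upto_mono[OF uv] by auto
  have eq: "(\<lambda>w. \<Sum>j<Suc N. Z j w * (B (\<tau> (Suc j)) w - B (\<tau> j) w)) = (\<lambda>w. S w + Z N w * D w)" by (intro ext) (simp add: S_def D_def)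
  note L = L0ip_uptoD[OF ih(1)] L0ip_uptoD[OF Z] L0ip_uptoD[OF D]
  have "E (\<lambda>w. (S w + Z N w * D w)\<^sup>2) = E (\<lambda>w. ((S w)\<^sup>2 + (Z N w)\<^sup>2 * (D w)\<^sup>2) + (2 * S w * Z N w) * D w)"
    by (intro arg_cong[of _ _ E] ext) (simp add: power2_eq_square algebra_simps)
  also have "\<dots> \<le> E (\<lambda>w. (S w)\<^sup>2 + (Z N w)\<^sup>2 * (D w)\<^sup>2) + E (\<lambda>w. (2 * S w * Z N w) * D w)"
    by (intro E_add_le L0_intros L)
  also have "E (\<lambda>w. (2 * S w * Z N w) * D w) = 0" unfolding D_def
    using uv u ih(1) Z by (intro increment_mean stable_mult stable_const stable_L0ip_upto) auto
  also have "E (\<lambda>w. (S w)\<^sup>2 + (Z N w)\<^sup>2 * (D w)\<^sup>2) \<le> E (\<lambda>w. (S w)\<^sup>2) + E (\<lambda>w. (Z N w)\<^sup>2 * (D w)\<^sup>2)"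
    by (intro E_add_le L0_intros L)
  also have "E (\<lambda>w. (Z N w)\<^sup>2 * (D w)\<^sup>2) = (n2 (Z N))\<^sup>2 * (\<tau> (Suc N) - \<tau> N)" unfolding D_def
    using increment_square[OF stable_power[OF stable_L0ip_upto[OF u] Z, of 2] _ u uv] n2_square[OF L(2)] by simp
  finally have "E (\<lambda>w. (S w + Z N w * D w)\<^sup>2) \<le> (\<Sum>j<Suc N. (n2 (Z j))\<^sup>2 * (\<tau> (Suc j) - \<tau> j))" using ih(2) by simp
  moreover have "(\<lambda>w. S w + Z N w * D w) \<in> L0ip_upto (\<tau> (Suc N))"
    using u uv by (intro stable_add stable_mult stable_L0ip_upto up D) auto
  ultimately show ?case using eq fun_cong[OF eq] by simp
qed

lemma integrator_dB: "integrator (\<lambda>t n w. B t w) 1 T"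
  unfolding integrator_def
proof (intro conjI ballI allI impI)
  show "(\<lambda>n w. B t w) \<in> adapted t" if "t \<in> {0..T}" for t
    using adapted_L0ip_upto[OF B_in_L0ip_upto[of t t]] that by simp
  fix t N \<tau> Z assume part: "is_partition t N \<tau>" and Z: "\<forall>j<N. Z j \<in> bL0 (\<tau> j)"
  have iso: "(\<lambda>w. \<Sum>j<N. Z j w * (B (\<tau> (Suc j)) w - B (\<tau> j) w)) \<in> L0ip_upto (\<tau> N) \<and>
     E (\<lambda>w. (\<Sum>j<N. Z j w * (B (\<tau> (Suc j)) w - B (\<tau> j) w))\<^sup>2) \<le> (\<Sum>j<N. (n2 (Z j))\<^sup>2 * (\<tau> (Suc j) - \<tau> j))"
    by (rule dB_isometry) (use Z bL0_L0ip_upto is_partition_mono[OF part, of j "Suc j" for j] part in \<open>auto simp: is_partition_def intro: less_imp_le\<close>)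
  show "(d2 (\<lambda>n w. \<Sum>j<N. Z j w * (B (\<tau> (Suc j)) w - B (\<tau> j) w)) (\<lambda>_ _. 0))\<^sup>2 \<le> 1 * (\<Sum>j<N. (n2 (Z j))\<^sup>2 * (\<tau> (Suc j) - \<tau> j))"
    using iso n2_square[OF L0ip_uptoD[OF conjunct1[OF iso]]] by (simp add: cdist_def)
qed simp

lemma V_mult_dB:
  assumes X: "X \<in> cseq n2 (L0ip_upto u)" and uv: "u \<le> v" shows "(\<lambda>n w. X n w * (B v w - B u w)) \<in> V2"
proof (rule two.cseqI)
  note XL = two.cseqD(1)[OF X]
  have u: "0 \<le> u" by (rule L0ip_upto_time_nonneg[OF XL])
  show "(\<lambda>w. X n w * (B v w - B u w)) \<in> L0ip" for n using u uv by (intro L0_intros L0ip_uptoD[OF XL] B_L0ip) auto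
  fix e :: real assume e: "0 < e"
  define d where "d = e / (sqrt (v - u) + 1)"
  have pos: "0 < sqrt (v - u) + 1" using uv by (simp add: add_nonneg_pos)
  have d: "0 < d" "(sqrt (v - u) + 1) * d = e" using e pos by (auto simp: d_def)
  obtain M where M: "\<forall>m\<ge>M. \<forall>n\<ge>M. n2 (\<lambda>w. X m w - X n w) < d" using two.cseqD(2)[OF X d(1)] by blast
  have "n2 (\<lambda>w. X m w * (B v w - B u w) - X n w * (B v w - B u w)) < e" if "m \<ge> M" "n \<ge> M" for m n
  proof -
    have "n2 (\<lambda>w. X m w * (B v w - B u w) - X n w * (B v w - B u w)) = n2 (\<lambda>w. (X m w - X n w) * (B v w - B u w))"
      by (simp add: left_diff_distrib)
    also have "\<dots> = n2 (\<lambda>w. X m w - X n w) * sqrt (v - u)" by (rule n2_mult_dB[OF _ uv]) (intro stable_diff stable_L0ip_upto u XL)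
    also have "\<dots> \<le> d * sqrt (v - u)" using M that uv by (intro mult_right_mono) (auto intro: less_imp_le)
    also have "\<dots> < (sqrt (v - u) + 1) * d" using d by (simp add: algebra_simps)
    finally show ?thesis using d by simp
  qed
  then show "\<exists>M. \<forall>m\<ge>M. \<forall>n\<ge>M. n2 (\<lambda>w. X m w * (B v w - B u w) - X n w * (B v w - B u w)) < e" by blast
qed

lemma step_integral_V:
  assumes S: "is_step E 2 T S" and A: "A = (\<lambda>t n w. t) \<or> A = (\<lambda>t n w. B t w)"
  shows "step_integral A S \<in> V2"
proof -
  obtain N \<tau> \<xi> where SS: "S = (N, \<tau>, \<xi>)" by (cases S) auto
  have \<xi>: "\<xi> j \<in> cseq n2 (L0ip_upto (\<tau> j))" "\<tau> j \<le> \<tau> (Suc j)" if "j < N" for j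
    using S that unfolding SS by (auto simp: LG_2_eq[OF L0ip_upto_subset])
  have t: "(\<lambda>n w. \<xi> j n w * (A (\<tau> (Suc j)) n w - A (\<tau> j) n w)) \<in> V2" if j: "j < N" for j
    using A
  proof
    assume "A = (\<lambda>t n w. t)"
    then show ?thesis using two.cseq_scale[of "\<xi> j" "\<tau> (Suc j) - \<tau> j"] two.cseq_mono[OF L0ip_upto_subset] \<xi>(1)[OF j]
      by (auto simp: mult.commute)
  next
    assume "A = (\<lambda>t n w. B t w)"
    then show ?thesis using V_mult_dB[OF \<xi>[OF j]] by simp
  qed
  have "step_integral A S = (\<lambda>n w. \<Sum>j<N. \<xi> j n w * (A (\<tau> (Suc j)) n w - A (\<tau> j) n w))" by (intro ext) (simp add: SS)
  then show ?thesis using two.cdist_sum_le[of "{..<N}" "\<lambda>j n w. \<xi> j n w * (A (\<tau> (Suc j)) n w - A (\<tau> j) n w)" "\<lambda>j n w. 0"] t V_zero by simp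
qed

end

section \<open>Processes continuous in mean square\<close>

lemma partition_cover:
  fixes \<tau> :: "nat \<Rightarrow> real"
  shows "\<tau> 0 \<le> t \<Longrightarrow> t < \<tau> N \<Longrightarrow> \<exists>k<N. \<tau> k \<le> t \<and> t < \<tau> (Suc k)"
proof (induction N)
  case (Suc N) then show ?case by (cases "t < \<tau> N") (auto simp: less_Suc_eq)
qed simp

lemma partition_sum_eq:
  assumes p: "is_partition T N \<tau>" and k: "k < N" "\<tau> k \<le> t" "t < \<tau> (Suc k)"
  shows "(\<Sum>j<N. f j * indicator {\<tau> j..<\<tau> (Suc j)} t) = (f k :: real)"
proof -
  have one: "(\<Sum>j<N. (if j = k then 1 else 0) * indicator {\<tau> j..<\<tau> (Suc j)} t) = (1::real)"
  proof -
    have "(\<Sum>j<N. (if j = k then 1 else 0) * indicator {\<tau> j..<\<tau> (Suc j)} t) = (\<Sum>j<N. if j = k then (1::real) else 0)"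
      by (rule sum.cong) (use k in auto)
    then show ?thesis using k by simp
  qed
  show ?thesis using partition_sum_cases[OF p, of t]
  proof
    assume "\<forall>f :: nat \<Rightarrow> real. (\<Sum>j<N. f j * indicator {\<tau> j..<\<tau> (Suc j)} t) = 0"
    then show ?thesis using one by (metis zero_neq_one)
  next
    assume "\<exists>k<N. \<tau> k \<le> t \<and> t < \<tau> (Suc k) \<and> (\<forall>f :: nat \<Rightarrow> real. (\<Sum>j<N. f j * indicator {\<tau> j..<\<tau> (Suc j)} t) = f k)"
    then obtain l where l: "\<And>f :: nat \<Rightarrow> real. (\<Sum>j<N. f j * indicator {\<tau> j..<\<tau> (Suc j)} t) = f l" by blast
    have "l = k" using l[of "\<lambda>j. if j = k then 1 else 0"] one by (auto split: if_splits)
    then show ?thesis using l by simp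
  qed
qed

lemma uniform_partition:
  assumes "0 < T" "0 < N" shows "is_partition T N (\<lambda>i. real i * T / real N)"
  using assms by (auto simp: is_partition_def field_simps)

context G_Brownian_expectation
begin

text \<open>
  On a fine uniform partition of \<open>[u,v]\<close> the process stays close to its values at the left
  endpoints, which are in turn close to bounded ones.
\<close>

lemma MG2_continuous_piece:
  assumes uv: "0 \<le> u" "u \<le> v" "v \<le> T"
    and X: "\<And>t. t \<in> {u..v} \<Longrightarrow> X t \<in> adapted t" and V2: "\<And>t. t \<in> {0..T} \<Longrightarrow> X t \<in> V2"
    and cont: "\<And>e. 0 < e \<Longrightarrow> \<exists>\<delta>>0. \<forall>s\<in>{u..v}. \<forall>t\<in>{u..v}. \<bar>s - t\<bar> < \<delta> \<longrightarrow> d2 (X s) (X t) < e"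
  shows "(\<lambda>t n w. X t n w * indicator {u..<v} t) \<in> MG2 T"
proof (cases "u = v")
  case True
  then show ?thesis using MG2_zero[of T] uv by simp
next
  case False
  then have uv': "u < v" using uv by simp
  let ?X = "\<lambda>t n w. X t n w * indicator {u..<v} t"
  show ?thesis unfolding MG2_def
  proof (intro CollectI conjI ballI allI impI)
    show "(?X t) \<in> V2" if "t \<in> {0..T}" for t by (rule cut_V[OF V2[OF that]])
    fix e :: real assume e: "0 < e"
    define d where "d = sqrt (e / (8 * (T + 1)))"
    have T: "0 \<le> T" using uv by simp
    have d: "0 < d" using e T by (simp add: d_def)
    obtain \<delta> where \<delta>: "0 < \<delta>" "\<And>s t. s \<in> {u..v} \<Longrightarrow> t \<in> {u..v} \<Longrightarrow> \<bar>s - t\<bar> < \<delta> \<Longrightarrow> d2 (X s) (X t) < d" using cont[OF d] by blast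
    obtain N :: nat where N: "(v - u) / \<delta> < real N" using reals_Archimedean2 by blast
    have N0: "0 < N" using N uv' \<delta>(1) by (smt (verit) divide_pos_pos of_nat_0_less_iff)
    have NN: "(v - u) / real N < \<delta>" using N N0 \<delta>(1) by (simp add: field_simps)
    define \<tau> where "\<tau> i = real i * (v - u) / real N" for i
    have part: "is_partition (v - u) N \<tau>" using uniform_partition[of "v - u" N] uv' N0 by (simp add: \<tau>_def[abs_def])
    have \<tau>uv: "u + \<tau> j \<in> {u..v}" if "j \<le> N" for j
    proof -
      have "real j * (v - u) / real N \<le> real N * (v - u) / real N" using that uv by (intro divide_right_mono mult_right_mono) auto
      moreover have "0 \<le> real j * (v - u) / real N" using uv by simp
      ultimately show ?thesis using N0 uv by (simp add: \<tau>_def)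
    qed
    have step: "\<tau> (Suc j) - \<tau> j < \<delta>" for j using NN by (simp add: \<tau>_def diff_divide_distrib[symmetric] algebra_simps)
    have "\<exists>Z. Z \<in> bL0 (u + \<tau> j) \<and> d2 (X (u + \<tau> j)) (\<lambda>_. Z) < d" if "j \<le> N" for j
      using adaptedD(2)[OF X[OF \<tau>uv[OF that]] d] by blast
    then obtain Z where Z: "\<And>j. j \<le> N \<Longrightarrow> Z j \<in> bL0 (u + \<tau> j)" "\<And>j. j \<le> N \<Longrightarrow> d2 (X (u + \<tau> j)) (\<lambda>_. Z j) < d" by metis
    define Ls where "Ls = map (\<lambda>j. (Z j, u + \<tau> j, u + \<tau> (Suc j))) [0..<N]"
    have eproc: "eproc Ls t w = (\<Sum>j<N. Z j w * indicator {\<tau> j..<\<tau> (Suc j)} (t - u))" for t w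
      by (simp add: eproc_def Ls_def comp_def interv_sum_list_conv_sum_set_nat atLeast0LessThan indicator_def algebra_simps)
    have "u + \<tau> (Suc j) \<le> T" if "j < N" for j using \<tau>uv[of "Suc j"] that uv by auto
    then have elem: "elem T Ls" unfolding Ls_def elem_def
      using Z(1) is_partition_mono[OF part, of j "Suc j" for j] by (auto simp: Suc_le_eq intro: less_imp_le)
    have "upper_less T (\<lambda>t. (d2 (?X t) (\<lambda>_. eproc Ls t))\<^sup>2) e"
    proof (rule upper_less_const[OF T])
      fix t assume t: "t \<in> {0..T}"
      have "d2 (?X t) (\<lambda>_. eproc Ls t) \<le> 2 * d"
      proof (cases "t \<in> {u..<v}")
        case True
        then obtain k where k: "k < N" "\<tau> k \<le> t - u" "t - u < \<tau> (Suc k)"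
          using partition_cover[of \<tau> "t - u" N] part by (auto simp: is_partition_def)
        have e: "eproc Ls t = Z k" by (intro ext) (simp add: eproc partition_sum_eq[OF part k])
        have kN: "k \<le> N" using k by simp
        have "d2 (X t) (\<lambda>_. Z k) \<le> d2 (X t) (X (u + \<tau> k)) + d2 (X (u + \<tau> k)) (\<lambda>_. Z k)"
          using \<tau>uv[OF kN] uv by (intro two.cdist_triangle V2 t V_const[OF bL0_L0ip[OF Z(1)[OF kN]]]) auto
        also have "d2 (X t) (X (u + \<tau> k)) < d"
          using k step[of k] True \<tau>uv[OF kN] by (intro \<delta>(2)) auto
        finally show ?thesis using True Z(2)[OF kN] by (simp add: e)
      next
        case False
        have e: "eproc Ls t = (\<lambda>_. 0)"
        proof (intro ext)
          fix w
          have "indicator {\<tau> j..<\<tau> (Suc j)} (t - u) = (0::real)" if "j < N" for j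
            using False \<tau>uv[of j] \<tau>uv[of "Suc j"] that by (auto simp: indicator_def)
          then show "eproc Ls t w = 0" by (simp add: eproc)
        qed
        show ?thesis using False d by (simp add: e two.cdist_self)
      qed
      then show "(d2 (?X t) (\<lambda>_. eproc Ls t))\<^sup>2 \<le> (2 * d)\<^sup>2"
        by (intro power_mono two.cdist_nonneg cut_V V2 t eproc_V[OF elem t])
    next
      show "(2 * d)\<^sup>2 * T < e" using e T by (simp add: d_def power_mult_distrib field_simps add_pos_nonneg)
    qed
    then show "\<exists>Ls. elem T Ls \<and> upper_less T (\<lambda>t. (d2 (?X t) (\<lambda>_. eproc Ls t))\<^sup>2) e" using elem by blast
  qed
qed

lemma MG2_continuous:
  assumes T: "0 \<le> T" and X: "\<And>t. t \<in> {0..T} \<Longrightarrow> X t \<in> adapted t"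
    and cont: "\<And>e. 0 < e \<Longrightarrow> \<exists>\<delta>>0. \<forall>s\<in>{0..T}. \<forall>t\<in>{0..T}. \<bar>s - t\<bar> < \<delta> \<longrightarrow> d2 (X s) (X t) < e"
  shows "X \<in> MG2 T"
proof (rule MG2_spike)
  show "(\<lambda>t n w. X t n w * indicator {0..<T} t) \<in> MG2 T"
    by (rule MG2_continuous_piece[OF order_refl T order_refl X _ cont]) (use adaptedD(1)[OF X] in auto)
  show "negligible {T}" by simp
  show "X t \<in> V2" if "t \<in> {0..T}" for t using adaptedD(1)[OF X[OF that]] .
  show "d2 (X t) (\<lambda>n w. X t n w * indicator {0..<T} t) = 0" if "t \<in> {0..T} - {T}" for t
    using that by (simp add: two.cdist_self indicator_def)
qed (rule T)

section \<open>The quadratic variation\<close>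

abbreviation "dB \<equiv> (\<lambda>t (n::nat) w. B t w)"

lemma d2_B: "0 \<le> s \<Longrightarrow> s \<le> t \<Longrightarrow> d2 (\<lambda>_. B t) (\<lambda>_. B s) = sqrt (t - s)"
  using n2_mult_dB[of "\<lambda>_. 1" s t] by (simp add: two.cdist_const n2_const stable_const stable_L0ip_upto)

lemma B_adapted: "0 \<le> t \<Longrightarrow> (\<lambda>n. B t) \<in> adapted t"
  by (rule adapted_L0ip_upto[OF B_in_L0ip_upto]) auto

lemma B_MG2: assumes T: "0 \<le> T" shows "dB \<in> MG2 T"
proof (rule MG2_continuous[OF T])
  show "(\<lambda>n. B t) \<in> adapted t" if "t \<in> {0..T}" for t using that by (intro B_adapted) auto
  fix e :: real assume e: "0 < e"
  have "d2 (\<lambda>_. B s) (\<lambda>_. B t) < e" if "s \<in> {0..T}" "t \<in> {0..T}" "\<bar>s - t\<bar> < e\<^sup>2" for s t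
  proof -
    have "d2 (\<lambda>_. B s) (\<lambda>_. B t) = sqrt \<bar>s - t\<bar>"
      using d2_B[of s t] d2_B[of t s] that two.cdist_commute[OF V_const[OF B_L0ip] V_const[OF B_L0ip], of s t] by (cases "s \<le> t") auto
    also have "\<dots> < e" using that(3) e by (simp add: real_less_lsqrt)
    finally show ?thesis .
  qed
  then show "\<exists>\<delta>>0. \<forall>s\<in>{0..T}. \<forall>t\<in>{0..T}. \<bar>s - t\<bar> < \<delta> \<longrightarrow> d2 (\<lambda>_. B s) (\<lambda>_. B t) < e"
    using e by (intro exI[of _ "e\<^sup>2"]) auto
qed

text \<open>
  The integral \<open>\<integral> B dB\<close> up to \<open>t\<close> in the representative that the definition of \<open>QV\<close> selects.
\<close>

definition BdB :: "real \<Rightarrow> rv" where "BdB t = (SOME J. has_dB_integral E t dB J)"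

lemma QV_eq: "QV E t = (\<lambda>n w. (B t w)\<^sup>2 - 2 * BdB t n w)"
  by (simp add: QV_def BdB_def)

lemma has_int_BdB: assumes t: "0 \<le> t" shows "has_int dB t dB (BdB t)"
proof -
  obtain I where I: "has_int dB t dB I" by (rule has_int_exists[OF integrator_dB t B_MG2[OF t]])
  have "has_dB_integral E t dB I" unfolding has_dB_integral_def by (rule has_int_has_G_integral[OF integrator_dB t I]) simp
  then have h: "has_dB_integral E t dB (BdB t)" unfolding BdB_def by (rule someI[of "has_dB_integral E t dB" I])
  obtain I' where I': "has_int dB t dB I'" "d1 (BdB t) I' = 0"
    by (rule has_G_integral_has_int[OF integrator_dB t h[unfolded has_dB_integral_def]]) (use step_integral_V in auto)
  have V2: "BdB t \<in> V2" using h by (auto simp: has_dB_integral_def has_G_integral_def LG_2_eq)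
  have "d2 (BdB t) I' = 0" by (rule d1_zero_imp_d2_zero[OF V2 has_intD(2)[OF I'(1)] I'(2)])
  then have z: "d2 I' (BdB t) = 0" using two.cdist_commute[OF V2 has_intD(2)[OF I'(1)]] by simp
  show ?thesis
    by (rule has_int_cong[OF integrator_dB t I'(1) negligible_empty _ _ V2 z]) (use adaptedD(1)[OF B_adapted] two.cdist_self in auto)
qed

lemma has_int_dB_elem:
  assumes Z: "Z \<in> L0ip_upto u" and uv: "u \<le> v" "v \<le> T"
  shows "has_int dB T (\<lambda>t n w. Z w * indicator {u..<v} t) (\<lambda>n w. Z w * (B v w - B u w))"
  unfolding has_int_def
proof (intro conjI ballI allI impI)
  let ?Z = "\<lambda>t n w. Z w * indicator {u..<v} t" and ?I = "\<lambda>n w. Z w * (B v w - B u w)"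
  have u: "0 \<le> u" by (rule L0ip_upto_time_nonneg[OF Z])
  have T: "0 \<le> T" using u uv by simp
  have ZL: "Z \<in> L0ip" by (rule L0ip_uptoD[OF Z])
  have "Z \<in> L0ip_upto T" using Z L0ip_upto_mono[of u T] uv by auto
  then show "?I \<in> adapted T"
    using u uv by (intro adapted_L0ip_upto stable_mult stable_diff stable_L0ip_upto B_in_L0ip_upto) auto
  show "(?Z t) \<in> V2" for t by (rule cut_V[OF V_const[OF ZL]])
  fix e :: real assume e: "0 < e"
  define d where "d = min (sqrt (e / (2 * (T + 1)))) (e / (sqrt T + 1))"
  have d: "0 < d" using e T by (simp add: d_def add_nonneg_pos)
  obtain R where R: "(\<lambda>w. max (-R) (min R (Z w))) \<in> bL0 u" "n2 (\<lambda>w. Z w - max (-R) (min R (Z w))) < d"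
    using bL0_truncation[OF Z d] by blast
  define W where "W = (\<lambda>w. max (-R) (min R (Z w)))"
  have W: "W \<in> bL0 u" "n2 (\<lambda>w. Z w - W w) < d" using R by (auto simp: W_def)
  have WL: "W \<in> L0ip" by (rule bL0_L0ip[OF W(1)])
  define Ls where "Ls = [(W, u, v)]"
  have Ls: "elem T Ls" using W uv by (simp add: Ls_def elem_Cons)
  have eproc: "(\<lambda>_::nat. eproc Ls t) = (\<lambda>n w. W w * indicator {u..<v} t)" for t by (intro ext) (simp add: Ls_def eproc_Cons)
  have eint: "eint dB Ls = (\<lambda>n w. W w * (B v w - B u w))" by (intro ext) (simp add: Ls_def eint_Cons)
  have n0: "0 \<le> n2 (\<lambda>w. Z w - W w)" by (intro n2_nonneg L0_intros ZL WL)
  have "upper_less T (\<lambda>t. (d2 (?Z t) (\<lambda>_. eproc Ls t))\<^sup>2) e"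
  proof (rule upper_less_const[OF T])
    fix t assume "t \<in> {0..T}"
    have "d2 (?Z t) (\<lambda>_. eproc Ls t) \<le> 1 * d2 (\<lambda>n. Z) (\<lambda>n. W)"
      unfolding eproc by (rule two.cdist_mono) (auto intro: cut_V V_const ZL WL V_zero simp: indicator_def)
    also have "\<dots> \<le> d" using W(2) by (simp add: two.cdist_const)
    finally have le: "d2 (?Z t) (\<lambda>_. eproc Ls t) \<le> d" .
    have "0 \<le> d2 (?Z t) (\<lambda>_. eproc Ls t)"
      unfolding eproc by (intro two.cdist_nonneg cut_V V_const ZL WL)
    then show "(d2 (?Z t) (\<lambda>_. eproc Ls t))\<^sup>2 \<le> d\<^sup>2" using le by (intro power_mono) auto
  next
    have "d\<^sup>2 \<le> (sqrt (e / (2 * (T + 1))))\<^sup>2" using d by (intro power_mono) (auto simp: d_def)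
    also have "\<dots> = e / (2 * (T + 1))" using e T by simp
    finally have "d\<^sup>2 * T \<le> e / (2 * (T + 1)) * T" using T by (intro mult_right_mono)
    also have "\<dots> < e" using e T by (simp add: field_simps add_nonneg_pos)
    finally show "d\<^sup>2 * T < e" .
  qed
  moreover have "d2 ?I (eint dB Ls) < e"
  proof -
    have Wu: "(\<lambda>w. Z w - W w) \<in> L0ip_upto u" by (intro stable_diff stable_L0ip_upto u Z bL0_L0ip_upto W)
    have "d2 ?I (eint dB Ls) = n2 (\<lambda>w. (Z w - W w) * (B v w - B u w))"
      unfolding eint by (simp add: cdist_def left_diff_distrib)
    also have "\<dots> = n2 (\<lambda>w. Z w - W w) * sqrt (v - u)" by (rule n2_mult_dB[OF Wu uv(1)])
    also have "\<dots> \<le> d * sqrt T" using W(2) n0 uv u by (intro mult_mono) auto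
    also have "\<dots> \<le> (e / (sqrt T + 1)) * sqrt T" using T by (intro mult_right_mono) (auto simp: d_def)
    also have "\<dots> < e"
    proof -
      have "0 < sqrt T + 1" using T by (simp add: add_nonneg_pos)
      then show ?thesis using e by (simp add: field_simps)
    qed
    finally show ?thesis .
  qed
  ultimately show "\<exists>Ls. elem T Ls \<and> upper_less T (\<lambda>t. (d2 (?Z t) (\<lambda>_. eproc Ls t))\<^sup>2) e \<and> d2 ?I (eint dB Ls) < e"
    using Ls by blast
qed

lemma has_int_zero: "integrator A C T \<Longrightarrow> 0 \<le> T \<Longrightarrow> has_int A T (\<lambda>t n w. 0) (\<lambda>n w. 0)"
  unfolding has_int_def
  by (auto intro!: adapted_const V_zero exI[of _ "[]"] upper_less_const[of _ _ 0] simp: two.cdist_self eproc_def[abs_def] eint_def[abs_def])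

lemma has_int_sum:
  assumes A: "integrator A C T" and T: "0 \<le> T"
  shows "(\<And>i. i \<in> K \<Longrightarrow> has_int A T (\<eta> i) (I i)) \<Longrightarrow> has_int A T (\<lambda>t n w. \<Sum>i\<in>K. \<eta> i t n w) (\<lambda>n w. \<Sum>i\<in>K. I i n w)"
  by (induction K rule: infinite_finite_induct) (auto intro: has_int_zero[OF A T] has_int_add[OF A T])

lemma n2_mult_dB_square:
  assumes Z: "Z \<in> L0ip_upto u" and uv: "u \<le> v"
  shows "n2 (\<lambda>w. Z w * (B v w - B u w)\<^sup>2) = sqrt c4 * (v - u) * n2 Z"
proof -
  have u: "0 \<le> u" by (rule L0ip_upto_time_nonneg[OF Z])
  have "E (\<lambda>w. (Z w * (B v w - B u w)\<^sup>2)\<^sup>2) = c4 * (v - u)\<^sup>2 * E (\<lambda>w. (Z w)\<^sup>2)"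
    using increment_fourth[OF stable_power[OF stable_L0ip_upto[OF u] Z, of 2] _ u uv] by (simp add: power_mult_distrib flip: power_mult)
  then show ?thesis using uv by (simp add: n2_def real_sqrt_mult)
qed

text \<open>
  Riemann sums with left endpoints over \<open>N\<close> equal parts: within a part, \<open>B\<close> moves by at most
  \<open>sqrt ((v - u) / N)\<close> in norm.
\<close>

lemma BdB_increment_approx:
  assumes uv: "0 \<le> u" "u < v" and N: "0 < N"
  defines "\<tau> \<equiv> (\<lambda>i. u + real i * (v - u) / real N)"
  shows "d2 (\<lambda>n w. BdB v n w - BdB u n w) (\<lambda>n w. \<Sum>i<N. B (\<tau> i) w * (B (\<tau> (Suc i)) w - B (\<tau> i) w)) \<le> sqrt (3 * (((v - u) * v + 1) / real N))"
proof -
  let ?S = "\<lambda>t n w. \<Sum>i<N. B (\<tau> i) w * indicator {\<tau> i..<\<tau> (Suc i)} t" and ?D = "\<lambda>t n w. B t w - B t w * indicator {..u} t"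
  have v: "0 \<le> v" using uv by simp
  have p: "is_partition (v - u) N (\<lambda>i. real i * (v - u) / real N)" by (rule uniform_partition) (use uv N in auto)
  have \<tau>uv: "\<tau> i \<in> {u..v}" if "i \<le> N" for i
  proof -
    have "real i * (v - u) / real N \<le> real N * (v - u) / real N" using that uv by (intro divide_right_mono mult_right_mono) auto
    moreover have "0 \<le> real i * (v - u) / real N" using uv by simp
    ultimately show ?thesis using N uv by (simp add: \<tau>_def)
  qed
  have \<tau>m: "\<tau> i \<le> \<tau> (Suc i)" for i using uv by (simp add: \<tau>_def divide_right_mono mult_right_mono)
  have \<tau>0: "0 \<le> \<tau> i" for i using uv by (simp add: \<tau>_def)
  have BV: "dB t \<in> V2" if "0 \<le> t" for t using that by (intro adaptedD(1)[OF B_adapted])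
  have "has_int dB v (\<lambda>t n w. B t w * indicator {..u} t) (BdB u)"
    by (rule has_int_extend[OF has_int_BdB[OF uv(1)]]) (use uv BV in auto)
  then have n1: "has_int dB v (\<lambda>t n w. B t w - B t w * indicator {..u} t) (\<lambda>n w. BdB v n w - BdB u n w)"
    by (rule has_int_diff[OF integrator_dB v has_int_BdB[OF v]])
  have n2: "has_int dB v (\<lambda>t n w. \<Sum>i<N. B (\<tau> i) w * indicator {\<tau> i..<\<tau> (Suc i)} t) (\<lambda>n w. \<Sum>i<N. B (\<tau> i) w * (B (\<tau> (Suc i)) w - B (\<tau> i) w))"
    by (rule has_int_sum[OF integrator_dB v], rule has_int_dB_elem) (use \<tau>uv \<tau>m \<tau>0 in \<open>auto intro!: B_in_L0ip_upto simp: Suc_le_eq\<close>)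
  have s0: "upper_less v (\<lambda>t. (v - u) / real N) (((v - u) * v + 1) / real N)"
    by (rule upper_less_const[OF v, of _ "(v - u) / real N"]) (use N in \<open>auto simp: field_simps\<close>)
  have "upper_less v (\<lambda>t. (d2 (?D t) (?S t))\<^sup>2) (((v - u) * v + 1) / real N)"
  proof (rule upper_less_spike[OF s0])
    show "negligible {u, v}" by simp
    fix t assume t: "t \<in> {0..v} - {u, v}"
    have ind: "indicator {\<tau> i..<\<tau> (Suc i)} t = (indicator {real i * (v - u) / real N..<real (Suc i) * (v - u) / real N} (t - u) :: real)" for i
      by (auto simp: indicator_def \<tau>_def)
    show "(d2 (?D t) (?S t))\<^sup>2 \<le> (v - u) / real N"
    proof (cases "u < t")
      case True
      then have "\<exists>k<N. real k * (v - u) / real N \<le> t - u \<and> t - u < real (Suc k) * (v - u) / real N"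
        using partition_cover[of "\<lambda>i. real i * (v - u) / real N" "t - u" N] t N by auto
      then obtain k where k: "k < N" "real k * (v - u) / real N \<le> t - u" "t - u < real (Suc k) * (v - u) / real N" by blast
      have "(?S t) = dB (\<tau> k)"
        unfolding ind by (intro ext) (rule partition_sum_eq[OF p k])
      moreover have "(?D t) = dB t" using True by (intro ext) simp
      moreover have kt: "\<tau> k \<le> t" using k by (simp add: \<tau>_def)
      moreover have "real (Suc k) * (v - u) / real N = real k * (v - u) / real N + (v - u) / real N"
        using N by (simp add: field_simps)
      then have "t - \<tau> k \<le> (v - u) / real N" using k(3) unfolding \<tau>_def by linarith
      ultimately show ?thesis using d2_B[OF \<tau>0 kt] by simp
    next
      case False
      have e1: "(?S t) = (\<lambda>n w. 0)"
      proof (intro ext sum.neutral ballI)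
        fix i w assume "i \<in> {..<N}"
        then have "u \<le> \<tau> i" using \<tau>uv[of i] by auto
        then have "t < \<tau> i" using False t by auto
        then show "B (\<tau> i) w * indicator {\<tau> i..<\<tau> (Suc i)} t = 0" by simp
      qed
      have e2: "(?D t) = (\<lambda>n w. 0)" using False by (intro ext) simp
      have "d2 (?D t) (?S t) = d2 (\<lambda>n w. 0) (\<lambda>n w. 0)"
        by (rule arg_cong2[OF e2 e1])
      also have "\<dots> = 0" by (rule two.cdist_self)
      finally have z: "d2 (?D t) (?S t) = 0" .
      show ?thesis using uv unfolding z by simp
    qed
  qed
  from has_int_dist_small[OF integrator_dB v n1 n2 this] show ?thesis by simp
qed

lemma QV_adapted: assumes "0 \<le> t" shows "QV E t \<in> adapted t"
  unfolding QV_eq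
  by (intro adapted_diff adapted_scale has_intD(1)[OF has_int_BdB[OF assms]] adapted_L0ip_upto stable_power stable_L0ip_upto B_in_L0ip_upto assms order_refl)

text \<open>
  The increment of the quadratic variation is the limit of the sums \<open>S\<close> of squared increments of
  \<open>B\<close> over \<open>N\<close> equal parts. By Minkowski's inequality and the fourth moments, \<open>Z * S\<close> has norm
  at most the sum of \<open>sqrt c4 * (v - u) / N * n2 Z\<close> over the parts, which is the bound claimed,
  whatever \<open>N\<close>.
\<close>

lemma QV_increment:
  assumes Z: "Z \<in> bL0 u" and uv: "u \<le> v"
  shows "d2 (\<lambda>n w. Z w * (QV E v n w - QV E u n w)) (\<lambda>_ _. 0) \<le> sqrt c4 * (v - u) * n2 Z"
proof (cases "u = v")
  case True then show ?thesis by (simp add: two.cdist_self)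
next
  case False
  then have uv': "u < v" using uv by simp
  have u: "0 \<le> u" by (rule bL0_time_nonneg[OF Z])
  obtain M where M: "0 < M" "\<And>w. \<bar>Z w\<bar> \<le> M" by (rule bL0_bounded[OF Z]) blast
  let ?Q = "\<lambda>n w. Z w * (QV E v n w - QV E u n w)"
  have ZL: "Z \<in> L0ip" by (rule bL0_L0ip[OF Z])
  have b: "d2 ?Q (\<lambda>_ _. 0) \<le> 2 * M * sqrt (3 * (((v - u) * v + 1) / real N)) + sqrt c4 * (v - u) * n2 Z"
    if N: "0 < N" for N
  proof -
    define \<tau> where "\<tau> = (\<lambda>i. u + real i * (v - u) / real N)"
    have \<tau>m: "\<tau> i \<le> \<tau> (Suc i)" for i using uv by (simp add: \<tau>_def divide_right_mono mult_right_mono)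
    have \<tau>u: "u \<le> \<tau> i" for i using uv by (simp add: \<tau>_def)
    have \<tau>0: "0 \<le> \<tau> i" for i using \<tau>u[of i] u by simp
    have \<tau>N: "\<tau> N = v" "\<tau> 0 = u" using N by (auto simp: \<tau>_def)
    define R where "R w = (\<Sum>i<N. B (\<tau> i) w * (B (\<tau> (Suc i)) w - B (\<tau> i) w))" for w
    define S where "S w = (\<Sum>i<N. (B (\<tau> (Suc i)) w - B (\<tau> i) w)\<^sup>2)" for w
    have RL: "R \<in> L0ip" unfolding R_def by (intro L0_intros B_L0ip \<tau>0)
    have SL: "S \<in> L0ip" unfolding S_def by (intro L0_intros B_L0ip \<tau>0)
    have ap: "d2 (\<lambda>n w. BdB v n w - BdB u n w) (\<lambda>n. R) \<le> sqrt (3 * (((v - u) * v + 1) / real N))"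
      using BdB_increment_approx[OF u uv' N] by (simp add: R_def[abs_def] \<tau>_def)
    have SR: "S w = (B v w)\<^sup>2 - (B u w)\<^sup>2 - 2 * R w" for w
    proof -
      have "S w + 2 * R w = (\<Sum>i<N. (B (\<tau> (Suc i)) w)\<^sup>2 - (B (\<tau> i) w)\<^sup>2)"
        unfolding S_def R_def sum_distrib_left sum.distrib[symmetric] by (rule sum.cong) (auto simp: power2_eq_square algebra_simps)
      also have "\<dots> = (B v w)\<^sup>2 - (B u w)\<^sup>2" using sum_lessThan_telescope[of "\<lambda>i. (B (\<tau> i) w)\<^sup>2" N] \<tau>N by simp
      finally show ?thesis by simp
    qed
    have QVV: "QV E v \<in> V2" "QV E u \<in> V2" using adaptedD(1)[OF QV_adapted] u uv by auto
    have JV: "BdB v \<in> V2" "BdB u \<in> V2" using has_intD(2)[OF has_int_BdB] u uv by auto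
    have V1: "?Q \<in> V2" by (intro two.cseq_bmult[OF ZL M(2)] V_intros QVV)
    have ZSV: "(\<lambda>n w. Z w * S w) \<in> V2" by (intro V_const L0_intros ZL SL)
    have "d2 ?Q (\<lambda>n w. Z w * S w) \<le> (2 * M) * d2 (\<lambda>n w. BdB v n w - BdB u n w) (\<lambda>n. R)"
    proof (rule two.cdist_mono[OF V1 ZSV])
      show "(\<lambda>n w. BdB v n w - BdB u n w) \<in> V2" by (intro V_intros JV)
      show "(\<lambda>n. R) \<in> V2" by (rule V_const[OF RL])
      show "0 \<le> 2 * M" using M by simp
      fix n w
      have "Z w * (QV E v n w - QV E u n w) - Z w * S w = - (2 * Z w) * (BdB v n w - BdB u n w - R w)"
        by (simp add: QV_eq SR algebra_simps)
      then have "\<bar>Z w * (QV E v n w - QV E u n w) - Z w * S w\<bar> = 2 * \<bar>Z w\<bar> * \<bar>BdB v n w - BdB u n w - R w\<bar>"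
        by (simp add: abs_mult)
      also have "\<dots> \<le> 2 * M * \<bar>BdB v n w - BdB u n w - R w\<bar>" using M(2) by (intro mult_right_mono) auto
      finally show "\<bar>Z w * (QV E v n w - QV E u n w) - Z w * S w\<bar> \<le> 2 * M * \<bar>BdB v n w - BdB u n w - R w\<bar>" .
    qed
    also have "\<dots> \<le> (2 * M) * sqrt (3 * (((v - u) * v + 1) / real N))" using M ap by (intro mult_left_mono) auto
    finally have 1: "d2 ?Q (\<lambda>n w. Z w * S w) \<le> 2 * M * sqrt (3 * (((v - u) * v + 1) / real N))" .
    have tL: "(\<lambda>w. Z w * (B (\<tau> (Suc i)) w - B (\<tau> i) w)\<^sup>2) \<in> L0ip" for i by (intro L0_intros ZL B_L0ip \<tau>0)
    have "d2 (\<lambda>n w. \<Sum>i<N. Z w * (B (\<tau> (Suc i)) w - B (\<tau> i) w)\<^sup>2) (\<lambda>n w. \<Sum>i<N. 0) \<le> (\<Sum>i<N. d2 (\<lambda>n w. Z w * (B (\<tau> (Suc i)) w - B (\<tau> i) w)\<^sup>2) (\<lambda>n w. 0))"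
      using two.cdist_sum_le[of "{..<N}" "\<lambda>i n w. Z w * (B (\<tau> (Suc i)) w - B (\<tau> i) w)\<^sup>2" "\<lambda>i n w. 0"] V_const[OF tL] V_zero by simp
    also have "\<dots> = (\<Sum>i<N. sqrt c4 * (\<tau> (Suc i) - \<tau> i) * n2 Z)"
      using n2_mult_dB_square[OF bL0_L0ip_upto[OF bL0_mono[OF Z \<tau>u]] \<tau>m] by (simp add: cdist_def)
    also have "\<dots> = sqrt c4 * (v - u) * n2 Z"
      using sum_lessThan_telescope[of \<tau> N] \<tau>N by (simp flip: sum_distrib_left sum_distrib_right)
    finally have 2: "d2 (\<lambda>n w. Z w * S w) (\<lambda>n w. 0) \<le> sqrt c4 * (v - u) * n2 Z" by (simp add: S_def sum_distrib_left)
    show ?thesis using two.cdist_triangle[OF V1 ZSV V_zero] 1 2 by linarith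
  qed
  have "(\<lambda>k. 2 * M * sqrt (3 * (((v - u) * v + 1) * (1 / real (Suc k)))) + sqrt c4 * (v - u) * n2 Z) \<longlonglongrightarrow> 2 * M * sqrt (3 * (((v - u) * v + 1) * 0)) + sqrt c4 * (v - u) * n2 Z"
    by (intro tendsto_intros one_over_Suc_tendsto)
  then have "d2 ?Q (\<lambda>_ _. 0) \<le> 2 * M * sqrt (3 * (((v - u) * v + 1) * 0)) + sqrt c4 * (v - u) * n2 Z"
    by (rule LIMSEQ_le_const) (use b[of "Suc k" for k] in auto)
  then show ?thesis by simp
qed

lemma integrator_QV: "0 \<le> T \<Longrightarrow> integrator (QV E) (c4 * T) T"
  using integrator_bounded_variation[of T "QV E" "sqrt c4"] QV_adapted QV_increment c4_nonneg by simp

end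

section \<open>Lipschitz functions of processes\<close>

text \<open>
  The sum is the piecewise linear interpolation of \<open>f\<close> with nodes \<open>y i\<close>, written with the
  clamped lengths of \<open>z\<close> in each mesh interval; \<open>f\<close> and its interpolation vary by at most
  \<open>L * h\<close> within a mesh interval.
\<close>

lemma Lipschitz_interpolation:
  fixes f :: "real \<Rightarrow> real"
  assumes L: "\<And>x y. \<bar>f x - f y\<bar> \<le> L * \<bar>x - y\<bar>" and h: "0 < h" and z: "y0 \<le> z"
  defines "y \<equiv> (\<lambda>i. y0 + real i * h)"
  defines "P \<equiv> (\<lambda>m. f y0 + (\<Sum>i<m. (f (y (Suc i)) - f (y i)) / h * (min (max z (y i)) (y (Suc i)) - y i)))"
  shows "(y m \<le> z \<longrightarrow> P m = f (y m)) \<and> (z \<le> y m \<longrightarrow> \<bar>P m - f z\<bar> \<le> 2 * L * h)"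
proof (induction m)
  have L0: "0 \<le> L" using L[of 0 1] by (simp add: order_trans[OF abs_ge_zero])
  case 0
  show ?case using z L0 h by (auto simp: P_def y_def)
next
  have L0: "0 \<le> L" using L[of 0 1] by (simp add: order_trans[OF abs_ge_zero])
  case (Suc m)
  have yS: "y (Suc m) = y m + h" by (simp add: y_def algebra_simps)
  have PS: "P (Suc m) = P m + (f (y (Suc m)) - f (y m)) / h * (min (max z (y m)) (y (Suc m)) - y m)" by (simp add: P_def)
  consider "z \<le> y m" | "y m < z" "z < y (Suc m)" | "y (Suc m) \<le> z" by linarith
  then show ?case
  proof cases
    case 1
    then have "P (Suc m) = P m" using h yS by (simp add: PS)
    then show ?thesis using Suc 1 h yS by auto
  next
    case 2
    have Pm: "P m = f (y m)" using Suc 2 by auto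
    define \<theta> where "\<theta> = (z - y m) / h"
    have \<theta>: "0 \<le> \<theta>" "\<theta> \<le> 1" using 2 h yS by (auto simp: \<theta>_def field_simps)
    have "P (Suc m) - f z = (f (y m) - f z) + (f (y (Suc m)) - f (y m)) * \<theta>" using 2 by (simp add: PS Pm \<theta>_def)
    also have "\<bar>\<dots>\<bar> \<le> \<bar>f (y m) - f z\<bar> + \<bar>f (y (Suc m)) - f (y m)\<bar> * \<theta>"
      by (rule order_trans[OF abs_triangle_ineq]) (use \<theta> in \<open>simp add: abs_mult\<close>)
    also have "\<dots> \<le> L * h + (L * h) * 1"
    proof (intro add_mono mult_mono)
      have "L * \<bar>y m - z\<bar> \<le> L * h" using 2 yS L0 by (intro mult_left_mono) auto
      then show "\<bar>f (y m) - f z\<bar> \<le> L * h" using L[of "y m" z] by linarith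
      show "\<bar>f (y (Suc m)) - f (y m)\<bar> \<le> L * h" using L[of "y (Suc m)" "y m"] yS h by simp
    qed (use \<theta> L0 h in auto)
    finally show ?thesis using 2 by auto
  next
    case 3
    have Pm: "P m = f (y m)" using Suc 3 yS h by auto
    have "P (Suc m) = f (y (Suc m))" using 3 h yS by (simp add: PS Pm)
    then show ?thesis using 3 L0 h by auto
  qed
qed

context G_Brownian_expectation
begin

lemma d2_coeff: assumes "Z \<in> L0ip" shows "d2 (\<lambda>n w. a * Z w) (\<lambda>n w. b * Z w) = \<bar>a - b\<bar> * n2 Z"
  using n2_scale[OF assms, of "a - b"] by (simp add: cdist_def left_diff_distrib)

lemma MG2_continuous_coeff:
  fixes g :: "real \<Rightarrow> real"
  assumes g: "continuous_on UNIV g" and Z: "Z \<in> bL0 u" and uv: "u \<le> v" "v \<le> T"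
  shows "(\<lambda>t n w. g t * Z w * indicator {u..<v} t) \<in> MG2 T"
proof (rule MG2_continuous_piece)
  show u: "0 \<le> u" by (rule bL0_time_nonneg[OF Z])
  have ZL: "Z \<in> L0ip" by (rule bL0_L0ip[OF Z])
  show "(\<lambda>n w. g t * Z w) \<in> adapted t" if "t \<in> {u..v}" for t
    by (rule adapted_bL0[OF bL0_scale[OF bL0_mono[OF Z]]]) (use that in auto)
  show "(\<lambda>n w. g t * Z w) \<in> V2" for t by (intro V_const L0_intros ZL)
  fix e :: real assume e: "0 < e"
  have n0: "0 \<le> n2 Z" by (rule n2_nonneg[OF ZL])
  have "uniformly_continuous_on {u..v} g"
    by (rule compact_uniformly_continuous[OF continuous_on_subset[OF g]]) auto
  then obtain \<delta> where \<delta>: "0 < \<delta>" "\<And>s t. s \<in> {u..v} \<Longrightarrow> t \<in> {u..v} \<Longrightarrow> dist t s < \<delta> \<Longrightarrow> dist (g t) (g s) < e / (n2 Z + 1)"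
    unfolding uniformly_continuous_on_def using e n0 by (metis add_nonneg_pos divide_pos_pos zero_less_one)
  have "d2 (\<lambda>n w. g s * Z w) (\<lambda>n w. g t * Z w) < e" if st: "s \<in> {u..v}" "t \<in> {u..v}" "\<bar>s - t\<bar> < \<delta>" for s t
  proof -
    have "\<bar>g s - g t\<bar> < e / (n2 Z + 1)" using \<delta>(2)[OF st(2,1)] st(3) by (simp add: dist_real_def)
    then have "\<bar>g s - g t\<bar> * n2 Z \<le> e / (n2 Z + 1) * n2 Z" using n0 by (intro mult_right_mono) auto
    also have "\<dots> < e" using e n0 by (simp add: field_simps)
    finally show ?thesis by (simp add: d2_coeff[OF ZL])
  qed
  then show "\<exists>\<delta>>0. \<forall>s\<in>{u..v}. \<forall>t\<in>{u..v}. \<bar>s - t\<bar> < \<delta> \<longrightarrow> d2 (\<lambda>n w. g s * Z w) (\<lambda>n w. g t * Z w) < e"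
    using \<delta>(1) by blast
qed (use uv in auto)

lemma clip_tendsto:
  fixes a :: real assumes "x \<longlonglongrightarrow> a" "\<bar>a\<bar> \<le> K" shows "(\<lambda>n. max (-K) (min K (x n))) \<longlonglongrightarrow> a"
proof -
  have "(\<lambda>n. max (-K) (min K (x n))) \<longlonglongrightarrow> max (-K) (min K a)" by (intro tendsto_intros assms)
  moreover have "max (-K) (min K a) = a" using assms(2) by auto
  ultimately show ?thesis by simp
qed

text \<open>
  A measurable function is almost everywhere a limit of continuous ones, which may be clipped to
  its bounds.
\<close>

lemma MG2_bounded_measurable_coeff:
  fixes a :: "real \<Rightarrow> real"
  assumes a: "a \<in> borel_measurable (lebesgue_on {0..T})" and K: "\<And>t. \<bar>a t\<bar> \<le> K"
    and Z: "Z \<in> bL0 u" and uv: "u \<le> v" "v \<le> T"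
  shows "(\<lambda>t n w. a t * Z w * indicator {u..<v} t) \<in> MG2 T"
proof -
  have T: "0 \<le> T" using bL0_time_nonneg[OF Z] uv by simp
  have ZL: "Z \<in> L0ip" by (rule bL0_L0ip[OF Z])
  have W: "(\<lambda>n w. c * Z w * indicator {u..<v} t) \<in> V2" for c and t :: real by (intro cut_V V_const L0_intros ZL)
  have "a measurable_on {0..T}" using a by (subst measurable_on_iff_borel_measurable) auto
  then obtain N g where N: "negligible N" and g: "\<And>n. continuous_on UNIV (g n)"
    and lim: "\<And>x. x \<notin> N \<Longrightarrow> (\<lambda>n. g n x) \<longlonglongrightarrow> (if x \<in> {0..T} then a x else 0)"
    unfolding measurable_on_def by blast
  define c where "c n t = max (-K) (min K (g n t))" for n t
  have K0: "0 \<le> K" using K[of 0] by linarith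
  have cK: "\<bar>c n t\<bar> \<le> K" for n t using K0 by (auto simp: c_def)
  define h where "h n t = (if t \<in> N then 0 else c n t)" for n t
  define b where "b t = (if t \<in> N then 0 else a t)" for t
  have h: "(\<lambda>t m w. h n t * Z w * indicator {u..<v} t) \<in> MG2 T" for n
  proof (rule MG2_spike[OF _ N W _ T])
    show "(\<lambda>t m w. c n t * Z w * indicator {u..<v} t) \<in> MG2 T"
      unfolding c_def by (intro MG2_continuous_coeff continuous_intros g Z uv)
  qed (simp add: h_def two.cdist_self)
  have "(\<lambda>t m w. b t * Z w * indicator {u..<v} t) \<in> MG2 T"
  proof (rule MG2_dominated_convergence(1)[OF T h W])
    fix t assume t: "t \<in> {0..T}"
    have hb: "(\<lambda>n. h n t) \<longlonglongrightarrow> b t"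
    proof (cases "t \<in> N")
      case False
      then show ?thesis using clip_tendsto[OF _ K[of t], of "\<lambda>n. g n t"] lim[OF False] t by (simp add: h_def b_def c_def)
    qed (simp add: h_def b_def)
    have "(\<lambda>n. \<bar>h n t - b t\<bar> * n2 Z) \<longlonglongrightarrow> \<bar>b t - b t\<bar> * n2 Z" by (intro tendsto_intros hb)
    then show "(\<lambda>n. d2 (\<lambda>m w. h n t * Z w * indicator {u..<v} t) (\<lambda>m w. b t * Z w * indicator {u..<v} t)) \<longlonglongrightarrow> 0"
      by (cases "t \<in> {u..<v}") (simp_all add: d2_coeff[OF ZL] two.cdist_self)
  next
    show "(\<lambda>t. (K * n2 Z)\<^sup>2) integrable_on {0..T}" by (rule integrable_const_ivl)
    fix n t assume "t \<in> {0..T}"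
    have z: "d2 (\<lambda>m w. h n t * Z w) (\<lambda>_ _. 0) = \<bar>h n t\<bar> * n2 Z" using d2_coeff[OF ZL, of "h n t" 0] by simp
    have "\<bar>h n t\<bar> * n2 Z \<le> K * n2 Z" using cK K0 n2_nonneg[OF ZL] by (intro mult_right_mono) (auto simp: h_def)
    then have "(\<bar>h n t\<bar> * n2 Z)\<^sup>2 \<le> (K * n2 Z)\<^sup>2" using n2_nonneg[OF ZL] by (intro power_mono) auto
    then show "(d2 (\<lambda>m w. h n t * Z w * indicator {u..<v} t) (\<lambda>_ _. 0))\<^sup>2 \<le> (K * n2 Z)\<^sup>2"
      by (cases "t \<in> {u..<v}") (simp_all add: z two.cdist_self)
  qed
  then show ?thesis by (rule MG2_spike[OF _ N W _ T]) (simp add: b_def two.cdist_self)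
qed

lemma MG2_measurable_coeff:
  fixes a :: "real \<Rightarrow> real"
  assumes a: "a \<in> borel_measurable (lebesgue_on {0..T})" and G: "G integrable_on {0..T}" "\<And>t. t \<in> {0..T} \<Longrightarrow> (a t)\<^sup>2 \<le> G t"
    and Z: "Z \<in> bL0 u" and uv: "u \<le> v" "v \<le> T"
  shows "(\<lambda>t n w. a t * Z w * indicator {u..<v} t) \<in> MG2 T"
proof -
  have T: "0 \<le> T" using bL0_time_nonneg[OF Z] uv by simp
  have ZL: "Z \<in> L0ip" by (rule bL0_L0ip[OF Z])
  have W: "(\<lambda>n w. c * Z w * indicator {u..<v} t) \<in> V2" for c and t :: real by (intro cut_V V_const L0_intros ZL)
  define c where "c k t = max (- real k) (min (real k) (a t))" for k t
  have "(\<lambda>t. c k t) \<in> borel_measurable (lebesgue_on {0..T})" for k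
    unfolding c_def using a by (intro borel_measurable_max borel_measurable_min) auto
  moreover have "\<bar>c k t\<bar> \<le> real k" for k t by (auto simp: c_def)
  ultimately have h: "(\<lambda>t m w. c k t * Z w * indicator {u..<v} t) \<in> MG2 T" for k
    by (intro MG2_bounded_measurable_coeff[OF _ _ Z uv]) auto
  show ?thesis
  proof (rule MG2_dominated_convergence(1)[OF T h W])
    fix t assume t: "t \<in> {0..T}"
    obtain k0 :: nat where k0: "\<bar>a t\<bar> \<le> real k0" using real_arch_simple by blast
    have "\<forall>\<^sub>F k in sequentially. c k t = a t"
      using eventually_ge_at_top[of k0] by (rule eventually_mono) (use k0 in \<open>auto simp: c_def\<close>)
    then have hb: "(\<lambda>n. c n t) \<longlonglongrightarrow> a t" by (rule tendsto_eventually)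
    have "(\<lambda>n. \<bar>c n t - a t\<bar> * n2 Z) \<longlonglongrightarrow> \<bar>a t - a t\<bar> * n2 Z" by (intro tendsto_intros hb)
    then show "(\<lambda>n. d2 (\<lambda>m w. c n t * Z w * indicator {u..<v} t) (\<lambda>m w. a t * Z w * indicator {u..<v} t)) \<longlonglongrightarrow> 0"
      by (cases "t \<in> {u..<v}") (simp_all add: d2_coeff[OF ZL] two.cdist_self)
  next
    show "(\<lambda>t. (n2 Z)\<^sup>2 * G t) integrable_on {0..T}" using G(1) by (intro integrable_on_mult_right)
    fix n t assume t: "t \<in> {0..T}"
    have z: "d2 (\<lambda>m w. c n t * Z w) (\<lambda>_ _. 0) = \<bar>c n t\<bar> * n2 Z" using d2_coeff[OF ZL, of "c n t" 0] by simp
    have "\<bar>c n t\<bar> \<le> \<bar>a t\<bar>" by (auto simp: c_def)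
    then have "(c n t)\<^sup>2 \<le> G t" using G(2)[OF t] abs_le_square_iff[of "c n t" "a t"] by simp
    then have "(\<bar>c n t\<bar> * n2 Z)\<^sup>2 \<le> (n2 Z)\<^sup>2 * G t" using mult_left_mono[of "(c n t)\<^sup>2" "G t" "(n2 Z)\<^sup>2"] by (simp add: power_mult_distrib mult.commute)
    moreover have "0 \<le> (n2 Z)\<^sup>2 * G t" using G(2)[OF t] order_trans[OF zero_le_power2] by (intro mult_nonneg_nonneg) auto
    ultimately show "(d2 (\<lambda>m w. c n t * Z w * indicator {u..<v} t) (\<lambda>_ _. 0))\<^sup>2 \<le> (n2 Z)\<^sup>2 * G t"
      by (cases "t \<in> {u..<v}") (simp_all add: z two.cdist_self)
  qed
qed

text \<open>
  For a bounded \<open>Z\<close>, interpolation in the space variable approximates \<open>f t (Z w)\<close> uniformly by a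
  finite sum of measurable functions of time times bounded variables.
\<close>

lemma MG2_Lipschitz_bL0:
  fixes f :: "real \<Rightarrow> real \<Rightarrow> real"
  assumes f: "\<And>y. (\<lambda>t. f t y) \<in> borel_measurable (lebesgue_on {0..T})" and L: "\<And>t x y. t \<in> {0..T} \<Longrightarrow> \<bar>f t x - f t y\<bar> \<le> L * \<bar>x - y\<bar>"
    and G: "G integrable_on {0..T}" "\<And>t. t \<in> {0..T} \<Longrightarrow> (f t 0)\<^sup>2 \<le> G t"
    and Z: "Z \<in> bL0 u" and uv: "u \<le> v" "v \<le> T"
  shows "(\<lambda>t n w. f t (Z w) * indicator {u..<v} t) \<in> MG2 T"
proof -
  have T: "0 \<le> T" using bL0_time_nonneg[OF Z] uv by simp
  have u0: "0 \<le> u" by (rule bL0_time_nonneg[OF Z])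
  obtain M where M: "0 < M" "\<And>w. \<bar>Z w\<bar> \<le> M" by (rule bL0_bounded[OF Z]) blast
  have L0: "0 \<le> L" using L[of 0 0 1] T by (simp add: order_trans[OF abs_ge_zero])
  have V2: "(\<lambda>n w. f t (Z w) * indicator {u..<v} t) \<in> V2" if "t \<in> {0..T}" for t
    by (intro cut_V V_const bL0_L0ip[OF bL0_lipschitz[OF Z L[OF that]]])
  show ?thesis
  proof (rule MG2_limit[OF V2])
    fix e :: real assume e: "0 < e"
    define d where "d = sqrt (e / (2 * (T + 1)))"
    have d: "0 < d" using e T by (simp add: d_def)
    obtain m :: nat where m: "4 * L * M / d + 1 < real m" using reals_Archimedean2 by blast
    have "0 \<le> 4 * L * M / d" using L0 M d by simp
    then have m0: "0 < real m" using m by linarith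
    define h where "h = 2 * M / real m"
    have h: "0 < h" using M m0 by (simp add: h_def)
    have "4 * L * M / d < real m" using m by simp
    then have hd: "2 * L * h \<le> d" using m0 d by (simp add: h_def field_simps)
    define y where "y i = - M + real i * h" for i
    have ym: "y m = M" using m0 by (simp add: y_def h_def)
    define W where "W i w = min (max (Z w) (y i)) (y (Suc i)) - y i" for i w
    have W: "W i \<in> bL0 u" for i unfolding W_def by (rule bL0_lipschitz[OF Z, of _ 1]) auto
    define \<zeta> where "\<zeta> t n w = f t (- M) * 1 * indicator {u..<v} t + (\<Sum>i<m. (f t (y (Suc i)) - f t (y i)) / h * W i w * indicator {u..<v} t)" for t :: real and n :: nat and w
    have 1: "(\<lambda>t n w. f t (- M) * 1 * indicator {u..<v} t) \<in> MG2 T"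
    proof (rule MG2_measurable_coeff[OF f _ _ _ uv])
      show "(\<lambda>t. 2 * G t + 2 * (L * M)\<^sup>2) integrable_on {0..T}" by (intro integrable_add integrable_on_mult_right G(1) integrable_const_ivl)
      show "(\<lambda>_. 1) \<in> bL0 u" by (rule bL0_const[OF u0])
      fix t assume t: "t \<in> {0..T}"
      have "\<bar>f t (- M) - f t 0\<bar> \<le> L * M" using L[OF t, of "- M" 0] M by simp
      then have "(f t (- M) - f t 0)\<^sup>2 \<le> (L * M)\<^sup>2" using abs_le_square_iff[of "f t (- M) - f t 0" "L * M"] by simp
      then show "(f t (- M))\<^sup>2 \<le> 2 * G t + 2 * (L * M)\<^sup>2"
        using sum_square_le[of "f t 0" "f t (- M) - f t 0"] G(2)[OF t] by simp
    qed
    have 2: "(\<lambda>t n w. (f t (y (Suc i)) - f t (y i)) / h * W i w * indicator {u..<v} t) \<in> MG2 T" for i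
    proof (rule MG2_measurable_coeff[OF _ _ _ W uv])
      show "(\<lambda>t. (f t (y (Suc i)) - f t (y i)) / h) \<in> borel_measurable (lebesgue_on {0..T})"
        using f[of "y (Suc i)"] f[of "y i"] by (intro borel_measurable_divide borel_measurable_diff) auto
      show "(\<lambda>t. L\<^sup>2) integrable_on {0..T}" by (rule integrable_const_ivl)
      fix t assume t: "t \<in> {0..T}"
      have "\<bar>f t (y (Suc i)) - f t (y i)\<bar> \<le> L * h" using L[OF t, of "y (Suc i)" "y i"] h by (simp add: y_def algebra_simps)
      then have "\<bar>(f t (y (Suc i)) - f t (y i)) / h\<bar> \<le> L" using h by (simp add: abs_divide pos_divide_le_eq)
      then show "((f t (y (Suc i)) - f t (y i)) / h)\<^sup>2 \<le> L\<^sup>2" using abs_le_square_iff[of "(f t (y (Suc i)) - f t (y i)) / h" L] L0 by simp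
    qed
    have \<zeta>: "\<zeta> \<in> MG2 T" unfolding \<zeta>_def[abs_def] by (intro MG2_add MG2_sum 1 2 T)
    have "upper_less T (\<lambda>t. (d2 (\<lambda>n w. f t (Z w) * indicator {u..<v} t) (\<zeta> t))\<^sup>2) e"
    proof (rule upper_less_const[OF T])
      fix t assume t: "t \<in> {0..T}"
      have "d2 (\<lambda>n w. f t (Z w) * indicator {u..<v} t) (\<zeta> t) \<le> 1 * d2 (\<lambda>n w. d) (\<lambda>n w. 0)"
      proof (rule two.cdist_mono[OF V2[OF t] MG2D(1)[OF \<zeta> t]])
        fix n w
        have z: "- M \<le> Z w" "Z w \<le> y m" using M(2)[of w] by (auto simp: ym abs_le_iff)
        have "\<bar>f t (- M) + (\<Sum>i<m. (f t (y (Suc i)) - f t (y i)) / h * W i w) - f t (Z w)\<bar> \<le> 2 * L * h"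
          using Lipschitz_interpolation[of "f t" L h "- M" "Z w" m, OF L[OF t] h z(1)] z(2) by (simp add: W_def y_def)
        then have "\<bar>f t (Z w) - (f t (- M) + (\<Sum>i<m. (f t (y (Suc i)) - f t (y i)) / h * W i w))\<bar> \<le> d" using hd by (simp add: abs_minus_commute)
        then show "\<bar>f t (Z w) * indicator {u..<v} t - \<zeta> t n w\<bar> \<le> 1 * \<bar>d - 0\<bar>"
          using d by (cases "t \<in> {u..<v}") (auto simp: \<zeta>_def)
      qed (auto intro: V_const V_zero L0_intros)
      also have "\<dots> = d" using d by (simp add: two.cdist_const n2_const)
      finally show "(d2 (\<lambda>n w. f t (Z w) * indicator {u..<v} t) (\<zeta> t))\<^sup>2 \<le> d\<^sup>2"
        by (intro power_mono two.cdist_nonneg V2 t MG2D(1)[OF \<zeta> t])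
    next
      show "d\<^sup>2 * T < e" using e T by (simp add: d_def field_simps add_nonneg_pos)
    qed
    then show "\<exists>\<zeta>\<in>MG2 T. upper_less T (\<lambda>t. (d2 (\<lambda>n w. f t (Z w) * indicator {u..<v} t) (\<zeta> t))\<^sup>2) e" using \<zeta> by blast
  qed
qed

text \<open>
  The map \<open>\<eta> \<mapsto> f t (\<eta> t)\<close> is Lipschitz for the distance of processes, so elementary \<open>\<eta>\<close> suffice,
  and these have one bounded value on each cell of a partition.
\<close>

lemma MG2_Lipschitz:
  fixes f :: "real \<Rightarrow> real \<Rightarrow> real"
  assumes f: "\<And>y. (\<lambda>t. f t y) \<in> borel_measurable (lebesgue_on {0..T})" and L: "\<And>t x y. t \<in> {0..T} \<Longrightarrow> \<bar>f t x - f t y\<bar> \<le> L * \<bar>x - y\<bar>"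
    and G: "G integrable_on {0..T}" "\<And>t. t \<in> {0..T} \<Longrightarrow> (f t 0)\<^sup>2 \<le> G t"
    and X: "\<eta> \<in> MG2 T" and T: "0 \<le> T"
  shows "(\<lambda>t n w. f t (\<eta> t n w)) \<in> MG2 T"
proof (rule MG2_limit)
  show V2: "(\<lambda>n w. f t (\<eta> t n w)) \<in> V2" if "t \<in> {0..T}" for t by (rule two.cseq_lipschitz[OF MG2D(1)[OF X that] L[OF that]])
  fix e :: real assume e: "0 < e"
  have L0: "0 \<le> L" using L[of 0 0 1] T by (simp add: order_trans[OF abs_ge_zero])
  have L1: "0 < L\<^sup>2 + 1" by (simp add: add_nonneg_pos)
  obtain Ls where Ls: "elem T Ls" "upper_less T (\<lambda>t. (d2 (\<eta> t) (\<lambda>_. eproc Ls t))\<^sup>2) (e / (L\<^sup>2 + 1))" using MG2D(2)[OF X, of "e / (L\<^sup>2 + 1)"] e L1 by auto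
  let ?g = "\<lambda>t n w. f t (eproc Ls t w)" and ?f = "\<lambda>t n w. f t (\<eta> t n w)"
  have W: "(?g t) \<in> V2" if t: "t \<in> {0..T}" for t by (rule two.cseq_lipschitz[OF eproc_V[OF Ls(1) t] L[OF t]])
  have "?g \<in> MG2 T"
  proof -
    obtain N \<tau> Z where p: "is_partition T N \<tau>" "\<And>j. j < N \<Longrightarrow> Z j \<in> bL0 (\<tau> j)"
      and eproc: "\<And>t w. eproc Ls t w = (\<Sum>j<N. Z j w * indicator {\<tau> j..<\<tau> (Suc j)} t)"
      by (rule elem_partition[OF T Ls(1)]) blast
    have \<tau>T: "\<tau> j \<le> \<tau> (Suc j)" "\<tau> (Suc j) \<le> T" if "j < N" for j
      using that is_partition_mono[OF p(1), of j "Suc j"] is_partition_mono[OF p(1), of "Suc j" N] p(1)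
      unfolding is_partition_def by (cases "Suc j = N"; force)+
    have "(\<lambda>t n w. \<Sum>j<N. f t (Z j w) * indicator {\<tau> j..<\<tau> (Suc j)} t) \<in> MG2 T"
    proof (rule MG2_sum[OF _ T])
      fix j assume j: "j \<in> {..<N}"
      show "(\<lambda>t n w. f t (Z j w) * indicator {\<tau> j..<\<tau> (Suc j)} t) \<in> MG2 T"
        by (rule MG2_Lipschitz_bL0[OF f L G]) (use p(2) \<tau>T j in auto)
    qed
    then show ?thesis
    proof (rule MG2_spike[OF _ _ W _ T])
      show "negligible {T}" by simp
      fix t assume t: "t \<in> {0..T} - {T}"
      then obtain k where k: "k < N" "\<tau> k \<le> t" "t < \<tau> (Suc k)"
        using partition_cover[of \<tau> t N] p(1) unfolding is_partition_def by auto
      have eq: "(?g t) = (\<lambda>n w. \<Sum>j<N. f t (Z j w) * indicator {\<tau> j..<\<tau> (Suc j)} t)"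
        by (intro ext) (simp add: eproc partition_sum_eq[OF p(1) k])
      show "d2 (?g t) (\<lambda>n w. \<Sum>j<N. f t (Z j w) * indicator {\<tau> j..<\<tau> (Suc j)} t) = 0"
        unfolding eq by (rule two.cdist_self)
    qed
  qed
  moreover have "upper_less T (\<lambda>t. (d2 (?f t) (?g t))\<^sup>2) ((L\<^sup>2 + 1) * (e / (L\<^sup>2 + 1)) + 0 * (e / (L\<^sup>2 + 1)))"
  proof (rule upper_less_lin[OF Ls(2) Ls(2) L1 order_refl])
    fix t assume t: "t \<in> {0..T}"
    have "d2 (?f t) (?g t) \<le> L * d2 (\<eta> t) (\<lambda>_. eproc Ls t)"
      by (rule two.cdist_mono[OF V2[OF t] W[OF t] MG2D(1)[OF X t] eproc_V[OF Ls(1) t] L0]) (rule L[OF t])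
    then have "(d2 (?f t) (?g t))\<^sup>2 \<le> (L * d2 (\<eta> t) (\<lambda>_. eproc Ls t))\<^sup>2"
      by (intro power_mono two.cdist_nonneg V2 W t)
    also have "\<dots> \<le> (L\<^sup>2 + 1) * (d2 (\<eta> t) (\<lambda>_. eproc Ls t))\<^sup>2" by (simp add: power_mult_distrib mult_right_mono)
    finally show "(d2 (?f t) (?g t))\<^sup>2 \<le> (L\<^sup>2 + 1) * (d2 (\<eta> t) (\<lambda>_. eproc Ls t))\<^sup>2 + 0 * (d2 (\<eta> t) (\<lambda>_. eproc Ls t))\<^sup>2" by simp
  qed
  ultimately show "\<exists>\<zeta>\<in>MG2 T. upper_less T (\<lambda>t. (d2 (?f t) (\<zeta> t))\<^sup>2) e" using L1 by (intro bexI[of _ "\<lambda>t n w. f t (eproc Ls t w)"]) auto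
qed

section \<open>First order remainders\<close>

text \<open>
  The second bound gives convergence only where \<open>X\<close> and \<open>Y\<close> are bounded by some \<open>R\<close>; elsewhere
  the first one is used, with \<open>Y\<close> replaced by one fixed late term of its Cauchy sequence. A
  single cylinder function has higher moments, so its contribution on the set where \<open>X\<close> or \<open>Y\<close>
  exceeds \<open>R\<close> is small. In other words, a fixed element of the completion is uniformly
  integrable.
\<close>

lemma remainder_small:
  assumes X: "X \<in> V2" and Y: "Y \<in> V2" and K: "0 \<le> K" and C: "0 \<le> C"
    and \<rho>L: "\<And>\<delta> n. \<bar>\<delta>\<bar> \<le> 1 \<Longrightarrow> \<delta> \<noteq> 0 \<Longrightarrow> (\<lambda>w. \<rho> \<delta> (X n w) (Y n w)) \<in> L0ip"
    and b1: "\<And>\<delta> x y. \<bar>\<delta>\<bar> \<le> 1 \<Longrightarrow> \<delta> \<noteq> 0 \<Longrightarrow> \<bar>\<rho> \<delta> x y\<bar> \<le> K * (1 + \<bar>y\<bar>)"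
    and b2: "\<And>\<delta> x y. \<bar>\<delta>\<bar> \<le> 1 \<Longrightarrow> \<delta> \<noteq> 0 \<Longrightarrow> \<bar>\<rho> \<delta> x y\<bar> \<le> C * (1 + \<bar>x\<bar> + \<bar>y\<bar>) ^ k * \<bar>\<delta>\<bar>"
    and e: "0 < e"
  shows "\<exists>\<delta>0>0. \<exists>M. \<forall>\<delta>. \<delta> \<noteq> 0 \<longrightarrow> \<bar>\<delta>\<bar> < \<delta>0 \<longrightarrow> (\<forall>n\<ge>M. n2 (\<lambda>w. \<rho> \<delta> (X n w) (Y n w)) \<le> e)"
proof -
  note XL = two.cseqD(1)[OF X] and YL = two.cseqD(1)[OF Y]
  obtain BX where BX: "BX > 0" "\<And>n. n2 (X n) \<le> BX" using V_bounded[OF X] by blast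
  obtain BY where BY: "BY > 0" "\<And>n. n2 (Y n) \<le> BY" using V_bounded[OF Y] by blast
  (* Of the final bound e, one part d covers the set where X and Y are bounded and three parts K *
     d the other terms; P is the truncation level for the fixed term Y M, R the one for X and Y. *)
  define d where "d = e / (4 * (K + 1))"
  have d: "0 < d" using e K by (simp add: d_def)
  obtain M where M: "\<And>m n. m \<ge> M \<Longrightarrow> n \<ge> M \<Longrightarrow> n2 (\<lambda>w. Y m w - Y n w) < d" using two.cseqD(2)[OF Y d] by blast
  define Q where "Q = n2 (\<lambda>w. (1 + \<bar>Y M w\<bar>)\<^sup>2)"
  have QL: "(\<lambda>w. (1 + \<bar>Y M w\<bar>)\<^sup>2) \<in> L0ip" by (intro L0_intros YL)
  have Q: "0 \<le> Q" unfolding Q_def by (rule n2_nonneg[OF QL])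
  define P where "P = (Q + 1) / d"
  have P: "0 < P" "Q / P \<le> d" using Q d by (auto simp: P_def field_simps)
  define R where "R = (1 + P) * (BX + BY) / d"
  have cancel: "p / (p * q / d) * q \<le> d" if "0 < p" "0 < q" for p q using that d by (simp add: field_simps)
  have R: "0 < R" "(1 + P) / R * (BX + BY) \<le> d" using P d BX BY cancel[of "1 + P" "BX + BY"] by (auto simp: R_def)
  define D where "D = C * (1 + 2 * R) ^ k"
  have D: "0 \<le> D" using C R by (simp add: D_def)
  define \<delta>0 where "\<delta>0 = min 1 (d / (D + 1))"
  have \<delta>0: "0 < \<delta>0" "\<delta>0 \<le> 1" using d D by (auto simp: \<delta>0_def)
  have D\<delta>: "D * \<bar>\<delta>\<bar> \<le> d" if "\<bar>\<delta>\<bar> < \<delta>0" for \<delta>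
  proof -
    have "D * \<bar>\<delta>\<bar> \<le> D * (d / (D + 1))" using that D by (intro mult_left_mono) (auto simp: \<delta>0_def)
    also have "\<dots> \<le> d" using D d by (simp add: field_simps)
    finally show ?thesis .
  qed
  have pt: "\<bar>\<rho> \<delta> x y\<bar> \<le> D * \<bar>\<delta>\<bar> + K * (\<bar>y - z\<bar> + ((1 + P) / R * (\<bar>x\<bar> + \<bar>y\<bar>) + (1 / P) * (1 + \<bar>z\<bar>)\<^sup>2))" if \<delta>: "\<delta> \<noteq> 0" "\<bar>\<delta>\<bar> < \<delta>0" for \<delta> x y z
  proof -
    have r: "0 \<le> \<bar>y - z\<bar> + ((1 + P) / R * (\<bar>x\<bar> + \<bar>y\<bar>) + (1 / P) * (1 + \<bar>z\<bar>)\<^sup>2)" using P R by (intro add_nonneg_nonneg mult_nonneg_nonneg) auto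
    show ?thesis
    proof (cases "\<bar>x\<bar> \<le> R \<and> \<bar>y\<bar> \<le> R")
      case True
      have "\<bar>\<rho> \<delta> x y\<bar> \<le> C * (1 + \<bar>x\<bar> + \<bar>y\<bar>) ^ k * \<bar>\<delta>\<bar>" using b2 \<delta> \<delta>0 by auto
      also have "\<dots> \<le> D * \<bar>\<delta>\<bar>" unfolding D_def using True C by (intro mult_right_mono mult_left_mono power_mono) auto
      finally show ?thesis using mult_nonneg_nonneg[OF K r] by linarith
    next
      case False
      then have big: "1 \<le> (\<bar>x\<bar> + \<bar>y\<bar>) / R" using R by (auto simp: field_simps)
      have "1 + \<bar>z\<bar> \<le> (1 + P) * ((\<bar>x\<bar> + \<bar>y\<bar>) / R) + (1 / P) * (1 + \<bar>z\<bar>)\<^sup>2"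
      proof (cases "\<bar>z\<bar> \<le> P")
        case True
        have "1 + \<bar>z\<bar> \<le> (1 + P) * 1" using True by simp
        also have "\<dots> \<le> (1 + P) * ((\<bar>x\<bar> + \<bar>y\<bar>) / R)" using big P by (intro mult_left_mono) auto
        finally show ?thesis using P by (simp add: add_increasing2)
      next
        case False
        then have "P * (1 + \<bar>z\<bar>) \<le> (1 + \<bar>z\<bar>) * (1 + \<bar>z\<bar>)" by (intro mult_right_mono) auto
        then have "1 + \<bar>z\<bar> \<le> (1 / P) * (1 + \<bar>z\<bar>)\<^sup>2" using P by (simp add: power2_eq_square pos_le_divide_eq mult.commute)
        moreover have "0 \<le> (1 + P) * ((\<bar>x\<bar> + \<bar>y\<bar>) / R)" using P R by (intro mult_nonneg_nonneg) auto
        ultimately show ?thesis by linarith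
      qed
      then have "1 + \<bar>y\<bar> \<le> \<bar>y - z\<bar> + ((1 + P) / R * (\<bar>x\<bar> + \<bar>y\<bar>) + (1 / P) * (1 + \<bar>z\<bar>)\<^sup>2)" by simp
      then have "K * (1 + \<bar>y\<bar>) \<le> K * (\<bar>y - z\<bar> + ((1 + P) / R * (\<bar>x\<bar> + \<bar>y\<bar>) + (1 / P) * (1 + \<bar>z\<bar>)\<^sup>2))" using K by (rule mult_left_mono)
      moreover have "\<bar>\<rho> \<delta> x y\<bar> \<le> K * (1 + \<bar>y\<bar>)" using b1 \<delta> \<delta>0 by auto
      moreover have "0 \<le> D * \<bar>\<delta>\<bar>" using D by simp
      ultimately show ?thesis by linarith
    qed
  qed
  have "n2 (\<lambda>w. \<rho> \<delta> (X n w) (Y n w)) \<le> e" if \<delta>: "\<delta> \<noteq> 0" "\<bar>\<delta>\<bar> < \<delta>0" and n: "M \<le> n" for \<delta> n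
  proof -
    have L1: "(\<lambda>w. \<bar>X n w\<bar> + \<bar>Y n w\<bar>) \<in> L0ip" "(\<lambda>w. Y n w - Y M w) \<in> L0ip" by (intro L0_intros XL YL)+
    define U where "U w = (1 + P) / R * (\<bar>X n w\<bar> + \<bar>Y n w\<bar>) + (1 / P) * (1 + \<bar>Y M w\<bar>)\<^sup>2" for w
    define W where "W w = \<bar>Y n w - Y M w\<bar> + U w" for w
    have UL: "U \<in> L0ip" unfolding U_def by (intro L0_intros XL YL)
    have WL: "W \<in> L0ip" unfolding W_def by (intro L0_intros XL YL UL)
    have "n2 (\<lambda>w. \<bar>X n w\<bar> + \<bar>Y n w\<bar>) \<le> 1 * n2 (X n) + 1 * n2 (Y n)" by (rule two.dominated[OF L1(1) XL YL]) auto
    then have s: "n2 (\<lambda>w. \<bar>X n w\<bar> + \<bar>Y n w\<bar>) \<le> BX + BY" using BX(2)[of n] BY(2)[of n] by linarith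
    have "n2 U \<le> (1 + P) / R * n2 (\<lambda>w. \<bar>X n w\<bar> + \<bar>Y n w\<bar>) + (1 / P) * Q" unfolding Q_def
      by (rule two.dominated[OF UL L1(1) QL]) (use P R in \<open>auto simp: U_def\<close>)
    also have "\<dots> \<le> (1 + P) / R * (BX + BY) + Q / P" using s P R by (intro add_mono mult_left_mono) auto
    finally have U: "n2 U \<le> 2 * d" using P R by linarith
    have "n2 W \<le> 1 * n2 (\<lambda>w. Y n w - Y M w) + 1 * n2 U"
      by (rule two.dominated[OF WL L1(2) UL]) (auto simp: W_def)
    then have W: "n2 W \<le> 3 * d" using M[OF n order_refl] U by linarith
    have W0: "0 \<le> W w" for w unfolding W_def U_def using P R by (intro add_nonneg_nonneg mult_nonneg_nonneg) auto
    have "n2 (\<lambda>w. \<rho> \<delta> (X n w) (Y n w)) \<le> 1 * n2 (\<lambda>w. D * \<bar>\<delta>\<bar>) + K * n2 W"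
    proof (rule two.dominated)
      show "(\<lambda>w. \<rho> \<delta> (X n w) (Y n w)) \<in> L0ip" using \<rho>L \<delta> \<delta>0 by auto
      fix w show "\<bar>\<rho> \<delta> (X n w) (Y n w)\<bar> \<le> 1 * \<bar>D * \<bar>\<delta>\<bar>\<bar> + K * \<bar>W w\<bar>"
        using pt[OF \<delta>, of "X n w" "Y n w" "Y M w"] W0[of w] D by (simp add: W_def U_def abs_mult)
    qed (use K in \<open>auto intro: L0_intros WL\<close>)
    also have "\<dots> \<le> d + K * (3 * d)" using D\<delta>[OF \<delta>(2)] D W K by (intro add_mono mult_left_mono) (auto simp: n2_const abs_mult)
    also have "\<dots> \<le> 4 * (K + 1) * d" using d K by (simp add: algebra_simps)
    also have "\<dots> = e" using K by (simp add: d_def)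
    finally show ?thesis .
  qed
  then show ?thesis using \<delta>0(1) by blast
qed

end

section \<open>Stochastic differential equations\<close>

lemma exp_has_integral:
  fixes l t :: real assumes "0 < l" "0 \<le> t"
  shows "((\<lambda>r. exp (l * r)) has_integral (exp (l * t) - 1) / l) {0..t}"
proof -
  have "((\<lambda>r. exp (l * r)) has_integral (exp (l * t) / l - exp (l * 0) / l)) {0..t}"
    by (rule fundamental_theorem_of_calculus[OF assms(2)])
      (use assms in \<open>auto intro!: derivative_eq_intros simp flip: has_real_derivative_iff_has_vector_derivative\<close>)
  then show ?thesis by (simp add: diff_divide_distrib)
qed

text \<open>
  For a function that is merely integrable: starting from a constant bound, each insertion into
  the inequality halves the excess over \<open>2 * a * exp (2 * c * t)\<close>.
\<close>

lemma Gronwall_integrable: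
  fixes g :: "real \<Rightarrow> real"
  assumes g: "g integrable_on {0..T}" "\<And>t. t \<in> {0..T} \<Longrightarrow> 0 \<le> g t" and a: "0 \<le> a" and c: "0 < c"
    and le: "\<And>t. t \<in> {0..T} \<Longrightarrow> g t \<le> a + c * integral {0..t} g"
    and t: "t \<in> {0..T}"
  shows "g t \<le> 2 * a * exp (2 * c * t)"
proof -
  define M where "M = a + c * integral {0..T} g"
  have sub: "g integrable_on {0..t}" if "t \<in> {0..T}" for t
    by (rule integrable_on_subinterval[OF g(1)]) (use that in auto)
  have M0: "0 \<le> M" unfolding M_def using a c integral_nonneg[OF g] by simp
  have iter: "\<forall>t\<in>{0..T}. g t \<le> (2 * a + M * (1/2) ^ k) * exp (2 * c * t)" for k
  proof (induction k)
    case 0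
    show ?case
    proof
      fix t assume t: "t \<in> {0..T}"
      have "integral {0..t} g \<le> integral {0..T} g" by (rule integral_subset_le[OF _ sub[OF t] g(1)]) (use t g(2) in auto)
      then have "g t \<le> M" using le[OF t] c unfolding M_def by (smt (verit) mult_left_mono)
      also have "M \<le> (2 * a + M) * 1" using a by simp
      also have "\<dots> \<le> (2 * a + M) * exp (2 * c * t)" using a M0 c t by (intro mult_left_mono) auto
      finally show "g t \<le> (2 * a + M * (1/2) ^ 0) * exp (2 * c * t)" by simp
    qed
  next
    case (Suc k)
    show ?case
    proof
      fix t assume t: "t \<in> {0..T}"
      define b where "b = 2 * a + M * (1/2) ^ k"
      have b: "0 \<le> b" using a M0 by (simp add: b_def)
      have h: "((\<lambda>r. b * exp (2 * c * r)) has_integral b * ((exp (2 * c * t) - 1) / (2 * c))) {0..t}"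
        using exp_has_integral[of "2 * c" t] c t by (intro has_integral_mult_right) auto
      have "integral {0..t} g \<le> integral {0..t} (\<lambda>r. b * exp (2 * c * r))"
        by (rule integral_le[OF sub[OF t]]) (use h Suc t in \<open>auto simp: b_def\<close>)
      also have "\<dots> = b * ((exp (2 * c * t) - 1) / (2 * c))" by (rule integral_unique[OF h])
      finally have "g t \<le> a + c * (b * ((exp (2 * c * t) - 1) / (2 * c)))" using le[OF t] c by (smt (verit) mult_left_mono)
      also have "\<dots> = a + b * (exp (2 * c * t) - 1) / 2" using c by (simp add: field_simps)
      also have "\<dots> = a * exp (2 * c * t) + (M * (1/2) ^ k / 2) * exp (2 * c * t) - M * (1/2) ^ k / 2"
        by (simp add: b_def field_simps)
      also have "\<dots> \<le> a * exp (2 * c * t) + (M * (1/2) ^ k / 2) * exp (2 * c * t)"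
        using M0 by simp
      also have "\<dots> \<le> (2 * a + M * (1/2) ^ Suc k) * exp (2 * c * t)"
        using a by (simp add: algebra_simps mult_right_mono)
      finally show "g t \<le> (2 * a + M * (1/2) ^ Suc k) * exp (2 * c * t)" .
    qed
  qed
  have "(\<lambda>k. (2 * a + M * (1/2) ^ k) * exp (2 * c * t)) \<longlonglongrightarrow> (2 * a + M * 0) * exp (2 * c * t)"
    by (intro tendsto_intros LIMSEQ_power_zero) simp
  then have "g t \<le> (2 * a + M * 0) * exp (2 * c * t)" by (rule LIMSEQ_le_const) (use iter t in auto)
  then show ?thesis by simp
qed

context G_Brownian_expectation
begin

lemma has_int_bound:
  assumes A: "integrator A C T" and t: "0 \<le> t" "t \<le> T" and X: "\<eta> \<in> MG2 T" and I: "has_int A t \<eta> I"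
  shows "(d2 I (\<lambda>_ _. 0))\<^sup>2 \<le> 3 * C * integral {0..T} (\<lambda>r. (d2 (\<eta> r) (\<lambda>_ _. 0))\<^sup>2)"
proof -
  have At: "integrator A C t" by (rule integrator_restrict[OF A t(2)])
  have i: "(\<lambda>r. (d2 (\<eta> r) (\<lambda>_ _. 0))\<^sup>2) integrable_on {0..T}" using t by (intro MG2_norm_integrable X) auto
  have "(d2 I (\<lambda>_ _. 0))\<^sup>2 \<le> 3 * C * integral {0..t} (\<lambda>r. (d2 (\<eta> r) (\<lambda>_ _. 0))\<^sup>2)"
    by (rule has_int_dist[OF At t(1) I has_int_zero[OF At t(1)]])
  also have "\<dots> \<le> 3 * C * integral {0..T} (\<lambda>r. (d2 (\<eta> r) (\<lambda>_ _. 0))\<^sup>2)"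
    using integratorD(1)[OF A] t
    by (intro mult_left_mono integral_subset_le[OF _ integrable_on_subinterval[OF i] i]) auto
  finally show ?thesis .
qed

lemma has_int_process_MG2:
  assumes A: "integrator A C T" and T: "0 \<le> T" and X: "\<eta> \<in> MG2 T" and I: "\<And>t. t \<in> {0..T} \<Longrightarrow> has_int A t \<eta> (I t)"
  shows "I \<in> MG2 T"
proof (rule MG2_continuous[OF T])
  show "I t \<in> adapted t" if "t \<in> {0..T}" for t by (rule has_intD(1)[OF I[OF that]])
  have C0: "0 \<le> C" by (rule integratorD(1)[OF A])
  let ?g = "\<lambda>r. (d2 (\<eta> r) (\<lambda>_ _. 0))\<^sup>2"
  have i: "?g integrable_on {0..T}" by (rule MG2_norm_integrable[OF T X])
  define h where "h t = integral {0..t} ?g" for t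
  have "uniformly_continuous_on {0..T} h" unfolding h_def
    by (intro compact_uniformly_continuous indefinite_integral_continuous_1 i) simp
  fix e :: real assume e: "0 < e"
  define d where "d = e\<^sup>2 / (3 * C + 1)"
  have d: "0 < d" "(3 * C + 1) * d = e\<^sup>2" using e C0 by (auto simp: d_def)
  obtain \<delta> where \<delta>: "0 < \<delta>" "\<And>s t. s \<in> {0..T} \<Longrightarrow> t \<in> {0..T} \<Longrightarrow> dist t s < \<delta> \<Longrightarrow> dist (h t) (h s) < d"
    by (rule uniformly_continuous_onE[OF \<open>uniformly_continuous_on {0..T} h\<close> d(1)]) (rule that)
  have lt: "d2 (I t) (I s) < e" if st: "s \<in> {0..T}" "t \<in> {0..T}" "s \<le> t" "\<bar>s - t\<bar> < \<delta>" for s t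
  proof -
    have "(d2 (I t) (I s))\<^sup>2 \<le> 3 * C * integral {s..t} ?g"
      by (rule has_int_increment[OF A _ _ _ X I I]) (use st in auto)
    also have "integral {s..t} ?g = h t - h s"
      using Henstock_Kurzweil_Integration.integral_combine[OF _ _ integrable_on_subinterval[OF i, of 0 t], of s] st by (auto simp: h_def)
    also have "3 * C * (h t - h s) \<le> 3 * C * d" using \<delta>(2)[OF st(1,2)] st C0 by (intro mult_left_mono) (auto simp: dist_real_def)
    also have "\<dots> < (3 * C + 1) * d" using d by (simp add: algebra_simps)
    finally have "(d2 (I t) (I s))\<^sup>2 < e\<^sup>2" using d by simp
    then show ?thesis using e by (intro power2_less_imp_less[of _ e]) auto
  qed
  have "d2 (I s) (I t) < e" if st: "s \<in> {0..T}" "t \<in> {0..T}" "\<bar>s - t\<bar> < \<delta>" for s t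
    using lt[of s t] lt[of t s] st two.cdist_commute[OF has_intD(2)[OF I[OF st(1)]] has_intD(2)[OF I[OF st(2)]]]
    by (cases "s \<le> t") (auto simp: abs_minus_commute)
  then show "\<exists>\<delta>>0. \<forall>s\<in>{0..T}. \<forall>t\<in>{0..T}. \<bar>s - t\<bar> < \<delta> \<longrightarrow> d2 (I s) (I t) < e" using \<delta>(1) by blast
qed

lemma MG2_const: "0 \<le> T \<Longrightarrow> (\<lambda>t n w. c) \<in> MG2 T"
  by (rule MG2_continuous) (auto intro: adapted_const simp: two.cdist_self exI[of _ 1])

lemma V_affine_sum:
  assumes "\<And>i. i \<in> K \<Longrightarrow> I i \<in> V2" shows "(\<lambda>n w. x + (\<Sum>i\<in>K. I i n w)) \<in> V2"
proof -
  have "(\<lambda>n w. \<Sum>i\<in>K. I i n w) \<in> V2" using two.cdist_sum_le[of K I I] assms by simp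
  then show ?thesis by (intro two.cseq_add V_const L0_intros)
qed

lemma d2_affine_sum:
  assumes "finite K" "\<And>i. i \<in> K \<Longrightarrow> I i \<in> V2" "\<And>i. i \<in> K \<Longrightarrow> J i \<in> V2"
  shows "(d2 (\<lambda>n w. x + (\<Sum>i\<in>K. I i n w)) (\<lambda>n w. y + (\<Sum>i\<in>K. J i n w)))\<^sup>2 \<le> 2 * (x - y)\<^sup>2 + 2 * real (card K) * (\<Sum>i\<in>K. (d2 (I i) (J i))\<^sup>2)"
proof -
  have s: "(\<lambda>n w. \<Sum>i\<in>K. I i n w) \<in> V2" "(\<lambda>n w. \<Sum>i\<in>K. J i n w) \<in> V2"
    "d2 (\<lambda>n w. \<Sum>i\<in>K. I i n w) (\<lambda>n w. \<Sum>i\<in>K. J i n w) \<le> (\<Sum>i\<in>K. d2 (I i) (J i))" using two.cdist_sum_le[of K I J] assms by auto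
  have c: "(\<lambda>n w. z) \<in> V2" for z :: real by (intro V_const L0_intros)
  have "d2 (\<lambda>n w. x + (\<Sum>i\<in>K. I i n w)) (\<lambda>n w. y + (\<Sum>i\<in>K. J i n w)) \<le> d2 (\<lambda>n w. x) (\<lambda>n w. y) + d2 (\<lambda>n w. \<Sum>i\<in>K. I i n w) (\<lambda>n w. \<Sum>i\<in>K. J i n w)"
    by (rule d2_add_le[OF c s(1) c s(2)])
  also have "\<dots> \<le> \<bar>x - y\<bar> + (\<Sum>i\<in>K. d2 (I i) (J i))" using s(3) by (simp add: two.cdist_const n2_const)
  finally have "(d2 (\<lambda>n w. x + (\<Sum>i\<in>K. I i n w)) (\<lambda>n w. y + (\<Sum>i\<in>K. J i n w)))\<^sup>2 \<le> (\<bar>x - y\<bar> + (\<Sum>i\<in>K. d2 (I i) (J i)))\<^sup>2"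
    by (intro power_mono two.cdist_nonneg V_affine_sum assms)
  also have "\<dots> \<le> 2 * \<bar>x - y\<bar>\<^sup>2 + 2 * (\<Sum>i\<in>K. d2 (I i) (J i))\<^sup>2" by (rule sum_square_le)
  also have "(\<Sum>i\<in>K. d2 (I i) (J i))\<^sup>2 \<le> (\<Sum>i\<in>K. (d2 (I i) (J i))\<^sup>2) * real (card K)"
    by (rule sum_squared_le_sum_of_squares)
  finally show ?thesis by (simp add: algebra_simps)
qed

text \<open>
  The difference of the equations is squared, each integral is estimated by \<open>has_int_dist\<close>, and
  Gronwall's inequality absorbs the part of the integrands controlled by \<open>D - Y\<close>. What remains
  is \<open>R\<close>. The two equations need not have the same form; below, one is the equation of a
  difference quotient and the other its formal limit.
\<close>

lemma SDE_stability:
  assumes K: "finite K" and T: "0 \<le> T" and A: "\<And>i. i \<in> K \<Longrightarrow> integrator (A i) C T" and C: "0 \<le> C"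
    and I: "\<And>i t. i \<in> K \<Longrightarrow> t \<in> {0..T} \<Longrightarrow> has_int (A i) t (\<eta> i) (I i t)"
    and J: "\<And>i t. i \<in> K \<Longrightarrow> t \<in> {0..T} \<Longrightarrow> has_int (A i) t (\<zeta> i) (J i t)"
    and D: "D \<in> MG2 T" "\<And>t. t \<in> {0..T} \<Longrightarrow> d2 (D t) (\<lambda>n w. x + (\<Sum>i\<in>K. I i t n w)) = 0"
    and Y: "Y \<in> MG2 T" "\<And>t. t \<in> {0..T} \<Longrightarrow> d2 (Y t) (\<lambda>n w. y + (\<Sum>i\<in>K. J i t n w)) = 0"
    and R: "\<And>i. i \<in> K \<Longrightarrow> R i integrable_on {0..T}" "\<And>i t. i \<in> K \<Longrightarrow> t \<in> {0..T} \<Longrightarrow> 0 \<le> R i t"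
    and l: "0 \<le> l" and le: "\<And>i t. i \<in> K \<Longrightarrow> t \<in> {0..T} \<Longrightarrow> (d2 (\<eta> i t) (\<zeta> i t))\<^sup>2 \<le> l * (d2 (D t) (Y t))\<^sup>2 + R i t"
    and t: "t \<in> {0..T}"
  shows "(d2 (D t) (Y t))\<^sup>2 \<le> 2 * (2 * (x - y)\<^sup>2 + 6 * C * real (card K) * (\<Sum>i\<in>K. integral {0..T} (R i))) * exp (2 * (6 * C * real (card K) * real (card K) * l + 1) * T)"
proof -
  let ?g = "\<lambda>t. (d2 (D t) (Y t))\<^sup>2"
  let ?n = "real (card K)"
  define a where "a = 2 * (x - y)\<^sup>2 + 6 * C * ?n * (\<Sum>i\<in>K. integral {0..T} (R i))"
  define c where "c = 6 * C * ?n * ?n * l + 1"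
  have g: "?g integrable_on {0..T}" by (rule MG2_dist_integrable[OF T D(1) Y(1)])
  have Ri0: "0 \<le> integral {0..T} (R i)" if "i \<in> K" for i by (rule integral_nonneg[OF R(1)[OF that] R(2)[OF that]])
  have a0: "0 \<le> a" unfolding a_def using C Ri0 by (intro add_nonneg_nonneg mult_nonneg_nonneg sum_nonneg) auto
  have c0: "0 < c" unfolding c_def using C l by (intro add_nonneg_pos) auto
  have est: "?g t \<le> a + c * integral {0..t} ?g" if t: "t \<in> {0..T}" for t
  proof -
    have t': "0 \<le> t" "t \<le> T" using t by auto
    have gi: "?g integrable_on {0..t}" by (rule integrable_on_subinterval[OF g]) (use t in auto)
    have IV: "I i t \<in> V2" if "i \<in> K" for i by (rule has_intD(2)[OF I[OF that t]])
    have JV: "J i t \<in> V2" if "i \<in> K" for i by (rule has_intD(2)[OF J[OF that t]])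
    note v = MG2D(1)[OF D(1) t] V_affine_sum[of K "\<lambda>i. I i t" x, OF IV] MG2D(1)[OF Y(1) t] V_affine_sum[of K "\<lambda>i. J i t" y, OF JV]
    have "d2 (D t) (Y t) = d2 (\<lambda>n w. x + (\<Sum>i\<in>K. I i t n w)) (Y t)" by (rule d2_eq_0_cong[OF v(1,2,3) D(2)[OF t]])
    also have "\<dots> = d2 (Y t) (\<lambda>n w. x + (\<Sum>i\<in>K. I i t n w))" by (rule two.cdist_commute[OF v(2,3)])
    also have "\<dots> = d2 (\<lambda>n w. y + (\<Sum>i\<in>K. J i t n w)) (\<lambda>n w. x + (\<Sum>i\<in>K. I i t n w))" by (rule d2_eq_0_cong[OF v(3,4,2) Y(2)[OF t]])
    finally have "?g t \<le> 2 * (y - x)\<^sup>2 + 2 * ?n * (\<Sum>i\<in>K. (d2 (J i t) (I i t))\<^sup>2)"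
      using d2_affine_sum[OF K JV IV] by simp
    also have "(\<Sum>i\<in>K. (d2 (J i t) (I i t))\<^sup>2) \<le> (\<Sum>i\<in>K. 3 * C * (l * integral {0..t} ?g + integral {0..T} (R i)))"
    proof (rule sum_mono)
      fix i assume i: "i \<in> K"
      have Ai: "integrator (A i) C t" by (rule integrator_restrict[OF A[OF i] t'(2)])
      have Rt: "R i integrable_on {0..t}" by (rule integrable_on_subinterval[OF R(1)[OF i]]) (use t in auto)
      have "(d2 (J i t) (I i t))\<^sup>2 = (d2 (I i t) (J i t))\<^sup>2" using two.cdist_commute[OF IV[OF i] JV[OF i]] by simp
      also have "\<dots> \<le> 3 * C * integral {0..t} (\<lambda>r. (d2 (\<eta> i r) (\<zeta> i r))\<^sup>2)"
        by (rule has_int_dist[OF Ai t'(1) I[OF i t] J[OF i t]])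
      also have "integral {0..t} (\<lambda>r. (d2 (\<eta> i r) (\<zeta> i r))\<^sup>2) \<le> integral {0..t} (\<lambda>r. l * ?g r + R i r)"
      proof (rule integral_le)
        show "(\<lambda>r. (d2 (\<eta> i r) (\<zeta> i r))\<^sup>2) integrable_on {0..t}"
          by (rule MG2_dist_integrable[OF t'(1) has_int_MG2[OF I[OF i t]] has_int_MG2[OF J[OF i t]]])
        show "(\<lambda>r. l * ?g r + R i r) integrable_on {0..t}" by (intro integrable_add integrable_on_mult_right gi Rt)
      qed (use le[OF i] t in auto)
      also have "\<dots> = l * integral {0..t} ?g + integral {0..t} (R i)"
        using gi Rt by (subst integral_add) (auto intro: integrable_on_mult_right)
      also have "integral {0..t} (R i) \<le> integral {0..T} (R i)"
        by (rule integral_subset_le[OF _ Rt R(1)[OF i]]) (use t R(2)[OF i] in auto)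
      finally show "(d2 (J i t) (I i t))\<^sup>2 \<le> 3 * C * (l * integral {0..t} ?g + integral {0..T} (R i))"
        using C by (simp add: mult_left_mono)
    qed
    also have "\<dots> = 3 * C * (?n * l * integral {0..t} ?g + (\<Sum>i\<in>K. integral {0..T} (R i)))"
      by (simp add: sum.distrib sum_distrib_left[symmetric] algebra_simps)
    finally have "?g t \<le> 2 * (y - x)\<^sup>2 + 2 * ?n * (3 * C * (?n * l * integral {0..t} ?g + (\<Sum>i\<in>K. integral {0..T} (R i))))"
      by (simp add: mult_left_mono)
    also have "\<dots> = a + (c - 1) * integral {0..t} ?g" by (simp add: a_def c_def algebra_simps power2_commute)
    also have "\<dots> \<le> a + c * integral {0..t} ?g" using integral_nonneg[OF gi] by (simp add: algebra_simps)
    finally show ?thesis .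
  qed
  have "?g t \<le> 2 * a * exp (2 * c * t)" by (rule Gronwall_integrable[OF g _ a0 c0 est t]) auto
  also have "\<dots> \<le> 2 * a * exp (2 * c * T)" using a0 c0 t by (intro mult_left_mono) auto
  finally show ?thesis by (simp add: a_def c_def)
qed

text \<open>
  Picard iteration. The squared distance of consecutive iterates is at most
  \<open>M * (1/4) ^ k * exp (l * t)\<close>, with \<open>l\<close> chosen so large that integrating \<open>exp (l * t)\<close> gains
  the factor \<open>1/4\<close>; so the iterates converge uniformly in time, and the limit is a fixed point.
\<close>

lemma SDE_solution:
  assumes K: "finite K" and T: "0 \<le> T" and A: "\<And>i. i \<in> K \<Longrightarrow> integrator (A i) C T" and C: "0 \<le> C"
    and F: "\<And>i Y. i \<in> K \<Longrightarrow> Y \<in> MG2 T \<Longrightarrow> (\<lambda>r. F i r (Y r)) \<in> MG2 T" and L: "0 \<le> L"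
    and Lip: "\<And>i r X Y. i \<in> K \<Longrightarrow> r \<in> {0..T} \<Longrightarrow> X \<in> V2 \<Longrightarrow> Y \<in> V2 \<Longrightarrow> d2 (F i r X) (F i r Y) \<le> L * d2 X Y"
  obtains Y I where "Y \<in> MG2 T" "\<And>i t. i \<in> K \<Longrightarrow> t \<in> {0..T} \<Longrightarrow> has_int (A i) t (\<lambda>r. F i r (Y r)) (I i t)"
     "\<And>t. t \<in> {0..T} \<Longrightarrow> d2 (Y t) (\<lambda>n w. x + (\<Sum>i\<in>K. I i t n w)) = 0"
proof -
  let ?n = "real (card K)"
  define J where "J Y i t = (SOME I. has_int (A i) t (\<lambda>r. F i r (Y r)) I)" for Y i t
  have J: "has_int (A i) t (\<lambda>r. F i r (Y r)) (J Y i t)" if iK: "i \<in> K" and t: "t \<in> {0..T}" and Y: "Y \<in> MG2 T" for Y i t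
  proof -
    have t': "0 \<le> t" "t \<le> T" using t by auto
    obtain I where "has_int (A i) t (\<lambda>r. F i r (Y r)) I"
      by (rule has_int_exists[OF integrator_restrict[OF A[OF iK] t'(2)] t'(1) MG2_restrict[OF F[OF iK Y] t']])
    then show ?thesis unfolding J_def by (rule someI[of "has_int (A i) t (\<lambda>r. F i r (Y r))"])
  qed
  define \<Phi> where "\<Phi> Y t n w = x + (\<Sum>i\<in>K. J Y i t n w)" for Y t n w
  have JV: "J Y i t \<in> V2" if "i \<in> K" "t \<in> {0..T}" "Y \<in> MG2 T" for Y i t by (rule has_intD(2)[OF J[OF that]])
  have \<Phi>MG2: "\<Phi> Y \<in> MG2 T" if Y: "Y \<in> MG2 T" for Y
  proof -
    have "J Y i \<in> MG2 T" if i: "i \<in> K" for i by (rule has_int_process_MG2[OF A[OF i] T F[OF i Y] J[OF i _ Y]])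
    then have "(\<lambda>t n w. x + (\<Sum>i\<in>K. J Y i t n w)) \<in> MG2 T" by (intro MG2_add MG2_const MG2_sum T)
    then show ?thesis by (simp add: \<Phi>_def[abs_def])
  qed
  define c where "c = 6 * C * ?n * ?n * L\<^sup>2 + 1"
  have c: "0 < c" unfolding c_def using C by (intro add_nonneg_pos) auto
  have contr: "(d2 (\<Phi> Y t) (\<Phi> Y' t))\<^sup>2 \<le> c * integral {0..t} (\<lambda>r. (d2 (Y r) (Y' r))\<^sup>2)"
    if Y: "Y \<in> MG2 T" and Y': "Y' \<in> MG2 T" and t: "t \<in> {0..T}" for Y Y' t
  proof -
    have t': "0 \<le> t" "t \<le> T" using t by auto
    have gi: "(\<lambda>r. (d2 (Y r) (Y' r))\<^sup>2) integrable_on {0..t}"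
      by (rule MG2_dist_integrable[OF t'(1) MG2_restrict[OF Y t'] MG2_restrict[OF Y' t']])
    have g0: "0 \<le> integral {0..t} (\<lambda>r. (d2 (Y r) (Y' r))\<^sup>2)" by (intro integral_nonneg gi) auto
    have "(d2 (\<Phi> Y t) (\<Phi> Y' t))\<^sup>2 \<le> 2 * (x - x)\<^sup>2 + 2 * ?n * (\<Sum>i\<in>K. (d2 (J Y i t) (J Y' i t))\<^sup>2)"
      unfolding \<Phi>_def[abs_def] by (rule d2_affine_sum[OF K JV[OF _ t Y] JV[OF _ t Y']])
    also have "(\<Sum>i\<in>K. (d2 (J Y i t) (J Y' i t))\<^sup>2) \<le> (\<Sum>i\<in>K. 3 * C * (L\<^sup>2 * integral {0..t} (\<lambda>r. (d2 (Y r) (Y' r))\<^sup>2)))"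
    proof (rule sum_mono)
      fix i assume i: "i \<in> K"
      have "(d2 (J Y i t) (J Y' i t))\<^sup>2 \<le> 3 * C * integral {0..t} (\<lambda>r. (d2 (F i r (Y r)) (F i r (Y' r)))\<^sup>2)"
        by (rule has_int_dist[OF integrator_restrict[OF A[OF i] t'(2)] t'(1) J[OF i t Y] J[OF i t Y']])
      also have "integral {0..t} (\<lambda>r. (d2 (F i r (Y r)) (F i r (Y' r)))\<^sup>2) \<le> integral {0..t} (\<lambda>r. L\<^sup>2 * (d2 (Y r) (Y' r))\<^sup>2)"
      proof (rule integral_le)
        show "(\<lambda>r. (d2 (F i r (Y r)) (F i r (Y' r)))\<^sup>2) integrable_on {0..t}"
          by (rule MG2_dist_integrable[OF t'(1) MG2_restrict[OF F[OF i Y] t'] MG2_restrict[OF F[OF i Y'] t']])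
        show "(\<lambda>r. L\<^sup>2 * (d2 (Y r) (Y' r))\<^sup>2) integrable_on {0..t}" by (intro integrable_on_mult_right gi)
        fix r assume "r \<in> {0..t}"
        then have r: "r \<in> {0..T}" using t by auto
        have "(d2 (F i r (Y r)) (F i r (Y' r)))\<^sup>2 \<le> (L * d2 (Y r) (Y' r))\<^sup>2"
          by (intro power_mono Lip i r two.cdist_nonneg MG2D(1)[OF Y r] MG2D(1)[OF Y' r] MG2D(1)[OF F[OF i Y] r] MG2D(1)[OF F[OF i Y'] r])
        then show "(d2 (F i r (Y r)) (F i r (Y' r)))\<^sup>2 \<le> L\<^sup>2 * (d2 (Y r) (Y' r))\<^sup>2" by (simp add: power_mult_distrib)
      qed
      also have "\<dots> = L\<^sup>2 * integral {0..t} (\<lambda>r. (d2 (Y r) (Y' r))\<^sup>2)" by simp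
      finally show "(d2 (J Y i t) (J Y' i t))\<^sup>2 \<le> 3 * C * (L\<^sup>2 * integral {0..t} (\<lambda>r. (d2 (Y r) (Y' r))\<^sup>2))" using C by (simp add: mult_left_mono)
    qed
    also have "2 * (x - x)\<^sup>2 + 2 * ?n * (\<Sum>i\<in>K. 3 * C * (L\<^sup>2 * integral {0..t} (\<lambda>r. (d2 (Y r) (Y' r))\<^sup>2))) = (c - 1) * integral {0..t} (\<lambda>r. (d2 (Y r) (Y' r))\<^sup>2)"
      by (simp add: c_def algebra_simps)
    also have "\<dots> \<le> c * integral {0..t} (\<lambda>r. (d2 (Y r) (Y' r))\<^sup>2)" using g0 by (intro mult_right_mono) auto
    finally show ?thesis by (simp add: mult_left_mono)
  qed
  define P where "P k = (\<Phi> ^^ k) (\<lambda>t n w. 0)" for k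
  have P0: "P 0 = (\<lambda>t n w. 0)" and PS: "P (Suc k) = \<Phi> (P k)" for k by (simp_all add: P_def)
  have P: "P k \<in> MG2 T" for k by (induction k) (auto simp: P0 PS MG2_zero T \<Phi>MG2)
  have PV: "P k t \<in> V2" if "t \<in> {0..T}" for k t by (rule MG2D(1)[OF P that])
  define M where "M = 2 * x\<^sup>2 + 2 * ?n * (\<Sum>i\<in>K. 3 * C * integral {0..T} (\<lambda>r. (d2 (F i r (\<lambda>_ _. 0)) (\<lambda>_ _. 0))\<^sup>2))"
  have d0: "(d2 (P (Suc 0) t) (P 0 t))\<^sup>2 \<le> M" if t: "t \<in> {0..T}" for t
  proof -
    have 0: "(\<lambda>t n w. 0) \<in> MG2 T" by (rule MG2_zero[OF T])
    have t': "0 \<le> t" "t \<le> T" using t by auto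
    have "(d2 (P (Suc 0) t) (P 0 t))\<^sup>2 = (d2 (\<lambda>n w. x + (\<Sum>i\<in>K. J (\<lambda>t n w. 0) i t n w)) (\<lambda>n w. 0 + (\<Sum>i\<in>K. (\<lambda>i n w. 0) i n w)))\<^sup>2"
      by (simp add: P0 PS \<Phi>_def[abs_def])
    also have "\<dots> \<le> 2 * (x - 0)\<^sup>2 + 2 * ?n * (\<Sum>i\<in>K. (d2 (J (\<lambda>t n w. 0) i t) (\<lambda>n w. 0))\<^sup>2)"
      by (rule d2_affine_sum[OF K JV[OF _ t 0] V_zero])
    also have "\<dots> \<le> M" unfolding M_def
      using has_int_bound[OF A t' F[OF _ 0] J[OF _ t 0]] by (auto intro!: mult_left_mono sum_mono)
    finally show ?thesis .
  qed
  have M0: "0 \<le> M" using d0[of 0] T order_trans[OF zero_le_power2] by auto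
  define l where "l = 4 * c"
  have l: "0 < l" using c by (simp add: l_def)
  have dk: "\<forall>t\<in>{0..T}. (d2 (P (Suc k) t) (P k t))\<^sup>2 \<le> M * (1/4) ^ k * exp (l * t)" for k
  proof (induction k)
    case 0
    show ?case
    proof
      fix t assume t: "t \<in> {0..T}"
      have "M * 1 \<le> M * exp (l * t)" using M0 l t by (intro mult_left_mono) auto
      then show "(d2 (P (Suc 0) t) (P 0 t))\<^sup>2 \<le> M * (1/4) ^ 0 * exp (l * t)" using d0[OF t] by simp
    qed
  next
    case (Suc k)
    show ?case
    proof
      fix t assume t: "t \<in> {0..T}"
      then have t': "0 \<le> t" "t \<le> T" by auto
      define b where "b = M * (1/4) ^ k"
      have b: "0 \<le> b" using M0 by (simp add: b_def)
      have h: "((\<lambda>r. b * exp (l * r)) has_integral b * ((exp (l * t) - 1) / l)) {0..t}"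
        using exp_has_integral[OF l t'(1)] by (intro has_integral_mult_right)
      have "(d2 (P (Suc (Suc k)) t) (P (Suc k) t))\<^sup>2 \<le> c * integral {0..t} (\<lambda>r. (d2 (P (Suc k) r) (P k r))\<^sup>2)"
        using contr[OF P[of "Suc k"] P[of k] t] by (simp only: PS)
      also have "integral {0..t} (\<lambda>r. (d2 (P (Suc k) r) (P k r))\<^sup>2) \<le> integral {0..t} (\<lambda>r. b * exp (l * r))"
      proof (rule integral_le)
        show "(\<lambda>r. (d2 (P (Suc k) r) (P k r))\<^sup>2) integrable_on {0..t}" by (rule MG2_dist_integrable[OF t'(1) MG2_restrict[OF P t'] MG2_restrict[OF P t']])
      qed (use h Suc t in \<open>auto simp: b_def\<close>)
      also have "\<dots> = b * ((exp (l * t) - 1) / l)" by (rule integral_unique[OF h])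
      also have "c * (b * ((exp (l * t) - 1) / l)) = b * (exp (l * t) - 1) / 4" using c by (simp add: l_def field_simps)
      also have "\<dots> \<le> b * exp (l * t) / 4" using b by (simp add: algebra_simps)
      finally show "(d2 (P (Suc (Suc k)) t) (P (Suc k) t))\<^sup>2 \<le> M * (1/4) ^ Suc k * exp (l * t)"
        using c by (simp add: b_def mult_left_mono)
    qed
  qed
  define S where "S = sqrt (M * exp (l * T))"
  have S0: "0 \<le> S" using M0 by (simp add: S_def)
  have step: "d2 (P (Suc k) t) (P k t) \<le> S * (1/2) ^ k" if t: "t \<in> {0..T}" for k t
  proof (rule power2_le_imp_le)
    have "(d2 (P (Suc k) t) (P k t))\<^sup>2 \<le> M * (1/4) ^ k * exp (l * t)" using dk t by blast
    also have "\<dots> \<le> M * (1/4) ^ k * exp (l * T)" using M0 l t by (intro mult_left_mono) auto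
    also have "\<dots> = (S * (1/2) ^ k)\<^sup>2"
    proof -
      have "((1/2::real) ^ k)\<^sup>2 = (1/4) ^ k" by (simp add: power2_eq_square flip: power_mult_distrib)
      then show ?thesis using M0 by (simp add: S_def power_mult_distrib mult.commute mult.left_commute)
    qed
    finally show "(d2 (P (Suc k) t) (P k t))\<^sup>2 \<le> (S * (1/2) ^ k)\<^sup>2" .
  qed (use S0 in simp)
  have far: "d2 (P k t) (P m t) \<le> 2 * S * (1/2) ^ k - 2 * S * (1/2) ^ m" if t: "t \<in> {0..T}" and km: "k \<le> m" for k m t
    using km
  proof (induction m rule: dec_induct)
    case base then show ?case by (simp add: two.cdist_self)
  next
    case (step m)
    have "d2 (P k t) (P (Suc m) t) \<le> d2 (P k t) (P m t) + d2 (P m t) (P (Suc m) t)"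
      by (intro two.cdist_triangle PV t)
    also have "d2 (P m t) (P (Suc m) t) \<le> S * (1/2) ^ m"
      using \<open>\<And>t k. t \<in> {0..T} \<Longrightarrow> d2 (P (Suc k) t) (P k t) \<le> S * (1/2) ^ k\<close>[OF t, of m] two.cdist_commute[OF PV[OF t] PV[OF t]] by simp
    finally show ?case using step.IH by simp
  qed
  have near: "d2 (P k t) (P m t) \<le> 2 * S * (1/2) ^ k" if t: "t \<in> {0..T}" and km: "k \<le> m" for k m t
    using far[OF t km] mult_nonneg_nonneg[OF S0, of "(1/2) ^ m"] by simp
  have pow0: "(\<lambda>k. 2 * S * (1/2) ^ k) \<longlonglongrightarrow> 0"
    using tendsto_mult[OF tendsto_const[of "2 * S"] LIMSEQ_power_zero[of "1/2::real"]] by simp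
  have lim: "\<exists>y. y \<in> V2 \<and> (\<lambda>k. d2 (P k t) y) \<longlonglongrightarrow> 0" if t: "t \<in> {0..T}" for t
  proof (rule two.cseq_complete[of "\<lambda>k. P k t", OF PV[OF t]])
    fix e :: real assume e: "0 < e"
    obtain N where N: "\<forall>k\<ge>N. 2 * S * (1/2) ^ k < e"
      using order_tendstoD(2)[OF pow0 e] unfolding eventually_sequentially by blast
    have "d2 (P k t) (P m t) < e" if "k \<ge> N" "m \<ge> N" for k m
      using near[OF t, of k m] near[OF t, of m k] N that two.cdist_commute[OF PV[OF t, of k] PV[OF t, of m]]
      by (cases "k \<le> m") (auto intro: le_less_trans)
    then show "\<exists>N. \<forall>k\<ge>N. \<forall>l\<ge>N. d2 (P k t) (P l t) < e" by blast
  qed blast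
  have "\<forall>t. \<exists>y. t \<in> {0..T} \<longrightarrow> y \<in> V2 \<and> (\<lambda>k. d2 (P k t) y) \<longlonglongrightarrow> 0" using lim by blast
  then have "\<exists>Y. \<forall>t. t \<in> {0..T} \<longrightarrow> Y t \<in> V2 \<and> (\<lambda>k. d2 (P k t) (Y t)) \<longlonglongrightarrow> 0" by (rule choice)
  then obtain Y where YV: "\<And>t. t \<in> {0..T} \<Longrightarrow> Y t \<in> V2" and Ylim: "\<And>t. t \<in> {0..T} \<Longrightarrow> (\<lambda>k. d2 (P k t) (Y t)) \<longlonglongrightarrow> 0" by blast
  have Yb: "d2 (P k t) (Y t) \<le> 2 * S * (1/2) ^ k" if t: "t \<in> {0..T}" for k t
  proof -
    have "(\<lambda>m. 2 * S * (1/2) ^ k + d2 (P m t) (Y t)) \<longlonglongrightarrow> 2 * S * (1/2) ^ k + 0" by (intro tendsto_intros Ylim t)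
    then have "d2 (P k t) (Y t) \<le> 2 * S * (1/2) ^ k + 0"
    proof (rule LIMSEQ_le_const)
      show "\<exists>N. \<forall>m\<ge>N. d2 (P k t) (Y t) \<le> 2 * S * (1/2) ^ k + d2 (P m t) (Y t)"
      proof (intro exI allI impI)
        fix m assume "k \<le> m"
        then show "d2 (P k t) (Y t) \<le> 2 * S * (1/2) ^ k + d2 (P m t) (Y t)"
          using two.cdist_triangle[OF PV[OF t, of k] PV[OF t, of m] YV[OF t]] near[OF t, of k m] by linarith
      qed
    qed
    then show ?thesis by simp
  qed
  have sq0: "(\<lambda>k. B * (2 * S * (1/2) ^ k)\<^sup>2) \<longlonglongrightarrow> 0" for B :: real
    using tendsto_mult[OF tendsto_const[of B] tendsto_power[OF pow0, of 2]] by simp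
  have Ysq: "(d2 (P k t) (Y t))\<^sup>2 \<le> (2 * S * (1/2) ^ k)\<^sup>2" if t: "t \<in> {0..T}" for k t
    by (intro power_mono Yb two.cdist_nonneg PV YV t)
  have Y: "Y \<in> MG2 T"
  proof (rule MG2_limit[OF YV])
    fix e :: real assume e: "0 < e"
    obtain k where k: "T * (2 * S * (1/2) ^ k)\<^sup>2 < e" using eventually_happens[OF order_tendstoD(2)[OF sq0[of T] e]] by auto
    have "upper_less T (\<lambda>t. (d2 (Y t) (P k t))\<^sup>2) e"
      by (rule upper_less_const[OF T, of _ "(2 * S * (1/2) ^ k)\<^sup>2"])
        (use k Ysq two.cdist_commute[OF PV YV] in \<open>auto simp: mult.commute\<close>)
    then show "\<exists>\<zeta>\<in>MG2 T. upper_less T (\<lambda>t. (d2 (Y t) (\<zeta> t))\<^sup>2) e" using P by blast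
  qed
  show thesis
  proof (rule that[OF Y J[OF _ _ Y]])
    fix t assume t: "t \<in> {0..T}"
    have t': "0 \<le> t" "t \<le> T" using t by auto
    have \<Phi>V2: "\<Phi> Y t \<in> V2" by (rule MG2D(1)[OF \<Phi>MG2[OF Y] t])
    have b: "(d2 (Y t) (\<Phi> Y t))\<^sup>2 \<le> (2 + 2 * c * t) * (2 * S * (1/2) ^ k)\<^sup>2" for k
    proof -
      have "(d2 (P (Suc k) t) (\<Phi> Y t))\<^sup>2 \<le> c * integral {0..t} (\<lambda>r. (d2 (P k r) (Y r))\<^sup>2)"
        using contr[OF P Y t] by (simp add: PS)
      also have "integral {0..t} (\<lambda>r. (d2 (P k r) (Y r))\<^sup>2) \<le> integral {0..t} (\<lambda>r. (2 * S * (1/2) ^ k)\<^sup>2)"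
        by (rule integral_le[OF MG2_dist_integrable[OF t'(1) MG2_restrict[OF P t'] MG2_restrict[OF Y t']] integrable_const_ivl]) (use Ysq t in auto)
      also have "\<dots> = t * (2 * S * (1/2) ^ k)\<^sup>2" using t' by simp
      finally have 1: "(d2 (P (Suc k) t) (\<Phi> Y t))\<^sup>2 \<le> c * (t * (2 * S * (1/2) ^ k)\<^sup>2)" using c by (simp add: mult_left_mono)
      have "d2 (P (Suc k) t) (Y t) \<le> 2 * S * (1/2) ^ k"
        using Yb[OF t, of "Suc k"] mult_nonneg_nonneg[OF S0, of "(1/2) ^ k"] by simp
      then have 2: "(d2 (Y t) (P (Suc k) t))\<^sup>2 \<le> (2 * S * (1/2) ^ k)\<^sup>2"
        using two.cdist_commute[OF PV[OF t] YV[OF t]] two.cdist_nonneg[OF YV[OF t] PV[OF t]] by (intro power_mono) auto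
      have "(d2 (Y t) (\<Phi> Y t))\<^sup>2 \<le> 2 * (d2 (Y t) (P (Suc k) t))\<^sup>2 + 2 * (d2 (P (Suc k) t) (\<Phi> Y t))\<^sup>2"
        by (intro d2_triangle_square YV PV t \<Phi>V2)
      also have "\<dots> \<le> 2 * (2 * S * (1/2) ^ k)\<^sup>2 + 2 * (c * (t * (2 * S * (1/2) ^ k)\<^sup>2))" using 1 2 by linarith
      finally show ?thesis by (simp add: algebra_simps)
    qed
    have "(d2 (Y t) (\<Phi> Y t))\<^sup>2 \<le> 0" by (rule LIMSEQ_le_const[OF sq0[of "2 + 2 * c * t"]]) (use b in blast)
    then have "d2 (Y t) (\<Phi> Y t) = 0" by simp
    then show "d2 (Y t) (\<lambda>n w. x + (\<Sum>i\<in>K. J Y i t n w)) = 0" by (simp add: \<Phi>_def[abs_def])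
  qed
qed

end

section \<open>Difference quotients of the coefficients\<close>

lemma Lipschitz_deriv_bounded:
  fixes f :: "real \<Rightarrow> real"
  assumes "(f has_real_derivative D) (at x)" "\<And>y. \<bar>f y - f x\<bar> \<le> L * \<bar>y - x\<bar>" shows "\<bar>D\<bar> \<le> L"
proof (rule tendsto_upperbound[of "\<lambda>h. \<bar>(f (x + h) - f x) / h\<bar>" _ "at 0"])
  show "((\<lambda>h. \<bar>(f (x + h) - f x) / h\<bar>) \<longlongrightarrow> \<bar>D\<bar>) (at 0)"
    using assms(1) unfolding DERIV_def by (intro tendsto_rabs)
  have "\<bar>(f (x + h) - f x) / h\<bar> \<le> L" if "h \<noteq> 0" for h
    using assms(2)[of "x + h"] that by (simp add: abs_divide pos_divide_le_eq)
  then show "\<forall>\<^sub>F h in at 0. \<bar>(f (x + h) - f x) / h\<bar> \<le> L" by (simp add: eventually_at_filter)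
qed simp

lemma mean_value_segment:
  fixes g :: "real \<Rightarrow> real"
  assumes g: "\<And>s. (g has_real_derivative g' s) (at s)"
  shows "\<exists>\<theta>. 0 \<le> \<theta> \<and> \<theta> \<le> 1 \<and> g (a + h) - g a = h * g' (a + \<theta> * h)"
proof (cases "h = 0")
  case True then show ?thesis by (intro exI[of _ 0]) simp
next
  case False
  have d: "((\<lambda>s. g (a + s * h)) has_real_derivative g' (a + s * h) * h) (at s)" for s
  proof -
    have "((\<lambda>s. a + s * h) has_real_derivative h) (at s)" by (auto intro!: derivative_eq_intros)
    from DERIV_chain'[OF this g] show ?thesis by (simp add: mult.commute)
  qed
  obtain z where z: "0 < z" "z < 1" "g (a + 1 * h) - g (a + 0 * h) = (1 - 0) * (g' (a + z * h) * h)"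
    using MVT2[of 0 1 "\<lambda>s. g (a + s * h)" "\<lambda>s. g' (a + s * h) * h", OF zero_less_one d] by blast
  then show ?thesis by (intro exI[of _ z]) (simp add: mult.commute)
qed

lemma Cllip_pair_growth:
  fixes F :: "real \<Rightarrow> real \<Rightarrow> real"
  assumes "(\<lambda>(a, y). F a y) \<in> Cllip"
  obtains C n where "0 \<le> C" "\<And>a y a' y'. \<bar>F a y - F a' y'\<bar> \<le> C * (1 + (\<bar>a\<bar> + \<bar>y\<bar>) ^ n + (\<bar>a'\<bar> + \<bar>y'\<bar>) ^ n) * (\<bar>a - a'\<bar> + \<bar>y - y'\<bar>)"
proof -
  obtain C n where C: "C > 0" and H: "\<And>p q :: real \<times> real. \<bar>(case p of (a, y) \<Rightarrow> F a y) - (case q of (a, y) \<Rightarrow> F a y)\<bar> \<le> C * (1 + norm p ^ n + norm q ^ n) * norm (p - q)"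
    using assms unfolding Cllip_def by blast
  have np: "norm (a, y) \<le> \<bar>a\<bar> + \<bar>y\<bar>" for a y :: real using norm_Pair_le[of a y] by simp
  show thesis
  proof (rule that[of C n])
    show "0 \<le> C" using C by simp
    fix a y a' y'
    have "\<bar>F a y - F a' y'\<bar> \<le> C * (1 + norm (a, y) ^ n + norm (a', y') ^ n) * norm ((a, y) - (a', y'))"
      using H[of "(a, y)" "(a', y')"] by simp
    also have "\<dots> \<le> C * (1 + (\<bar>a\<bar> + \<bar>y\<bar>) ^ n + (\<bar>a'\<bar> + \<bar>y'\<bar>) ^ n) * (\<bar>a - a'\<bar> + \<bar>y - y'\<bar>)"
      using C np[of a y] np[of a' y'] np[of "a - a'" "y - y'"]
      by (intro mult_mono add_mono power_mono mult_left_mono mult_nonneg_nonneg add_nonneg_nonneg zero_le_power)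
        auto
    finally show "\<bar>F a y - F a' y'\<bar> \<le> C * (1 + (\<bar>a\<bar> + \<bar>y\<bar>) ^ n + (\<bar>a'\<bar> + \<bar>y'\<bar>) ^ n) * (\<bar>a - a'\<bar> + \<bar>y - y'\<bar>)" .
  qed
qed

lemma Cllip_section_polylip1:
  fixes F :: "real \<Rightarrow> real \<Rightarrow> real"
  assumes "(\<lambda>(a, y). F a y) \<in> Cllip" shows "polylip1 (F a)"
proof -
  obtain C n where C: "0 \<le> C" and H: "\<And>a y a' y'. \<bar>F a y - F a' y'\<bar> \<le> C * (1 + (\<bar>a\<bar> + \<bar>y\<bar>) ^ n + (\<bar>a'\<bar> + \<bar>y'\<bar>) ^ n) * (\<bar>a - a'\<bar> + \<bar>y - y'\<bar>)"
    by (rule Cllip_pair_growth[OF assms]) blast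
  show ?thesis
  proof (rule polylip1I[of _ "C * (3 * (\<bar>a\<bar> + 1) ^ n)" n])
    fix x y :: real
    let ?S = "1 + \<bar>x\<bar> + \<bar>y\<bar>"
    have "\<bar>a\<bar> + \<bar>x\<bar> \<le> (\<bar>a\<bar> + 1) * ?S" "\<bar>a\<bar> + \<bar>y\<bar> \<le> (\<bar>a\<bar> + 1) * ?S" by (simp_all add: algebra_simps)
    then have p: "(\<bar>a\<bar> + \<bar>x\<bar>) ^ n \<le> (\<bar>a\<bar> + 1) ^ n * ?S ^ n" "(\<bar>a\<bar> + \<bar>y\<bar>) ^ n \<le> (\<bar>a\<bar> + 1) ^ n * ?S ^ n"
      by (auto simp flip: power_mult_distrib intro!: power_mono)
    have "1 * 1 \<le> (\<bar>a\<bar> + 1) ^ n * ?S ^ n" by (intro mult_mono one_le_power) auto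
    then have "1 + (\<bar>a\<bar> + \<bar>x\<bar>) ^ n + (\<bar>a\<bar> + \<bar>y\<bar>) ^ n \<le> 3 * (\<bar>a\<bar> + 1) ^ n * ?S ^ n" using p by simp
    then have "C * (1 + (\<bar>a\<bar> + \<bar>x\<bar>) ^ n + (\<bar>a\<bar> + \<bar>y\<bar>) ^ n) * \<bar>x - y\<bar> \<le> C * (3 * (\<bar>a\<bar> + 1) ^ n * ?S ^ n) * \<bar>x - y\<bar>"
      using C by (intro mult_right_mono mult_left_mono) auto
    then show "\<bar>F a x - F a y\<bar> \<le> C * (3 * (\<bar>a\<bar> + 1) ^ n) * ?S ^ n * \<bar>x - y\<bar>"
      using H[of a x a y] by (simp add: mult.assoc)
  qed
qed

text \<open>
  Mean value theorem, first in \<open>y\<close> and then in the parameter, for the step \<open>\<delta> * c\<close> in the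
  parameter and \<open>\<delta> * y\<close> in space. The factor \<open>c\<close> allows the space derivative to be isolated
  (\<open>c = 0\<close>) besides the full derivative (\<open>c = 1\<close>).
\<close>

lemma remainder_bounds:
  fixes F Fx Fa :: "real \<Rightarrow> real \<Rightarrow> real" and \<alpha> c :: real
  assumes L: "\<And>a y a' y'. \<bar>F a y - F a' y'\<bar> \<le> L * (\<bar>a - a'\<bar> + \<bar>y - y'\<bar>)"
    and Fx: "\<And>a y. (F a has_real_derivative Fx a y) (at y)" and Fa: "\<And>a y. ((\<lambda>a. F a y) has_real_derivative Fa a y) (at a)"
    and Cx: "(\<lambda>(a, y). Fx a y) \<in> Cllip" and Ca: "(\<lambda>(a, y). Fa a y) \<in> Cllip" and c: "\<bar>c\<bar> \<le> 1"
  defines "\<rho> \<equiv> (\<lambda>\<delta> x y. (F (\<alpha> + \<delta> * c) (x + \<delta> * y) - F \<alpha> x) / \<delta> - (Fx \<alpha> x * y + Fa \<alpha> x * c))"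
  shows "\<bar>Fx a y\<bar> \<le> L" "\<bar>Fa a y\<bar> \<le> L"
    "\<delta> \<noteq> 0 \<Longrightarrow> \<bar>(F (\<alpha> + \<delta> * c) (x + \<delta> * y) - F \<alpha> x) / \<delta>\<bar> \<le> L * (1 + \<bar>y\<bar>)"
    "\<delta> \<noteq> 0 \<Longrightarrow> \<bar>\<rho> \<delta> x y\<bar> \<le> 2 * L * (1 + \<bar>y\<bar>)"
    "\<exists>C\<ge>0. \<exists>k. \<forall>\<delta> x y. \<bar>\<delta>\<bar> \<le> 1 \<longrightarrow> \<delta> \<noteq> 0 \<longrightarrow> \<bar>\<rho> \<delta> x y\<bar> \<le> C * (1 + \<bar>x\<bar> + \<bar>y\<bar>) ^ k * \<bar>\<delta>\<bar>"
proof -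
  have L0: "0 \<le> L" using L[of 0 0 0 1] by (simp add: order_trans[OF abs_ge_zero])
  show Fxb: "\<bar>Fx a y\<bar> \<le> L" for a y by (rule Lipschitz_deriv_bounded[OF Fx]) (use L[of a _ a y] in simp)
  show Fab: "\<bar>Fa a y\<bar> \<le> L" for a y by (rule Lipschitz_deriv_bounded[OF Fa]) (use L[of _ y a y] in simp)
  show q: "\<bar>(F (\<alpha> + \<delta> * c) (x + \<delta> * y) - F \<alpha> x) / \<delta>\<bar> \<le> L * (1 + \<bar>y\<bar>)" if d: "\<delta> \<noteq> 0" for \<delta> x y
  proof -
    have "\<bar>F (\<alpha> + \<delta> * c) (x + \<delta> * y) - F \<alpha> x\<bar> \<le> L * (\<bar>\<delta>\<bar> * \<bar>c\<bar> + \<bar>\<delta>\<bar> * \<bar>y\<bar>)"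
      using L[of "\<alpha> + \<delta> * c" "x + \<delta> * y" \<alpha> x] by (simp add: abs_mult)
    also have "\<dots> \<le> L * (\<bar>\<delta>\<bar> * 1 + \<bar>\<delta>\<bar> * \<bar>y\<bar>)" using L0 c by (intro mult_left_mono add_mono) auto
    also have "\<dots> = L * (1 + \<bar>y\<bar>) * \<bar>\<delta>\<bar>" by (simp add: algebra_simps)
    finally show ?thesis using d by (simp add: abs_divide pos_divide_le_eq)
  qed
  show "\<bar>\<rho> \<delta> x y\<bar> \<le> 2 * L * (1 + \<bar>y\<bar>)" if d: "\<delta> \<noteq> 0" for \<delta> x y
  proof -
    have "\<bar>Fx \<alpha> x * y + Fa \<alpha> x * c\<bar> \<le> \<bar>Fx \<alpha> x\<bar> * \<bar>y\<bar> + \<bar>Fa \<alpha> x\<bar> * \<bar>c\<bar>"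
      by (rule order_trans[OF abs_triangle_ineq]) (simp add: abs_mult)
    also have "\<dots> \<le> L * \<bar>y\<bar> + L * 1" using Fxb Fab c L0 by (intro add_mono mult_mono) auto
    finally have "\<bar>Fx \<alpha> x * y + Fa \<alpha> x * c\<bar> \<le> L * (1 + \<bar>y\<bar>)" by (simp add: algebra_simps)
    then show ?thesis using q[OF d, of x y] unfolding \<rho>_def by linarith
  qed
  obtain C1 n1 where C1: "0 \<le> C1" and H1: "\<And>a y a' y'. \<bar>Fx a y - Fx a' y'\<bar> \<le> C1 * (1 + (\<bar>a\<bar> + \<bar>y\<bar>) ^ n1 + (\<bar>a'\<bar> + \<bar>y'\<bar>) ^ n1) * (\<bar>a - a'\<bar> + \<bar>y - y'\<bar>)"
    by (rule Cllip_pair_growth[OF Cx]) blast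
  obtain C2 n2 where C2: "0 \<le> C2" and H2: "\<And>a y a' y'. \<bar>Fa a y - Fa a' y'\<bar> \<le> C2 * (1 + (\<bar>a\<bar> + \<bar>y\<bar>) ^ n2 + (\<bar>a'\<bar> + \<bar>y'\<bar>) ^ n2) * (\<bar>a - a'\<bar> + \<bar>y - y'\<bar>)"
    by (rule Cllip_pair_growth[OF Ca]) blast
  define A where "A = \<bar>\<alpha>\<bar> + 1"
  have gr: "C * (1 + (\<bar>a\<bar> + \<bar>z\<bar>) ^ n + (\<bar>\<alpha>\<bar> + \<bar>x\<bar>) ^ n) * (\<bar>a - \<alpha>\<bar> + \<bar>z - x\<bar>) \<le> C * (3 * A ^ n) * (1 + \<bar>x\<bar> + \<bar>y\<bar>) ^ Suc n * \<bar>\<delta>\<bar>"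
    if "0 \<le> C" "\<bar>\<delta>\<bar> \<le> 1" "\<bar>a - \<alpha>\<bar> \<le> \<bar>\<delta>\<bar>" "\<bar>z - x\<bar> \<le> \<bar>\<delta>\<bar> * \<bar>y\<bar>" for C n a z x y \<delta>
  proof -
    let ?S = "1 + \<bar>x\<bar> + \<bar>y\<bar>"
    have a: "\<bar>a\<bar> \<le> A" using that by (simp add: A_def)
    have "\<bar>\<delta>\<bar> * \<bar>y\<bar> \<le> 1 * \<bar>y\<bar>" using that by (intro mult_right_mono) auto
    then have z: "\<bar>z\<bar> \<le> \<bar>x\<bar> + \<bar>y\<bar>" using that by linarith
    have A1: "1 \<le> A" by (simp add: A_def)
    have "A + (\<bar>x\<bar> + \<bar>y\<bar>) \<le> A * ?S" using A1 mult_right_mono[OF A1, of "\<bar>x\<bar> + \<bar>y\<bar>"] by (simp add: algebra_simps)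
    moreover have "\<bar>\<alpha>\<bar> + \<bar>x\<bar> \<le> A + (\<bar>x\<bar> + \<bar>y\<bar>)" by (simp add: A_def)
    ultimately have "\<bar>a\<bar> + \<bar>z\<bar> \<le> A * ?S" "\<bar>\<alpha>\<bar> + \<bar>x\<bar> \<le> A * ?S" using a z by linarith+
    then have p: "(\<bar>a\<bar> + \<bar>z\<bar>) ^ n \<le> A ^ n * ?S ^ n" "(\<bar>\<alpha>\<bar> + \<bar>x\<bar>) ^ n \<le> A ^ n * ?S ^ n"
      by (auto simp flip: power_mult_distrib intro!: power_mono)
    have "1 * 1 \<le> A ^ n * ?S ^ n" using A1 by (intro mult_mono one_le_power) auto
    then have s: "1 + (\<bar>a\<bar> + \<bar>z\<bar>) ^ n + (\<bar>\<alpha>\<bar> + \<bar>x\<bar>) ^ n \<le> 3 * A ^ n * ?S ^ n" using p by simp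
    have "\<bar>a - \<alpha>\<bar> + \<bar>z - x\<bar> \<le> \<bar>\<delta>\<bar> * (1 + \<bar>y\<bar>)" using that by (simp add: algebra_simps)
    also have "\<dots> \<le> \<bar>\<delta>\<bar> * ?S" by (intro mult_left_mono) auto
    finally have d: "\<bar>a - \<alpha>\<bar> + \<bar>z - x\<bar> \<le> \<bar>\<delta>\<bar> * ?S" .
    have "C * (1 + (\<bar>a\<bar> + \<bar>z\<bar>) ^ n + (\<bar>\<alpha>\<bar> + \<bar>x\<bar>) ^ n) * (\<bar>a - \<alpha>\<bar> + \<bar>z - x\<bar>) \<le> C * (3 * A ^ n * ?S ^ n) * (\<bar>\<delta>\<bar> * ?S)"
      using that(1) A1 by (intro mult_mono[OF mult_left_mono[OF s] d]) auto
    then show ?thesis by (simp add: algebra_simps)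
  qed
  define C where "C = C1 * (3 * A ^ n1) + C2 * (3 * A ^ n2)"
  have A0: "0 \<le> A" by (simp add: A_def)
  have b: "\<bar>\<rho> \<delta> x y\<bar> \<le> C * (1 + \<bar>x\<bar> + \<bar>y\<bar>) ^ (n1 + n2 + 2) * \<bar>\<delta>\<bar>" if d: "\<bar>\<delta>\<bar> \<le> 1" "\<delta> \<noteq> 0" for \<delta> x y
  proof -
    let ?S = "1 + \<bar>x\<bar> + \<bar>y\<bar>"
    obtain \<theta> where \<theta>: "0 \<le> \<theta>" "\<theta> \<le> 1" "F (\<alpha> + \<delta> * c) (x + \<delta> * y) - F (\<alpha> + \<delta> * c) x = (\<delta> * y) * Fx (\<alpha> + \<delta> * c) (x + \<theta> * (\<delta> * y))"
      using mean_value_segment[of "F (\<alpha> + \<delta> * c)" "Fx (\<alpha> + \<delta> * c)" x "\<delta> * y", OF Fx] by blast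
    obtain \<theta>' where \<theta>': "0 \<le> \<theta>'" "\<theta>' \<le> 1" "F (\<alpha> + \<delta> * c) x - F \<alpha> x = (\<delta> * c) * Fa (\<alpha> + \<theta>' * (\<delta> * c)) x"
      using mean_value_segment[of "\<lambda>a. F a x" "\<lambda>a. Fa a x" \<alpha> "\<delta> * c", OF Fa] by blast
    have "F (\<alpha> + \<delta> * c) (x + \<delta> * y) - F \<alpha> x = \<delta> * (y * Fx (\<alpha> + \<delta> * c) (x + \<theta> * (\<delta> * y)) + c * Fa (\<alpha> + \<theta>' * (\<delta> * c)) x)"
      using \<theta>(3) \<theta>'(3) by (simp add: algebra_simps)
    then have "(F (\<alpha> + \<delta> * c) (x + \<delta> * y) - F \<alpha> x) / \<delta> = y * Fx (\<alpha> + \<delta> * c) (x + \<theta> * (\<delta> * y)) + c * Fa (\<alpha> + \<theta>' * (\<delta> * c)) x"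
      using d by simp
    then have "\<rho> \<delta> x y = y * (Fx (\<alpha> + \<delta> * c) (x + \<theta> * (\<delta> * y)) - Fx \<alpha> x) + c * (Fa (\<alpha> + \<theta>' * (\<delta> * c)) x - Fa \<alpha> x)"
      unfolding \<rho>_def by (simp add: algebra_simps)
    then have "\<bar>\<rho> \<delta> x y\<bar> \<le> \<bar>y\<bar> * \<bar>Fx (\<alpha> + \<delta> * c) (x + \<theta> * (\<delta> * y)) - Fx \<alpha> x\<bar> + \<bar>c\<bar> * \<bar>Fa (\<alpha> + \<theta>' * (\<delta> * c)) x - Fa \<alpha> x\<bar>"
      by (simp add: abs_mult[symmetric] abs_triangle_ineq)
    also have "\<dots> \<le> ?S * (C1 * (3 * A ^ n1) * ?S ^ Suc n1 * \<bar>\<delta>\<bar>) + 1 * (C2 * (3 * A ^ n2) * ?S ^ Suc n2 * \<bar>\<delta>\<bar>)"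
    proof (intro add_mono mult_mono c)
      have dc: "\<bar>\<delta> * c\<bar> \<le> \<bar>\<delta>\<bar>" using c by (simp add: abs_mult mult_left_le)
      have t1: "\<bar>\<theta> * (\<delta> * y)\<bar> \<le> \<bar>\<delta>\<bar> * \<bar>y\<bar>" using \<theta> by (simp add: abs_mult mult_left_le_one_le)
      have t2: "\<bar>\<theta>' * (\<delta> * c)\<bar> \<le> \<bar>\<delta>\<bar>"
      proof -
        have "\<bar>\<theta>' * (\<delta> * c)\<bar> \<le> \<bar>\<delta> * c\<bar>" using \<theta>' by (simp add: abs_mult mult_left_le_one_le)
        then show ?thesis using dc by linarith
      qed
      show "\<bar>Fx (\<alpha> + \<delta> * c) (x + \<theta> * (\<delta> * y)) - Fx \<alpha> x\<bar> \<le> C1 * (3 * A ^ n1) * ?S ^ Suc n1 * \<bar>\<delta>\<bar>"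
        using order_trans[OF H1 gr[OF C1 d(1), of "\<alpha> + \<delta> * c" "x + \<theta> * (\<delta> * y)" x y n1]] dc t1 by simp
      show "\<bar>Fa (\<alpha> + \<theta>' * (\<delta> * c)) x - Fa \<alpha> x\<bar> \<le> C2 * (3 * A ^ n2) * ?S ^ Suc n2 * \<bar>\<delta>\<bar>"
        using order_trans[OF H2 gr[OF C2 d(1), of "\<alpha> + \<theta>' * (\<delta> * c)" x x y n2]] t2 by simp
    qed auto
    also have "\<dots> = C1 * (3 * A ^ n1) * ?S ^ (n1 + 2) * \<bar>\<delta>\<bar> + C2 * (3 * A ^ n2) * ?S ^ Suc n2 * \<bar>\<delta>\<bar>"
      by (simp add: power_add power2_eq_square mult_ac)
    also have "\<dots> \<le> C1 * (3 * A ^ n1) * ?S ^ (n1 + n2 + 2) * \<bar>\<delta>\<bar> + C2 * (3 * A ^ n2) * ?S ^ (n1 + n2 + 2) * \<bar>\<delta>\<bar>"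
      using C1 C2 A0 by (intro add_mono mult_right_mono mult_left_mono power_increasing) auto
    finally show ?thesis by (simp add: C_def algebra_simps)
  qed
  have "0 \<le> C" using C1 C2 A0 by (simp add: C_def)
  then show "\<exists>C\<ge>0. \<exists>k. \<forall>\<delta> x y. \<bar>\<delta>\<bar> \<le> 1 \<longrightarrow> \<delta> \<noteq> 0 \<longrightarrow> \<bar>\<rho> \<delta> x y\<bar> \<le> C * (1 + \<bar>x\<bar> + \<bar>y\<bar>) ^ k * \<bar>\<delta>\<bar>" using b by blast
qed

context G_Brownian_expectation
begin

lemma V_Lipschitz2:
  assumes F: "\<And>a y a' y'. \<bar>F a y - F a' y'\<bar> \<le> L * (\<bar>a - a'\<bar> + \<bar>y - y'\<bar>)" and X: "X \<in> V2"
  shows "(\<lambda>n w. F (a::real) (X n w)) \<in> V2"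
  by (rule two.cseq_lipschitz[OF X, of _ L]) (use F[of a _ a] in auto)

text \<open>
  The product \<open>Fx \<alpha> X * Y\<close> is not a Lipschitz function of \<open>X\<close> and \<open>Y\<close>, so the termwise formula
  \<open>G\<close> is not obviously a Cauchy sequence. It is one as the limit of the difference quotients
  \<open>W \<delta>\<close>, which are Lipschitz functions of \<open>X\<close> and \<open>Y\<close>.
\<close>

lemma quotient_limit:
  fixes F Fx Fa :: "real \<Rightarrow> real \<Rightarrow> real" and \<alpha> c :: real
  assumes L: "\<And>a y a' y'. \<bar>F a y - F a' y'\<bar> \<le> L * (\<bar>a - a'\<bar> + \<bar>y - y'\<bar>)"
    and Fx: "\<And>a y. (F a has_real_derivative Fx a y) (at y)" and Fa: "\<And>a y. ((\<lambda>a. F a y) has_real_derivative Fa a y) (at a)"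
    and Cx: "(\<lambda>(a, y). Fx a y) \<in> Cllip" and Ca: "(\<lambda>(a, y). Fa a y) \<in> Cllip" and c: "\<bar>c\<bar> \<le> 1"
    and X: "X \<in> V2" and Y: "Y \<in> V2"
  defines "W \<equiv> (\<lambda>\<delta> n w. (F (\<alpha> + \<delta> * c) (X n w + \<delta> * Y n w) - F \<alpha> (X n w)) / \<delta>)"
    and "G \<equiv> (\<lambda>n w. Fx \<alpha> (X n w) * Y n w + Fa \<alpha> (X n w) * c)"
  shows "W \<delta> \<in> V2" "G \<in> V2" "\<delta> \<noteq> 0 \<Longrightarrow> d2 (W \<delta>) (\<lambda>_ _. 0) \<le> L + L * d2 Y (\<lambda>_ _. 0)" "((\<lambda>\<delta>. d2 (W \<delta>) G) \<longlongrightarrow> 0) (at 0)"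
proof -
  note XL = two.cseqD(1)[OF X] and YL = two.cseqD(1)[OF Y]
  note rb = remainder_bounds[of F L Fx Fa c, OF L Fx Fa Cx Ca c]
  have L0: "0 \<le> L" using L[of 0 0 0 1] by (simp add: order_trans[OF abs_ge_zero])
  show WV: "W \<delta> \<in> V2" for \<delta>
  proof -
    have "(\<lambda>n w. F (\<alpha> + \<delta> * c) (X n w + \<delta> * Y n w)) \<in> V2"
      by (intro V_Lipschitz2[OF L, of "\<lambda>n w. X n w + \<delta> * Y n w"] V_intros X Y)
    then have "(\<lambda>n w. (1 / \<delta>) * (F (\<alpha> + \<delta> * c) (X n w + \<delta> * Y n w) - F \<alpha> (X n w))) \<in> V2"
      by (intro V_intros V_Lipschitz2[OF L X])
    then show ?thesis by (simp add: W_def)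
  qed
  show "d2 (W \<delta>) (\<lambda>_ _. 0) \<le> L + L * d2 Y (\<lambda>_ _. 0)" if d: "\<delta> \<noteq> 0" for \<delta>
  proof -
    have "d2 (W \<delta>) (\<lambda>_ _. 0) \<le> 1 * d2 (\<lambda>n w. L) (\<lambda>n w. 0) + L * d2 Y (\<lambda>n w. 0)"
    proof (rule two.cdist_dominated[OF WV V_zero _ V_zero Y V_zero])
      show "(\<lambda>n w. L) \<in> V2" by (intro V_const L0_intros)
      fix n w show "\<bar>W \<delta> n w - 0\<bar> \<le> 1 * \<bar>L - 0\<bar> + L * \<bar>Y n w - 0\<bar>"
        using rb(3)[OF d, of \<alpha> "X n w" "Y n w"] L0 by (simp add: W_def algebra_simps)
    qed (use L0 in auto)
    then show ?thesis using L0 by (simp add: two.cdist_const n2_const)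
  qed
  have GL: "G n \<in> L0ip" for n unfolding G_def
    using stable_apply[OF stable_L0ip XL[of n] Cllip_section_polylip1[OF Cx, of \<alpha>]]
      stable_apply[OF stable_L0ip XL[of n] Cllip_section_polylip1[OF Ca, of \<alpha>]]
    by (intro stable_add stable_mult stable_L0ip YL stable_const) auto
  define \<rho> where "\<rho> = (\<lambda>\<delta> x y. (F (\<alpha> + \<delta> * c) (x + \<delta> * y) - F \<alpha> x) / \<delta> - (Fx \<alpha> x * y + Fa \<alpha> x * c))"
  have \<rho>WG: "(\<lambda>w. \<rho> \<delta> (X n w) (Y n w)) = (\<lambda>w. W \<delta> n w - G n w)" for \<delta> n by (simp add: \<rho>_def W_def G_def)
  obtain C k where C: "0 \<le> C" and Ck: "\<And>\<delta> x y. \<bar>\<delta>\<bar> \<le> 1 \<Longrightarrow> \<delta> \<noteq> 0 \<Longrightarrow> \<bar>\<rho> \<delta> x y\<bar> \<le> C * (1 + \<bar>x\<bar> + \<bar>y\<bar>) ^ k * \<bar>\<delta>\<bar>"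
    using rb(5)[of \<alpha>] unfolding \<rho>_def by blast
  have upper_less: "\<exists>\<delta>0>0. \<exists>M. \<forall>\<delta>. \<delta> \<noteq> 0 \<longrightarrow> \<bar>\<delta>\<bar> < \<delta>0 \<longrightarrow> (\<forall>n\<ge>M. n2 (\<lambda>w. W \<delta> n w - G n w) \<le> e)" if e: "0 < e" for e
    unfolding \<rho>WG[symmetric]
  proof (rule remainder_small[OF X Y _ C _ _ Ck e])
    show "0 \<le> 2 * L" using L0 by simp
    show "(\<lambda>w. \<rho> \<delta> (X n w) (Y n w)) \<in> L0ip" for \<delta> n unfolding \<rho>WG by (intro L0_intros two.cseqD(1)[OF WV] GL)
    show "\<bar>\<rho> \<delta> x y\<bar> \<le> 2 * L * (1 + \<bar>y\<bar>)" if "\<delta> \<noteq> 0" for \<delta> x y unfolding \<rho>_def by (rule rb(4)[OF that])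
  qed
  show G: "G \<in> V2"
  proof (rule two.cseqI[OF GL])
    fix e :: real assume e: "0 < e"
    obtain \<delta>0 M where \<delta>0: "0 < \<delta>0" and M: "\<And>\<delta> n. \<delta> \<noteq> 0 \<Longrightarrow> \<bar>\<delta>\<bar> < \<delta>0 \<Longrightarrow> n \<ge> M \<Longrightarrow> n2 (\<lambda>w. W \<delta> n w - G n w) \<le> e/3"
      using upper_less[of "e/3"] e by auto
    define \<delta> where "\<delta> = \<delta>0 / 2"
    have \<delta>: "\<delta> \<noteq> 0" "\<bar>\<delta>\<bar> < \<delta>0" using \<delta>0 by (auto simp: \<delta>_def)
    obtain M' where M': "\<forall>m\<ge>M'. \<forall>n\<ge>M'. n2 (\<lambda>w. W \<delta> m w - W \<delta> n w) < e/3" using two.cseqD(2)[OF WV[of \<delta>], of "e/3"] e by auto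
    note WL = two.cseqD(1)[OF WV[of \<delta>]]
    have "n2 (\<lambda>w. G m w - G n w) < e" if "m \<ge> max M M'" "n \<ge> max M M'" for m n
      using two.triangle[OF GL[of m] WL[of m] GL[of n]] two.triangle[OF WL[of m] WL[of n] GL[of n]]
        two.commute[OF GL[of m] WL[of m]] M[OF \<delta>, of m] M[OF \<delta>, of n] M' that by fastforce
    then show "\<exists>M. \<forall>m\<ge>M. \<forall>n\<ge>M. n2 (\<lambda>w. G m w - G n w) < e" by blast
  qed
  show "((\<lambda>\<delta>. d2 (W \<delta>) G) \<longlongrightarrow> 0) (at 0)"
  proof (rule tendstoI)
    fix e :: real assume e: "0 < e"
    obtain \<delta>0 M where \<delta>0: "0 < \<delta>0" and M: "\<And>\<delta> n. \<delta> \<noteq> 0 \<Longrightarrow> \<bar>\<delta>\<bar> < \<delta>0 \<Longrightarrow> n \<ge> M \<Longrightarrow> n2 (\<lambda>w. W \<delta> n w - G n w) \<le> e/2"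
      using upper_less[of "e/2"] e by auto
    have "dist (d2 (W \<delta>) G) 0 < e" if "\<delta> \<noteq> 0" "\<bar>\<delta>\<bar> < \<delta>0" for \<delta>
      using two.cdist_le[OF WV G, of M \<delta> "e/2"] M[OF that] two.cdist_nonneg[OF WV[of \<delta>] G] e by simp
    then show "\<forall>\<^sub>F \<delta> in at 0. dist (d2 (W \<delta>) G) 0 < e"
      unfolding eventually_at using \<delta>0 by (intro exI[of _ \<delta>0]) auto
  qed
qed

section \<open>The derivative of the solution in the parameter\<close>

text \<open>
  The formal derivative of the equation is a linear equation with bounded coefficients; let \<open>Y\<close>
  be its solution. The difference quotient \<open>D \<delta>\<close> of \<open>X\<close> solves an equation with integrands
  \<open>Q \<delta>\<close>, and \<open>Q \<delta> - W 1 \<delta> Y\<close> is bounded by \<open>L * \<bar>D \<delta> - Y\<bar>\<close> since \<open>W 1 \<delta> Y\<close> is the quotient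
  formed with \<open>X + \<delta> * Y\<close> in place of the perturbed solution. The rest, \<open>W 1 \<delta> Y - G 1 Y\<close>, tends
  to \<open>0\<close> for each time by \<open>quotient_limit\<close> and in the time integral by dominated convergence, so
  \<open>SDE_stability\<close> makes \<open>D \<delta> - Y\<close> tend to \<open>0\<close>.
\<close>

lemma SDE_derivative:
  fixes f fx fa :: "nat \<Rightarrow> real \<Rightarrow> real \<Rightarrow> real \<Rightarrow> real"
  assumes K: "finite K" and T: "0 \<le> T" and A: "\<And>i. i \<in> K \<Longrightarrow> integrator (A i) C T" and C: "0 \<le> C"
    and Lip: "\<And>i t a y a' y'. i \<in> K \<Longrightarrow> t \<in> {0..T} \<Longrightarrow> \<bar>f i a t y - f i a' t y'\<bar> \<le> L * (\<bar>a - a'\<bar> + \<bar>y - y'\<bar>)" and L: "0 \<le> L"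
    and meas: "\<And>i a y. i \<in> K \<Longrightarrow> (\<lambda>t. f i a t y) \<in> borel_measurable (lebesgue_on {0..T})"
    and X: "\<And>a. X a \<in> MG2 T"
    and I: "\<And>i a t. i \<in> K \<Longrightarrow> t \<in> {0..T} \<Longrightarrow> has_int (A i) t (\<lambda>r n w. f i a r (X a r n w)) (I i a t)"
    and eq: "\<And>a t. t \<in> {0..T} \<Longrightarrow> d2 (X a t) (\<lambda>n w. x a + (\<Sum>i\<in>K. I i a t n w)) = 0"
    and fx: "\<And>i a t y. i \<in> K \<Longrightarrow> t \<in> {0..T} \<Longrightarrow> (f i a t has_real_derivative fx i a t y) (at y)"
    and fa: "\<And>i a t y. i \<in> K \<Longrightarrow> t \<in> {0..T} \<Longrightarrow> ((\<lambda>a. f i a t y) has_real_derivative fa i a t y) (at a)"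
    and Cx: "\<And>i t. i \<in> K \<Longrightarrow> t \<in> {0..T} \<Longrightarrow> (\<lambda>(a, y). fx i a t y) \<in> Cllip"
    and Ca: "\<And>i t. i \<in> K \<Longrightarrow> t \<in> {0..T} \<Longrightarrow> (\<lambda>(a, y). fa i a t y) \<in> Cllip"
    and x': "(x has_real_derivative x') (at \<alpha>)"
  obtains Y J Ja where "Y \<in> MG2 T"
    "\<And>t. t \<in> {0..T} \<Longrightarrow> ((\<lambda>\<delta>. d2 (\<lambda>n w. (X (\<alpha> + \<delta>) t n w - X \<alpha> t n w) / \<delta>) (Y t)) \<longlongrightarrow> 0) (at 0)"
    "\<And>i t. i \<in> K \<Longrightarrow> t \<in> {0..T} \<Longrightarrow> has_int (A i) t (\<lambda>r n w. fx i \<alpha> r (X \<alpha> r n w) * Y r n w) (J i t)"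
    "\<And>i t. i \<in> K \<Longrightarrow> t \<in> {0..T} \<Longrightarrow> has_int (A i) t (\<lambda>r n w. fa i \<alpha> r (X \<alpha> r n w)) (Ja i t)"
    "\<And>t. t \<in> {0..T} \<Longrightarrow> d2 (Y t) (\<lambda>n w. x' + (\<Sum>i\<in>K. J i t n w + Ja i t n w)) = 0"
proof -
  have XV: "X a t \<in> V2" if "t \<in> {0..T}" for a t by (rule MG2D(1)[OF X that])
  have TT: "T \<in> {0..T}" using T by simp
  (* The bound for the coefficient at 0, needed for substituting other processes, comes from the
     integrability of f i a t along the given solution. *)
  have fMP: "(\<lambda>t n w. f i a t (\<eta> t n w)) \<in> MG2 T" if i: "i \<in> K" and \<eta>: "\<eta> \<in> MG2 T" for i a \<eta>
  proof -
    have fX: "(\<lambda>t n w. f i a t (X a t n w)) \<in> MG2 T" by (rule has_int_MG2[OF I[OF i TT]])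
    show ?thesis
    proof (rule MG2_Lipschitz[OF meas[OF i] _ _ _ \<eta> T])
      show "\<bar>f i a t y - f i a t y'\<bar> \<le> L * \<bar>y - y'\<bar>" if "t \<in> {0..T}" for t y y' using Lip[OF i that, of a y a y'] by simp
      show "(\<lambda>t. (2 * L\<^sup>2) * (d2 (X a t) (\<lambda>_ _. 0))\<^sup>2 + 2 * (d2 (\<lambda>n w. f i a t (X a t n w)) (\<lambda>_ _. 0))\<^sup>2) integrable_on {0..T}"
        by (intro integrable_add integrable_on_mult_right MG2_norm_integrable T X fX)
      fix t assume t: "t \<in> {0..T}"
      have c: "(\<lambda>n w. f i a t 0) \<in> V2" by (intro V_const L0_intros)
      have "\<bar>f i a t 0\<bar> = d2 (\<lambda>n w. f i a t 0) (\<lambda>n w. 0)" by (simp add: two.cdist_const n2_const)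
      also have "\<dots> \<le> L * d2 (X a t) (\<lambda>n w. 0) + 1 * d2 (\<lambda>n w. f i a t (X a t n w)) (\<lambda>n w. 0)"
      proof (rule two.cdist_dominated[OF c V_zero XV[OF t] V_zero MG2D(1)[OF fX t] V_zero L])
        fix n w show "\<bar>f i a t 0 - 0\<bar> \<le> L * \<bar>X a t n w - 0\<bar> + 1 * \<bar>f i a t (X a t n w) - 0\<bar>"
          using Lip[OF i t, of a 0 a "X a t n w"] by simp
      qed simp
      finally have "\<bar>f i a t 0\<bar>\<^sup>2 \<le> (L * d2 (X a t) (\<lambda>n w. 0) + 1 * d2 (\<lambda>n w. f i a t (X a t n w)) (\<lambda>n w. 0))\<^sup>2"
        by (intro power_mono) auto
      also have "\<dots> \<le> 2 * (L * d2 (X a t) (\<lambda>n w. 0))\<^sup>2 + 2 * (1 * d2 (\<lambda>n w. f i a t (X a t n w)) (\<lambda>n w. 0))\<^sup>2" by (rule sum_square_le)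
      finally show "(f i a t 0)\<^sup>2 \<le> (2 * L\<^sup>2) * (d2 (X a t) (\<lambda>_ _. 0))\<^sup>2 + 2 * (d2 (\<lambda>n w. f i a t (X a t n w)) (\<lambda>_ _. 0))\<^sup>2"
        by (simp add: power_mult_distrib)
    qed
  qed
  define W where "W c \<delta> Y i t n w = (f i (\<alpha> + \<delta> * c) t (X \<alpha> t n w + \<delta> * Y t n w) - f i \<alpha> t (X \<alpha> t n w)) / \<delta>" for c \<delta> Y i t n w
  define G where "G c Y i t n w = fx i \<alpha> t (X \<alpha> t n w) * Y t n w + fa i \<alpha> t (X \<alpha> t n w) * c" for c Y i t n w
  have WMP: "W c \<delta> Y i \<in> MG2 T" if i: "i \<in> K" and Y: "Y \<in> MG2 T" for c \<delta> Y i
  proof -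
    have "(\<lambda>t n w. X \<alpha> t n w + \<delta> * Y t n w) \<in> MG2 T" by (intro MG2_add MG2_scale X Y)
    from fMP[OF i this] have "(\<lambda>t n w. (1 / \<delta>) * (f i (\<alpha> + \<delta> * c) t (X \<alpha> t n w + \<delta> * Y t n w) - f i \<alpha> t (X \<alpha> t n w))) \<in> MG2 T"
      by (intro MG2_scale MG2_diff fMP[OF i X])
    then show ?thesis by (simp add: W_def[abs_def])
  qed
  have ql: "G c Y i t \<in> V2" "\<delta> \<noteq> 0 \<Longrightarrow> d2 (W c \<delta> Y i t) (\<lambda>_ _. 0) \<le> L + L * d2 (Y t) (\<lambda>_ _. 0)"
       "((\<lambda>\<delta>. d2 (W c \<delta> Y i t) (G c Y i t)) \<longlongrightarrow> 0) (at 0)"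
    if i: "i \<in> K" and Y: "Y t \<in> V2" and t: "t \<in> {0..T}" and c: "\<bar>c\<bar> \<le> 1" for c \<delta> Y i t
    using quotient_limit[where F = "\<lambda>a y. f i a t y" and Fx = "\<lambda>a y. fx i a t y" and Fa = "\<lambda>a y. fa i a t y" and \<alpha> = \<alpha>,
       OF Lip[OF i t] fx[OF i t] fa[OF i t] Cx[OF i t] Ca[OF i t] c XV[OF t] Y]
    by (simp_all add: W_def[abs_def] G_def[abs_def])
  have GDC: "G c Y i \<in> MG2 T \<and> (\<lambda>k. integral {0..T} (\<lambda>t. (d2 (W c (\<delta> k) Y i t) (G c Y i t))\<^sup>2)) \<longlonglongrightarrow> 0"
    if i: "i \<in> K" and Y: "Y \<in> MG2 T" and c: "\<bar>c\<bar> \<le> 1" and \<delta>: "\<delta> \<longlonglongrightarrow> 0" "\<And>k. \<delta> k \<noteq> 0" for c Y i and \<delta> :: "nat \<Rightarrow> real"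
  proof -
    have Gi: "(\<lambda>t. (2 * L\<^sup>2) * (d2 (Y t) (\<lambda>_ _. 0))\<^sup>2 + 2 * L\<^sup>2) integrable_on {0..T}"
      by (intro integrable_add integrable_on_mult_right MG2_norm_integrable T Y integrable_const_ivl)
    have YV: "Y t \<in> V2" if "t \<in> {0..T}" for t by (rule MG2D(1)[OF Y that])
    have GV: "G c Y i t \<in> V2" if t: "t \<in> {0..T}" for t by (rule ql(1)[of i Y t c, OF i YV[OF t] t c])
    have at0: "filterlim \<delta> (at 0) sequentially" using \<delta> by (simp add: filterlim_at)
    have lim: "(\<lambda>k. d2 (W c (\<delta> k) Y i t) (G c Y i t)) \<longlonglongrightarrow> 0" if t: "t \<in> {0..T}" for t
      by (rule filterlim_compose[OF ql(3)[of i Y t c, OF i YV[OF t] t c] at0])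
    have le: "(d2 (W c (\<delta> k) Y i t) (\<lambda>_ _. 0))\<^sup>2 \<le> (2 * L\<^sup>2) * (d2 (Y t) (\<lambda>_ _. 0))\<^sup>2 + 2 * L\<^sup>2" if t: "t \<in> {0..T}" for k t
    proof -
      have "(d2 (W c (\<delta> k) Y i t) (\<lambda>_ _. 0))\<^sup>2 \<le> (L + L * d2 (Y t) (\<lambda>_ _. 0))\<^sup>2"
        using ql(2)[of i Y t c, OF i YV[OF t] t c \<delta>(2)] by (intro power_mono two.cdist_nonneg MG2D(1)[OF WMP[OF i Y] t] V_zero)
      also have "\<dots> \<le> 2 * L\<^sup>2 + 2 * (L * d2 (Y t) (\<lambda>_ _. 0))\<^sup>2" by (rule sum_square_le)
      finally show ?thesis by (simp add: power_mult_distrib)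
    qed
    show ?thesis
      using MG2_dominated_convergence[of T "\<lambda>k. W c (\<delta> k) Y i" "G c Y i", OF T WMP[OF i Y] GV lim Gi le] by blast
  qed
  have GMP: "G c Y i \<in> MG2 T" if "i \<in> K" "Y \<in> MG2 T" "\<bar>c\<bar> \<le> 1" for c Y i
    using GDC[OF that, of "\<lambda>k. 1 / real (Suc k)"] one_over_Suc_tendsto by auto
  define F where "F i r Z n w = fx i \<alpha> r (X \<alpha> r n w) * Z n w + fa i \<alpha> r (X \<alpha> r n w) * 1" for i r and Z :: rv and n w
  have FG: "F i r (Y r) = G 1 Y i r" for i r Y by (intro ext) (simp add: F_def G_def)
  have FMP: "(\<lambda>r. F i r (Y r)) \<in> MG2 T" if "i \<in> K" "Y \<in> MG2 T" for i Y
    using GMP[OF that, of 1] by (simp add: FG)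
  have FL: "d2 (F i r Z) (F i r Z') \<le> L * d2 Z Z'" if i: "i \<in> K" and r: "r \<in> {0..T}" and Z: "Z \<in> V2" "Z' \<in> V2" for i r Z Z'
  proof (rule two.cdist_mono[OF _ _ Z L])
    show "F i r Z \<in> V2" using ql(1)[of i "\<lambda>_. Z" r 1] i r Z by (simp add: FG[of i r "\<lambda>_. Z"])
    show "F i r Z' \<in> V2" using ql(1)[of i "\<lambda>_. Z'" r 1] i r Z by (simp add: FG[of i r "\<lambda>_. Z'"])
    fix n w
    have b: "\<bar>fx i \<alpha> r y\<bar> \<le> L" for y by (rule Lipschitz_deriv_bounded[OF fx[OF i r]]) (use Lip[OF i r, of \<alpha> _ \<alpha>] in simp)
    have "\<bar>F i r Z n w - F i r Z' n w\<bar> = \<bar>fx i \<alpha> r (X \<alpha> r n w)\<bar> * \<bar>Z n w - Z' n w\<bar>"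
      by (simp add: F_def abs_mult flip: right_diff_distrib)
    also have "\<dots> \<le> L * \<bar>Z n w - Z' n w\<bar>" by (intro mult_right_mono b) auto
    finally show "\<bar>F i r Z n w - F i r Z' n w\<bar> \<le> L * \<bar>Z n w - Z' n w\<bar>" .
  qed
  obtain Y Iy where Y: "Y \<in> MG2 T" and Iy: "\<And>i t. i \<in> K \<Longrightarrow> t \<in> {0..T} \<Longrightarrow> has_int (A i) t (\<lambda>r. F i r (Y r)) (Iy i t)"
     and Yeq: "\<And>t. t \<in> {0..T} \<Longrightarrow> d2 (Y t) (\<lambda>n w. x' + (\<Sum>i\<in>K. Iy i t n w)) = 0"
    by (rule SDE_solution[of K T A C F L x', OF K T A C FMP L FL, rotated -1], rule that)
  have YV: "Y t \<in> V2" if "t \<in> {0..T}" for t by (rule MG2D(1)[OF Y that])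
  (* c = 0 isolates the term with the space derivative; Y = 0 and c = 1 the one with the parameter
     derivative. *)
  have G0: "(\<lambda>r n w. fx i \<alpha> r (X \<alpha> r n w) * Y r n w) \<in> MG2 T" if "i \<in> K" for i
    using GMP[OF that Y, of 0] by (simp add: G_def[abs_def])
  have G1: "(\<lambda>r n w. fa i \<alpha> r (X \<alpha> r n w)) \<in> MG2 T" if "i \<in> K" for i
    using GMP[OF that MG2_zero[OF T], of 1] by (simp add: G_def[abs_def])
  have ex: "\<exists>J. has_int (A i) t \<eta> J" if i: "i \<in> K" and t: "t \<in> {0..T}" and \<eta>: "\<eta> \<in> MG2 T" for i t \<eta>
  proof -
    have t': "0 \<le> t" "t \<le> T" using t by auto
    show ?thesis by (rule has_int_exists[OF integrator_restrict[OF A[OF i] t'(2)] t'(1) MG2_restrict[OF \<eta> t']]) blast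
  qed
  define J where "J i t = (SOME J. has_int (A i) t (\<lambda>r n w. fx i \<alpha> r (X \<alpha> r n w) * Y r n w) J)" for i t
  define Ja where "Ja i t = (SOME J. has_int (A i) t (\<lambda>r n w. fa i \<alpha> r (X \<alpha> r n w)) J)" for i t
  have J: "has_int (A i) t (\<lambda>r n w. fx i \<alpha> r (X \<alpha> r n w) * Y r n w) (J i t)" if "i \<in> K" "t \<in> {0..T}" for i t
    unfolding J_def by (rule someI_ex[OF ex[OF that G0[OF that(1)]]])
  have Ja: "has_int (A i) t (\<lambda>r n w. fa i \<alpha> r (X \<alpha> r n w)) (Ja i t)" if "i \<in> K" "t \<in> {0..T}" for i t
    unfolding Ja_def by (rule someI_ex[OF ex[OF that G1[OF that(1)]]])
  show thesis
  proof (rule that[OF Y _ J Ja])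
    fix t assume t: "t \<in> {0..T}"
    have t': "0 \<le> t" "t \<le> T" using t by auto
    have u: "d2 (Iy i t) (\<lambda>n w. J i t n w + Ja i t n w) = 0" if i: "i \<in> K" for i
    proof -
      have At: "integrator (A i) C t" by (rule integrator_restrict[OF A[OF i] t'(2)])
      have "has_int (A i) t (\<lambda>r. F i r (Y r)) (\<lambda>n w. J i t n w + Ja i t n w)"
        using has_int_add[OF At t'(1) J[OF i t] Ja[OF i t]] by (simp add: F_def[abs_def])
      then show ?thesis by (rule has_int_unique[OF At t'(1) Iy[OF i t]])
    qed
    have IV: "Iy i t \<in> V2" "(\<lambda>n w. J i t n w + Ja i t n w) \<in> V2" if "i \<in> K" for i
      using has_intD(2)[OF Iy[OF that t]] has_intD(2)[OF J[OF that t]] has_intD(2)[OF Ja[OF that t]] by (auto intro: V_intros)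
    have "(d2 (\<lambda>n w. x' + (\<Sum>i\<in>K. Iy i t n w)) (\<lambda>n w. x' + (\<Sum>i\<in>K. J i t n w + Ja i t n w)))\<^sup>2 \<le> 0"
      using d2_affine_sum[where I = "\<lambda>i. Iy i t" and J = "\<lambda>i n w. J i t n w + Ja i t n w" and x = x' and y = x', OF K IV] u by simp
    then have z: "d2 (\<lambda>n w. x' + (\<Sum>i\<in>K. Iy i t n w)) (\<lambda>n w. x' + (\<Sum>i\<in>K. J i t n w + Ja i t n w)) = 0" by simp
    show "d2 (Y t) (\<lambda>n w. x' + (\<Sum>i\<in>K. J i t n w + Ja i t n w)) = 0"
      using d2_eq_0_cong[OF YV[OF t] V_affine_sum[where K = K and I = "\<lambda>i. Iy i t" and x = x', OF IV(1)]
        V_affine_sum[where K = K and I = "\<lambda>i n w. J i t n w + Ja i t n w" and x = x', OF IV(2)] Yeq[OF t]] z by simp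
  next
    fix t assume t: "t \<in> {0..T}"
    define D where "D \<delta> r n w = (X (\<alpha> + \<delta>) r n w - X \<alpha> r n w) / \<delta>" for \<delta> r n w
    define Q where "Q \<delta> i r n w = (f i (\<alpha> + \<delta>) r (X (\<alpha> + \<delta>) r n w) - f i \<alpha> r (X \<alpha> r n w)) / \<delta>" for \<delta> i r n w
    define ID where "ID \<delta> i r n w = (I i (\<alpha> + \<delta>) r n w - I i \<alpha> r n w) / \<delta>" for \<delta> i r n w
    define xq where "xq \<delta> = (x (\<alpha> + \<delta>) - x \<alpha>) / \<delta>" for \<delta>
    have D: "D \<delta> \<in> MG2 T" for \<delta>
      using MG2_scale[OF MG2_diff[OF X X], of "1 / \<delta>" "\<alpha> + \<delta>" \<alpha>] by (simp add: D_def[abs_def])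
    have DV: "D \<delta> r \<in> V2" if "r \<in> {0..T}" for \<delta> r by (rule MG2D(1)[OF D that])
    have nQ: "has_int (A i) r (Q \<delta> i) (ID \<delta> i r)" if i: "i \<in> K" and r: "r \<in> {0..T}" for i r \<delta>
    proof -
      have r': "0 \<le> r" "r \<le> T" using r by auto
      have Ar: "integrator (A i) C r" by (rule integrator_restrict[OF A[OF i] r'(2)])
      show ?thesis using has_int_scale[OF Ar r'(1) has_int_diff[OF Ar r'(1) I[OF i r] I[OF i r]], of "1 / \<delta>" "\<alpha> + \<delta>" \<alpha>]
        by (simp add: Q_def[abs_def] ID_def[abs_def])
    qed
    have Deq: "d2 (D \<delta> r) (\<lambda>n w. xq \<delta> + (\<Sum>i\<in>K. ID \<delta> i r n w)) = 0" if r: "r \<in> {0..T}" for \<delta> r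
    proof -
      have IV: "I i a r \<in> V2" if "i \<in> K" for i a by (rule has_intD(2)[OF I[OF that r]])
      have IDV: "ID \<delta> i r \<in> V2" if "i \<in> K" for i by (rule has_intD(2)[OF nQ[OF that r]])
      have "d2 (D \<delta> r) (\<lambda>n w. xq \<delta> + (\<Sum>i\<in>K. ID \<delta> i r n w)) \<le> \<bar>1/\<delta>\<bar> * d2 (X (\<alpha> + \<delta>) r) (\<lambda>n w. x (\<alpha> + \<delta>) + (\<Sum>i\<in>K. I i (\<alpha> + \<delta>) r n w))
          + \<bar>1/\<delta>\<bar> * d2 (X \<alpha> r) (\<lambda>n w. x \<alpha> + (\<Sum>i\<in>K. I i \<alpha> r n w))"
      proof (rule two.cdist_dominated[OF DV[OF r] V_affine_sum[OF IDV] XV[OF r] V_affine_sum[OF IV] XV[OF r] V_affine_sum[OF IV]])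
        fix n w
        have "D \<delta> r n w - (xq \<delta> + (\<Sum>i\<in>K. ID \<delta> i r n w)) = (1/\<delta>) * (X (\<alpha> + \<delta>) r n w - (x (\<alpha> + \<delta>) + (\<Sum>i\<in>K. I i (\<alpha> + \<delta>) r n w)))
           - (1/\<delta>) * (X \<alpha> r n w - (x \<alpha> + (\<Sum>i\<in>K. I i \<alpha> r n w)))"
          by (simp add: D_def xq_def ID_def sum_divide_distrib[symmetric] sum_subtractf diff_divide_distrib add_divide_distrib)
        then show "\<bar>D \<delta> r n w - (xq \<delta> + (\<Sum>i\<in>K. ID \<delta> i r n w))\<bar> \<le> \<bar>1/\<delta>\<bar> * \<bar>X (\<alpha> + \<delta>) r n w - (x (\<alpha> + \<delta>) + (\<Sum>i\<in>K. I i (\<alpha> + \<delta>) r n w))\<bar>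
           + \<bar>1/\<delta>\<bar> * \<bar>X \<alpha> r n w - (x \<alpha> + (\<Sum>i\<in>K. I i \<alpha> r n w))\<bar>"
          by (simp only: abs_mult[symmetric] abs_triangle_ineq4)
      qed auto
      then have "d2 (D \<delta> r) (\<lambda>n w. xq \<delta> + (\<Sum>i\<in>K. ID \<delta> i r n w)) \<le> 0" using eq[OF r] by simp
      then show ?thesis using two.cdist_nonneg[OF DV[OF r, of \<delta>] V_affine_sum[of K "\<lambda>i. ID \<delta> i r" "xq \<delta>", OF IDV]] by linarith
    qed
    have QF: "(d2 (Q \<delta> i r) (F i r (Y r)))\<^sup>2 \<le> (2 * L\<^sup>2) * (d2 (D \<delta> r) (Y r))\<^sup>2 + 2 * (d2 (W 1 \<delta> Y i r) (G 1 Y i r))\<^sup>2"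
      if i: "i \<in> K" and r: "r \<in> {0..T}" and \<delta>: "\<delta> \<noteq> 0" for i r \<delta>
    proof -
      have QV: "Q \<delta> i r \<in> V2" by (rule has_intD(3)[OF nQ[OF i TT] r])
      have WV: "W 1 \<delta> Y i r \<in> V2" by (rule MG2D(1)[OF WMP[OF i Y] r])
      have GV: "G 1 Y i r \<in> V2" by (rule ql(1)[of i Y r 1, OF i YV[OF r] r]) simp
      have "d2 (Q \<delta> i r) (W 1 \<delta> Y i r) \<le> L * d2 (D \<delta> r) (Y r)"
      proof (rule two.cdist_mono[OF QV WV DV[OF r] YV[OF r] L])
        fix n w
        have "\<bar>Q \<delta> i r n w - W 1 \<delta> Y i r n w\<bar> = \<bar>f i (\<alpha> + \<delta>) r (X (\<alpha> + \<delta>) r n w) - f i (\<alpha> + \<delta>) r (X \<alpha> r n w + \<delta> * Y r n w)\<bar> / \<bar>\<delta>\<bar>"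
          by (simp add: Q_def W_def abs_divide flip: diff_divide_distrib)
        also have "\<dots> \<le> (L * \<bar>X (\<alpha> + \<delta>) r n w - (X \<alpha> r n w + \<delta> * Y r n w)\<bar>) / \<bar>\<delta>\<bar>"
          using Lip[OF i r, of "\<alpha> + \<delta>" "X (\<alpha> + \<delta>) r n w" "\<alpha> + \<delta>"] by (intro divide_right_mono) auto
        also have "X (\<alpha> + \<delta>) r n w - (X \<alpha> r n w + \<delta> * Y r n w) = \<delta> * (D \<delta> r n w - Y r n w)"
          using \<delta> by (simp add: D_def field_simps)
        also have "L * \<bar>\<delta> * (D \<delta> r n w - Y r n w)\<bar> / \<bar>\<delta>\<bar> = L * \<bar>D \<delta> r n w - Y r n w\<bar>" using \<delta> by (simp add: abs_mult)
        finally show "\<bar>Q \<delta> i r n w - W 1 \<delta> Y i r n w\<bar> \<le> L * \<bar>D \<delta> r n w - Y r n w\<bar>" .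
      qed
      then have "(d2 (Q \<delta> i r) (W 1 \<delta> Y i r))\<^sup>2 \<le> (L * d2 (D \<delta> r) (Y r))\<^sup>2" by (intro power_mono two.cdist_nonneg QV WV)
      then show ?thesis using d2_triangle_square[OF QV WV GV] by (simp add: FG power_mult_distrib)
    qed
    show "((\<lambda>\<delta>. d2 (\<lambda>n w. (X (\<alpha> + \<delta>) t n w - X \<alpha> t n w) / \<delta>) (Y t)) \<longlongrightarrow> 0) (at 0)"
      unfolding tendsto_at_iff_sequentially
    proof (intro allI impI)
      fix \<delta> :: "nat \<Rightarrow> real" assume nz: "\<forall>k. \<delta> k \<in> UNIV - {0}" and \<delta>0: "\<delta> \<longlonglongrightarrow> 0"
      have nz': "\<delta> k \<noteq> 0" for k using nz by simp
      define R where "R k i r = 2 * (d2 (W 1 (\<delta> k) Y i r) (G 1 Y i r))\<^sup>2" for k i r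
      have Ri: "R k i integrable_on {0..T}" if i: "i \<in> K" for k i
      proof -
        have GM: "G 1 Y i \<in> MG2 T" by (rule GMP[OF i Y]) simp
        show ?thesis unfolding R_def[abs_def] by (intro integrable_on_mult_right MG2_dist_integrable T WMP[OF i Y] GM)
      qed
      define B where "B = exp (2 * (6 * C * real (card K) * real (card K) * (2 * L\<^sup>2) + 1) * T)"
      have bound: "(d2 (D (\<delta> k) t) (Y t))\<^sup>2 \<le> 2 * (2 * (xq (\<delta> k) - x')\<^sup>2 + 6 * C * real (card K) * (\<Sum>i\<in>K. integral {0..T} (R k i))) * B" for k
        unfolding B_def
      proof (rule SDE_stability[OF K T A C nQ Iy D Deq Y Yeq _ _ _ _ t])
        show "R k i integrable_on {0..T}" if "i \<in> K" for i by (rule Ri[OF that])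
        show "0 \<le> R k i r" for i r by (simp add: R_def)
        show "(d2 (Q (\<delta> k) i r) (F i r (Y r)))\<^sup>2 \<le> (2 * L\<^sup>2) * (d2 (D (\<delta> k) r) (Y r))\<^sup>2 + R k i r" if "i \<in> K" "r \<in> {0..T}" for i r
          unfolding R_def by (rule QF[OF that nz'])
      qed simp_all
      have xql: "(\<lambda>k. xq (\<delta> k)) \<longlonglongrightarrow> x'"
      proof -
        have "((\<lambda>h. xq h) \<longlongrightarrow> x') (at 0)" using x' unfolding DERIV_def xq_def .
        moreover have "filterlim \<delta> (at 0) sequentially" using \<delta>0 nz' by (simp add: filterlim_at)
        ultimately show ?thesis by (rule filterlim_compose)
      qed
      have Rl: "(\<lambda>k. integral {0..T} (R k i)) \<longlonglongrightarrow> 0" if i: "i \<in> K" for i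
      proof -
        have "(\<lambda>k. integral {0..T} (\<lambda>t. (d2 (W 1 (\<delta> k) Y i t) (G 1 Y i t))\<^sup>2)) \<longlonglongrightarrow> 0" using GDC[OF i Y _ \<delta>0 nz', of 1] by simp
        from tendsto_mult[OF tendsto_const[of 2] this] show ?thesis by (simp add: R_def[abs_def])
      qed
      have "(\<lambda>k. 2 * (2 * (xq (\<delta> k) - x')\<^sup>2 + 6 * C * real (card K) * (\<Sum>i\<in>K. integral {0..T} (R k i))) * B) \<longlonglongrightarrow> 2 * (2 * (x' - x')\<^sup>2 + 6 * C * real (card K) * (\<Sum>i\<in>K. 0)) * B"
        by (intro tendsto_intros xql Rl)
      then have rhs: "(\<lambda>k. 2 * (2 * (xq (\<delta> k) - x')\<^sup>2 + 6 * C * real (card K) * (\<Sum>i\<in>K. integral {0..T} (R k i))) * B) \<longlonglongrightarrow> 0" by simp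
      have "(\<lambda>k. (d2 (D (\<delta> k) t) (Y t))\<^sup>2) \<longlonglongrightarrow> 0"
        by (rule tendsto_sandwich[OF _ _ tendsto_const rhs]) (use bound in \<open>auto intro!: always_eventually\<close>)
      then have "(\<lambda>k. d2 (D (\<delta> k) t) (Y t)) \<longlonglongrightarrow> 0" by (subst (asm) power_tendsto_0_iff) auto
      then show "((\<lambda>\<delta>. d2 (\<lambda>n w. (X (\<alpha> + \<delta>) t n w - X \<alpha> t n w) / \<delta>) (Y t)) \<circ> \<delta>) \<longlonglongrightarrow> 0"
        by (simp add: o_def D_def[abs_def])
    qed
  qed
qed

lemma integrator_mono:
  assumes "integrator A C T" "C \<le> C'" shows "integrator A C' T"
  unfolding integrator_def
proof (intro conjI ballI allI impI)
  show "0 \<le> C'" using integratorD(1)[OF assms(1)] assms(2) by simp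
  show "A t \<in> adapted t" if "t \<in> {0..T}" for t by (rule integratorD(2)[OF assms(1) that])
  fix t N \<tau> Z assume h: "t \<le> T" "is_partition t N \<tau>" "\<forall>j<N. Z j \<in> bL0 (\<tau> j)"
  have "0 \<le> (\<Sum>j<N. (n2 (Z j))\<^sup>2 * (\<tau> (Suc j) - \<tau> j))"
    using h(2) unfolding is_partition_def by (intro sum_nonneg mult_nonneg_nonneg) (auto intro: less_imp_le)
  then have "C * (\<Sum>j<N. (n2 (Z j))\<^sup>2 * (\<tau> (Suc j) - \<tau> j)) \<le> C' * (\<Sum>j<N. (n2 (Z j))\<^sup>2 * (\<tau> (Suc j) - \<tau> j))"
    using assms(2) by (intro mult_right_mono)
  moreover have "(d2 (\<lambda>n w. \<Sum>j<N. Z j w * (A (\<tau> (Suc j)) n w - A (\<tau> j) n w)) (\<lambda>_ _. 0))\<^sup>2 \<le> C * (\<Sum>j<N. (n2 (Z j))\<^sup>2 * (\<tau> (Suc j) - \<tau> j))"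
    by (rule integrator_estimate[OF assms(1) h(1,2)]) (use h(3) in blast)
  ultimately show "(d2 (\<lambda>n w. \<Sum>j<N. Z j w * (A (\<tau> (Suc j)) n w - A (\<tau> j) n w)) (\<lambda>_ _. 0))\<^sup>2 \<le> C' * (\<Sum>j<N. (n2 (Z j))\<^sup>2 * (\<tau> (Suc j) - \<tau> j))" by linarith
qed

lemma has_LG2_derivative_iff:
  assumes "\<And>a. g a \<in> V2"
  shows "has_LG2_derivative E g h \<alpha> \<longleftrightarrow> h \<in> V2 \<and> ((\<lambda>\<delta>. d2 (\<lambda>n w. (g (\<alpha> + \<delta>) n w - g \<alpha> n w) / \<delta>) h) \<longlongrightarrow> 0) (at 0)"
proof -
  have V2: "(\<lambda>n w. (g (\<alpha> + \<delta>) n w - g \<alpha> n w) / \<delta>) \<in> V2" for \<delta>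
    using two.cseq_scale[OF two.cseq_diff[OF assms assms], of "1 / \<delta>" "\<alpha> + \<delta>" \<alpha>] by simp
  have "((\<lambda>\<delta>. EG E (\<lambda>n w. \<bar>(g (\<alpha> + \<delta>) n w - g \<alpha> n w) / \<delta> - h n w\<bar>\<^sup>2)) \<longlongrightarrow> 0) (at 0) \<longleftrightarrow>
     ((\<lambda>\<delta>. d2 (\<lambda>n w. (g (\<alpha> + \<delta>) n w - g \<alpha> n w) / \<delta>) h) \<longlongrightarrow> 0) (at 0)" if "h \<in> V2"
    unfolding EG_square(2)[OF V2 that] by (subst power_tendsto_0_iff) auto
  then show ?thesis unfolding has_LG2_derivative_def by (auto simp: LG_2_eq)
qed

lemma derivative_unique:
  assumes V2: "\<And>\<delta>. D \<delta> \<in> V2" "Y \<in> V2" "Z \<in> V2" and Y: "((\<lambda>\<delta>. d2 (D \<delta>) Y) \<longlongrightarrow> 0) (at (0::real))" and Z: "((\<lambda>\<delta>. d2 (D \<delta>) Z) \<longlongrightarrow> 0) (at 0)"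
  shows "d2 Y Z = 0"
proof -
  have "((\<lambda>\<delta>. d2 (D \<delta>) Y + d2 (D \<delta>) Z) \<longlongrightarrow> 0 + 0) (at 0)" by (intro tendsto_intros Y Z)
  moreover have "d2 Y Z \<le> d2 (D \<delta>) Y + d2 (D \<delta>) Z" for \<delta>
    using two.cdist_triangle[OF V2(2) V2(1)[of \<delta>] V2(3)] two.cdist_commute[OF V2(1)[of \<delta>] V2(2)] by simp
  ultimately have "d2 Y Z \<le> 0 + 0" by (intro tendsto_lowerbound[OF _ always_eventually, of _ _ "at 0"]) auto
  then show ?thesis using two.cdist_nonneg[OF V2(2,3)] by simp
qed

section \<open>Integral equations for representatives\<close>

lemma d1_affine_sum:
  assumes I: "\<And>i. i \<in> K \<Longrightarrow> I i \<in> V1 \<and> J i \<in> V1 \<and> d1 (I i) (J i) = 0"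
  shows "(\<lambda>n w. x + (\<Sum>i\<in>K. I i n w)) \<in> V1 \<and> (\<lambda>n w. x + (\<Sum>i\<in>K. J i n w)) \<in> V1 \<and>
     d1 (\<lambda>n w. x + (\<Sum>i\<in>K. I i n w)) (\<lambda>n w. x + (\<Sum>i\<in>K. J i n w)) = 0"
proof -
  let ?I = "\<lambda>n w. \<Sum>i\<in>K. I i n w" and ?J = "\<lambda>n w. \<Sum>i\<in>K. J i n w"
  have s: "?I \<in> V1" "?J \<in> V1" "d1 ?I ?J \<le> 0" using one.cdist_sum_le[of K I J] I by auto
  have "(\<lambda>n w. x) \<in> V1" by (intro V_V1 V_const L0_intros)
  then have V2: "(\<lambda>n w. x + ?I n w) \<in> V1" "(\<lambda>n w. x + ?J n w) \<in> V1" using s by (auto intro: one.cseq_add)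
  have "d1 (\<lambda>n w. x + ?I n w) (\<lambda>n w. x + ?J n w) \<le> 1 * d1 ?I ?J" by (rule one.cdist_mono[OF V2 s(1,2)]) auto
  then show ?thesis using V2 s(3) one.cdist_nonneg[OF V2] by simp
qed

text \<open>
  The equation as stated holds in the first-order norm, with integrals determined only up to it.
  Passing to the integrals in mean square changes nothing in that norm, and by
  \<open>d1_zero_imp_d2_zero\<close> the equation then holds in mean square.
\<close>

lemma equation_has_int:
  assumes K: "finite K" and A: "\<And>i. i \<in> K \<Longrightarrow> integrator (A i) C t" and t: "0 \<le> t"
    and I: "\<And>i. i \<in> K \<Longrightarrow> has_G_integral E (q i) (A i) t (\<eta> i) (I i)"
    and q: "\<And>i. i \<in> K \<Longrightarrow> q i = 1 \<or> q i = 2 \<and> (\<forall>S. is_step E 2 t S \<longrightarrow> step_integral (A i) S \<in> V2)"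
    and Z: "Z \<in> V2" and eq: "LG_eq E 1 Z (\<lambda>n w. x + (\<Sum>i\<in>K. I i n w))"
  obtains J where "\<And>i. i \<in> K \<Longrightarrow> has_int (A i) t (\<eta> i) (J i)" "d2 Z (\<lambda>n w. x + (\<Sum>i\<in>K. J i n w)) = 0"
proof -
  have ex: "\<exists>J. has_int (A i) t (\<eta> i) J \<and> I i \<in> V1 \<and> d1 (I i) J = 0" if i: "i \<in> K" for i
    by (rule has_G_integral_has_int[OF A[OF i] t I[OF i] q[OF i]]) blast
  have "\<forall>i. \<exists>J. i \<in> K \<longrightarrow> has_int (A i) t (\<eta> i) J \<and> I i \<in> V1 \<and> d1 (I i) J = 0" using ex by blast
  then obtain J where J: "\<forall>i. i \<in> K \<longrightarrow> has_int (A i) t (\<eta> i) (J i) \<and> I i \<in> V1 \<and> d1 (I i) (J i) = 0" by (rule choice[THEN exE])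
  have JV: "J i \<in> V2" if "i \<in> K" for i using J that has_intD(2) by blast
  have s: "(\<lambda>n w. x + (\<Sum>i\<in>K. I i n w)) \<in> V1 \<and> (\<lambda>n w. x + (\<Sum>i\<in>K. J i n w)) \<in> V1 \<and>
     d1 (\<lambda>n w. x + (\<Sum>i\<in>K. I i n w)) (\<lambda>n w. x + (\<Sum>i\<in>K. J i n w)) = 0"
    by (rule d1_affine_sum) (use J JV V_V1 in blast)
  have "d1 Z (\<lambda>n w. x + (\<Sum>i\<in>K. I i n w)) = 0"
    using eq LG_norm_1[OF V_V1[OF Z] s[THEN conjunct1]] by (simp add: LG_eq_def)
  then have "d1 Z (\<lambda>n w. x + (\<Sum>i\<in>K. J i n w)) \<le> 0"
    using one.cdist_triangle[OF V_V1[OF Z] s[THEN conjunct1] s[THEN conjunct2, THEN conjunct1]] s by simp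
  then have "d1 Z (\<lambda>n w. x + (\<Sum>i\<in>K. J i n w)) = 0"
    using one.cdist_nonneg[OF V_V1[OF Z] s[THEN conjunct2, THEN conjunct1]] by linarith
  then have "d2 Z (\<lambda>n w. x + (\<Sum>i\<in>K. J i n w)) = 0"
    using d1_zero_imp_d2_zero[OF Z V_affine_sum[where K = K and I = J and x = x, OF JV]] by simp
  then show thesis using J by (intro that) auto
qed

lemma LG_eqI:
  assumes "Y \<in> V2" "Z \<in> V2" "d2 Y Z = 0" shows "LG_eq E 1 Y Z"
  using LG_norm_1[OF V_V1 V_V1, OF assms(1,2)] d1_le_d2[OF assms(1,2)] one.cdist_nonneg[OF V_V1 V_V1, OF assms(1,2)] assms(3)
  by (simp add: LG_eq_def)

end

lemma uniform_pair_Lipschitz: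
  fixes \<F> :: "(real \<Rightarrow> real \<Rightarrow> real \<Rightarrow> real) set"
  assumes "finite \<F>" "\<And>f. f \<in> \<F> \<Longrightarrow> \<exists>L. \<forall>t\<in>S. L-lipschitz_on UNIV (\<lambda>(\<alpha>, y). f \<alpha> t y)"
  shows "\<exists>L\<ge>0. \<forall>f\<in>\<F>. \<forall>t\<in>S. \<forall>a y a' y'. \<bar>f a t y - f a' t y'\<bar> \<le> L * (\<bar>a - a'\<bar> + \<bar>y - y'\<bar>)"
  using assms
proof (induction rule: finite_induct)
  case empty then show ?case by auto
next
  case (insert g \<F>)
  obtain L where L: "0 \<le> L" "\<forall>f\<in>\<F>. \<forall>t\<in>S. \<forall>a y a' y'. \<bar>f a t y - f a' t y'\<bar> \<le> L * (\<bar>a - a'\<bar> + \<bar>y - y'\<bar>)"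
    using insert by blast
  obtain M where M: "\<forall>t\<in>S. M-lipschitz_on UNIV (\<lambda>(\<alpha>, y). g \<alpha> t y)" using insert.prems[of g] by blast
  have g: "\<bar>g a t y - g a' t y'\<bar> \<le> \<bar>M\<bar> * (\<bar>a - a'\<bar> + \<bar>y - y'\<bar>)" if "t \<in> S" for t a y a' y'
  proof -
    have "\<bar>g a t y - g a' t y'\<bar> \<le> M * dist (a, y) (a', y')"
      using lipschitz_onD[OF M[rule_format, OF that], of "(a, y)" "(a', y')"] by (simp add: dist_real_def)
    also have "\<dots> \<le> \<bar>M\<bar> * (\<bar>a - a'\<bar> + \<bar>y - y'\<bar>)"
      using norm_Pair_le[of "a - a'" "y - y'"] by (intro mult_mono) (auto simp: dist_norm)
    finally show ?thesis .
  qed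
  have le: "L * d \<le> max L \<bar>M\<bar> * d" "\<bar>M\<bar> * d \<le> max L \<bar>M\<bar> * d" if "0 \<le> d" for d
    using that by (auto intro: mult_right_mono)
  show ?case
  proof (intro exI[of _ "max L \<bar>M\<bar>"] conjI ballI allI)
    fix f t and a y a' y' :: real assume f: "f \<in> insert g \<F>" and t: "t \<in> S"
    have d: "0 \<le> \<bar>a - a'\<bar> + \<bar>y - y'\<bar>" by simp
    show "\<bar>f a t y - f a' t y'\<bar> \<le> max L \<bar>M\<bar> * (\<bar>a - a'\<bar> + \<bar>y - y'\<bar>)"
      using f L(2)[rule_format, of f t a y a' y'] g[OF t, of a y a' y'] t order_trans[OF _ le(1)[OF d]] order_trans[OF _ le(2)[OF d]]
      by blast
  qed (use L in auto)
qed

theorem theorem4p4: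
  fixes s T :: real
    and H :: "('w \<Rightarrow> real) set" and E' :: "('w \<Rightarrow> real) \<Rightarrow> real" and \<xi> :: "nat \<Rightarrow> 'w \<Rightarrow> real"
    and E :: "(path \<Rightarrow> real) \<Rightarrow> real"
    and x x' :: "real \<Rightarrow> real"
    and b \<sigma> h b\<^sub>x \<sigma>\<^sub>x h\<^sub>x b\<^sub>\<alpha> \<sigma>\<^sub>\<alpha> h\<^sub>\<alpha> :: "real \<Rightarrow> real \<Rightarrow> real \<Rightarrow> real"
    and X :: "real \<Rightarrow> real \<Rightarrow> rv"
  assumes s: "0 \<le> s" "s \<le> 1"
    and E: "G_expectation s H E' \<xi> E"
    and T: "T > 0"
    and x_lipschitz: "\<exists>L. L-lipschitz_on UNIV x"
    and coeff_lipschitz: "\<And>f. f \<in> {b, \<sigma>, h} \<Longrightarrow>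
          \<exists>L. \<forall>t\<in>{0..T}. L-lipschitz_on UNIV (\<lambda>(\<alpha>, y). f \<alpha> t y)"
    and coeff_measurable: "\<And>f \<alpha> y. f \<in> {b, \<sigma>, h} \<Longrightarrow>
          (\<lambda>t. f \<alpha> t y) \<in> borel_measurable (lebesgue_on {0..T})"
    and X_space: "\<And>\<alpha>. X \<alpha> \<in> MG E 2 T"
    and X_solution: "\<And>\<alpha> t. t \<in> {0..T} \<Longrightarrow> \<exists>I J K.
          has_dt_integral E t (\<lambda>r n \<omega>. b \<alpha> r (X \<alpha> r n \<omega>)) I \<and>
          has_dB_integral E t (\<lambda>r n \<omega>. \<sigma> \<alpha> r (X \<alpha> r n \<omega>)) J \<and>
          has_dQV_integral E t (\<lambda>r n \<omega>. h \<alpha> r (X \<alpha> r n \<omega>)) K \<and>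
          LG_eq E 1 (X \<alpha> t) (\<lambda>n \<omega>. x \<alpha> + I n \<omega> + J n \<omega> + K n \<omega>)"
    and deriv_space: "\<And>f f\<^sub>x \<alpha> t y. (f, f\<^sub>x) \<in> {(b, b\<^sub>x), (\<sigma>, \<sigma>\<^sub>x), (h, h\<^sub>x)} \<Longrightarrow> t \<in> {0..T} \<Longrightarrow>
          (f \<alpha> t has_real_derivative f\<^sub>x \<alpha> t y) (at y)"
    and deriv_param: "\<And>f f\<^sub>\<alpha> \<alpha> t y. (f, f\<^sub>\<alpha>) \<in> {(b, b\<^sub>\<alpha>), (\<sigma>, \<sigma>\<^sub>\<alpha>), (h, h\<^sub>\<alpha>)} \<Longrightarrow> t \<in> {0..T} \<Longrightarrow>
          ((\<lambda>a. f a t y) has_real_derivative f\<^sub>\<alpha> \<alpha> t y) (at \<alpha>)"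
    and deriv_Cllip: "\<And>f t. f \<in> {b\<^sub>x, \<sigma>\<^sub>x, h\<^sub>x, b\<^sub>\<alpha>, \<sigma>\<^sub>\<alpha>, h\<^sub>\<alpha>} \<Longrightarrow> t \<in> {0..T} \<Longrightarrow>
          (\<lambda>(\<alpha>, y). f \<alpha> t y) \<in> Cllip"
    and deriv_space_bounded: "\<And>f t. f \<in> {b\<^sub>x, \<sigma>\<^sub>x, h\<^sub>x} \<Longrightarrow> t \<in> {0..T} \<Longrightarrow>
          bounded (range (\<lambda>(\<alpha>, y). f \<alpha> t y))"
    and x_deriv: "\<And>\<alpha>. (x has_real_derivative x' \<alpha>) (at \<alpha>)"
  shows "(\<forall>\<alpha>. \<forall>t\<in>{0..T}. \<exists>f. has_LG2_derivative E (\<lambda>a. X a t) f \<alpha>) \<and>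
    (\<forall>Y. (\<forall>\<alpha>. \<forall>t\<in>{0..T}. has_LG2_derivative E (\<lambda>a. X a t) (Y \<alpha> t) \<alpha>) \<longrightarrow>
      (\<forall>\<alpha>. \<forall>t\<in>{0..T}. \<exists>I\<^sub>x J\<^sub>x K\<^sub>x I\<^sub>\<alpha> J\<^sub>\<alpha> K\<^sub>\<alpha>.
         has_dt_integral E t (\<lambda>r n \<omega>. b\<^sub>x \<alpha> r (X \<alpha> r n \<omega>) * Y \<alpha> r n \<omega>) I\<^sub>x \<and>
         has_dB_integral E t (\<lambda>r n \<omega>. \<sigma>\<^sub>x \<alpha> r (X \<alpha> r n \<omega>) * Y \<alpha> r n \<omega>) J\<^sub>x \<and>
         has_dQV_integral E t (\<lambda>r n \<omega>. h\<^sub>x \<alpha> r (X \<alpha> r n \<omega>) * Y \<alpha> r n \<omega>) K\<^sub>x \<and>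
         has_dt_integral E t (\<lambda>r n \<omega>. b\<^sub>\<alpha> \<alpha> r (X \<alpha> r n \<omega>)) I\<^sub>\<alpha> \<and>
         has_dB_integral E t (\<lambda>r n \<omega>. \<sigma>\<^sub>\<alpha> \<alpha> r (X \<alpha> r n \<omega>)) J\<^sub>\<alpha> \<and>
         has_dQV_integral E t (\<lambda>r n \<omega>. h\<^sub>\<alpha> \<alpha> r (X \<alpha> r n \<omega>)) K\<^sub>\<alpha> \<and>
         LG_eq E 1 (Y \<alpha> t)
           (\<lambda>n \<omega>. x' \<alpha> + I\<^sub>x n \<omega> + J\<^sub>x n \<omega> + K\<^sub>x n \<omega> + I\<^sub>\<alpha> n \<omega> + J\<^sub>\<alpha> n \<omega> + K\<^sub>\<alpha> n \<omega>)))"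
proof -
  interpret G_Brownian_expectation E "E' (\<lambda>w. \<xi> 0 w ^ 4)" by (rule G_expectation_increments[OF E])
  (* Time, B and the quadratic variation are numbered 0, 1 and 2, so that one sum over K stands
     for the three integrals; q is the order of the norm in which the integral is defined. *)
  define K where "K = {..<3::nat}"
  have K: "finite K" "i \<in> K \<longleftrightarrow> i = 0 \<or> i = 1 \<or> i = 2" and sumK: "(\<Sum>i\<in>K. g i) = g 0 + g 1 + g 2"
    for i and g :: "nat \<Rightarrow> real" by (auto simp: K_def numeral_3_eq_3 numeral_2_eq_2 lessThan_Suc)
  define A :: "nat \<Rightarrow> real \<Rightarrow> rv" where "A i = [\<lambda>t n w. t, \<lambda>t n w. B t w, QV E] ! i" for i
  define q :: "nat \<Rightarrow> real" where "q i = [2, 2, 1] ! i" for i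
  define f where "f i = [b, \<sigma>, h] ! i" for i
  define fx where "fx i = [b\<^sub>x, \<sigma>\<^sub>x, h\<^sub>x] ! i" for i
  define fa where "fa i = [b\<^sub>\<alpha>, \<sigma>\<^sub>\<alpha>, h\<^sub>\<alpha>] ! i" for i
  let ?f = "\<lambda>i a r n w. f i a r (X a r n w)" and ?fx = "\<lambda>i \<alpha> Y r n w. fx i \<alpha> r (X \<alpha> r n w) * Y r n w" and ?fa = "\<lambda>i \<alpha> r n w. fa i \<alpha> r (X \<alpha> r n w)"
    and ?D = "\<lambda>\<alpha> \<delta> t n w. (X (\<alpha> + \<delta>) t n w - X \<alpha> t n w) / \<delta>"
  define C where "C = 1\<^sup>2 * T + 1 + E' (\<lambda>w. \<xi> 0 w ^ 4) * T"
  have T0: "0 \<le> T" using T by simp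
  have c4T: "0 \<le> E' (\<lambda>w. \<xi> 0 w ^ 4) * T" using c4_nonneg T0 by simp
  then have C: "0 \<le> C" using T0 by (simp add: C_def)
  have A: "integrator (A i) C T" if "i \<in> K" for i
    using that integrator_mono[OF integrator_dt[of T], of C] integrator_mono[OF integrator_dB[of T], of C] integrator_mono[OF integrator_QV[of T], of C] T0 c4T
    by (auto simp: K A_def C_def)
  have At: "integrator (A i) C t" if "i \<in> K" "t \<in> {0..T}" for i t by (rule integrator_restrict[OF A]) (use that in auto)
  have q: "q i = 1 \<or> q i = 2 \<and> (\<forall>S. is_step E 2 t S \<longrightarrow> step_integral (A i) S \<in> V2)" if "i \<in> K" for i t
    using that step_integral_V by (auto simp: K A_def q_def)
  have q12: "q i = 1 \<or> q i = 2" if "i \<in> K" for i using q[OF that] by blast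
  have mem: "f i \<in> {b, \<sigma>, h}" "fx i \<in> {b\<^sub>x, \<sigma>\<^sub>x, h\<^sub>x, b\<^sub>\<alpha>, \<sigma>\<^sub>\<alpha>, h\<^sub>\<alpha>}" "fa i \<in> {b\<^sub>x, \<sigma>\<^sub>x, h\<^sub>x, b\<^sub>\<alpha>, \<sigma>\<^sub>\<alpha>, h\<^sub>\<alpha>}"
    "(f i, fx i) \<in> {(b, b\<^sub>x), (\<sigma>, \<sigma>\<^sub>x), (h, h\<^sub>x)}" "(f i, fa i) \<in> {(b, b\<^sub>\<alpha>), (\<sigma>, \<sigma>\<^sub>\<alpha>), (h, h\<^sub>\<alpha>)}" if "i \<in> K" for i
    using that by (auto simp: K f_def fx_def fa_def)
  obtain L where L: "0 \<le> L" and Lip': "\<forall>f\<in>{b, \<sigma>, h}. \<forall>t\<in>{0..T}. \<forall>a y a' y'. \<bar>f a t y - f a' t y'\<bar> \<le> L * (\<bar>a - a'\<bar> + \<bar>y - y'\<bar>)"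
    using uniform_pair_Lipschitz[of "{b, \<sigma>, h}" "{0..T}", OF _ coeff_lipschitz] by auto
  have Lip: "\<bar>f i a t y - f i a' t y'\<bar> \<le> L * (\<bar>a - a'\<bar> + \<bar>y - y'\<bar>)" if "i \<in> K" "t \<in> {0..T}" for i t a y a' y'
    using Lip' mem(1)[OF that(1)] that(2) by blast
  have meas: "(\<lambda>t. f i a t y) \<in> borel_measurable (lebesgue_on {0..T})" if "i \<in> K" for i a y by (rule coeff_measurable[OF mem(1)[OF that]])
  have X: "X a \<in> MG2 T" for a using X_space[of a] MG_iff_MG2[OF T0] by blast
  have XV: "X a t \<in> V2" if "t \<in> {0..T}" for a t by (rule MG2D(1)[OF X that])
  have "\<exists>I. (\<forall>i\<in>K. has_int (A i) t (?f i a) (I i)) \<and> d2 (X a t) (\<lambda>n w. x a + (\<Sum>i\<in>K. I i n w)) = 0"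
    if t: "t \<in> {0..T}" for a t
  proof -
    obtain I0 I1 I2 where I: "has_dt_integral E t (\<lambda>r n w. b a r (X a r n w)) I0"
        "has_dB_integral E t (\<lambda>r n w. \<sigma> a r (X a r n w)) I1" "has_dQV_integral E t (\<lambda>r n w. h a r (X a r n w)) I2"
        "LG_eq E 1 (X a t) (\<lambda>n w. x a + I0 n w + I1 n w + I2 n w)"
      using X_solution[OF t] by blast
    define I where "I i = [I0, I1, I2] ! i" for i
    have G: "has_G_integral E (q i) (A i) t (?f i a) (I i)" if "i \<in> K" for i
      using that I(1-3) by (auto simp: K A_def q_def f_def I_def has_dt_integral_def has_dB_integral_def has_dQV_integral_def)
    have eq: "LG_eq E 1 (X a t) (\<lambda>n w. x a + (\<Sum>i\<in>K. I i n w))" using I(4) by (simp add: sumK I_def add.assoc)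
    have t0: "0 \<le> t" using t by simp
    obtain J where "\<And>i. i \<in> K \<Longrightarrow> has_int (A i) t (?f i a) (J i)" "d2 (X a t) (\<lambda>n w. x a + (\<Sum>i\<in>K. J i n w)) = 0"
      using equation_has_int[of K A C t q "\<lambda>i r n w. f i a r (X a r n w)" I "X a t" "x a", OF K(1) At[OF _ t] t0 G q XV[OF t] eq] by blast
    then show ?thesis by blast
  qed
  then have "\<forall>a t. \<exists>I. t \<in> {0..T} \<longrightarrow> (\<forall>i\<in>K. has_int (A i) t (?f i a) (I i)) \<and> d2 (X a t) (\<lambda>n w. x a + (\<Sum>i\<in>K. I i n w)) = 0"
    by blast
  then have "\<exists>I. \<forall>a t. t \<in> {0..T} \<longrightarrow> (\<forall>i\<in>K. has_int (A i) t (?f i a) (I a t i)) \<and> d2 (X a t) (\<lambda>n w. x a + (\<Sum>i\<in>K. I a t i n w)) = 0"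
    unfolding choice_iff .
  then obtain I where I: "\<And>a t i. t \<in> {0..T} \<Longrightarrow> i \<in> K \<Longrightarrow> has_int (A i) t (?f i a) (I a t i)"
    and Xeq: "\<And>a t. t \<in> {0..T} \<Longrightarrow> d2 (X a t) (\<lambda>n w. x a + (\<Sum>i\<in>K. I a t i n w)) = 0" by blast
  have ex: "\<exists>Y J Ja. Y \<in> MG2 T \<and>
    (\<forall>t\<in>{0..T}. ((\<lambda>\<delta>. d2 (?D \<alpha> \<delta> t) (Y t)) \<longlongrightarrow> 0) (at 0)) \<and>
    (\<forall>i\<in>K. \<forall>t\<in>{0..T}. has_int (A i) t (?fx i \<alpha> Y) (J i t)) \<and>
    (\<forall>i\<in>K. \<forall>t\<in>{0..T}. has_int (A i) t (?fa i \<alpha>) (Ja i t)) \<and>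
    (\<forall>t\<in>{0..T}. d2 (Y t) (\<lambda>n w. x' \<alpha> + (\<Sum>i\<in>K. J i t n w + Ja i t n w)) = 0)" for \<alpha>
  proof (rule SDE_derivative[of K T A C f L X "\<lambda>i a t. I a t i" x fx fa "x' \<alpha>" \<alpha>])
    show "finite K" by (rule K(1))
    show "has_int (A i) t (?f i a) (I a t i)" if "i \<in> K" "t \<in> {0..T}" for i a t by (rule I[OF that(2,1)])
    show "(f i a t has_real_derivative fx i a t y) (at y)" if "i \<in> K" "t \<in> {0..T}" for i a t y by (rule deriv_space[OF mem(4)[OF that(1)] that(2)])
    show "((\<lambda>a. f i a t y) has_real_derivative fa i a t y) (at a)" if "i \<in> K" "t \<in> {0..T}" for i a t y by (rule deriv_param[OF mem(5)[OF that(1)] that(2)])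
    show "(\<lambda>(a, y). fx i a t y) \<in> Cllip" if "i \<in> K" "t \<in> {0..T}" for i t by (rule deriv_Cllip[OF mem(2)[OF that(1)] that(2)])
    show "(\<lambda>(a, y). fa i a t y) \<in> Cllip" if "i \<in> K" "t \<in> {0..T}" for i t by (rule deriv_Cllip[OF mem(3)[OF that(1)] that(2)])
  next
    fix Y J Ja assume "Y \<in> MG2 T"
      "\<And>t. t \<in> {0..T} \<Longrightarrow> ((\<lambda>\<delta>. d2 (?D \<alpha> \<delta> t) (Y t)) \<longlongrightarrow> 0) (at 0)"
      "\<And>i t. i \<in> K \<Longrightarrow> t \<in> {0..T} \<Longrightarrow> has_int (A i) t (?fx i \<alpha> Y) (J i t)"
      "\<And>i t. i \<in> K \<Longrightarrow> t \<in> {0..T} \<Longrightarrow> has_int (A i) t (?fa i \<alpha>) (Ja i t)"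
      "\<And>t. t \<in> {0..T} \<Longrightarrow> d2 (Y t) (\<lambda>n w. x' \<alpha> + (\<Sum>i\<in>K. J i t n w + Ja i t n w)) = 0"
    then show ?thesis by (intro exI[of _ Y] exI[of _ J] exI[of _ Ja] conjI ballI)
  qed (use T0 A C Lip L meas X Xeq x_deriv in auto)
  have diff: "has_LG2_derivative E (\<lambda>a. X a t) Z \<alpha> \<longleftrightarrow> Z \<in> V2 \<and> ((\<lambda>\<delta>. d2 (?D \<alpha> \<delta> t) Z) \<longlongrightarrow> 0) (at 0)"
    if "t \<in> {0..T}" for t Z \<alpha> by (rule has_LG2_derivative_iff[OF XV[OF that]])
  show ?thesis
  proof (intro conjI allI ballI impI)
    fix \<alpha> t assume t: "t \<in> {0..T}"
    obtain Y J Ja where "Y \<in> MG2 T" "\<forall>t\<in>{0..T}. ((\<lambda>\<delta>. d2 (?D \<alpha> \<delta> t) (Y t)) \<longlongrightarrow> 0) (at 0)"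
      using ex[of \<alpha>] by blast
    then show "\<exists>f. has_LG2_derivative E (\<lambda>a. X a t) f \<alpha>" using diff[OF t, of "Y t" \<alpha>] MG2D(1)[of Y T t] t by blast
  next
    fix Y \<alpha> t assume Y: "\<forall>\<alpha>. \<forall>t\<in>{0..T}. has_LG2_derivative E (\<lambda>a. X a t) (Y \<alpha> t) \<alpha>" and t: "t \<in> {0..T}"
    have t': "0 \<le> t" "t \<le> T" using t by auto
    obtain Z J Ja where Z: "Z \<in> MG2 T"
      and DZ: "\<forall>t\<in>{0..T}. ((\<lambda>\<delta>. d2 (?D \<alpha> \<delta> t) (Z t)) \<longlongrightarrow> 0) (at 0)"
      and J: "\<forall>i\<in>K. \<forall>t\<in>{0..T}. has_int (A i) t (?fx i \<alpha> Z) (J i t)"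
      and Ja: "\<forall>i\<in>K. \<forall>t\<in>{0..T}. has_int (A i) t (?fa i \<alpha>) (Ja i t)"
      and Zeq: "\<forall>t\<in>{0..T}. d2 (Z t) (\<lambda>n w. x' \<alpha> + (\<Sum>i\<in>K. J i t n w + Ja i t n w)) = 0"
      using ex[of \<alpha>] by blast
    have ZV: "Z r \<in> V2" if "r \<in> {0..T}" for r by (rule MG2D(1)[OF Z that])
    have YV: "Y \<alpha> r \<in> V2" and YZ: "d2 (Y \<alpha> r) (Z r) = 0" if r: "r \<in> {0..T}" for r
    proof -
      have D: "Y \<alpha> r \<in> V2 \<and> ((\<lambda>\<delta>. d2 (?D \<alpha> \<delta> r) (Y \<alpha> r)) \<longlongrightarrow> 0) (at 0)"
        using Y r diff[OF r] by blast
      then show "Y \<alpha> r \<in> V2" by blast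
      have DV: "(?D \<alpha> \<delta> r) \<in> V2" for \<delta>
        using two.cseq_scale[OF two.cseq_diff[OF XV[OF r] XV[OF r]], of "1 / \<delta>" "\<alpha> + \<delta>" \<alpha>] by simp
      show "d2 (Y \<alpha> r) (Z r) = 0" by (rule derivative_unique[OF DV _ ZV[OF r] _ DZ[rule_format, OF r]]) (use D in blast)+
    qed
    (* Y agrees with the constructed derivative in the norm at every time, hence has the same
       integrals. *)
    have nY: "has_int (A i) t (?fx i \<alpha> (Y \<alpha>)) (J i t)" if i: "i \<in> K" for i
    proof (rule has_int_cong[OF At[OF i t] t'(1) J[rule_format, OF i t] negligible_empty])
      have JV: "J i t \<in> V2" by (rule has_intD(2)[OF J[rule_format, OF i t]])
      then show "J i t \<in> V2" "d2 (J i t) (J i t) = 0" by (simp_all add: two.cdist_self)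
      have fV: "(\<lambda>n w. fx i \<alpha> r (X \<alpha> r n w) * W n w) \<in> V2" if r: "r \<in> {0..T}" and W: "W \<in> V2" for r W
        using quotient_limit(2)[of "\<lambda>a y. f i a r y" L "\<lambda>a y. fx i a r y" "\<lambda>a y. fa i a r y" 0 "X \<alpha> r" W \<alpha>,
           OF Lip[OF i r] deriv_space[OF mem(4)[OF i] r] deriv_param[OF mem(5)[OF i] r] deriv_Cllip[OF mem(2)[OF i] r] deriv_Cllip[OF mem(3)[OF i] r] _ XV[OF r] W]
        by simp
      show "(?fx i \<alpha> (Y \<alpha>) r) \<in> V2" if "r \<in> {0..t}" for r by (rule fV[OF _ YV]) (use that t in auto)
      fix r assume "r \<in> {0..t} - {}"
      then have r: "r \<in> {0..T}" using t by auto
      have "d2 (?fx i \<alpha> Z r) (?fx i \<alpha> (Y \<alpha>) r) \<le> L * d2 (Z r) (Y \<alpha> r)"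
      proof (rule two.cdist_mono[OF fV[OF r ZV[OF r]] fV[OF r YV[OF r]] ZV[OF r] YV[OF r] L])
        fix n w
        have "\<bar>fx i \<alpha> r y\<bar> \<le> L" for y
          by (rule Lipschitz_deriv_bounded[OF deriv_space[OF mem(4)[OF i] r]]) (use Lip[OF i r, of \<alpha> _ \<alpha>] in simp)
        then show "\<bar>fx i \<alpha> r (X \<alpha> r n w) * Z r n w - fx i \<alpha> r (X \<alpha> r n w) * Y \<alpha> r n w\<bar> \<le> L * \<bar>Z r n w - Y \<alpha> r n w\<bar>"
          by (simp add: abs_mult mult_right_mono flip: right_diff_distrib)
      qed
      then show "d2 (?fx i \<alpha> Z r) (?fx i \<alpha> (Y \<alpha>) r) = 0"
        using YZ[OF r] two.cdist_commute[OF ZV[OF r] YV[OF r]] two.cdist_nonneg[OF fV[OF r ZV[OF r]] fV[OF r YV[OF r]]] by simp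
    qed
    have G: "has_G_integral E (q i) (A i) t (?fx i \<alpha> (Y \<alpha>)) (J i t)" if i: "i \<in> K" for i
      by (rule has_int_has_G_integral[OF At[OF i t] t'(1) nY[OF i] q12[OF i]])
    have Ga: "has_G_integral E (q i) (A i) t (?fa i \<alpha>) (Ja i t)" if i: "i \<in> K" for i
      by (rule has_int_has_G_integral[OF At[OF i t] t'(1) Ja[rule_format, OF i t] q12[OF i]])
    have JV: "(\<lambda>n w. J i t n w + Ja i t n w) \<in> V2" if i: "i \<in> K" for i
      by (intro two.cseq_add has_intD(2)[OF nY[OF i]] has_intD(2)[OF Ja[rule_format, OF i t]])
    have "d2 (Y \<alpha> t) (\<lambda>n w. x' \<alpha> + (\<Sum>i\<in>K. J i t n w + Ja i t n w)) = 0"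
      using d2_eq_0_cong[OF YV[OF t] ZV[OF t] V_affine_sum[where I = "\<lambda>i n w. J i t n w + Ja i t n w" and x = "x' \<alpha>" and K = K, OF JV] YZ[OF t]] Zeq[rule_format, OF t] by simp
    then have "LG_eq E 1 (Y \<alpha> t) (\<lambda>n w. x' \<alpha> + (\<Sum>i\<in>K. J i t n w + Ja i t n w))"
      by (intro LG_eqI YV t V_affine_sum JV)
    moreover have "(\<lambda>n w. x' \<alpha> + (\<Sum>i\<in>K. J i t n w + Ja i t n w)) =
       (\<lambda>n w. x' \<alpha> + J 0 t n w + J 1 t n w + J 2 t n w + Ja 0 t n w + Ja 1 t n w + Ja 2 t n w)" by (intro ext) (simp add: sumK)
    ultimately have "LG_eq E 1 (Y \<alpha> t) (\<lambda>n w. x' \<alpha> + J 0 t n w + J 1 t n w + J 2 t n w + Ja 0 t n w + Ja 1 t n w + Ja 2 t n w)" by (rule subst[rotated])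
    moreover have "has_dt_integral E t (\<lambda>r n w. b\<^sub>x \<alpha> r (X \<alpha> r n w) * Y \<alpha> r n w) (J 0 t)" "has_dt_integral E t (\<lambda>r n w. b\<^sub>\<alpha> \<alpha> r (X \<alpha> r n w)) (Ja 0 t)"
      using G[of 0] Ga[of 0] by (simp_all add: K A_def q_def fx_def fa_def has_dt_integral_def)
    moreover have "has_dB_integral E t (\<lambda>r n w. \<sigma>\<^sub>x \<alpha> r (X \<alpha> r n w) * Y \<alpha> r n w) (J 1 t)" "has_dB_integral E t (\<lambda>r n w. \<sigma>\<^sub>\<alpha> \<alpha> r (X \<alpha> r n w)) (Ja 1 t)"
      using G[of 1] Ga[of 1] by (simp_all add: K A_def q_def fx_def fa_def has_dB_integral_def)
    moreover have "has_dQV_integral E t (\<lambda>r n w. h\<^sub>x \<alpha> r (X \<alpha> r n w) * Y \<alpha> r n w) (J 2 t)" "has_dQV_integral E t (\<lambda>r n w. h\<^sub>\<alpha> \<alpha> r (X \<alpha> r n w)) (Ja 2 t)"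
      using G[of 2] Ga[of 2] by (simp_all add: K A_def q_def fx_def fa_def has_dQV_integral_def)
    ultimately show "\<exists>I\<^sub>x J\<^sub>x K\<^sub>x I\<^sub>\<alpha> J\<^sub>\<alpha> K\<^sub>\<alpha>.
         has_dt_integral E t (\<lambda>r n w. b\<^sub>x \<alpha> r (X \<alpha> r n w) * Y \<alpha> r n w) I\<^sub>x \<and>
         has_dB_integral E t (\<lambda>r n w. \<sigma>\<^sub>x \<alpha> r (X \<alpha> r n w) * Y \<alpha> r n w) J\<^sub>x \<and>
         has_dQV_integral E t (\<lambda>r n w. h\<^sub>x \<alpha> r (X \<alpha> r n w) * Y \<alpha> r n w) K\<^sub>x \<and>
         has_dt_integral E t (\<lambda>r n w. b\<^sub>\<alpha> \<alpha> r (X \<alpha> r n w)) I\<^sub>\<alpha> \<and>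
         has_dB_integral E t (\<lambda>r n w. \<sigma>\<^sub>\<alpha> \<alpha> r (X \<alpha> r n w)) J\<^sub>\<alpha> \<and>
         has_dQV_integral E t (\<lambda>r n w. h\<^sub>\<alpha> \<alpha> r (X \<alpha> r n w)) K\<^sub>\<alpha> \<and>
         LG_eq E 1 (Y \<alpha> t)
           (\<lambda>n w. x' \<alpha> + I\<^sub>x n w + J\<^sub>x n w + K\<^sub>x n w + I\<^sub>\<alpha> n w + J\<^sub>\<alpha> n w + K\<^sub>\<alpha> n w)"
      by (intro exI[of _ "J 0 t"] exI[of _ "J 1 t"] exI[of _ "J 2 t"] exI[of _ "Ja 0 t"] exI[of _ "Ja 1 t"] exI[of _ "Ja 2 t"] conjI)
  qed
qed

end
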